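(* Let $K$ be an imaginary quadratic number field with class number $1$, let $\mathcal{O}_K$ be its ring of integers, let $w_K$ be the number of units of $\mathcal{O}_K$, and let $d_K$ be the square root of the absolute value of the discriminant of $K$. Let $S\subset\mathbb{P}^3$ be the cubic surface defined by $x_0^3=x_1x_2x_3$, and let $U$ be the complement in $S$ of the three lines $\{x_0=x_j=0\}$, $j=1,2,3$, i.e. $U=\{\mathbf{x}\in S: x_0x_1x_2x_3\neq 0\}$. For $B>0$ let $$N_{U,K,H}(B)=\#\{\mathbf{x}\in U(K)\mid H(\mathbf{x})\le B\}.$$ Then, as $B\to\infty$, $$N_{U,K,H}(B)= c_{S,K,H}\,B(\log B)^6+O(B(\log B)^5),$$ where $$c_{S,K,H}=\frac{2^7\pi^9}{6!\,w_K^7\,d_K^9}\prod_p\left(1-\frac{1}{\|p\|_\infty}\right)^7\left(1+\frac{7}{\|p\|_\infty}+\frac{1}{\|p\|_\infty^2}\right),$$ the product running over all prime elements $p$ of $\mathcal{O}_K$ up to multiplication by units.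
   Context: $M_K$ denotes the set of places of $K$. For a non-archimedean place $\nu$ with residue characteristic $p$, $\|x\|_\nu=|N_{K_\nu/\mathbb{Q}_p}(x)|_p$ for $x\in K_\nu$, where $|\cdot|_p$ is the usual $p$-adic absolute value on $\mathbb{Q}_p$. $K$ has a single archimedean place $\infty$, which is complex, and $\|x\|_\infty=|\sigma(x)|^2$ where $\sigma$ is a complex embedding and $|\cdot|$ the usual absolute value on $\mathbb{C}$ (so for $p\in\mathcal{O}_K$, $\|p\|_\infty$ is the norm of the ideal $(p)$). The height of $\mathbf{x}=(x_0:\dots:x_3)\in S(K)$ with $x_i\in K$ is $H(\mathbf{x})=\prod_{\nu\in M_K}\max_{0\le j\le 3}\|x_j\|_\nu$. *)

theory Defs
  imports
    "HOL-Analysis.Analysis"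
    "HOL-Algebra.Algebra"
    "HOL-Library.Landau_Symbols"
begin

text \<open>
  A number field is a type of class \<^class>\<open>field_char_0\<close>; the argument \<open>K :: 'k itself\<close>
  names it. Its ring of integers and its completions are rings in the sense of
  \<^theory>\<open>HOL-Algebra.Ring\<close>.
\<close>

section \<open>Imaginary quadratic fields\<close>

definition field_embedding :: "('a::field \<Rightarrow> 'b::field) \<Rightarrow> bool" where
  "field_embedding f \<longleftrightarrow>
     f 1 = 1 \<and> (\<forall>x y. f (x + y) = f x + f y) \<and> (\<forall>x y. f (x * y) = f x * f y)"

text \<open>
  \<^const>\<open>vector_space.dim\<close> is 0 on spaces without a finite basis, so the first conjunct
  says that the degree over the rationals is finite and equal to 2.
\<close>

definition imaginary_quadratic :: "'k::field_char_0 itself \<Rightarrow> bool" where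
  "imaginary_quadratic K \<longleftrightarrow>
     vector_space.dim (\<lambda>(q::rat) (x::'k). of_rat q * x) UNIV = 2 \<and>
     \<not> (\<exists>f :: 'k \<Rightarrow> real. field_embedding f)"

definition ring_of_integers :: "'k::field_char_0 itself \<Rightarrow> 'k ring" where
  "ring_of_integers K =
     \<lparr>carrier = {x. algebraic_int x}, mult = (*), one = 1, ring.zero = 0, add = (+)\<rparr>"

definition ideal_equiv :: "('a, 'b) ring_scheme \<Rightarrow> ('a set \<times> 'a set) set" where
  "ideal_equiv R = {(I, J).
     ideal I R \<and> I \<noteq> {\<zero>\<^bsub>R\<^esub>} \<and> ideal J R \<and> J \<noteq> {\<zero>\<^bsub>R\<^esub>} \<and>
     (\<exists>a\<in>carrier R - {\<zero>\<^bsub>R\<^esub>}. \<exists>b\<in>carrier R - {\<zero>\<^bsub>R\<^esub>}. a <#\<^bsub>R\<^esub> I = b <#\<^bsub>R\<^esub> J)}"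

definition class_number :: "('a, 'b) ring_scheme \<Rightarrow> nat" where
  "class_number R = card ({I. ideal I R \<and> I \<noteq> {\<zero>\<^bsub>R\<^esub>}} // ideal_equiv R)"

definition unit_number :: "'k::field_char_0 itself \<Rightarrow> nat" where
  "unit_number K = card (Units (ring_of_integers K))"

definition complex_embedding :: "'k::field_char_0 \<Rightarrow> complex" where
  "complex_embedding = (SOME f. field_embedding f)"

text \<open>
  The two embeddings of an imaginary quadratic field are \<open>f\<close> and \<open>cnj \<circ> f\<close>, so this is the
  squared determinant of the values of all embeddings at an integral basis \<open>b\<^sub>1, b\<^sub>2\<close>.
\<close>

definition discriminant :: "'k::field_char_0 itself \<Rightarrow> int" where
  "discriminant K = (THE D. \<exists>(b\<^sub>1::'k) b\<^sub>2 f.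
     {of_int m * b\<^sub>1 + of_int n * b\<^sub>2 | m n. True} = carrier (ring_of_integers K) \<and>
     field_embedding f \<and>
     of_int D = (f b\<^sub>1 * cnj (f b\<^sub>2) - f b\<^sub>2 * cnj (f b\<^sub>1))\<^sup>2)"

definition sqrt_abs_disc :: "'k::field_char_0 itself \<Rightarrow> real" where
  "sqrt_abs_disc K = sqrt (of_int \<bar>discriminant K\<bar>)"


section \<open>Places\<close>

definition absolute_value :: "('k::field \<Rightarrow> real) \<Rightarrow> bool" where
  "absolute_value v \<longleftrightarrow>
     (\<forall>x. v x \<ge> 0) \<and> (\<forall>x. v x = 0 \<longleftrightarrow> x = 0) \<and>
     (\<forall>x y. v (x * y) = v x * v y) \<and> (\<forall>x y. v (x + y) \<le> v x + v y)"

definition nontrivial_absolute_values :: "('k::field \<Rightarrow> real) set" where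
  "nontrivial_absolute_values = {v. absolute_value v \<and> (\<exists>x. x \<noteq> 0 \<and> v x \<noteq> 1)}"

definition absolute_value_equiv :: "(('k::field \<Rightarrow> real) \<times> ('k \<Rightarrow> real)) set" where
  "absolute_value_equiv = {(v, w).
     v \<in> nontrivial_absolute_values \<and> w \<in> nontrivial_absolute_values \<and>
     (\<exists>e>0. \<forall>x. w x = v x powr e)}"

definition places :: "'k::field itself \<Rightarrow> ('k \<Rightarrow> real) set set" where
  "places K = nontrivial_absolute_values // absolute_value_equiv"

definition nonarchimedean :: "('k::field \<Rightarrow> real) set \<Rightarrow> bool" where
  "nonarchimedean \<nu> \<longleftrightarrow> (\<forall>v\<in>\<nu>. \<forall>x y. v (x + y) \<le> max (v x) (v y))"

text \<open>
  The residue field is \<open>{x. v x \<le> 1}\<close> modulo \<open>{x. v x < 1}\<close>, so its characteristic is the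
  prime \<open>p\<close> with \<open>v p < 1\<close>.
\<close>

definition residue_characteristic :: "('k::field \<Rightarrow> real) set \<Rightarrow> nat" where
  "residue_characteristic \<nu> = (THE p. Factorial_Ring.prime p \<and> (\<forall>v\<in>\<nu>. v (of_nat p) < 1))"


section \<open>Completions\<close>

definition place_cauchy :: "('k::field \<Rightarrow> real) set \<Rightarrow> (nat \<Rightarrow> 'k) \<Rightarrow> bool" where
  "place_cauchy \<nu> s \<longleftrightarrow> (\<forall>v\<in>\<nu>. \<forall>e>0. \<exists>M. \<forall>m\<ge>M. \<forall>n\<ge>M. v (s m - s n) < e)"

definition place_null :: "('k::field \<Rightarrow> real) set \<Rightarrow> (nat \<Rightarrow> 'k) set" where
  "place_null \<nu> = {s. \<forall>v\<in>\<nu>. (\<lambda>n. v (s n)) \<longlonglongrightarrow> 0}"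

definition cauchy_ring :: "('k::field \<Rightarrow> real) set \<Rightarrow> (nat \<Rightarrow> 'k) ring" where
  "cauchy_ring \<nu> =
     \<lparr>carrier = {s. place_cauchy \<nu> s}, mult = (\<lambda>s t n. s n * t n), one = (\<lambda>n. 1),
      ring.zero = (\<lambda>n. 0), add = (\<lambda>s t n. s n + t n)\<rparr>"

definition completion :: "('k::field \<Rightarrow> real) set \<Rightarrow> (nat \<Rightarrow> 'k) set ring" where
  "completion \<nu> = cauchy_ring \<nu> Quot place_null \<nu>"

definition to_completion :: "('k::field \<Rightarrow> real) set \<Rightarrow> 'k \<Rightarrow> (nat \<Rightarrow> 'k) set" where
  "to_completion \<nu> x = place_null \<nu> +>\<^bsub>cauchy_ring \<nu>\<^esub> (\<lambda>n. x)"

text \<open>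
  \<open>\<rat>\<^sub>p\<close>, realised inside the completion as the closure of \<open>\<rat>\<close>, and the \<open>p\<close>-adic absolute
  value, first on \<open>\<rat>\<close> and then extended by continuity.
\<close>

definition padic_subfield :: "('k::field_char_0 \<Rightarrow> real) set \<Rightarrow> (nat \<Rightarrow> 'k) set set" where
  "padic_subfield \<nu> =
     {place_null \<nu> +>\<^bsub>cauchy_ring \<nu>\<^esub> (\<lambda>n. of_rat (q n)) | q. place_cauchy \<nu> (\<lambda>n. of_rat (q n))}"

definition padic_abs :: "nat \<Rightarrow> rat \<Rightarrow> real" where
  "padic_abs p q = (if q = 0 then 0 else
     of_nat p powi (int (multiplicity (int p) (snd (quotient_of q))) -
                    int (multiplicity (int p) (fst (quotient_of q)))))"

definition padic_abs_completion ::
    "('k::field_char_0 \<Rightarrow> real) set \<Rightarrow> (nat \<Rightarrow> 'k) set \<Rightarrow> real" where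
  "padic_abs_completion \<nu> c =
     (let q = (SOME q. (\<lambda>n. of_rat (q n)) \<in> c)
      in lim (\<lambda>n. padic_abs (residue_characteristic \<nu>) (q n)))"


section \<open>Norm of a finite field extension\<close>

definition ring_det :: "('a, 'b) ring_scheme \<Rightarrow> nat \<Rightarrow> (nat \<Rightarrow> nat \<Rightarrow> 'a) \<Rightarrow> 'a" where
  "ring_det R n A = (\<Oplus>\<^bsub>R\<^esub>\<sigma>\<in>{\<sigma>. \<sigma> permutes {..<n}}.
     (if evenperm \<sigma> then \<one>\<^bsub>R\<^esub> else \<ominus>\<^bsub>R\<^esub> \<one>\<^bsub>R\<^esub>) \<otimes>\<^bsub>R\<^esub> (\<Otimes>\<^bsub>R\<^esub>i\<in>{..<n}. A i (\<sigma> i)))"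

text \<open>
  The determinant of multiplication by \<open>x\<close> on the field \<open>L\<close>, with respect to any basis
  \<open>us\<close> of \<open>L\<close> over its subfield \<open>F\<close>.
\<close>

definition field_norm :: "('a, 'b) ring_scheme \<Rightarrow> 'a set \<Rightarrow> 'a \<Rightarrow> 'a" where
  "field_norm L F x = (THE y. \<exists>us A.
     ring.independent L F us \<and> ring.Span L F us = carrier L \<and>
     (\<forall>i<length us. \<forall>j<length us. A i j \<in> F) \<and>
     (\<forall>j<length us. x \<otimes>\<^bsub>L\<^esub> us ! j = (\<Oplus>\<^bsub>L\<^esub>i\<in>{..<length us}. A i j \<otimes>\<^bsub>L\<^esub> us ! i)) \<and>
     y = ring_det L (length us) A)"


section \<open>Heights\<close>

definition norm_infinity :: "'k::field_char_0 \<Rightarrow> real" where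
  "norm_infinity x = (cmod (complex_embedding x))\<^sup>2"

definition place_norm :: "('k::field_char_0 \<Rightarrow> real) set \<Rightarrow> 'k \<Rightarrow> real" where
  "place_norm \<nu> x =
     (if nonarchimedean \<nu>
      then padic_abs_completion \<nu> (field_norm (completion \<nu>) (padic_subfield \<nu>) (to_completion \<nu> x))
      else norm_infinity x)"

definition local_height :: "('k::field_char_0 \<Rightarrow> real) set \<Rightarrow> 'k ^ 4 \<Rightarrow> real" where
  "local_height \<nu> x = (MAX j. place_norm \<nu> (x $ j))"

text \<open>
  For \<open>x \<noteq> 0\<close> almost all factors are 1; they are left out because \<^const>\<open>prod\<close> over an
  infinite index set is 1.
\<close>

definition vector_height :: "'k::field_char_0 ^ 4 \<Rightarrow> real" where
  "vector_height x = (\<Prod>\<nu>\<in>{\<nu> \<in> places TYPE('k). local_height \<nu> x \<noteq> 1}. local_height \<nu> x)"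

definition projective_space :: "('k::field ^ 4) set set" where
  "projective_space =
     (UNIV - {0}) // {(x, y). x \<noteq> 0 \<and> y \<noteq> 0 \<and> (\<exists>c. c \<noteq> 0 \<and> y = c *s x)}"

definition height :: "('k::field_char_0 ^ 4) set \<Rightarrow> real" where
  "height P = vector_height (SOME x. x \<in> P)"


section \<open>The cubic surface and its rational points\<close>

definition cubic_surface :: "('k::field ^ 4) set set" where
  "cubic_surface = {P \<in> projective_space. \<forall>x\<in>P. (x $ 0) ^ 3 = x $ 1 * x $ 2 * x $ 3}"

definition coordinate_line :: "4 \<Rightarrow> ('k::field ^ 4) set set" where
  "coordinate_line j = {P \<in> projective_space. \<forall>x\<in>P. x $ 0 = 0 \<and> x $ j = 0}"

definition open_subset :: "('k::field ^ 4) set set" where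
  "open_subset = cubic_surface - (\<Union>j\<in>{1, 2, 3}. coordinate_line j)"

definition counting_function :: "'k::field_char_0 itself \<Rightarrow> real \<Rightarrow> nat" where
  "counting_function K B = card {P \<in> (open_subset :: ('k ^ 4) set set). height P \<le> B}"


section \<open>The leading constant\<close>

definition prime_classes :: "'k::field_char_0 itself \<Rightarrow> 'k set set" where
  "prime_classes K =
     (let R = ring_of_integers K; S = {p \<in> carrier R. ring_prime\<^bsub>R\<^esub> p}
      in S // {(p, q). p \<in> S \<and> q \<in> S \<and> p \<sim>\<^bsub>R\<^esub> q})"

definition euler_factor :: "'k::field_char_0 set \<Rightarrow> real" where
  "euler_factor C =
     (let N = norm_infinity (SOME p. p \<in> C)
      in (1 - 1 / N) ^ 7 * (1 + 7 / N + 1 / N\<^sup>2))"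

text \<open>The infinite product is the limit of the net of its finite partial products.\<close>

definition leading_constant :: "'k::field_char_0 itself \<Rightarrow> real" where
  "leading_constant K =
     2 ^ 7 * pi ^ 9 / (fact 6 * real (unit_number K) ^ 7 * sqrt_abs_disc K ^ 9) *
     Lim (finite_subsets_at_top (prime_classes K)) (prod euler_factor)"

end

theory Submission
  imports Defs "HOL-Library.Multiset"
begin

text \<open>
  By Ostrowski's theorem and the computation of the normalised absolute values on the completions, the
  height of a point with coprime integral coordinates is the largest norm of a coordinate. The points of
  \<open>U\<close> correspond, up to two free units, to triples of integral ideals of norm at most \<open>B\<close> without a common
  prime factor whose product is a cube. At a prime the exponents of such a triple form a vector with a
  zero coordinate and coordinate sum divisible by 3. These vectors are the natural combinations of
  the nine lattice points on the boundary of a triangle that use at most two neighbouring points, so the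
  triples correspond to 9-tuples of ideals subject to coprimality conditions. Moebius inversion on the subsets
  of the nine indices removes the conditions and produces the Euler product. The remaining sum over
  9-tuples is evaluated by summing over the ideals at the three corners first, which gives
  \<open>B\<close> times a weighted sum over 6-tuples of ideals; Abel summation with the square root error in the
  count of ideals turns the latter into the volume 1/2880 of a polytope in dimension 6, times
  \<open>(ln B)\<^sup>6\<close>.
\<close>

section \<open>Summation over multisets of given norm\<close>

text \<open>The error must be smaller by one power of the logarithm, uniformly in the Moebius
  divisor. Two features provide this. The six points that are not corners enter with weight 1/norm,
  so each sum over ideals replaced by an integral loses just one logarithm; and the relative error
  in counting a corner ideal decays exponentially away from the boundary of the polytope, so that
  its sum over one further ideal stays bounded. In the Moebius sum, a divisor of norm n costs 1/n
  times a factor linear in log n, and the local weight vanishes on singletons because all nine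
  points are faces: the series converges like a sum over squares, even with the logarithm. The
  constant comes from the density 2 pi/(w d) of ideals, with w units and d the root of the absolute
  discriminant: two free units and nine ideals give w^2 (2 pi/(w d))^9/2880, and 2^9/2880 = 2^7/6!.
  As the height is defined through completions, the norm to the p-adic numbers must be computed for
  an arbitrary basis, in degree one or two according to whether the prime and its conjugate are
  associated.\<close>

lemma abel_summation:
  fixes a f :: "nat \<Rightarrow> real"
  shows "(\<Sum>k=1..Suc n. a k * f k) =
    (\<Sum>k=1..Suc n. a k) * f (Suc n) + (\<Sum>k=1..n. (\<Sum>j=1..k. a j) * (f k - f (Suc k)))"
proof (induction n)
  case (Suc n)
  have "(\<Sum>k=1..Suc (Suc n). a k * f k) = (\<Sum>k=1..Suc n. a k * f k) + a (Suc (Suc n)) * f (Suc (Suc n))"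
    by simp
  also have "\<dots> = (\<Sum>k=1..Suc n. a k) * f (Suc n) + (\<Sum>k=1..n. (\<Sum>j=1..k. a j) * (f k - f (Suc k)))
     + a (Suc (Suc n)) * f (Suc (Suc n))"
    by (simp only: Suc)
  finally show ?case by (simp add: algebra_simps)
qed simp

text \<open>Summation by parts produces the coefficients \<open>f n\<close> and
  \<open>f k - f (Suc k)\<close>. All are nonnegative, so an upper bound for the partial sums of
  \<open>a\<close> suffices, and they telescope to \<open>f 1\<close>.\<close>

lemma abel_upper_bound:
  fixes a f :: "nat \<Rightarrow> real"
  assumes S: "\<And>k. k \<in> {1..n} \<Longrightarrow> (\<Sum>j=1..k. a j) \<le> C" and C: "C \<ge> 0"
    and f0: "\<And>k. k \<in> {1..n} \<Longrightarrow> f k \<ge> 0"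
    and fa: "\<And>k. k \<ge> 1 \<Longrightarrow> k < n \<Longrightarrow> f (Suc k) \<le> f k" and n: "n \<ge> 1"
  shows "(\<Sum>k=1..n. a k * f k) \<le> C * f 1"
proof -
  obtain m where m: "n = Suc m" using n by (cases n) auto
  have tel: "(\<Sum>k=1..m. C * (f k - f (Suc k))) = C * (f 1 - f (Suc m))"
    by (induction m) (auto simp: algebra_simps)
  have "(\<Sum>k=1..n. a k * f k) \<le> C * f (Suc m) + (\<Sum>k=1..m. C * (f k - f (Suc k)))"
    unfolding m abel_summation
    by (intro add_mono mult_right_mono sum_mono S f0) (use fa m in auto)
  also have "\<dots> = C * f 1" unfolding tel by (simp add: algebra_simps)
  finally show ?thesis .
qed

lemma abel_abs_bound:
  fixes a f :: "nat \<Rightarrow> real"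
  assumes S: "\<And>k. k \<in> {1..n} \<Longrightarrow> \<bar>\<Sum>j=1..k. a j\<bar> \<le> C" and C: "C \<ge> 0"
    and f0: "\<And>k. k \<in> {1..n} \<Longrightarrow> f k \<ge> 0"
    and fa: "\<And>k. k \<ge> 1 \<Longrightarrow> k < n \<Longrightarrow> f (Suc k) \<le> f k" and n: "n \<ge> 1"
  shows "\<bar>\<Sum>k=1..n. a k * f k\<bar> \<le> C * f 1"
proof -
  have 1: "(\<Sum>k=1..n. a k * f k) \<le> C * f 1"
    by (rule abel_upper_bound) (use assms abs_le_D1 in blast)+
  have S': "\<And>k. k \<in> {1..n} \<Longrightarrow> (\<Sum>j=1..k. - a j) \<le> C"
    using S by (simp add: sum_negf abs_le_iff)
  have "(\<Sum>k=1..n. - a k * f k) \<le> C * f 1"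
    by (rule abel_upper_bound) (use assms S' in blast)+
  thus ?thesis using 1 by (simp add: sum_negf)
qed

text \<open>The terms are \<open>sqrt k\<close> times \<open>1/k - 1/(k+1)\<close>, as met in a
  summation by parts with a square root error. The induction carries the stronger bound
  \<open>2 - 2 / sqrt (n + 1)\<close>, whose increments dominate the terms.\<close>

lemma sum_inverse_sqrt_bound: "(\<Sum>k=1..n. 1 / (sqrt k * (real k + 1))) \<le> 2"
proof -
  have "(\<Sum>k=1..n. 1 / (sqrt k * (real k + 1))) \<le> 2 - 2 / sqrt (real n + 1)"
  proof (induction n)
    case (Suc n)
    define a b where "a = sqrt (real n + 1)" and "b = sqrt (real n + 2)"
    have ab: "a > 0" "b > 0" "b\<^sup>2 = a\<^sup>2 + 1" "a \<le> b" "b\<^sup>2 = real n + 2" by (auto simp: a_def b_def)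
    have "1 = (b - a) * (b + a)" using ab(3) by (simp add: power2_eq_square algebra_simps)
    also have "\<dots> \<le> (b - a) * (2 * b)" using ab by (intro mult_left_mono) auto
    finally have *: "1 \<le> (b - a) * (2 * b)" .
    have "1 / (a * b\<^sup>2) \<le> (b - a) * (2 * b) / (a * b\<^sup>2)"
      using ab * by (intro divide_right_mono) auto
    also have "\<dots> = 2 / a - 2 / b"
      using ab(1,2) by (simp add: field_simps power2_eq_square)
    finally have "1 / (a * b\<^sup>2) \<le> 2 / a - 2 / b" .
    hence "1 / (a * (real n + 2)) \<le> 2 / a - 2 / b" using ab(5) by simp
    moreover have "(\<Sum>k=1..Suc n. 1 / (sqrt k * (real k + 1))) =
      (\<Sum>k=1..n. 1 / (sqrt k * (real k + 1))) + 1 / (a * (real n + 2))"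
      by (simp add: a_def add.commute)
    ultimately show ?case using Suc by (simp add: a_def b_def add.commute)
  qed simp
  also have "\<dots> \<le> 2" by simp
  finally show ?thesis .
qed

lemma integrable_antimono_nonneg:
  fixes \<phi> :: "real \<Rightarrow> real"
  assumes "\<And>s t. 0 \<le> s \<Longrightarrow> s \<le> t \<Longrightarrow> \<phi> t \<le> \<phi> s" and "0 \<le> a"
  shows "\<phi> integrable_on {a..b}"
  proof -
  have "(\<lambda>x. - \<phi> x) integrable_on {a..b}"
    by (rule integrable_on_mono_on) (use assms in \<open>auto simp: mono_on_def\<close>)
  thus ?thesis using integrable_neg_iff by blast
qed

text \<open>In the variable t = ln x the measure dx/x becomes dt: the interval from ln k to ln (k+1)
  has length between 1/(k+1) and 1/k, so an antitone \<phi> compares term by term with its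
  integral.\<close>

lemma antimono_log_sum_integral:
  fixes \<phi> :: "real \<Rightarrow> real"
  assumes anti: "\<And>s t. 0 \<le> s \<Longrightarrow> s \<le> t \<Longrightarrow> \<phi> t \<le> \<phi> s" and nn: "\<And>t. 0 \<le> t \<Longrightarrow> \<phi> t \<ge> 0"
  shows "integral {0..ln (real n + 1)} \<phi> \<le> (\<Sum>k=1..n. \<phi> (ln (real k)) / real k)"
    and "(\<Sum>k=1..Suc n. \<phi> (ln (real k)) / real k) \<le> \<phi> 0 + integral {0..ln (real n + 1)} \<phi>"
proof -
  have step: "\<phi> (ln (real n + 2)) / (real n + 2) \<le> integral {ln (real n + 1)..ln (real n + 2)} \<phi> \<and>
      integral {ln (real n + 1)..ln (real n + 2)} \<phi> \<le> \<phi> (ln (real n + 1)) / (real n + 1) \<and>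
      integral {0..ln (real n + 2)} \<phi> =
      integral {0..ln (real n + 1)} \<phi> + integral {ln (real n + 1)..ln (real n + 2)} \<phi>" for n :: nat
  proof -
    define a b where "a = ln (real n + 1)" and "b = ln (real n + 2)"
    have ab: "0 \<le> a" "a \<le> b" by (auto simp: a_def b_def)
    have int: "\<phi> integrable_on {x..y}" if "0 \<le> x" for x y
      using integrable_antimono_nonneg[of \<phi>, OF anti that] .
    have "- ((real n + 2 - (real n + 1)) / (real n + 2)) \<ge> ln ((real n + 1) / (real n + 2))"
      using ln_le_minus_one[of "(real n + 1) / (real n + 2)"] by (simp add: field_simps)
    hence d1: "b - a \<ge> 1 / (real n + 2)"
      unfolding a_def b_def by (simp add: ln_div)
    have "ln ((real n + 2) / (real n + 1)) \<le> 1 / (real n + 1)"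
      using ln_le_minus_one[of "(real n + 2) / (real n + 1)"] by (simp add: field_simps)
    hence d2: "b - a \<le> 1 / (real n + 1)"
      unfolding a_def b_def by (simp add: ln_div)
    have "integral {a..b} (\<lambda>_. \<phi> b) \<le> integral {a..b} \<phi>"
      by (rule integral_le[OF _ int]) (use ab anti in auto)
    moreover have "integral {a..b} \<phi> \<le> integral {a..b} (\<lambda>_. \<phi> a)"
      by (rule integral_le[OF int]) (use ab anti in auto)
    ultimately have "(b - a) * \<phi> b \<le> integral {a..b} \<phi>" "integral {a..b} \<phi> \<le> (b - a) * \<phi> a"
      using ab by auto
    moreover have "1 / (real n + 2) * \<phi> b \<le> (b - a) * \<phi> b"
      by (rule mult_right_mono[OF d1 nn]) (use ab in auto)
    moreover have "(b - a) * \<phi> a \<le> 1 / (real n + 1) * \<phi> a"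
      by (rule mult_right_mono[OF d2 nn]) (use ab in auto)
    moreover have "integral {0..b} \<phi> = integral {0..a} \<phi> + integral {a..b} \<phi>"
      using Henstock_Kurzweil_Integration.integral_combine[OF ab int[of 0]] by simp
    ultimately show ?thesis unfolding a_def b_def by auto
  qed
  show "integral {0..ln (real n + 1)} \<phi> \<le> (\<Sum>k=1..n. \<phi> (ln (real k)) / real k)"
  proof (induction n)
    case (Suc n)
    thus ?case using step[of n] by (simp add: add_ac)
  qed simp
  show "(\<Sum>k=1..Suc n. \<phi> (ln (real k)) / real k) \<le> \<phi> 0 + integral {0..ln (real n + 1)} \<phi>"
  proof (induction n)
    case (Suc n)
    thus ?case using step[of n] by (simp add: add_ac)
  qed simp
qed

text \<open>By unique factorisation a nonzero ideal is a multiset of primes; this is its norm when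
  \<open>N\<close> gives the norms of the primes.\<close>

definition nrm :: "('p \<Rightarrow> nat) \<Rightarrow> 'p multiset \<Rightarrow> nat" where
  "nrm N m = prod_mset (image_mset N m)"

lemma nrm_simps [simp]:
  "nrm N {#} = 1" "nrm N (add_mset p m) = N p * nrm N m" "nrm N (m + m') = nrm N m * nrm N m'"
  by (simp_all add: nrm_def)

lemma nrm_repeat_mset: "nrm N (repeat_mset k m) = nrm N m ^ k"
  by (induction k) auto

text \<open>The analysis is carried out for an abstract set of primes. The essential input is that
  the number of multisets of norm at most n is \<rho> n up to a multiple of sqrt n; for the ring of
  integers this comes from lattice points in a disc.\<close>

locale norm_system =
  fixes P :: "'p set" and N :: "'p \<Rightarrow> nat" and \<rho> C0 :: real
  assumes N_ge: "p \<in> P \<Longrightarrow> N p \<ge> 2"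
    and fin0: "finite {m. set_mset m \<subseteq> P \<and> nrm N m \<le> n}"
    and cnt0: "n \<ge> 1 \<Longrightarrow> \<bar>real (card {m. set_mset m \<subseteq> P \<and> nrm N m \<le> n}) - \<rho> * real n\<bar> \<le> C0 * sqrt (real n)"
    and rho_pos: "\<rho> > 0"
begin

definition II :: "'p multiset set" where "II = {m. set_mset m \<subseteq> P}"
definition IN :: "real \<Rightarrow> 'p multiset set" where "IN B = {m \<in> II. real (nrm N m) \<le> B}"
definition rr :: "nat \<Rightarrow> real" where "rr n = real (card {m \<in> II. nrm N m = n})"

lemma nrm_pos: "m \<in> II \<Longrightarrow> nrm N m > 0"
proof (induction m)
  case (add p m)
  thus ?case using N_ge[of p] by (auto simp: II_def)
qed simp

lemma nrm_ge1: "m \<in> II \<Longrightarrow> nrm N m \<ge> 1" using nrm_pos by fastforce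

lemma nrm_ge1_real: "m \<in> II \<Longrightarrow> real (nrm N m) \<ge> 1" using nrm_ge1 by fastforce

lemma ln_nrm_nonneg: "m \<in> II \<Longrightarrow> ln (real (nrm N m)) \<ge> 0"
  using nrm_ge1_real by simp

lemma IN_altdef: "B \<ge> 0 \<Longrightarrow> IN B = {m. set_mset m \<subseteq> P \<and> nrm N m \<le> nat \<lfloor>B\<rfloor>}"
  by (auto simp: IN_def II_def le_nat_iff le_floor_iff)

lemma finite_IN [simp, intro]: "finite (IN B)"
proof (cases "B \<ge> 0")
  case True
  show ?thesis unfolding IN_altdef[OF True] by (rule fin0)
next
  case False
  hence "IN B = {}" by (auto simp: IN_def)
  thus ?thesis by simp
qed

lemma IN_empty: "B < 1 \<Longrightarrow> IN B = {}"
  using nrm_ge1_real by (force simp: IN_def)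

lemma C0_nonneg: "C0 \<ge> 0"
  using cnt0[of 1] by (smt (verit) abs_ge_zero of_nat_1 order_refl mult_cancel_left2 real_sqrt_one)

lemma sum_IN:
  fixes g :: "nat \<Rightarrow> real"
  assumes "B \<ge> 0"
  shows "(\<Sum>m\<in>IN B. g (nrm N m)) = (\<Sum>k=1..nat \<lfloor>B\<rfloor>. rr k * g k)"
proof -
  have "(\<Sum>m\<in>IN B. g (nrm N m)) = (\<Sum>k=1..nat \<lfloor>B\<rfloor>. \<Sum>m\<in>{m\<in>IN B. nrm N m = k}. g (nrm N m))"
  proof (rule sum.group[symmetric])
    show "nrm N ` IN B \<subseteq> {1..nat \<lfloor>B\<rfloor>}"
      using nrm_ge1 by (auto simp: IN_altdef[OF assms] II_def simp del: One_nat_def)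
  qed auto
  also have "\<dots> = (\<Sum>k=1..nat \<lfloor>B\<rfloor>. rr k * g k)"
  proof (rule sum.cong[OF refl])
    fix k assume k: "k \<in> {1..nat \<lfloor>B\<rfloor>}"
    have "{m\<in>IN B. nrm N m = k} = {m\<in>II. nrm N m = k}"
      using IN_altdef[OF assms] k by (auto simp: II_def)
    thus "(\<Sum>m\<in>{m\<in>IN B. nrm N m = k}. g (nrm N m)) = rr k * g k" by (simp add: rr_def)
  qed
  finally show ?thesis .
qed

lemma card_IN: "B \<ge> 0 \<Longrightarrow> real (card (IN B)) = (\<Sum>k=1..nat \<lfloor>B\<rfloor>. rr k)"
  using sum_IN[of B "\<lambda>_. 1"] by simp

lemma sum_rr_bound: "n \<ge> 1 \<Longrightarrow> \<bar>\<Sum>k=1..n. (rr k - \<rho>)\<bar> \<le> C0 * sqrt n"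
  using card_IN[of "real n"] cnt0[of n] IN_altdef[of "real n"]
  by (simp add: sum_subtractf mult.commute)

lemma sum_rr_le: "(\<Sum>k=1..n. rr k) \<le> (\<rho> + C0) * n"
proof (cases "n \<ge> 1")
  case True
  have "sqrt n \<le> n" using True by (simp add: sqrt_le_D real_le_lsqrt self_le_power)
  hence "C0 * sqrt n \<le> C0 * n" using C0_nonneg by (rule mult_left_mono)
  thus ?thesis using sum_rr_bound[OF True] by (simp add: sum_subtractf algebra_simps)
next
  case False
  thus ?thesis by (cases n) auto
qed

text \<open>The partial sums of \<open>rr k - (\<rho> + C0)\<close> are at most 0, hence so is their
  sum against a nonnegative antitone weight.\<close>

lemma sum_rr_antimono_le:
  assumes "\<And>k. k \<in> {1..n} \<Longrightarrow> f k \<ge> 0" "\<And>k. k \<ge> 1 \<Longrightarrow> k < n \<Longrightarrow> f (Suc k) \<le> f k"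
  shows "(\<Sum>k=1..n. rr k * f k) \<le> (\<rho> + C0) * (\<Sum>k=1..n. f k)"
proof (cases "n \<ge> 1")
  case True
  have "(\<Sum>k=1..n. (rr k - (\<rho> + C0)) * f k) \<le> 0 * f 1"
    by (rule abel_upper_bound) (use assms True sum_rr_le in \<open>auto simp: sum_subtractf mult.commute\<close>)
  thus ?thesis by (simp add: algebra_simps sum_subtractf sum.distrib sum_distrib_left)
qed simp

text \<open>In the summation by parts the boundary term contributes at most \<open>C0\<close>; the
  other terms are at most \<open>C0 / (sqrt k * (k + 1))\<close> and add up to at most
  \<open>2 * C0\<close>.\<close>

lemma sum_rr_harmonic: "n \<ge> 1 \<Longrightarrow> \<bar>\<Sum>k=1..n. (rr k - \<rho>) / real k\<bar> \<le> 3 * C0"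
proof -
  assume n: "n \<ge> 1"
  then obtain m where m: "n = Suc m" by (cases n) auto
  define S where "S = (\<lambda>n. \<Sum>k=1..n. (rr k - \<rho>))"
  have S: "\<bar>S k\<bar> \<le> C0 * sqrt k" if "k \<ge> 1" for k using sum_rr_bound[OF that] by (simp add: S_def)
  have "(\<Sum>k=1..n. (rr k - \<rho>) * (1 / real k)) =
     S (Suc m) * (1 / real (Suc m)) + (\<Sum>k=1..m. S k * (1 / real k - 1 / real (Suc k)))"
    unfolding m abel_summation S_def ..
  also have "\<bar>\<dots>\<bar> \<le> C0 + (\<Sum>k=1..m. C0 * (1 / (sqrt k * (real k + 1))))"
  proof (rule order_trans[OF abs_triangle_ineq add_mono])
    have "\<bar>S (Suc m)\<bar> \<le> C0 * sqrt (Suc m)" using S[of "Suc m"] by simp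
    also have "\<dots> \<le> C0 * Suc m"
      using C0_nonneg by (intro mult_left_mono) (auto simp: real_le_lsqrt self_le_power)
    finally show "\<bar>S (Suc m) * (1 / real (Suc m))\<bar> \<le> C0"
      by (simp add: abs_mult field_simps)
    show "\<bar>\<Sum>k=1..m. S k * (1 / real k - 1 / real (Suc k))\<bar> \<le> (\<Sum>k=1..m. C0 * (1 / (sqrt k * (real k + 1))))"
    proof (rule order_trans[OF sum_abs sum_mono])
      fix k assume k: "k \<in> {1..m}"
      have e: "1 / real k - 1 / real (Suc k) = 1 / (real k * (real k + 1))"
        using k by (simp add: field_simps)
      have "\<bar>S k * (1 / real k - 1 / real (Suc k))\<bar> = \<bar>S k\<bar> * (1 / (real k * (real k + 1)))"
        unfolding e by (simp add: abs_mult)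
      also have "\<dots> \<le> (C0 * sqrt k) * (1 / (real k * (real k + 1)))"
        using S[of k] k by (intro mult_right_mono) auto
      also have "\<dots> = (C0 * sqrt k) * (1 / ((sqrt k * sqrt k) * (real k + 1)))" by simp
      also have "\<dots> = C0 * (1 / (sqrt k * (real k + 1)))"
        using k by (auto simp del: real_sqrt_mult_self)
      finally show "\<bar>S k * (1 / real k - 1 / real (Suc k))\<bar> \<le> C0 * (1 / (sqrt k * (real k + 1)))" .
    qed
  qed
  also have "\<dots> \<le> C0 + C0 * 2"
    unfolding sum_distrib_left[symmetric]
    by (intro add_left_mono mult_left_mono sum_inverse_sqrt_bound C0_nonneg)
  finally show ?thesis by simp
qed

definition C1 :: real where "C1 = 3 * C0 + \<rho>"

lemma C1_pos: "C1 > 0" using C0_nonneg rho_pos by (simp add: C1_def)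

text \<open>Replacing \<open>rr\<close> by its mean \<rho> costs \<open>3 * C0 * \<phi> 0\<close>,
  since the harmonic discrepancies stay bounded; replacing the resulting sum by an integral costs
  \<open>\<rho> * \<phi> 0\<close>. The error depends on \<phi> only through
  \<open>\<phi> 0\<close>, which allows the estimate to be iterated.\<close>

lemma sum_antimono_log:
  assumes anti: "\<And>s t. 0 \<le> s \<Longrightarrow> s \<le> t \<Longrightarrow> \<phi> t \<le> \<phi> s" and nn: "\<And>t. 0 \<le> t \<Longrightarrow> \<phi> t \<ge> 0"
    and supp: "\<And>t. t > L \<Longrightarrow> \<phi> t = 0" and L: "L \<ge> 0"
  shows "\<bar>(\<Sum>m\<in>IN (exp L). \<phi> (ln (nrm N m)) / nrm N m) - \<rho> * integral {0..L} \<phi>\<bar> \<le> C1 * \<phi> 0"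
proof -
  define B where "B = nat \<lfloor>exp L\<rfloor>"
  have X1: "B \<ge> 1" using L by (simp add: B_def le_nat_floor)
  have X2: "real B \<le> exp L" "exp L < real B + 1" using L by (auto simp: B_def)
  have L2: "L \<le> ln (real B + 1)" using X2 by (simp add: ln_ge_iff)
  have int: "\<phi> integrable_on {x..y}" if "0 \<le> x" for x y
    using integrable_antimono_nonneg[of \<phi>, OF anti that] .
  \<comment> \<open>The sum over integers naturally ends at \<open>ln (B + 1)\<close>, which is at
    least L. Beyond L the function vanishes, so both integrals agree.\<close>
  have "integral {0..ln (real B + 1)} \<phi> = integral {0..L} \<phi> + integral {L..ln (real B + 1)} \<phi>"
    using Henstock_Kurzweil_Integration.integral_combine[OF L L2 int[of 0]] by simp
  also have "integral {L..ln (real B + 1)} \<phi> = integral {L..ln (real B + 1)} (\<lambda>_. 0)"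
    by (rule integral_spike[of "{L}"]) (use supp in auto)
  finally have i1: "integral {0..ln (real B + 1)} \<phi> = integral {0..L} \<phi>" by simp
  obtain Y where Y: "B = Suc Y" using X1 by (cases B) auto
  have "integral {0..ln (real Y + 1)} \<phi> \<le> integral {0..ln (real B + 1)} \<phi>"
    by (rule integral_subset_le) (use int nn Y in auto)
  hence i2: "(\<Sum>k=1..B. \<phi> (ln (real k)) / real k) \<le> \<phi> 0 + integral {0..L} \<phi>"
    using antimono_log_sum_integral(2)[of \<phi> Y, OF anti nn] i1 Y by simp
  have i3: "integral {0..L} \<phi> \<le> (\<Sum>k=1..B. \<phi> (ln (real k)) / real k)"
    using antimono_log_sum_integral(1)[of \<phi> B, OF anti nn] i1 by simp
  have a: "\<bar>\<Sum>k=1..B. (rr k - \<rho>) / real k * \<phi> (ln (real k))\<bar> \<le> (3 * C0) * \<phi> (ln (real 1))"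
    by (rule abel_abs_bound) (use sum_rr_harmonic C0_nonneg X1 anti nn in auto)
  have "(\<Sum>m\<in>IN (exp L). \<phi> (ln (nrm N m)) / nrm N m) = (\<Sum>k=1..B. rr k * (\<phi> (ln (real k)) / real k))"
    using sum_IN[of "exp L" "\<lambda>k. \<phi> (ln (real k)) / real k"] by (simp add: B_def)
  also have "\<dots> - \<rho> * integral {0..L} \<phi> = (\<Sum>k=1..B. (rr k - \<rho>) / real k * \<phi> (ln (real k))) +
      \<rho> * ((\<Sum>k=1..B. \<phi> (ln (real k)) / real k) - integral {0..L} \<phi>)"
    by (simp add: sum_distrib_left sum_subtractf[symmetric] sum.distrib[symmetric] algebra_simps
        diff_divide_distrib)
  also have "\<bar>\<dots>\<bar> \<le> 3 * C0 * \<phi> 0 + \<rho> * \<phi> 0"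
  proof (rule order_trans[OF abs_triangle_ineq add_mono])
    show "\<bar>\<rho> * ((\<Sum>k=1..B. \<phi> (ln (real k)) / real k) - integral {0..L} \<phi>)\<bar> \<le> \<rho> * \<phi> 0"
      unfolding abs_mult using i2 i3 rho_pos by simp
  qed (use a in simp)
  finally show ?thesis by (simp add: C1_def algebra_simps)
qed

definition K1 :: real where "K1 = C1 + \<rho>"

lemma K1_pos: "K1 > 0" using C1_pos rho_pos by (simp add: K1_def)

text \<open>The previous estimate for the indicator function of [0, L]. It prices every unrestricted
  sum over one ideal at a factor \<open>K1 * (1 + L)\<close>.\<close>

lemma sum_inverse_nrm_le:
  assumes L: "L \<ge> 0" shows "(\<Sum>m\<in>IN (exp L). 1 / nrm N m) \<le> K1 * (1 + L)"
proof -
  define \<phi> :: "real \<Rightarrow> real" where "\<phi> = (\<lambda>t. if t \<le> L then 1 else 0)"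
  have "\<bar>(\<Sum>m\<in>IN (exp L). \<phi> (ln (nrm N m)) / nrm N m) - \<rho> * integral {0..L} \<phi>\<bar> \<le> C1 * \<phi> 0"
    by (rule sum_antimono_log) (use L in \<open>auto simp: \<phi>_def\<close>)
  moreover have "(\<Sum>m\<in>IN (exp L). \<phi> (ln (nrm N m)) / nrm N m) = (\<Sum>m\<in>IN (exp L). 1 / nrm N m)"
  proof (rule sum.cong[OF refl])
    fix m assume "m \<in> IN (exp L)"
    hence "real (nrm N m) \<ge> 1" "real (nrm N m) \<le> exp L" using nrm_ge1_real by (auto simp: IN_def)
    hence "ln (real (nrm N m)) \<le> L" by (metis exp_gt_zero ln_exp ln_le_cancel_iff order_less_le_trans zero_less_one)
    thus "\<phi> (ln (real (nrm N m))) / nrm N m = 1 / nrm N m" by (simp add: \<phi>_def)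
  qed
  moreover have "integral {0..L} \<phi> = integral {0..L} (\<lambda>_. 1)"
    by (rule integral_cong) (auto simp: \<phi>_def)
  ultimately have "(\<Sum>m\<in>IN (exp L). 1 / nrm N m) \<le> \<rho> * L + C1"
    using L by (simp add: \<phi>_def)
  also have "\<dots> \<le> K1 * (1 + L)"
    using C1_pos rho_pos L by (simp add: K1_def algebra_simps)
  finally show ?thesis .
qed

end

text \<open>The class of functions for which sums over multisets are compared with integrals.\<close>

definition adm :: "real \<Rightarrow> real \<Rightarrow> nat \<Rightarrow> (real list \<Rightarrow> real) \<Rightarrow> bool" where
  "adm L \<Phi> k F \<longleftrightarrow>
     (\<forall>ts us. length ts = k \<longrightarrow> (\<forall>t\<in>set ts. 0 \<le> t) \<longrightarrow> list_all2 (\<le>) ts us \<longrightarrow> F us \<le> F ts) \<and>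
     (\<forall>ts. length ts = k \<longrightarrow> (\<forall>t\<in>set ts. 0 \<le> t) \<longrightarrow> 0 \<le> F ts \<and> F ts \<le> \<Phi>) \<and>
     (\<forall>ts. length ts = k \<longrightarrow> (\<forall>t\<in>set ts. 0 \<le> t) \<longrightarrow> (\<exists>t\<in>set ts. t > L) \<longrightarrow> F ts = 0)"

text \<open>A recursion on the dimension through one-dimensional integrals: for the functions
  considered, each inner volume is again antitone in the outer variable, which makes the integral
  exist.\<close>

fun vol :: "real \<Rightarrow> nat \<Rightarrow> (real list \<Rightarrow> real) \<Rightarrow> real" where
  "vol L 0 F = F []"
| "vol L (Suc k) F = integral {0..L} (\<lambda>t. vol L k (\<lambda>ts. F (t # ts)))"

lemma admI:
  assumes "\<And>ts us. length ts = k \<Longrightarrow> \<forall>t\<in>set ts. 0 \<le> t \<Longrightarrow> list_all2 (\<le>) ts us \<Longrightarrow> F us \<le> F ts"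
    and "\<And>ts. length ts = k \<Longrightarrow> \<forall>t\<in>set ts. 0 \<le> t \<Longrightarrow> 0 \<le> F ts"
    and "\<And>ts. length ts = k \<Longrightarrow> \<forall>t\<in>set ts. 0 \<le> t \<Longrightarrow> F ts \<le> \<Phi>"
    and "\<And>ts t. length ts = k \<Longrightarrow> \<forall>t\<in>set ts. 0 \<le> t \<Longrightarrow> t \<in> set ts \<Longrightarrow> t > L \<Longrightarrow> F ts = 0"
  shows "adm L \<Phi> k F"
  using assms unfolding adm_def by blast

lemma admD:
  assumes "adm L \<Phi> k F" "length ts = k" "\<forall>t\<in>set ts. 0 \<le> t"
  shows "list_all2 (\<le>) ts us \<Longrightarrow> F us \<le> F ts" "0 \<le> F ts" "F ts \<le> \<Phi>"
    "t \<in> set ts \<Longrightarrow> t > L \<Longrightarrow> F ts = 0"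
  using assms unfolding adm_def by blast+

lemma adm_Cons:
  assumes adm: "adm L \<Phi> (Suc k) F" and t: "0 \<le> t"
  shows "adm L \<Phi> k (\<lambda>ts. F (t # ts))"
proof (rule admI)
  fix ts :: "real list" assume ts: "length ts = k" "\<forall>t\<in>set ts. 0 \<le> t"
  have ts': "length (t # ts) = Suc k" "\<forall>t\<in>set (t # ts). 0 \<le> t" using ts t by auto
  show "list_all2 (\<le>) ts us \<Longrightarrow> F (t # us) \<le> F (t # ts)" for us
    using admD(1)[OF adm ts', of "t # us"] by simp
  show "0 \<le> F (t # ts)" "F (t # ts) \<le> \<Phi>" using admD[OF adm ts'] by auto
  show "u \<in> set ts \<Longrightarrow> u > L \<Longrightarrow> F (t # ts) = 0" for u
    using admD(4)[OF adm ts', of u] by simp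
qed

text \<open>Recording the vanishing beyond L as the bound 0 lets the general volume bound show that
  the inner volume vanishes there.\<close>

lemma adm_Cons_supp:
  assumes adm: "adm L \<Phi> (Suc k) F" and t: "0 \<le> t" "L < t" shows "adm L 0 k (\<lambda>ts. F (t # ts))"
proof -
  have z: "F (t # ts) = 0" if "length ts = k" "\<forall>t\<in>set ts. 0 \<le> t" for ts
    by (rule admD(4)[OF adm]) (use that t in auto)
  show ?thesis
  proof (rule admI)
    fix ts us :: "real list" assume ts: "length ts = k" "\<forall>t\<in>set ts. 0 \<le> t" "list_all2 (\<le>) ts us"
    show "F (t # us) \<le> F (t # ts)"
      by (rule admD(1)[OF adm]) (use ts t in auto)
  qed (auto simp: z)
qed

lemma adm_Cons_le:
  assumes "adm L \<Phi> (Suc k) F" "0 \<le> s" "s \<le> t" "length ts = k" "\<And>u. u \<in> set ts \<Longrightarrow> 0 \<le> u"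
  shows "F (t # ts) \<le> F (s # ts)"
  by (rule admD(1)[OF assms(1)]) (use assms in \<open>auto simp: list_all2_refl\<close>)

text \<open>Bounds and monotonicity share one induction: integrability of the inner volume in the
  outer variable rests on its being antitone, which is monotonicity one dimension lower.\<close>

lemma vol_bounds:
  assumes "adm L \<Phi> k F" "L \<ge> 0"
  shows "0 \<le> vol L k F \<and> vol L k F \<le> \<Phi> * L ^ k \<and>
     (\<forall>G. adm L \<Phi> k G \<longrightarrow>
       (\<forall>ts. length ts = k \<longrightarrow> (\<forall>t\<in>set ts. 0 \<le> t) \<longrightarrow> F ts \<le> G ts) \<longrightarrow> vol L k F \<le> vol L k G)"
  using assms
proof (induction k arbitrary: F)
  case 0
  thus ?case by (auto simp: adm_def)
next
  case (Suc k)
  have int: "(\<lambda>t. vol L k (\<lambda>ts. G (t # ts))) integrable_on {0..L}" if G: "adm L \<Phi> (Suc k) G" for G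
  proof (rule integrable_antimono_nonneg)
    fix s t :: real assume st: "0 \<le> s" "s \<le> t"
    show "vol L k (\<lambda>ts. G (t # ts)) \<le> vol L k (\<lambda>ts. G (s # ts))"
      using Suc.IH[OF adm_Cons[OF G, of t]] adm_Cons[OF G, of s] adm_Cons_le[OF G] st Suc.prems by auto
  qed auto
  have "0 \<le> vol L (Suc k) F"
    unfolding vol.simps
    by (rule integral_nonneg[OF int[OF Suc.prems(1)]]) (use Suc.IH Suc.prems adm_Cons in auto)
  moreover have "vol L (Suc k) F \<le> integral {0..L} (\<lambda>t. \<Phi> * L ^ k)"
    unfolding vol.simps
    by (rule integral_le[OF int[OF Suc.prems(1)]]) (use Suc.IH Suc.prems adm_Cons in auto)
  hence "vol L (Suc k) F \<le> \<Phi> * L ^ Suc k" using Suc.prems by (simp add: algebra_simps)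
  moreover have "vol L (Suc k) F \<le> vol L (Suc k) G"
    if G: "adm L \<Phi> (Suc k) G"
     "\<forall>ts. length ts = Suc k \<longrightarrow> (\<forall>t\<in>set ts. 0 \<le> t) \<longrightarrow> F ts \<le> G ts" for G
    unfolding vol.simps
  proof (rule integral_le[OF int int])
    fix t assume "t \<in> {0..L}"
    thus "vol L k (\<lambda>ts. F (t # ts)) \<le> vol L k (\<lambda>ts. G (t # ts))"
      using Suc.IH[OF adm_Cons[OF Suc.prems(1), of t]] adm_Cons[OF G(1), of t] G(2) Suc.prems(2) by auto
  qed (use G Suc.prems in auto)
  ultimately show ?case by blast
qed

lemma vol_mono:
  assumes "adm L \<Phi> k F" "adm L \<Phi> k G" "L \<ge> 0"
    "\<And>ts. length ts = k \<Longrightarrow> (\<forall>t\<in>set ts. 0 \<le> t) \<Longrightarrow> F ts \<le> G ts"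
  shows "vol L k F \<le> vol L k G"
  using vol_bounds[OF assms(1,3)] assms(2,4) by blast

lemma vol_Cons_antimono:
  assumes "adm L \<Phi> (Suc k) F" "L \<ge> 0" "0 \<le> s" "s \<le> t"
  shows "vol L k (\<lambda>ts. F (t # ts)) \<le> vol L k (\<lambda>ts. F (s # ts))"
  by (rule vol_mono[OF adm_Cons[OF assms(1)] adm_Cons[OF assms(1)]])
     (use assms adm_Cons_le[OF assms(1)] in auto)

section \<open>Iterated sums over ideals compared with iterated integrals\<close>

context norm_system
begin

text \<open>Discrete counterpart of \<open>vol\<close>: on the logarithmic scale, the weight 1/norm
  gives the ideals the constant density \<rho>.\<close>

fun Sm :: "real \<Rightarrow> nat \<Rightarrow> (real list \<Rightarrow> real) \<Rightarrow> real" where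
  "Sm L 0 F = F []"
| "Sm L (Suc k) F = (\<Sum>m\<in>IN (exp L). Sm L k (\<lambda>ts. F (ln (nrm N m) # ts)) / nrm N m)"

lemma IN_exp_ln: "m \<in> IN (exp L) \<longleftrightarrow> m \<in> II \<and> ln (nrm N m) \<le> L"
proof (cases "m \<in> II")
  case True
  hence "real (nrm N m) > 0" using nrm_pos by simp
  hence "real (nrm N m) \<le> exp L \<longleftrightarrow> ln (nrm N m) \<le> L"
    by (metis exp_le_cancel_iff exp_ln)
  thus ?thesis using True by (simp add: IN_def)
qed (simp add: IN_def)

lemma Sm_mono:
  assumes "\<And>ts. length ts = k \<Longrightarrow> (\<And>t. t \<in> set ts \<Longrightarrow> 0 \<le> t \<and> t \<le> L) \<Longrightarrow> F ts \<le> G ts"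
  shows "Sm L k F \<le> Sm L k G"
  using assms
proof (induction k arbitrary: F G)
  case (Suc k)
  show ?case unfolding Sm.simps
  proof (rule sum_mono)
    fix m assume m: "m \<in> IN (exp L)"
    hence "0 \<le> ln (nrm N m)" "ln (nrm N m) \<le> L" using IN_exp_ln ln_nrm_nonneg by auto
    hence "Sm L k (\<lambda>ts. F (ln (nrm N m) # ts)) \<le> Sm L k (\<lambda>ts. G (ln (nrm N m) # ts))"
      by (intro Suc.IH Suc.prems) auto
    thus "Sm L k (\<lambda>ts. F (ln (nrm N m) # ts)) / nrm N m \<le> Sm L k (\<lambda>ts. G (ln (nrm N m) # ts)) / nrm N m"
      by (rule divide_right_mono) simp
  qed
qed simp

lemma Sm_add: "Sm L k (\<lambda>ts. F ts + G ts) = Sm L k F + Sm L k G"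
  by (induction k arbitrary: F G) (simp_all add: add_divide_distrib sum.distrib)

lemma Sm_cmult: "Sm L k (\<lambda>ts. c * F ts) = c * Sm L k F"
  by (induction k arbitrary: F) (simp_all add: sum_distrib_left)

lemma Sm_zero: "Sm L k (\<lambda>ts. 0) = 0"
  using Sm_cmult[of L k 0 "\<lambda>_. 0"] by simp

lemma Sm_sum: "finite A \<Longrightarrow> Sm L k (\<lambda>ts. \<Sum>a\<in>A. F a ts) = (\<Sum>a\<in>A. Sm L k (F a))"
  by (induction A rule: finite_induct) (simp_all add: Sm_add Sm_zero)

text \<open>Moving the sum over one ideal inside makes it accessible to an estimate that is uniform
  in the remaining variables.\<close>

lemma Sm_Suc_inner:
  "Sm L (Suc k) F = Sm L k (\<lambda>ts. \<Sum>m\<in>IN (exp L). F (ln (nrm N m) # ts) / nrm N m)"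
proof -
  have "Sm L k (\<lambda>ts. \<Sum>m\<in>IN (exp L). 1 / nrm N m * F (ln (nrm N m) # ts)) =
    (\<Sum>m\<in>IN (exp L). 1 / nrm N m * Sm L k (\<lambda>ts. F (ln (nrm N m) # ts)))"
    by (simp only: Sm_sum[OF finite_IN] Sm_cmult)
  thus ?thesis by simp
qed

lemma Sm_le_const:
  assumes "L \<ge> 0" "\<Phi> \<ge> 0"
    "\<And>ts. length ts = k \<Longrightarrow> (\<And>t. t \<in> set ts \<Longrightarrow> 0 \<le> t \<and> t \<le> L) \<Longrightarrow> F ts \<le> \<Phi>"
  shows "Sm L k F \<le> \<Phi> * (K1 * (1 + L)) ^ k"
proof -
  have "Sm L k F \<le> Sm L k (\<lambda>_. \<Phi>)" by (rule Sm_mono) (use assms in auto)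
  also have "\<dots> \<le> \<Phi> * (K1 * (1 + L)) ^ k"
  proof (induction k)
    case (Suc k)
    have "Sm L (Suc k) (\<lambda>_. \<Phi>) = Sm L k (\<lambda>_. \<Phi>) * (\<Sum>m\<in>IN (exp L). 1 / nrm N m)"
      by (simp add: sum_distrib_left)
    also have "\<dots> \<le> (\<Phi> * (K1 * (1 + L)) ^ k) * (K1 * (1 + L))"
      using sum_inverse_nrm_le[OF assms(1)] assms K1_pos Suc
      by (intro mult_mono) (auto intro!: sum_nonneg)
    finally show ?case by (simp add: algebra_simps)
  qed simp
  finally show ?thesis .
qed

text \<open>Split off one ideal. By induction its inner sum is a volume up to an error which, summed
  with weight 1/norm, gains a factor \<open>Q\<close>; the inner volume is antitone in the outer
  variable, so the outer sum becomes an integral with an error proportional to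
  \<open>\<Phi> * L ^ k\<close>. Each of the k replacements trades one logarithm for a
  constant.\<close>

lemma Sm_vol:
  assumes "adm L \<Phi> k F" "L \<ge> 0" "\<Phi> \<ge> 0"
  shows "\<bar>Sm L k F - \<rho> ^ k * vol L k F\<bar> \<le> k * C1 * \<Phi> * (K1 * (1 + L)) ^ (k - 1)"
  using assms(1)
proof (induction k arbitrary: F)
  case (Suc k)
  note adm = Suc.prems
  define \<phi> where "\<phi> = (\<lambda>t. vol L k (\<lambda>ts. F (t # ts)))"
  define Q where "Q = K1 * (1 + L)"
  have Q: "\<rho> * L \<le> Q" "Q \<ge> 0" "\<rho> \<le> Q"
    using K1_pos C1_pos rho_pos assms(2) by (auto simp: Q_def K1_def algebra_simps)
  have supp: "\<phi> t = 0" if "t > L" for t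
  proof -
    have "adm L 0 k (\<lambda>ts. F (t # ts))" using adm_Cons_supp[OF adm _ that] that assms(2) by simp
    thus ?thesis using vol_bounds[of L 0 k "\<lambda>ts. F (t # ts)"] assms by (auto simp: \<phi>_def)
  qed
  have \<phi>0: "0 \<le> \<phi> t \<and> \<phi> t \<le> \<Phi> * L ^ k" if "t \<ge> 0" for t
    using vol_bounds[OF adm_Cons[OF adm that] assms(2)] by (simp add: \<phi>_def)
  have "\<bar>(\<Sum>m\<in>IN (exp L). \<phi> (ln (nrm N m)) / nrm N m) - \<rho> * integral {0..L} \<phi>\<bar> \<le> C1 * \<phi> 0"
    by (rule sum_antimono_log) (use vol_Cons_antimono[OF adm assms(2)] \<phi>0 supp assms(2) in \<open>auto simp: \<phi>_def\<close>)
  also have "\<dots> \<le> C1 * (\<Phi> * L ^ k)" using \<phi>0[of 0] C1_pos by (intro mult_left_mono) auto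
  finally have a: "\<rho> ^ k * \<bar>(\<Sum>m\<in>IN (exp L). \<phi> (ln (nrm N m)) / nrm N m) - \<rho> * integral {0..L} \<phi>\<bar> \<le> \<rho> ^ k * (C1 * (\<Phi> * L ^ k))"
    using rho_pos by (intro mult_left_mono) auto
  also have "\<dots> = C1 * \<Phi> * (\<rho> * L) ^ k" by (simp add: power_mult_distrib)
  also have "\<dots> \<le> C1 * \<Phi> * Q ^ k"
    using Q C1_pos assms rho_pos by (intro mult_left_mono power_mono) auto
  finally have a: "\<rho> ^ k * \<bar>(\<Sum>m\<in>IN (exp L). \<phi> (ln (nrm N m)) / nrm N m) - \<rho> * integral {0..L} \<phi>\<bar> \<le> C1 * \<Phi> * Q ^ k" .
  have "\<bar>\<Sum>m\<in>IN (exp L). (Sm L k (\<lambda>ts. F (ln (nrm N m) # ts)) - \<rho> ^ k * \<phi> (ln (nrm N m))) / nrm N m\<bar>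
     \<le> (\<Sum>m\<in>IN (exp L). (k * C1 * \<Phi> * Q ^ (k - 1)) / nrm N m)"
  proof (rule order_trans[OF sum_abs sum_mono])
    fix m assume m: "m \<in> IN (exp L)"
    have "\<bar>Sm L k (\<lambda>ts. F (ln (nrm N m) # ts)) - \<rho> ^ k * \<phi> (ln (nrm N m))\<bar> \<le> k * C1 * \<Phi> * Q ^ (k - 1)"
      unfolding \<phi>_def Q_def using m IN_exp_ln ln_nrm_nonneg by (intro Suc.IH adm_Cons[OF adm]) auto
    thus "\<bar>(Sm L k (\<lambda>ts. F (ln (nrm N m) # ts)) - \<rho> ^ k * \<phi> (ln (nrm N m))) / nrm N m\<bar> \<le> (k * C1 * \<Phi> * Q ^ (k - 1)) / nrm N m"
      by (simp add: divide_right_mono)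
  qed
  also have "\<dots> = (k * C1 * \<Phi> * Q ^ (k - 1)) * (\<Sum>m\<in>IN (exp L). 1 / nrm N m)"
    by (simp add: sum_distrib_left)
  also have "\<dots> \<le> (k * C1 * \<Phi> * Q ^ (k - 1)) * Q"
    using sum_inverse_nrm_le[OF assms(2)] Q C1_pos assms by (intro mult_left_mono) (auto simp: Q_def)
  also have "\<dots> = k * C1 * \<Phi> * Q ^ k" by (cases k) auto
  finally have b: "\<bar>\<Sum>m\<in>IN (exp L). (Sm L k (\<lambda>ts. F (ln (nrm N m) # ts)) - \<rho> ^ k * \<phi> (ln (nrm N m))) / nrm N m\<bar>
     \<le> k * C1 * \<Phi> * Q ^ k" .
  have "Sm L (Suc k) F - \<rho> ^ Suc k * vol L (Suc k) F =
    (\<Sum>m\<in>IN (exp L). (Sm L k (\<lambda>ts. F (ln (nrm N m) # ts)) - \<rho> ^ k * \<phi> (ln (nrm N m))) / nrm N m) +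
    \<rho> ^ k * ((\<Sum>m\<in>IN (exp L). \<phi> (ln (nrm N m)) / nrm N m) - \<rho> * integral {0..L} \<phi>)"
    by (simp add: \<phi>_def diff_divide_distrib sum_subtractf sum_distrib_left algebra_simps)
  also have "\<bar>\<dots>\<bar> \<le> k * C1 * \<Phi> * Q ^ k + C1 * \<Phi> * Q ^ k"
    by (rule order_trans[OF abs_triangle_ineq add_mono[OF b]])
       (use a rho_pos in \<open>simp add: abs_mult\<close>)
  finally show ?case by (simp add: Q_def algebra_simps)
qed simp

end

text \<open>By the mean value theorem the term at n + 1 is at most the increment of
  \<open>x powr s / s\<close> from n to n + 1, because the exponent \<open>s - 1\<close> is not
  positive.\<close>

lemma sum_powr_bound:
  fixes s :: real assumes s: "0 < s" "s \<le> 1"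
  shows "(\<Sum>k=1..n. real k powr (s - 1)) \<le> real n powr s / s"
proof (induction n)
  case (Suc n)
  have "real (Suc n) powr s - real n powr s \<ge> s * real (Suc n) powr (s - 1)"
  proof (cases "n = 0")
    case False
    have "\<exists>z::real. real n < z \<and> z < real (Suc n) \<and>
        real (Suc n) powr s - real n powr s = (real (Suc n) - real n) * (s * z powr (s - 1))"
      by (rule MVT2) (use False in \<open>auto intro!: derivative_eq_intros\<close>)
    then obtain z where z: "real n < z" "z < real (Suc n)"
        "real (Suc n) powr s - real n powr s = s * z powr (s - 1)" by auto
    have "real (Suc n) powr (s - 1) \<le> z powr (s - 1)"
      by (rule powr_mono2') (use z False s in auto)
    thus ?thesis using z s by (simp add: mult_left_mono)
  qed (use s in auto)
  thus ?case using Suc s by (simp add: field_simps)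
qed simp

fun dot :: "real list \<Rightarrow> real list \<Rightarrow> real" where
  "dot (w # ws) (t # ts) = w * t + dot ws ts"
| "dot _ _ = 0"

lemma dot_nonneg: "\<forall>w\<in>set ws. w \<ge> 0 \<Longrightarrow> \<forall>t\<in>set ts. t \<ge> 0 \<Longrightarrow> dot ws ts \<ge> 0"
  by (induction ws ts rule: dot.induct) auto

lemma dot_mono: "\<forall>w\<in>set ws. w \<ge> 0 \<Longrightarrow> list_all2 (\<le>) ts us \<Longrightarrow> dot ws ts \<le> dot ws us"
proof (induction ws ts arbitrary: us rule: dot.induct)
  case (1 w ws t ts)
  then obtain u us' where us: "us = u # us'" "t \<le> u" "list_all2 (\<le>) ts us'"
    by (auto simp: list_all2_Cons1)
  thus ?case using 1 by (auto intro!: add_mono mult_left_mono)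
qed auto

lemma length_6: "length xs = 6 \<longleftrightarrow> (\<exists>a b c d e f. xs = [a, b, c, d, e, f])"
  by (auto simp: numeral_eq_Suc length_Suc_conv)

text \<open>
  Row \<open>i\<close> lists the \<open>i\<close>-th coordinates of (2,1,0), (1,2,0), (0,2,1), (0,1,2), (1,0,2), (2,0,1).
\<close>

definition W1 :: "real list" where "W1 = [2, 1, 0, 0, 1, 2]"
definition W2 :: "real list" where "W2 = [1, 2, 2, 1, 0, 0]"
definition W3 :: "real list" where "W3 = [0, 0, 1, 2, 2, 1]"

text \<open>Indicator of the region where each corner ideal still has room: the six other ideals use
  up \<open>dot W1 ts\<close> of the first bound \<open>c1\<close>, and likewise for the
  others.\<close>

definition Fc :: "real \<Rightarrow> real \<Rightarrow> real \<Rightarrow> real list \<Rightarrow> real" where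
  "Fc c1 c2 c3 ts = of_bool (dot W1 ts \<le> c1 \<and> dot W2 ts \<le> c2 \<and> dot W3 ts \<le> c3)"

lemma W_nonneg: "\<forall>w\<in>set W1. w \<ge> 0" "\<forall>w\<in>set W2. w \<ge> 0" "\<forall>w\<in>set W3. w \<ge> 0"
  by (simp_all add: W1_def W2_def W3_def)

text \<open>Each of the six columns has an entry at least 1, so a coordinate beyond L violates one
  of the three inequalities.\<close>

lemma adm_Fc:
  assumes "c1 \<le> L" "c2 \<le> L" "c3 \<le> L" shows "adm L 1 6 (Fc c1 c2 c3)"
proof (rule admI)
  fix ts us :: "real list" assume "list_all2 (\<le>) ts us"
  hence "dot W1 ts \<le> dot W1 us" "dot W2 ts \<le> dot W2 us" "dot W3 ts \<le> dot W3 us"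
    using dot_mono W_nonneg by auto
  thus "Fc c1 c2 c3 us \<le> Fc c1 c2 c3 ts" by (auto simp: Fc_def)
next
  fix ts :: "real list" and t
  assume "length ts = 6" "\<forall>t\<in>set ts. 0 \<le> t" "t \<in> set ts" "L < t"
  thus "Fc c1 c2 c3 ts = 0"
    using assms by (auto simp: length_6 Fc_def W1_def W2_def W3_def)
qed (auto simp: Fc_def)

section \<open>The corner ideals: their number and the error terms\<close>

context norm_system
begin

definition K2 :: real where "K2 = C0 + \<rho>"

lemma K2_pos: "K2 > 0" using C0_nonneg rho_pos by (simp add: K2_def)

text \<open>A corner such as (3,0,0) lets an ideal enter with its cube, hence the division by
  3.\<close>

definition cl :: "real \<Rightarrow> real" where "cl u = real (card (IN (exp (u / 3))))"

lemma cl_neg: "u < 0 \<Longrightarrow> cl u = 0"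
  by (simp add: cl_def IN_empty)

lemma card_IN_approx:
  assumes "B \<ge> 1" shows "\<bar>real (card (IN B)) - \<rho> * B\<bar> \<le> K2 * sqrt B"
proof -
  define n where "n = nat \<lfloor>B\<rfloor>"
  have n: "n \<ge> 1" "real n \<le> B" "B < real n + 1" using assms by (auto simp: n_def le_nat_iff)
  have "\<bar>real (card (IN B)) - \<rho> * real n\<bar> \<le> C0 * sqrt (real n)"
    using cnt0[OF n(1)] IN_altdef[of B] assms by (simp add: n_def)
  also have "\<dots> \<le> C0 * sqrt B" using n C0_nonneg by (intro mult_left_mono) auto
  finally have 1: "\<bar>real (card (IN B)) - \<rho> * real n\<bar> \<le> C0 * sqrt B" .
  have "\<bar>\<rho> * real n - \<rho> * B\<bar> = \<rho> * (B - real n)" using n rho_pos by (simp add: abs_mult flip: right_diff_distrib)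
  also have "\<dots> \<le> \<rho> * 1" using n rho_pos by (intro mult_left_mono) auto
  also have "\<dots> \<le> \<rho> * sqrt B" using assms rho_pos by (intro mult_left_mono) auto
  finally show ?thesis using 1 by (simp add: K2_def algebra_simps)
qed

text \<open>The square root error becomes the relative error \<open>exp (- (u / 6))\<close>: it is
  small except near \<open>u = 0\<close>, that is, near the boundary of the polytope.\<close>

lemma cl_approx:
  assumes "u \<ge> 0" shows "\<bar>cl u - \<rho> * exp (u / 3)\<bar> \<le> K2 * exp (u / 3) * exp (- (u / 6))"
proof -
  have "sqrt (exp (u / 3)) = exp (u / 6)"
    by (rule real_sqrt_unique) (simp_all add: power2_eq_square flip: exp_add)
  also have "\<dots> = exp (u / 3) * exp (- (u / 6))" by (simp flip: exp_add)
  finally show ?thesis using card_IN_approx[of "exp (u / 3)"] assms by (simp add: cl_def)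
qed

text \<open>The factors are replaced by their main terms one after the other; a factor not being
  replaced is bounded crudely by \<open>r + K\<close> times its size.\<close>

lemma product3_approx:
  fixes x y z B Y Z e1 e2 e3 K r :: real
  assumes x: "\<bar>x - r * B\<bar> \<le> K * B * e1" and y: "\<bar>y - r * Y\<bar> \<le> K * Y * e2" and z: "\<bar>z - r * Z\<bar> \<le> K * Z * e3"
    and pos: "B \<ge> 0" "Y \<ge> 0" "Z \<ge> 0" "K \<ge> 0" "r \<ge> 0" "0 \<le> y" "0 \<le> z"
    and e: "0 \<le> e1" "0 \<le> e2" "0 \<le> e3" "e1 \<le> 1" "e2 \<le> 1" "e3 \<le> 1"
  shows "\<bar>x * y * z - r ^ 3 * (B * Y * Z)\<bar> \<le> K * (r + K)\<^sup>2 * (B * Y * Z) * (e1 + e2 + e3)"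
proof -
  have ub: "K * A * e \<le> K * A" if "0 \<le> A" "e \<le> 1" "0 \<le> e" for A e
    using that pos mult_left_mono[of e 1 "K * A"] by simp
  have y': "y \<le> (r + K) * Y" and z': "z \<le> (r + K) * Z"
    using y z ub[of Y e2] ub[of Z e3] pos e by (auto simp: algebra_simps)
  have "x * y * z - r ^ 3 * (B * Y * Z) =
     (x - r * B) * (y * z) + (r * B) * (y - r * Y) * z + (r * B) * (r * Y) * (z - r * Z)"
    by (simp add: algebra_simps power3_eq_cube)
  also have "\<bar>\<dots>\<bar> \<le> \<bar>(x - r * B) * (y * z)\<bar> + \<bar>(r * B) * (y - r * Y) * z\<bar> + \<bar>(r * B) * (r * Y) * (z - r * Z)\<bar>"
    by linarith
  also have "\<dots> \<le> (K * B * e1) * (((r + K) * Y) * ((r + K) * Z)) + ((r + K) * B) * (K * Y * e2) * ((r + K) * Z) +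
       ((r + K) * B) * ((r + K) * Y) * (K * Z * e3)"
    unfolding abs_mult using assms y' z'
    by (intro add_mono mult_mono mult_nonneg_nonneg) (auto intro!: mult_right_mono)
  also have "\<dots> = K * (r + K)\<^sup>2 * (B * Y * Z) * (e1 + e2 + e3)"
    by (simp add: algebra_simps power2_eq_square)
  finally show ?thesis .
qed

definition gc :: "real list \<Rightarrow> real \<Rightarrow> real list \<Rightarrow> real" where
  "gc W c ts = of_bool (dot W ts \<le> c) * exp (- ((c - dot W ts) / 6))"

text \<open>Here a logarithm is saved. The summand is \<open>exp (- (h / 6))\<close> times
  \<open>nrm N m powr (s - 1)\<close> with \<open>s = w / 6\<close>, and the sum up to norm
  \<open>exp (h / w)\<close> is of order \<open>exp (h / 6)\<close> because s is positive. The total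
  is bounded independently of h and L, where the weight 1/norm alone would give a logarithm.\<close>

lemma gc_inner:
  assumes w: "w = 1 \<or> w = 2"
  shows "(\<Sum>m\<in>IN (exp L). (of_bool (w * ln (nrm N m) \<le> h) * exp (- ((h - w * ln (nrm N m)) / 6))) / nrm N m)
     \<le> 6 * (\<rho> + C0)"
proof (cases "h \<ge> 0")
  case False
  have "\<not> w * ln (nrm N m) \<le> h" if "m \<in> IN (exp L)" for m
    using False w that ln_nrm_nonneg[of m] by (auto simp: IN_def) 
  thus ?thesis using rho_pos C0_nonneg by simp
next
  case True
  define B where "B = exp (h / w)"
  define s where "s = w / 6"
  have s: "0 < s" "s \<le> 1" using w by (auto simp: s_def)
  have le: "w * ln (nrm N m) \<le> h \<longleftrightarrow> m \<in> IN B" if "m \<in> II" for m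
    using IN_exp_ln[of m "h / w"] that w by (auto simp: B_def)
  have "(\<Sum>m\<in>IN (exp L). (of_bool (w * ln (nrm N m) \<le> h) * exp (- ((h - w * ln (nrm N m)) / 6))) / nrm N m)
    = (\<Sum>m\<in>IN (exp L) \<inter> IN B. exp (- ((h - w * ln (nrm N m)) / 6)) / nrm N m)"
  proof (rule sum.mono_neutral_cong_right[OF finite_IN])
    show "\<forall>m\<in>IN (exp L) - IN (exp L) \<inter> IN B. of_bool (w * ln (nrm N m) \<le> h) * exp (- ((h - w * ln (nrm N m)) / 6)) / nrm N m = 0"
      using le by (auto simp: IN_def)
  qed (use le in \<open>auto simp: IN_def\<close>)
  also have "\<dots> \<le> (\<Sum>m\<in>IN B. exp (- ((h - w * ln (nrm N m)) / 6)) / nrm N m)"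
    by (rule sum_mono2) auto
  also have "\<dots> = (\<Sum>m\<in>IN B. exp (- (h / 6)) * (nrm N m) powr (s - 1))"
  proof (rule sum.cong[OF refl])
    fix m assume "m \<in> IN B"
    hence p: "real (nrm N m) > 0" using nrm_pos by (auto simp: IN_def)
    have "exp (- ((h - w * ln (nrm N m)) / 6)) / nrm N m = exp (- ((h - w * ln (nrm N m)) / 6)) / exp (ln (nrm N m))"
      using p by simp
    also have "\<dots> = exp (- (h / 6)) * exp ((s - 1) * ln (nrm N m))"
      by (simp add: s_def field_simps flip: exp_add exp_diff)
    finally show "exp (- ((h - w * ln (nrm N m)) / 6)) / nrm N m = exp (- (h / 6)) * (nrm N m) powr (s - 1)"
      using p by (simp add: powr_def)
  qed
  also have "\<dots> = exp (- (h / 6)) * (\<Sum>m\<in>IN B. (nrm N m) powr (s - 1))"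
    by (simp add: sum_distrib_left)
  also have "(\<Sum>m\<in>IN B. (nrm N m) powr (s - 1)) = (\<Sum>k=1..nat \<lfloor>B\<rfloor>. rr k * real k powr (s - 1))"
    using sum_IN[of B "\<lambda>k. real k powr (s - 1)"] by (simp add: B_def)
  also have "\<dots> \<le> (\<rho> + C0) * (\<Sum>k=1..nat \<lfloor>B\<rfloor>. real k powr (s - 1))"
    by (rule sum_rr_antimono_le) (use s in \<open>auto intro!: powr_mono2'\<close>)
  also have "\<dots> \<le> (\<rho> + C0) * (exp (h / 6) * 6)"
  proof (rule mult_left_mono)
    have "(\<Sum>k=1..nat \<lfloor>B\<rfloor>. real k powr (s - 1)) \<le> real (nat \<lfloor>B\<rfloor>) powr s / s"
      by (rule sum_powr_bound[OF s])
    also have "\<dots> \<le> B powr s / s"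
      using s by (intro divide_right_mono powr_mono2) (auto simp: B_def)
    also have "B powr s = exp (h / 6)" using w by (auto simp: B_def s_def powr_def)
    also have "exp (h / 6) / s \<le> exp (h / 6) * 6" using w by (auto simp: s_def)
    finally show "(\<Sum>k=1..nat \<lfloor>B\<rfloor>. real k powr (s - 1)) \<le> exp (h / 6) * 6" .
  qed (use rho_pos C0_nonneg in auto)
  finally have "(\<Sum>m\<in>IN (exp L). (of_bool (w * ln (nrm N m) \<le> h) * exp (- ((h - w * ln (nrm N m)) / 6))) / nrm N m)
    \<le> exp (- (h / 6)) * ((\<rho> + C0) * (exp (h / 6) * 6))" by simp
  also have "\<dots> = 6 * (\<rho> + C0)" by (simp add: exp_minus field_simps)
  finally show ?thesis .
qed

text \<open>The first ideal with nonzero weight in the row has a bounded sum by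
  \<open>gc_inner\<close>; the other k - 1 sums are estimated without restriction by
  \<open>K1 * (1 + L)\<close> each.\<close>

lemma Sm_gc:
  assumes "\<forall>w\<in>set W. w = 0 \<or> w = 1 \<or> w = 2" "\<exists>w\<in>set W. w \<noteq> 0" "L \<ge> 0" "length W = k"
  shows "Sm L k (gc W c) \<le> 6 * (\<rho> + C0) * (K1 * (1 + L)) ^ (k - 1)"
  using assms
proof (induction W arbitrary: c k)
  case (Cons w W)
  then obtain k' where k: "k = Suc k'" by auto
  define Q where "Q = K1 * (1 + L)"
  have Q0: "Q \<ge> 0" using K1_pos Cons.prems by (simp add: Q_def)
  show ?case
  proof (cases "w = 0")
    case False
    hence w: "w = 1 \<or> w = 2" using Cons.prems by auto
    have "Sm L (Suc k') (gc (w # W) c) \<le> 6 * (\<rho> + C0) * (K1 * (1 + L)) ^ k'"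
      unfolding Sm_Suc_inner
    proof (rule Sm_le_const)
      fix ts :: "real list"
      show "(\<Sum>m\<in>IN (exp L). gc (w # W) c (ln (nrm N m) # ts) / nrm N m) \<le> 6 * (\<rho> + C0)"
        using gc_inner[OF w, where L = L and h = "c - dot W ts"] by (simp add: gc_def algebra_simps)
    qed (use Cons.prems rho_pos C0_nonneg in auto)
    thus ?thesis by (simp add: k)
  next
    case True
    hence ex: "\<exists>w\<in>set W. w \<noteq> 0" using Cons.prems by auto
    then obtain k'' where k'': "k' = Suc k''" using Cons.prems k by (cases W) auto
    have "gc (w # W) c (t # ts) = gc W c ts" for t ts by (simp add: gc_def True)
    hence "Sm L k (gc (w # W) c) = Sm L k' (gc W c) * (\<Sum>m\<in>IN (exp L). 1 / nrm N m)"
      by (simp add: k sum_distrib_left)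
    also have "\<dots> \<le> (6 * (\<rho> + C0) * Q ^ (k' - 1)) * Q"
    proof (rule mult_mono)
      show "Sm L k' (gc W c) \<le> 6 * (\<rho> + C0) * Q ^ (k' - 1)"
        unfolding Q_def by (rule Cons.IH) (use Cons.prems ex k in auto)
      show "(\<Sum>m\<in>IN (exp L). 1 / nrm N m) \<le> Q" 
        using sum_inverse_nrm_le Cons.prems by (simp add: Q_def)
    qed (use Q0 rho_pos C0_nonneg in \<open>auto intro!: sum_nonneg\<close>)
    also have "\<dots> = 6 * (\<rho> + C0) * Q ^ (k - 1)" by (simp add: k k'')
    finally show ?thesis by (simp add: Q_def)
  qed
qed auto

text \<open>The number of choices for the three corner ideals, given the other six. The factor
  \<open>exp (sum_list ts)\<close> cancels the weights 1/norm built into \<open>Sm\<close>.\<close>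

definition Gc :: "real \<Rightarrow> real \<Rightarrow> real \<Rightarrow> real list \<Rightarrow> real" where
  "Gc c1 c2 c3 ts = exp (sum_list ts) * (cl (c1 - dot W1 ts) * cl (c2 - dot W2 ts) * cl (c3 - dot W3 ts))"

lemma Gc_approx:
  assumes len: "length ts = 6"
  shows "\<bar>Gc c1 c2 c3 ts - exp ((c1 + c2 + c3) / 3) * (\<rho> ^ 3 * Fc c1 c2 c3 ts)\<bar> \<le>
     exp ((c1 + c2 + c3) / 3) * (K2 * (\<rho> + K2)\<^sup>2) * (gc W1 c1 ts + gc W2 c2 ts + gc W3 c3 ts)"
proof -
  define u1 u2 u3 where "u1 = c1 - dot W1 ts" and "u2 = c2 - dot W2 ts" and "u3 = c3 - dot W3 ts"
  \<comment> \<open>Each column of the three rows sums to 3. Hence the exponential main terms of the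
    three counts combine with \<open>exp (sum_list ts)\<close> to a constant on the whole
    polytope.\<close>
  have su: "sum_list ts + (u1 + u2 + u3) / 3 = (c1 + c2 + c3) / 3"
    using len by (auto simp: length_6 u1_def u2_def u3_def W1_def W2_def W3_def field_simps)
  show ?thesis
  proof (cases "u1 \<ge> 0 \<and> u2 \<ge> 0 \<and> u3 \<ge> 0")
    case False
    hence "cl u1 * cl u2 * cl u3 = 0" using cl_neg by (auto simp: not_le)
    hence "Gc c1 c2 c3 ts = 0" by (auto simp: Gc_def u1_def u2_def u3_def)
    moreover have "Fc c1 c2 c3 ts = 0" using False by (auto simp: Fc_def u1_def u2_def u3_def)
    ultimately show ?thesis using K2_pos rho_pos by (auto simp: gc_def intro!: mult_nonneg_nonneg add_nonneg_nonneg)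
  next
    case True
    define a where "a = exp (sum_list ts)"
    define m where "m = cl u1 * cl u2 * cl u3"
    define e where "e = exp (u1 / 3) * exp (u2 / 3) * exp (u3 / 3)"
    define A where "A = K2 * (\<rho> + K2)\<^sup>2"
    define S where "S = exp (-(u1/6)) + exp (-(u2/6)) + exp (-(u3/6))"
    have 1: "\<bar>m - \<rho> ^ 3 * e\<bar> \<le> A * e * S"
      unfolding m_def e_def A_def S_def
      by (rule product3_approx) (use True cl_approx K2_pos rho_pos in \<open>auto simp: cl_def\<close>)
    have E: "exp ((c1 + c2 + c3) / 3) = a * e"
      unfolding su[symmetric] a_def e_def by (simp add: exp_add[symmetric] add_divide_distrib add.assoc)
    have F: "Fc c1 c2 c3 ts = 1" "gc W1 c1 ts + gc W2 c2 ts + gc W3 c3 ts = S" "Gc c1 c2 c3 ts = a * m"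
      using True by (simp_all add: Fc_def gc_def Gc_def S_def a_def m_def u1_def u2_def u3_def)
    have "\<bar>a * m - a * e * (\<rho> ^ 3 * 1)\<bar> = \<bar>a * (m - \<rho> ^ 3 * e)\<bar>" by (simp add: algebra_simps)
    also have "\<dots> = a * \<bar>m - \<rho> ^ 3 * e\<bar>" by (simp add: abs_mult a_def)
    also have "\<dots> \<le> a * (A * e * S)" using 1 by (rule mult_left_mono) (simp add: a_def)
    finally show ?thesis unfolding E F A_def[symmetric] by (simp only: mult_ac)
  qed
qed

text \<open>Three of the nine factors \<rho> come from the corner counts and six from
  \<open>Sm_vol\<close>. In the error, 18 collects 6 for each of the three rows from
  \<open>Sm_gc\<close>, and \<open>6 * C1 * \<rho> ^ 3\<close> is the error of \<open>Sm_vol\<close>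
  in dimension 6.\<close>

lemma Sm_Gc:
  assumes c: "c1 \<le> L" "c2 \<le> L" "c3 \<le> L" and L: "L \<ge> 0"
  shows "\<bar>Sm L 6 (Gc c1 c2 c3) - exp ((c1 + c2 + c3) / 3) * (\<rho> ^ 9 * vol L 6 (Fc c1 c2 c3))\<bar> \<le>
     exp ((c1 + c2 + c3) / 3) * ((18 * (K2 * (\<rho> + K2)\<^sup>2) * (\<rho> + C0) + 6 * C1 * \<rho> ^ 3) * (K1 * (1 + L)) ^ 5)"
proof -
  define E where "E = exp ((c1 + c2 + c3) / 3)"
  define Q where "Q = (K1 * (1 + L)) ^ 5"
  define A where "A = K2 * (\<rho> + K2)\<^sup>2"
  have E: "E \<ge> 0" by (simp add: E_def)
  have A: "A \<ge> 0" using K2_pos by (simp add: A_def)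
  have g: "Sm L 6 (gc W1 c1) \<le> 6 * (\<rho> + C0) * Q" "Sm L 6 (gc W2 c2) \<le> 6 * (\<rho> + C0) * Q"
     "Sm L 6 (gc W3 c3) \<le> 6 * (\<rho> + C0) * Q"
    using Sm_gc[of W1 L 6 c1] Sm_gc[of W2 L 6 c2] Sm_gc[of W3 L 6 c3] L
    by (simp_all add: W1_def W2_def W3_def Q_def)
  define D where "D = (\<lambda>ts. Gc c1 c2 c3 ts - E * (\<rho> ^ 3 * Fc c1 c2 c3 ts))"
  define S where "S = (\<lambda>ts. E * A * (gc W1 c1 ts + gc W2 c2 ts + gc W3 c3 ts))"
  have D: "\<bar>D ts\<bar> \<le> S ts" if "length ts = 6" for ts
    using Gc_approx[OF that, of c1 c2 c3] by (simp add: D_def S_def E_def A_def mult_ac)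
  have "Sm L 6 D \<le> Sm L 6 S" using D by (intro Sm_mono) (auto simp: abs_le_iff)
  moreover have "Sm L 6 (\<lambda>ts. (-1) * S ts) \<le> Sm L 6 D"
    using D by (intro Sm_mono) (fastforce simp: abs_le_iff)
  ultimately have DS: "\<bar>Sm L 6 D\<bar> \<le> Sm L 6 S" unfolding Sm_cmult by simp
  have "Sm L 6 S = E * A * (Sm L 6 (gc W1 c1) + Sm L 6 (gc W2 c2) + Sm L 6 (gc W3 c3))"
    by (simp only: S_def Sm_cmult Sm_add)
  also have "\<dots> \<le> E * A * (6 * (\<rho> + C0) * Q + 6 * (\<rho> + C0) * Q + 6 * (\<rho> + C0) * Q)"
    using g E A by (intro mult_left_mono add_mono) auto
  finally have 1: "\<bar>Sm L 6 D\<bar> \<le> E * (18 * A * (\<rho> + C0) * Q)" using DS by (simp add: algebra_simps)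
  have "Gc c1 c2 c3 = (\<lambda>ts. D ts + (E * \<rho> ^ 3) * Fc c1 c2 c3 ts)" by (auto simp: D_def)
  hence "Sm L 6 (Gc c1 c2 c3) = Sm L 6 D + (E * \<rho> ^ 3) * Sm L 6 (Fc c1 c2 c3)"
    by (simp only: Sm_add Sm_cmult)
  hence "Sm L 6 (Gc c1 c2 c3) - E * (\<rho> ^ 9 * vol L 6 (Fc c1 c2 c3)) =
     Sm L 6 D + (E * \<rho> ^ 3) * (Sm L 6 (Fc c1 c2 c3) - \<rho> ^ 6 * vol L 6 (Fc c1 c2 c3))"
    by (simp only: right_diff_distrib mult.assoc power_add[symmetric]) (simp add: algebra_simps flip: power_add)
  also have "\<bar>\<dots>\<bar> \<le> E * (18 * A * (\<rho> + C0) * Q) + (E * \<rho> ^ 3) * (6 * C1 * Q)"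
  proof (rule order_trans[OF abs_triangle_ineq add_mono[OF 1]])
    have "\<bar>Sm L 6 (Fc c1 c2 c3) - \<rho> ^ 6 * vol L 6 (Fc c1 c2 c3)\<bar> \<le> 6 * C1 * Q"
      using Sm_vol[OF adm_Fc[OF c] L] by (simp add: Q_def)
    thus "\<bar>(E * \<rho> ^ 3) * (Sm L 6 (Fc c1 c2 c3) - \<rho> ^ 6 * vol L 6 (Fc c1 c2 c3))\<bar> \<le> (E * \<rho> ^ 3) * (6 * C1 * Q)"
      using E rho_pos by (simp add: abs_mult mult_left_mono)
  qed
  finally show ?thesis by (simp add: E_def Q_def A_def algebra_simps)
qed

end

section \<open>The volume of the region\<close>

text \<open>The same volume as an iterated nonnegative Lebesgue integral, for which Fubini and
  affine substitutions are at hand. The range is the whole half line; the cut-off is left to the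
  support of \<open>F\<close>.\<close>

fun nnv :: "nat \<Rightarrow> (real list \<Rightarrow> ennreal) \<Rightarrow> ennreal" where
  "nnv 0 F = F []"
| "nnv (Suc k) F = (\<integral>\<^sup>+t. indicator {0..} t * nnv k (\<lambda>ts. F (t # ts)) \<partial>lborel)"

lemma vol_integrable:
  assumes "adm L \<Phi> (Suc k) F" "L \<ge> 0"
  shows "(\<lambda>t. vol L k (\<lambda>ts. F (t # ts))) integrable_on {0..L}"
  by (rule integrable_antimono_nonneg) (use vol_Cons_antimono[OF assms] in auto)

lemma vol_nnv:
  assumes "adm L \<Phi> k F" "L \<ge> 0"
  shows "ennreal (vol L k F) = nnv k (\<lambda>ts. ennreal (F ts))"
  using assms(1)
proof (induction k arbitrary: \<Phi> F)
  case (Suc k)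
  define \<phi> where "\<phi> = (\<lambda>t. vol L k (\<lambda>ts. F (t # ts)))"
  have int: "(\<phi> has_integral vol L (Suc k) F) {0..L}"
    using vol_integrable[OF Suc.prems assms(2)] by (simp add: \<phi>_def integrable_integral)
  have "(\<integral>\<^sup>+t. indicator {0..L} t * \<phi> t \<partial>lborel) = vol L (Suc k) F"
    by (rule nn_integral_has_integral_lebesgue[OF _ int])
       (use vol_bounds[OF adm_Cons[OF Suc.prems] assms(2)] in \<open>auto simp: \<phi>_def\<close>)
  moreover have "ennreal (indicator {0..L} t * \<phi> t) = indicator {0..} t * nnv k (\<lambda>ts. ennreal (F (t # ts)))" for t
  proof -
    consider "t < 0" | "0 \<le> t" "t \<le> L" | "0 \<le> t" "L < t" by linarith
    thus ?thesis
    proof cases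
      case 2
      thus ?thesis using Suc.IH[OF adm_Cons[OF Suc.prems, of t]] by (simp add: \<phi>_def)
    next
      case 3
      have a: "adm L 0 k (\<lambda>ts. F (t # ts))" using adm_Cons_supp[OF Suc.prems 3] .
      have "nnv k (\<lambda>ts. ennreal (F (t # ts))) = 0"
        using Suc.IH[OF a] vol_bounds[OF a assms(2)] by (metis ennreal_0 mult_zero_left order_antisym)
      thus ?thesis using 3 by simp
    qed simp
  qed
  ultimately show ?case by simp
qed simp

lemma vol_scale:
  assumes "M > 0"
  shows "vol (M * L) k F = M ^ k * vol L k (\<lambda>ts. F (map ((*) M) ts))"
proof (induction k arbitrary: F)
  case (Suc k)
  have img: "(\<lambda>x. x / M) ` {0..M * L} = {0..L}"
    using image_divide_atLeastAtMost[OF assms, of 0 "M * L"] assms by simp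
  have "vol (M * L) (Suc k) F = integral {0..M * L} (\<lambda>t. M ^ k * vol L k (\<lambda>ts. F (t # map ((*) M) ts)))"
    by (simp add: Suc.IH)
  also have "\<dots> = M * integral {0..L} (\<lambda>t. M ^ k * vol L k (\<lambda>ts. F (M * t # map ((*) M) ts)))"
    using integral_stretch_real[of M 0 "M * L" "\<lambda>t. M ^ k * vol L k (\<lambda>ts. F (t # map ((*) M) ts))"] assms
    unfolding img by (simp add: field_simps)
  finally show ?case by simp
qed simp

lemma dot_scale: "dot ws (map ((*) M) ts) = M * dot ws ts"
  by (induction ws ts rule: dot.induct) (auto simp: algebra_simps)

lemma vol_Fc_scale:
  assumes "0 < M" "M \<le> L"
  shows "vol L 6 (Fc M M M) = M ^ 6 * vol 1 6 (Fc 1 1 1)"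
proof -
  \<comment> \<open>Both sides equal the integral over the whole orthant, so the cut-off L may be
    lowered to M before scaling.\<close>
  have "ennreal (vol L 6 (Fc M M M)) = ennreal (vol M 6 (Fc M M M))"
    using vol_nnv[OF adm_Fc[of M L M M]] vol_nnv[OF adm_Fc[of M M M M]] assms by simp
  hence "vol L 6 (Fc M M M) = vol M 6 (Fc M M M)"
    using vol_bounds[OF adm_Fc[of M L M M]] vol_bounds[OF adm_Fc[of M M M M]] assms by simp
  also have "\<dots> = M ^ 6 * vol 1 6 (\<lambda>ts. Fc M M M (map ((*) M) ts))"
    using vol_scale[of M 1] assms by simp
  also have "(\<lambda>ts. Fc M M M (map ((*) M) ts)) = Fc 1 1 1"
    using assms by (auto simp: Fc_def dot_scale fun_eq_iff)
  finally show ?thesis .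
qed

text \<open>The six vectors form the pairs (2,1,0), (1,2,0) and (0,2,1), (0,1,2) and (1,0,2),
  (2,0,1), one on each edge of the triangle. Each pair acts on the two coordinates of its edge by
  sending (s, t) to (2s + t, s + 2t), a map of determinant 3.\<close>

definition pairint :: "(real \<Rightarrow> real \<Rightarrow> ennreal) \<Rightarrow> ennreal" where
  "pairint f = (\<integral>\<^sup>+s. indicator {0..} s * (\<integral>\<^sup>+t. indicator {0..} t * f (2 * s + t) (s + 2 * t) \<partial>lborel) \<partial>lborel)"

text \<open>Image of the quadrant under that map: \<open>2 * p - q\<close> and
  \<open>2 * q - p\<close> are three times the preimages s and t.\<close>

definition cone2 :: "real \<Rightarrow> real \<Rightarrow> ennreal" where
  "cone2 p q = indicator {0..} (2 * p - q) * indicator {0..} (2 * q - p)"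

lemma cone2_measurable [measurable]:
  assumes [measurable]: "f \<in> borel_measurable M" "g \<in> borel_measurable M"
  shows "(\<lambda>x. cone2 (f x) (g x)) \<in> borel_measurable M"
  unfolding cone2_def by measurable

text \<open>One variable is substituted at a time: \<open>p = 2 * s + t\<close> for fixed s, a
  translation, and then, after the integrals are exchanged, \<open>q = 2 * p - 3 * s\<close> for
  fixed p, which yields the factor 1/3.\<close>

lemma pairint_cone2:
  assumes [measurable]: "(\<lambda>(p, q). f p q) \<in> borel_measurable (borel \<Otimes>\<^sub>M borel)"
  shows "pairint f = ennreal (1 / 3) * (\<integral>\<^sup>+p. \<integral>\<^sup>+q. cone2 p q * f p q \<partial>lborel \<partial>lborel)"
proof -
  have [measurable]: "(\<lambda>x. f (g x) (h x)) \<in> borel_measurable M"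
    if "g \<in> borel_measurable M" "h \<in> borel_measurable M" for g h and M :: "'z measure"
    using measurable_compose[OF measurable_Pair[OF that] assms] by simp
  define I :: "real \<Rightarrow> ennreal" where "I = indicator {0..}"
  have [measurable]: "I \<in> borel_measurable borel" by (simp add: I_def)
  have "(\<integral>\<^sup>+t. I t * f (2 * s + t) (s + 2 * t) \<partial>lborel) =
        (\<integral>\<^sup>+p. I (p - 2 * s) * f p (2 * p - 3 * s) \<partial>lborel)" for s
    by (subst nn_integral_real_affine[of _ 1 "- 2 * s"]) (auto simp: algebra_simps)
  hence "pairint f = (\<integral>\<^sup>+s. \<integral>\<^sup>+p. I s * (I (p - 2 * s) * f p (2 * p - 3 * s)) \<partial>lborel \<partial>lborel)"
    unfolding pairint_def I_def[symmetric] by (simp add: nn_integral_cmult)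
  also have "\<dots> = (\<integral>\<^sup>+p. \<integral>\<^sup>+s. I s * (I (p - 2 * s) * f p (2 * p - 3 * s)) \<partial>lborel \<partial>lborel)"
    by (rule lborel_pair.Fubini'[symmetric]) measurable
  also have "\<dots> = (\<integral>\<^sup>+p. ennreal (1 / 3) * (\<integral>\<^sup>+q. cone2 p q * f p q \<partial>lborel) \<partial>lborel)"
  proof (rule nn_integral_cong)
    fix p :: real
    have e: "I (2 * p / 3 + - 1 / 3 * q) = indicator {0..} (2 * p - q)" for q
      by (auto simp: I_def indicator_def)
    have e2: "I (p - 2 * (2 * p / 3 + - 1 / 3 * q)) = indicator {0..} (2 * q - p)" for q
      by (auto simp: I_def indicator_def)
    have "(\<integral>\<^sup>+s. I s * (I (p - 2 * s) * f p (2 * p - 3 * s)) \<partial>lborel) =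
      ennreal (1 / 3) * (\<integral>\<^sup>+q. I (2 * p / 3 + - 1 / 3 * q) * (I (p - 2 * (2 * p / 3 + - 1 / 3 * q)) *
         f p (2 * p - 3 * (2 * p / 3 + - 1 / 3 * q))) \<partial>lborel)"
      by (subst nn_integral_real_affine[of _ "- 1 / 3" "2 * p / 3"]) auto
    also have "\<dots> = ennreal (1 / 3) * (\<integral>\<^sup>+q. cone2 p q * f p q \<partial>lborel)"
      unfolding e e2 by (simp add: cone2_def mult.assoc)
    finally show "(\<integral>\<^sup>+s. I s * (I (p - 2 * s) * f p (2 * p - 3 * s)) \<partial>lborel) =
        ennreal (1 / 3) * (\<integral>\<^sup>+q. cone2 p q * f p q \<partial>lborel)" .
  qed
  also have "\<dots> = ennreal (1 / 3) * (\<integral>\<^sup>+p. \<integral>\<^sup>+q. cone2 p q * f p q \<partial>lborel \<partial>lborel)"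
    by (rule nn_integral_cmult) measurable
  finally show ?thesis .
qed

lemma cone2_indicator: "cone2 p q = indicator {p / 2..2 * p} q"
  by (auto simp: cone2_def indicator_def)

lemma cone2_indicator': "cone2 p q = indicator {q / 2..2 * q} p"
  by (auto simp: cone2_def indicator_def)

text \<open>Truncated powers put piecewise polynomials into closed form. From exponent 2 on they are
  differentiable everywhere, so a single primitive serves for all pieces.\<close>

definition pp :: "nat \<Rightarrow> real \<Rightarrow> real" where "pp n x = max 0 x ^ n"

text \<open>The condition \<open>f' 0 = 0\<close> makes the derivative from the right agree at the
  kink with the derivative 0 from the left.\<close>

lemma DERIV_max_0:
  assumes "\<And>x. x \<ge> 0 \<Longrightarrow> (f has_real_derivative f' x) (at x)" "f' 0 = 0"
  shows "((\<lambda>x. f (max 0 x)) has_real_derivative f' (max 0 x)) (at x)"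
proof -
  consider "x < 0" | "x > 0" | "x = 0" by linarith
  thus ?thesis
  proof cases
    case 1
    have "((\<lambda>x::real. f 0) has_real_derivative f' (max 0 x)) (at x)" using 1 assms(2) by (simp add: max_def)
    thus ?thesis
      by (rule has_field_derivative_transform_within_open[of _ _ _ "{..<0}"]) (use 1 in auto)
  next
    case 2
    hence "(f has_real_derivative f' (max 0 x)) (at x)" using assms by (simp add: max_def)
    thus ?thesis
      by (rule has_field_derivative_transform_within_open[of _ _ _ "{0<..}"]) (use 2 in auto)
  next
    case 3
    have "((\<lambda>h. (f (0 + h) - f 0) / h) \<longlongrightarrow> 0) (at 0)"
      using assms(1)[of 0] assms(2) by (simp add: DERIV_def)
    hence 1: "((\<lambda>h. \<bar>(f (0 + h) - f 0) / h\<bar>) \<longlongrightarrow> 0) (at 0)" using tendsto_rabs_zero by blast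
    have 2: "norm ((f (max 0 (0 + h)) - f (max 0 0)) / h) \<le> \<bar>(f (0 + h) - f 0) / h\<bar>" for h
      by (cases "h \<ge> 0") (simp_all only: max_def real_norm_def add_0 if_True if_False refl diff_self div_0 abs_zero abs_ge_zero order_refl)
    have "((\<lambda>h. (f (max 0 (0 + h)) - f (max 0 0)) / h) \<longlongrightarrow> 0) (at 0)"
      by (rule Lim_null_comparison[OF _ 1]) (rule always_eventually, rule allI, rule 2)
    thus ?thesis using 3 assms(2) by (simp add: DERIV_def)
  qed
qed

lemma DERIV_pp [derivative_intros]:
  assumes "(g has_real_derivative g') (at x)" "n \<ge> 2"
  shows "((\<lambda>x. pp n (g x)) has_real_derivative (real n * pp (n - 1) (g x) * g')) (at x)"
proof -
  have "((\<lambda>x. max 0 x ^ n) has_real_derivative real n * max 0 y ^ (n - 1)) (at y)" for y :: real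
    by (rule DERIV_max_0) (use assms(2) in \<open>auto intro!: derivative_eq_intros\<close>)
  thus ?thesis unfolding pp_def using DERIV_chain2[OF _ assms(1)] by blast
qed

lemma pp_pos: "x \<ge> 0 \<Longrightarrow> pp n x = x ^ n" and pp_neg: "x \<le> 0 \<Longrightarrow> n > 0 \<Longrightarrow> pp n x = 0"
  by (simp_all add: pp_def max_def)

lemma pp_measurable [measurable]: "f \<in> borel_measurable M \<Longrightarrow> (\<lambda>x. pp n (f x)) \<in> borel_measurable M"
  unfolding pp_def by (intro borel_measurable_power borel_measurable_max) auto

lemma nn_integral_FTC_on:
  assumes "l \<le> u" "\<And>x. l \<le> x \<Longrightarrow> x \<le> u \<Longrightarrow> (F has_real_derivative f x) (at x)"
    "\<And>x. l \<le> x \<Longrightarrow> x \<le> u \<Longrightarrow> f x \<ge> 0"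
  shows "(\<integral>\<^sup>+x. indicator {l..u} x * ennreal (f x) \<partial>lborel) = ennreal (F u - F l)" "F u - F l \<ge> 0"
proof -
  have i: "(f has_integral (F u - F l)) {l..u}"
    by (rule fundamental_theorem_of_calculus[OF assms(1)])
       (use assms(2) in \<open>auto simp: has_real_derivative_iff_has_vector_derivative[symmetric]
          intro: has_field_derivative_at_within\<close>)
  have "(\<integral>\<^sup>+x. indicator {l..u} x * f x \<partial>lborel) = F u - F l"
    by (rule nn_integral_has_integral_lebesgue[OF _ i]) (use assms in auto)
  moreover have "ennreal (indicator {l..u} x * f x) = indicator {l..u} x * ennreal (f x)" for x
    by (auto simp: indicator_def)
  ultimately show "(\<integral>\<^sup>+x. indicator {l..u} x * ennreal (f x) \<partial>lborel) = ennreal (F u - F l)" by simp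
  show "F u - F l \<ge> 0" using has_integral_nonneg[OF i] assms(3) by auto
qed

text \<open>
  \<open>area0 a b\<close> is the area of \<open>{(p, q). q / 2 \<le> p \<le> 2 q, p \<le> a, q \<le> b}\<close> for \<open>a, b \<ge> 0\<close>; \<open>area1\<close>, \<open>area2\<close>,
  \<open>area3\<close> integrate it in \<open>a\<close>, in \<open>a\<close> and \<open>b\<close>, and twice in \<open>a\<close> and once in \<open>b\<close>.
\<close>

definition area0 :: "real \<Rightarrow> real \<Rightarrow> real" where
  "area0 a b = a * b - a\<^sup>2 / 4 - b\<^sup>2 / 4 + pp 2 (b / 2 - a) + pp 2 (a / 2 - b)"
definition area1 :: "real \<Rightarrow> real \<Rightarrow> real" where
  "area1 a b = a\<^sup>2 * b / 2 - a ^ 3 / 12 - a * b\<^sup>2 / 4 - pp 3 (b / 2 - a) / 3 + pp 3 b / 24 + 2 * pp 3 (a / 2 - b) / 3"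
definition area2 :: "real \<Rightarrow> real \<Rightarrow> real" where
  "area2 a b = a\<^sup>2 * b\<^sup>2 / 4 - a ^ 3 * b / 12 - a * b ^ 3 / 12 + a ^ 4 / 96 + b ^ 4 / 96
     - pp 4 (b / 2 - a) / 6 - pp 4 (a / 2 - b) / 6"
definition area3 :: "real \<Rightarrow> real \<Rightarrow> real" where
  "area3 a b = a ^ 3 * b\<^sup>2 / 12 - a ^ 4 * b / 48 - a\<^sup>2 * b ^ 3 / 24 + a ^ 5 / 480 + a * b ^ 4 / 96 - b ^ 5 / 960
     + pp 5 (b / 2 - a) / 30 - pp 5 (a / 2 - b) / 15"

lemma cone2_area:
  "(\<integral>\<^sup>+p. \<integral>\<^sup>+q. cone2 p q * (of_bool (p \<le> a) * of_bool (q \<le> b)) \<partial>lborel \<partial>lborel) =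
     (if a < 0 \<or> b < 0 then 0 else ennreal (area0 a b)) \<and> (a \<ge> 0 \<longrightarrow> b \<ge> 0 \<longrightarrow> area0 a b \<ge> 0)"
proof (cases "a < 0 \<or> b < 0")
  case True
  have z: "cone2 p q * (of_bool (p \<le> a) * of_bool (q \<le> b)) = 0" for p q
    using True by (auto simp: cone2_indicator indicator_def)
  have "(\<integral>\<^sup>+p. \<integral>\<^sup>+q. cone2 p q * (of_bool (p \<le> a) * of_bool (q \<le> b)) \<partial>lborel \<partial>lborel) = 0"
    by (simp only: z) simp
  thus ?thesis using True by auto
next
  case False
  hence ab: "a \<ge> 0" "b \<ge> 0" by auto
  \<comment> \<open>For p from 0 on this is the length of the section at p, the interval from p/2 to
    the smaller of 2p and b (or 0 if that is empty), in truncated powers.\<close>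
  define l where "l = (\<lambda>p. 3 / 2 * p - pp 1 (2 * p - b) + pp 1 (p / 2 - b))"
  have l: "l p = max 0 (min (2 * p) b - p / 2)" if "p \<ge> 0" for p
    using that ab by (auto simp: l_def pp_def max_def min_def)
  have "(\<integral>\<^sup>+q. cone2 p q * (of_bool (p \<le> a) * of_bool (q \<le> b)) \<partial>lborel) = indicator {0..a} p * ennreal (l p)" for p
  proof (cases "p \<in> {0..a}")
    case True
    have "(\<integral>\<^sup>+q. cone2 p q * (of_bool (p \<le> a) * of_bool (q \<le> b)) \<partial>lborel) = (\<integral>\<^sup>+q. indicator {p / 2..min (2 * p) b} q \<partial>lborel)"
      by (rule nn_integral_cong) (use True in \<open>auto simp: cone2_indicator indicator_def\<close>)
    also have "\<dots> = ennreal (l p)" using True l[of p]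
      by (cases "p / 2 \<le> min (2 * p) b") (auto simp: max_def)
    finally show ?thesis using True by simp
  next
    case False
    have z: "cone2 p q * (of_bool (p \<le> a) * of_bool (q \<le> b)) = 0" for q
      using False by (auto simp: cone2_indicator indicator_def)
    have "(\<integral>\<^sup>+q. cone2 p q * (of_bool (p \<le> a) * of_bool (q \<le> b)) \<partial>lborel) = 0"
      by (simp only: z) simp
    thus ?thesis using False by simp
  qed
  hence "(\<integral>\<^sup>+p. \<integral>\<^sup>+q. cone2 p q * (of_bool (p \<le> a) * of_bool (q \<le> b)) \<partial>lborel \<partial>lborel)
     = (\<integral>\<^sup>+p. indicator {0..a} p * ennreal (l p) \<partial>lborel)" by simp
  moreover define F where "F = (\<lambda>p. 3 / 4 * p\<^sup>2 - pp 2 (2 * p - b) / 4 + pp 2 (p / 2 - b))"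
  have D: "(F has_real_derivative l p) (at p)" for p
    unfolding F_def l_def by (auto intro!: derivative_eq_intros simp: field_simps)
  have l0: "l p \<ge> 0" if "0 \<le> p" for p unfolding l[OF that] by simp
  have "(\<integral>\<^sup>+p. indicator {0..a} p * ennreal (l p) \<partial>lborel) = ennreal (F a - F 0)"
    by (rule nn_integral_FTC_on(1)[OF ab(1) D l0])
  moreover have "F a - F 0 \<ge> 0"
    by (rule nn_integral_FTC_on(2)[OF ab(1) D l0])
  moreover have "F a - F 0 = area0 a b"
  proof -
    have "pp 2 (2 * a - b) = (2 * a - b)\<^sup>2 - pp 2 (b - 2 * a)"
      by (cases "2 * a \<le> b") (simp_all add: pp_pos pp_neg power2_eq_square algebra_simps)
    moreover have "pp 2 (b - 2 * a) = 4 * pp 2 (b / 2 - a)"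
      by (cases "2 * a \<le> b") (simp_all add: pp_pos pp_neg power2_eq_square field_simps)
    ultimately show ?thesis
      using ab pp_neg[of "-b" 2] by (simp add: F_def area0_def power2_eq_square field_simps)
  qed
  ultimately show ?thesis using ab by auto
qed

lemma DERIV_area1: "b \<ge> 0 \<Longrightarrow> ((\<lambda>a. area1 a b) has_real_derivative area0 a b) (at a)"
  unfolding area1_def area0_def
  by (auto intro!: derivative_eq_intros simp: field_simps)

lemma DERIV_area2: "((\<lambda>b. area2 a b) has_real_derivative area1 a b) (at b)" if "a \<ge> 0" "b \<ge> 0"
  unfolding area2_def area1_def using that
  by (auto intro!: derivative_eq_intros simp: pp_pos)

lemma DERIV_area3: "((\<lambda>a. area3 a b) has_real_derivative area2 a b) (at a)" if "b \<ge> 0"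
  unfolding area3_def area2_def using that
  by (auto intro!: derivative_eq_intros)

lemma area2_0: "b \<ge> 0 \<Longrightarrow> area2 0 b = 0" by (simp add: area2_def pp_pos pp_neg power_divide)
lemma area3_0: "b \<ge> 0 \<Longrightarrow> area3 0 b = 0" by (simp add: area3_def pp_pos pp_neg power_divide)
lemma area3_0': "a \<ge> 0 \<Longrightarrow> area3 a 0 = 0" by (simp add: area3_def pp_pos pp_neg power_divide)

text \<open>Integrating \<open>area0 (1 - q) (1 - p)\<close> over q from \<open>y / 2\<close> to
  \<open>min (2 * y) 1\<close> and over p from \<open>x / 2\<close> to \<open>min (2 * x) 1\<close>
  gives this double difference of the primitive \<open>area2\<close>.\<close>

definition areaQ :: "real \<Rightarrow> real \<Rightarrow> real" where
  "areaQ x y = area2 (1 - y / 2) (1 - x / 2) - area2 (max 0 (1 - 2 * y)) (1 - x / 2)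
     - (area2 (1 - y / 2) (max 0 (1 - 2 * x)) - area2 (max 0 (1 - 2 * y)) (max 0 (1 - 2 * x)))"

definition areaA :: "real \<Rightarrow> real \<Rightarrow> ennreal" where
  "areaA a b = (if a < 0 \<or> b < 0 then 0 else ennreal (area0 a b))"

lemma area_measurable [measurable]:
  assumes [measurable]: "f \<in> borel_measurable M" "g \<in> borel_measurable M"
  shows "(\<lambda>x. area0 (f x) (g x)) \<in> borel_measurable M" "(\<lambda>x. areaA (f x) (g x)) \<in> borel_measurable M"
proof -
  show [measurable]: "(\<lambda>x. area0 (f x) (g x)) \<in> borel_measurable M" unfolding area0_def by measurable
  show "(\<lambda>x. areaA (f x) (g x)) \<in> borel_measurable M" unfolding areaA_def by measurable
qed

lemma cone_areaA_inner:
  assumes y: "0 \<le> y" "y \<le> 1"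
  shows "(\<integral>\<^sup>+q. cone2 y q * areaA (1 - q) b \<partial>lborel) =
     (if b < 0 then 0 else ennreal (area1 (1 - y / 2) b - area1 (max 0 (1 - 2 * y)) b)) \<and>
     (b \<ge> 0 \<longrightarrow> area1 (1 - y / 2) b - area1 (max 0 (1 - 2 * y)) b \<ge> 0)"
proof (cases "b < 0")
  case False
  define u where "u = min (2 * y) 1"
  have u: "y / 2 \<le> u" "1 - u = max 0 (1 - 2 * y)" using y by (auto simp: u_def min_def max_def)
  have "(\<integral>\<^sup>+q. cone2 y q * areaA (1 - q) b \<partial>lborel) = (\<integral>\<^sup>+q. indicator {y / 2..u} q * ennreal (area0 (1 - q) b) \<partial>lborel)"
    by (rule nn_integral_cong) (use False in \<open>auto simp: cone2_indicator indicator_def areaA_def u_def\<close>)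
  moreover have "((\<lambda>q. - area1 (1 - q) b) has_real_derivative area0 (1 - q) b) (at q)" for q
  proof -
    have "((\<lambda>q. area1 (1 - q) b) has_real_derivative area0 (1 - q) b * (- 1)) (at q)"
      by (rule DERIV_chain2[where f = "\<lambda>a. area1 a b" and g = "\<lambda>q. 1 - q", OF DERIV_area1]) (use False in \<open>auto intro!: derivative_eq_intros\<close>)
    from DERIV_minus[OF this] show ?thesis by simp
  qed
  moreover have "area0 (1 - q) b \<ge> 0" if "q \<le> u" for q
    using cone2_area[of "1 - q" b] False that by (auto simp: u_def)
  ultimately show ?thesis
    using nn_integral_FTC_on[OF u(1), of "\<lambda>q. - area1 (1 - q) b" "\<lambda>q. area0 (1 - q) b"] False u(2) by auto
qed (auto simp: areaA_def)

lemma cone_areaA: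
  assumes x: "0 \<le> x" "x \<le> 1" and y: "0 \<le> y" "y \<le> 1"
  shows "(\<integral>\<^sup>+p. cone2 p x * (\<integral>\<^sup>+q. cone2 y q * areaA (1 - q) (1 - p) \<partial>lborel) \<partial>lborel) = ennreal (areaQ x y) \<and>
     areaQ x y \<ge> 0"
proof -
  define u where "u = min (2 * x) 1"
  have u: "x / 2 \<le> u" "1 - u = max 0 (1 - 2 * x)" using x by (auto simp: u_def min_def max_def)
  define a1 a0 where "a1 = 1 - y / 2" and "a0 = max 0 (1 - 2 * y)"
  have a: "a1 \<ge> 0" "a0 \<ge> 0" using y by (auto simp: a1_def a0_def)
  have "(\<integral>\<^sup>+p. cone2 p x * (\<integral>\<^sup>+q. cone2 y q * areaA (1 - q) (1 - p) \<partial>lborel) \<partial>lborel) =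
     (\<integral>\<^sup>+p. indicator {x / 2..u} p * ennreal (area1 a1 (1 - p) - area1 a0 (1 - p)) \<partial>lborel)"
    unfolding cone_areaA_inner[OF y, THEN conjunct1]
    by (rule nn_integral_cong) (auto simp: cone2_indicator' indicator_def u_def a1_def a0_def)
  moreover have "((\<lambda>p. - (area2 a1 (1 - p) - area2 a0 (1 - p))) has_real_derivative area1 a1 (1 - p) - area1 a0 (1 - p)) (at p)"
    if "p \<le> u" for p
  proof -
    have p: "1 - p \<ge> 0" using that by (simp add: u_def)
    have "((\<lambda>p. area2 a (1 - p)) has_real_derivative area1 a (1 - p) * (- 1)) (at p)" if "a \<ge> 0" for a
      by (rule DERIV_chain2[where f = "area2 a" and g = "\<lambda>p. 1 - p", OF DERIV_area2[OF that p]]) (auto intro!: derivative_eq_intros)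
    from DERIV_minus[OF DERIV_diff[OF this[OF a(1)] this[OF a(2)]]] show ?thesis by simp
  qed
  moreover have "area1 a1 (1 - p) - area1 a0 (1 - p) \<ge> 0" if "p \<le> u" for p
    using cone_areaA_inner[OF y, of "1 - p"] that by (auto simp: u_def a1_def a0_def)
  ultimately show ?thesis
    using nn_integral_FTC_on[OF u(1), of "\<lambda>p. - (area2 a1 (1 - p) - area2 a0 (1 - p))" "\<lambda>p. area1 a1 (1 - p) - area1 a0 (1 - p)"] u(2)
    by (auto simp: areaQ_def a1_def a0_def)
qed

text \<open>Integral of \<open>areaQ x y\<close> over y from 0 to \<open>1 - x\<close>. The
  coefficients -2 and 1/2 invert the slopes of \<open>1 - y / 2\<close> and
  \<open>1 - 2 * y\<close>; at y = 0 both arguments are 1, whence 3/2 = 2 - 1/2.\<close>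

definition areaR :: "real \<Rightarrow> real" where
  "areaR x = - 2 * area3 ((1 + x) / 2) (1 - x / 2) + 3 / 2 * area3 1 (1 - x / 2)
     + 1 / 2 * area3 (max 0 (2 * x - 1)) (1 - x / 2)
     + 2 * area3 ((1 + x) / 2) (max 0 (1 - 2 * x)) - 3 / 2 * area3 1 (max 0 (1 - 2 * x))"

lemma areaQ_integral:
  assumes x: "0 \<le> x" "x \<le> 1"
  shows "(\<integral>\<^sup>+y. indicator {0..1 - x} y * ennreal (areaQ x y) \<partial>lborel) = ennreal (areaR x) \<and> areaR x \<ge> 0"
proof -
  define F where "F = (\<lambda>b y. - 2 * area3 (1 - y / 2) b + 1 / 2 * area3 (max 0 (1 - 2 * y)) b)"
  have F: "((F b) has_real_derivative area2 (1 - y / 2) b - area2 (max 0 (1 - 2 * y)) b) (at y)" if b: "b \<ge> 0" for b y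
  proof -
    have 1: "((\<lambda>y. area3 (1 - y / 2) b) has_real_derivative area2 (1 - y / 2) b * (- 1 / 2)) (at y)"
      by (rule DERIV_chain2[where f = "\<lambda>a. area3 a b" and g = "\<lambda>y. 1 - y / 2", OF DERIV_area3[OF b]]) (auto intro!: derivative_eq_intros)
    have "((\<lambda>y. area3 (max 0 y) b) has_real_derivative area2 (max 0 y) b) (at y)" for y
      by (rule DERIV_max_0) (use DERIV_area3[OF b] area2_0[OF b] in auto)
    from DERIV_chain2[where f = "\<lambda>y. area3 (max 0 y) b" and g = "\<lambda>y. 1 - 2 * y", OF this]
    have 2: "((\<lambda>y. area3 (max 0 (1 - 2 * y)) b) has_real_derivative area2 (max 0 (1 - 2 * y)) b * (- 2)) (at y)"
      by this (auto intro!: derivative_eq_intros)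
    show ?thesis unfolding F_def
      using DERIV_add[OF DERIV_cmult[OF 1, of "-2"] DERIV_cmult[OF 2, of "1/2"]] by simp
  qed
  define b1 b0 where "b1 = 1 - x / 2" and "b0 = max 0 (1 - 2 * x)"
  have b: "b1 \<ge> 0" "b0 \<ge> 0" using x by (auto simp: b1_def b0_def)
  have "((\<lambda>y. F b1 y - F b0 y) has_real_derivative areaQ x y) (at y)" for y
    using DERIV_diff[OF F[OF b(1), of y] F[OF b(2), of y]] by (simp add: areaQ_def b1_def b0_def)
  moreover have "areaQ x y \<ge> 0" if "0 \<le> y" "y \<le> 1 - x" for y
    using cone_areaA[OF x, of y] that x by auto
  moreover have "(F b1 (1 - x) - F b0 (1 - x)) - (F b1 0 - F b0 0) = areaR x"
  proof -
    have e: "1 - (1 - x) / 2 = (1 + x) / 2" "1 - 2 * (1 - x) = 2 * x - 1" by (simp_all add: field_simps)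
    \<comment> \<open>\<open>2 * x - 1\<close> and \<open>1 - 2 * x\<close> are never both positive,
      so one of the two arguments is 0.\<close>
    have z: "area3 (max 0 (2 * x - 1)) b0 = 0"
      using area3_0[OF b(2)] area3_0'[of "max 0 (2 * x - 1)"] by (auto simp: max_def b0_def)
    show ?thesis unfolding F_def e z areaR_def b1_def[symmetric] b0_def[symmetric] by simp
  qed
  ultimately show ?thesis
    using nn_integral_FTC_on[of 0 "1 - x" "\<lambda>y. F b1 y - F b0 y" "areaQ x"] x by auto
qed

text \<open>Up to 1/2 the argument \<open>max 0 (2 * x - 1)\<close> is 0. Of the truncated powers
  only two survive, with kinks at 1/3 and 1/4; in the right half a single one survives, with its
  kink at 2/3.\<close>

lemma areaR_left:
  assumes "0 \<le> x" "x \<le> 1 / 2"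
  shows "areaR x = 15 / 128 * x - 27 / 256 * x\<^sup>2 - 99 / 512 * x ^ 3 - 351 / 2048 * x ^ 4 + 8781 / 20480 * x ^ 5
     - 2 / 15 * pp 5 (9 / 4 * x - 3 / 4) + 1 / 10 * pp 5 (2 * x - 1 / 2)"
proof -
  have m: "max 0 (2 * x - 1) = 0" "max 0 (1 - 2 * x) = 1 - 2 * x" using assms by auto
  have z: "pp 5 ((1 - x / 2) / 2 - (1 + x) / 2) = 0" "pp 5 ((1 + x) / 2 / 2 - (1 - x / 2)) = 0"
     "pp 5 ((1 - x / 2) / 2 - 1) = 0" "pp 5 (1 / 2 - (1 - x / 2)) = 0"
     "pp 5 ((1 - 2 * x) / 2 - (1 + x) / 2) = 0" "pp 5 ((1 - 2 * x) / 2 - 1) = 0"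
    by (rule pp_neg; use assms in \<open>simp add: field_simps\<close>)+
  have e: "(1 + x) / 2 / 2 - (1 - 2 * x) = 9 / 4 * x - 3 / 4" "1 / 2 - (1 - 2 * x) = 2 * x - 1 / 2"
    by (simp_all add: field_simps)
  show ?thesis unfolding areaR_def m area3_0[of "1 - x / 2", simplified] using area3_0[of "1 - x / 2"] assms
    unfolding area3_def z e
    by (simp add: field_simps) (simp add: algebra_simps power2_eq_square power3_eq_cube power4_eq_xxxx power_numeral_reduce)
qed

lemma areaR_right:
  assumes "1 / 2 \<le> x" "x \<le> 1"
  shows "areaR x = - 19 / 512 + 239 / 512 * x - 347 / 256 * x\<^sup>2 + 425 / 256 * x ^ 3 - 479 / 512 * x ^ 4 + 103 / 512 * x ^ 5
     + 1 / 60 * pp 5 (3 / 2 - 9 / 4 * x)"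
proof -
  have m: "max 0 (2 * x - 1) = 2 * x - 1" "max 0 (1 - 2 * x) = 0" using assms by auto
  have z: "pp 5 ((1 - x / 2) / 2 - (1 + x) / 2) = 0" "pp 5 ((1 + x) / 2 / 2 - (1 - x / 2)) = 0"
     "pp 5 ((1 - x / 2) / 2 - 1) = 0" "pp 5 (1 / 2 - (1 - x / 2)) = 0"
     "pp 5 ((2 * x - 1) / 2 - (1 - x / 2)) = 0"
    by (rule pp_neg; use assms in \<open>simp add: field_simps\<close>)+
  have e: "(1 - x / 2) / 2 - (2 * x - 1) = 3 / 2 - 9 / 4 * x"
    by (simp_all add: field_simps)
  have y: "area3 ((1 + x) / 2) 0 = 0" "area3 1 0 = 0" using area3_0' assms by auto
  show ?thesis unfolding areaR_def m y
    unfolding area3_def z e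
    by (simp add: field_simps) (simp add: algebra_simps power2_eq_square power3_eq_cube power4_eq_xxxx power_numeral_reduce)
qed

lemma areaR_integral: "(\<integral>\<^sup>+x. indicator {0..1} x * ennreal (areaR x) \<partial>lborel) = ennreal (3 / 320)"
proof -
  define F where "F = (\<lambda>x. 15 / 256 * x\<^sup>2 - 9 / 256 * x ^ 3 - 99 / 2048 * x ^ 4 - 351 / 10240 * x ^ 5 + 2927 / 40960 * x ^ 6
     - 4 / 405 * pp 6 (9 / 4 * x - 3 / 4) + 1 / 120 * pp 6 (2 * x - 1 / 2))"
  define G where "G = (\<lambda>x. - 19 / 512 * x + 239 / 1024 * x\<^sup>2 - 347 / 768 * x ^ 3 + 425 / 1024 * x ^ 4 - 479 / 2560 * x ^ 5 + 103 / 3072 * x ^ 6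
     - 1 / 810 * pp 6 (3 / 2 - 9 / 4 * x))"
  have nn: "areaR x \<ge> 0" if "0 \<le> x" "x \<le> 1" for x using areaQ_integral that by auto
  have F: "(F has_real_derivative areaR x) (at x)" if "0 \<le> x" "x \<le> 1 / 2" for x
    unfolding areaR_left[OF that] F_def by (auto intro!: derivative_eq_intros simp: field_simps)
  have G: "(G has_real_derivative areaR x) (at x)" if "1 / 2 \<le> x" "x \<le> 1" for x
    unfolding areaR_right[OF that] G_def by (auto intro!: derivative_eq_intros simp: field_simps)
  have 1: "(areaR has_integral (F (1 / 2) - F 0)) {0..1 / 2}"
    by (rule fundamental_theorem_of_calculus)
       (use F in \<open>auto simp: has_real_derivative_iff_has_vector_derivative[symmetric] intro: has_field_derivative_at_within\<close>)
  have 2: "(areaR has_integral (G 1 - G (1 / 2))) {1 / 2..1}"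
    by (rule fundamental_theorem_of_calculus)
       (use G in \<open>auto simp: has_real_derivative_iff_has_vector_derivative[symmetric] intro: has_field_derivative_at_within\<close>)
  have "(areaR has_integral ((F (1 / 2) - F 0) + (G 1 - G (1 / 2)))) {0..1}"
    by (rule has_integral_combine[OF _ _ 1 2]) auto
  also have "(F (1 / 2) - F 0) + (G 1 - G (1 / 2)) = 3 / 320"
    by (simp add: F_def G_def pp_def power_divide)
  finally have I: "(areaR has_integral 3 / 320) {0..1}" .
  have "(\<integral>\<^sup>+x. indicator {0..1} x * areaR x \<partial>lborel) = ennreal (3 / 320)"
    by (rule nn_integral_has_integral_lebesgue[OF _ I]) (use nn in auto)
  moreover have "ennreal (indicator {0..1} x * areaR x) = indicator {0..1} x * ennreal (areaR x)" for x
    by (auto simp: indicator_def)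
  ultimately show ?thesis by simp
qed

section \<open>Assembling the six-dimensional integral\<close>

lemma of_bool_measurable [measurable (raw)]:
  "Measurable.pred M P \<Longrightarrow> (\<lambda>x. of_bool (P x) :: ennreal) \<in> borel_measurable M"
  unfolding of_bool_def by measurable

text \<open>In each pair, p and q are its contributions to two of the three coordinates. The second
  coordinate receives \<open>q1 + p2\<close>; the other two inequalities bound \<open>p3\<close> and
  \<open>q3\<close> separately once \<open>q2\<close> and \<open>p1\<close> are fixed, so the
  innermost pair contributes the area of a truncated cone.\<close>

lemma nnv_Fc_pairint:
  "nnv 6 (\<lambda>ts. ennreal (Fc 1 1 1 ts)) = pairint (\<lambda>p1 q1. pairint (\<lambda>p2 q2. pairint (\<lambda>p3 q3.
     of_bool (q1 + p2 \<le> 1) * (of_bool (p3 \<le> 1 - q2) * of_bool (q3 \<le> 1 - p1)))))"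
proof -
  have F: "ennreal (Fc 1 1 1 [a, b, c, d, e, f]) =
     of_bool (a + 2 * b + (2 * c + d) \<le> 1) * (of_bool (2 * e + f \<le> 1 - (c + 2 * d)) * of_bool (e + 2 * f \<le> 1 - (2 * a + b)))"
    for a b c d e f by (auto simp: Fc_def W1_def W2_def W3_def)
  have 6: "6 = Suc (Suc (Suc (Suc (Suc (Suc 0)))))" by simp
  show ?thesis unfolding 6 nnv.simps F pairint_def ..
qed

lemma ennreal_third: "ennreal (1 / 3) * ennreal (1 / 3) = ennreal (1 / 9)" "ennreal (1 / 3) * ennreal (1 / 9) = ennreal (1 / 27)"
  by (simp_all flip: ennreal_mult)

lemma cone2_of_bool: "cone2 p q * (of_bool b * c) = of_bool b * (cone2 p q * c)"
  and cone2_ennreal: "cone2 p q * (ennreal r * c) = ennreal r * (cone2 p q * c)"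
  by (rule mult.left_commute)+

lemma nn_integral_cmult2:
  fixes f :: "'z \<Rightarrow> ennreal"
  assumes [measurable]: "f \<in> borel_measurable M"
  shows "(\<integral>\<^sup>+x. c * (d * f x) \<partial>M) = c * (d * (\<integral>\<^sup>+x. f x \<partial>M))"
  by (simp add: nn_integral_cmult)

text \<open>With the innermost area inserted, \<open>q2\<close> and \<open>p1\<close> are integrated
  over their cones, which gives \<open>areaQ\<close>; the remaining variables \<open>x = q1\<close>
  and \<open>y = p2\<close> run over the triangle \<open>x + y \<le> 1\<close>.\<close>

lemma nnv_Fc: "nnv 6 (\<lambda>ts. ennreal (Fc 1 1 1 ts)) = ennreal (1 / 2880)"
proof -
  have 3: "pairint (\<lambda>p3 q3. of_bool (q1 + p2 \<le> 1) * (of_bool (p3 \<le> 1 - q2) * of_bool (q3 \<le> 1 - p1)))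
    = ennreal (1 / 3) * (of_bool (q1 + p2 \<le> 1) * areaA (1 - q2) (1 - p1))" for q1 p2 q2 p1 :: real
  proof -
    have "pairint (\<lambda>p3 q3. of_bool (q1 + p2 \<le> 1) * (of_bool (p3 \<le> 1 - q2) * of_bool (q3 \<le> 1 - p1)))
      = ennreal (1 / 3) * (\<integral>\<^sup>+p. \<integral>\<^sup>+q. cone2 p q * (of_bool (q1 + p2 \<le> 1) * (of_bool (p \<le> 1 - q2) * of_bool (q \<le> 1 - p1))) \<partial>lborel \<partial>lborel)"
      by (rule pairint_cone2) measurable
    also have "\<dots> = ennreal (1 / 3) * (\<integral>\<^sup>+p. \<integral>\<^sup>+q. of_bool (q1 + p2 \<le> 1) * (cone2 p q * (of_bool (p \<le> 1 - q2) * of_bool (q \<le> 1 - p1))) \<partial>lborel \<partial>lborel)"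
      by (simp only: cone2_of_bool)
    also have "(\<integral>\<^sup>+p. \<integral>\<^sup>+q. of_bool (q1 + p2 \<le> 1) * (cone2 p q * (of_bool (p \<le> 1 - q2) * of_bool (q \<le> 1 - p1))) \<partial>lborel \<partial>lborel) =
       (\<integral>\<^sup>+p. of_bool (q1 + p2 \<le> 1) * (\<integral>\<^sup>+q. cone2 p q * (of_bool (p \<le> 1 - q2) * of_bool (q \<le> 1 - p1)) \<partial>lborel) \<partial>lborel)"
      by (rule nn_integral_cong, rule nn_integral_cmult) measurable
    also have "\<dots> = of_bool (q1 + p2 \<le> 1) * (\<integral>\<^sup>+p. \<integral>\<^sup>+q. cone2 p q * (of_bool (p \<le> 1 - q2) * of_bool (q \<le> 1 - p1)) \<partial>lborel \<partial>lborel)"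
      by (rule nn_integral_cmult) measurable
    finally show ?thesis using cone2_area[of "1 - q2" "1 - p1"] by (simp add: areaA_def)
  qed
  have 2: "pairint (\<lambda>p2 q2. ennreal (1 / 3) * (of_bool (q1 + p2 \<le> 1) * areaA (1 - q2) (1 - p1))) =
     ennreal (1 / 9) * (\<integral>\<^sup>+p2. of_bool (q1 + p2 \<le> 1) * (\<integral>\<^sup>+q2. cone2 p2 q2 * areaA (1 - q2) (1 - p1) \<partial>lborel) \<partial>lborel)"
    for q1 p1 :: real
  proof -
    have "pairint (\<lambda>p2 q2. ennreal (1 / 3) * (of_bool (q1 + p2 \<le> 1) * areaA (1 - q2) (1 - p1))) =
     ennreal (1 / 3) * (\<integral>\<^sup>+p2. \<integral>\<^sup>+q2. cone2 p2 q2 * (ennreal (1 / 3) * (of_bool (q1 + p2 \<le> 1) * areaA (1 - q2) (1 - p1))) \<partial>lborel \<partial>lborel)"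
      by (rule pairint_cone2) measurable
    also have "\<dots> = ennreal (1 / 3) * (\<integral>\<^sup>+p2. \<integral>\<^sup>+q2. ennreal (1 / 3) * (of_bool (q1 + p2 \<le> 1) * (cone2 p2 q2 * areaA (1 - q2) (1 - p1))) \<partial>lborel \<partial>lborel)"
      by (simp only: cone2_of_bool cone2_ennreal)
    also have "(\<integral>\<^sup>+p2. \<integral>\<^sup>+q2. ennreal (1 / 3) * (of_bool (q1 + p2 \<le> 1) * (cone2 p2 q2 * areaA (1 - q2) (1 - p1))) \<partial>lborel \<partial>lborel) =
       (\<integral>\<^sup>+p2. ennreal (1 / 3) * (of_bool (q1 + p2 \<le> 1) * (\<integral>\<^sup>+q2. cone2 p2 q2 * areaA (1 - q2) (1 - p1) \<partial>lborel)) \<partial>lborel)"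
      by (rule nn_integral_cong, rule nn_integral_cmult2) measurable
    also have "\<dots> = ennreal (1 / 3) * (\<integral>\<^sup>+p2. of_bool (q1 + p2 \<le> 1) * (\<integral>\<^sup>+q2. cone2 p2 q2 * areaA (1 - q2) (1 - p1) \<partial>lborel) \<partial>lborel)"
      by (rule nn_integral_cmult) measurable
    finally show ?thesis by (simp only: mult.assoc[symmetric] ennreal_third)
  qed
  define J where "J = (\<lambda>y p. \<integral>\<^sup>+q. cone2 y q * areaA (1 - q) (1 - p) \<partial>lborel)"
  have [measurable]: "(\<lambda>x. J (f x) (g x)) \<in> borel_measurable M"
    if [measurable]: "f \<in> borel_measurable M" "g \<in> borel_measurable M" for f g and M :: "'z measure"
    unfolding J_def by measurable
  have "nnv 6 (\<lambda>ts. ennreal (Fc 1 1 1 ts)) =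
    pairint (\<lambda>p x. ennreal (1 / 9) * (\<integral>\<^sup>+y. of_bool (x + y \<le> 1) * J y p \<partial>lborel))"
    unfolding nnv_Fc_pairint 3 2 J_def ..
  also have "\<dots> = ennreal (1 / 3) * (\<integral>\<^sup>+p. \<integral>\<^sup>+x. cone2 p x * (ennreal (1 / 9) * (\<integral>\<^sup>+y. of_bool (x + y \<le> 1) * J y p \<partial>lborel)) \<partial>lborel \<partial>lborel)"
    by (rule pairint_cone2) measurable
  also have "\<dots> = ennreal (1 / 3) * (\<integral>\<^sup>+p. \<integral>\<^sup>+x. ennreal (1 / 9) * (cone2 p x * (\<integral>\<^sup>+y. of_bool (x + y \<le> 1) * J y p \<partial>lborel)) \<partial>lborel \<partial>lborel)"
    by (simp only: cone2_ennreal)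
  also have "\<dots> = ennreal (1 / 27) * (\<integral>\<^sup>+p. \<integral>\<^sup>+x. cone2 p x * (\<integral>\<^sup>+y. of_bool (x + y \<le> 1) * J y p \<partial>lborel) \<partial>lborel \<partial>lborel)"
  proof -
    have "(\<integral>\<^sup>+p. \<integral>\<^sup>+x. ennreal (1 / 9) * (cone2 p x * (\<integral>\<^sup>+y. of_bool (x + y \<le> 1) * J y p \<partial>lborel)) \<partial>lborel \<partial>lborel) =
       (\<integral>\<^sup>+p. ennreal (1 / 9) * (\<integral>\<^sup>+x. cone2 p x * (\<integral>\<^sup>+y. of_bool (x + y \<le> 1) * J y p \<partial>lborel) \<partial>lborel) \<partial>lborel)"
      by (rule nn_integral_cong, rule nn_integral_cmult) measurable
    also have "\<dots> = ennreal (1 / 9) * (\<integral>\<^sup>+p. \<integral>\<^sup>+x. cone2 p x * (\<integral>\<^sup>+y. of_bool (x + y \<le> 1) * J y p \<partial>lborel) \<partial>lborel \<partial>lborel)"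
      by (rule nn_integral_cmult) measurable
    finally show ?thesis by (simp only: mult.assoc[symmetric] ennreal_third)
  qed
  also have "(\<integral>\<^sup>+p. \<integral>\<^sup>+x. cone2 p x * (\<integral>\<^sup>+y. of_bool (x + y \<le> 1) * J y p \<partial>lborel) \<partial>lborel \<partial>lborel) =
     (\<integral>\<^sup>+x. \<integral>\<^sup>+p. cone2 p x * (\<integral>\<^sup>+y. of_bool (x + y \<le> 1) * J y p \<partial>lborel) \<partial>lborel \<partial>lborel)"
    by (rule lborel_pair.Fubini') measurable
  also have "\<dots> = (\<integral>\<^sup>+x. \<integral>\<^sup>+y. \<integral>\<^sup>+p. of_bool (x + y \<le> 1) * (cone2 p x * J y p) \<partial>lborel \<partial>lborel \<partial>lborel)"
  proof (rule nn_integral_cong)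
    fix x :: real
    have "(\<integral>\<^sup>+p. cone2 p x * (\<integral>\<^sup>+y. of_bool (x + y \<le> 1) * J y p \<partial>lborel) \<partial>lborel) =
       (\<integral>\<^sup>+p. \<integral>\<^sup>+y. cone2 p x * (of_bool (x + y \<le> 1) * J y p) \<partial>lborel \<partial>lborel)"
      by (rule nn_integral_cong, rule nn_integral_cmult[symmetric]) measurable
    also have "\<dots> = (\<integral>\<^sup>+p. \<integral>\<^sup>+y. of_bool (x + y \<le> 1) * (cone2 p x * J y p) \<partial>lborel \<partial>lborel)"
      by (simp only: cone2_of_bool)
    also have "\<dots> = (\<integral>\<^sup>+y. \<integral>\<^sup>+p. of_bool (x + y \<le> 1) * (cone2 p x * J y p) \<partial>lborel \<partial>lborel)"
      by (rule lborel_pair.Fubini') measurable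
    finally show "(\<integral>\<^sup>+p. cone2 p x * (\<integral>\<^sup>+y. of_bool (x + y \<le> 1) * J y p \<partial>lborel) \<partial>lborel) = \<dots>" .
  qed
  also have "\<dots> = (\<integral>\<^sup>+x. indicator {0..1} x * ennreal (areaR x) \<partial>lborel)"
  proof (rule nn_integral_cong)
    fix x :: real
    have "(\<integral>\<^sup>+p. of_bool (x + y \<le> 1) * (cone2 p x * J y p) \<partial>lborel) =
       indicator {0..1} x * (indicator {0..1 - x} y * ennreal (areaQ x y))" for y
    proof (cases "0 \<le> x \<and> 0 \<le> y \<and> x + y \<le> 1")
      case True
      thus ?thesis using cone_areaA[of x y] by (simp add: J_def)
    next
      case False
      have z: "of_bool (x + y \<le> 1) * (cone2 p x * J y p) = 0" for p
      proof (cases "0 \<le> y")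
        case True
        thus ?thesis using False by (auto simp: cone2_def indicator_def)
      next
        case False
        hence z: "cone2 y q = 0" for q by (auto simp: cone2_def indicator_def)
        have "J y p = 0" unfolding J_def z by simp
        thus ?thesis by simp
      qed
      have "indicator {0..1} x * (indicator {0..1 - x} y * ennreal (areaQ x y)) = 0"
        using False by (auto simp: indicator_def)
      thus ?thesis unfolding z by simp
    qed
    hence "(\<integral>\<^sup>+y. \<integral>\<^sup>+p. of_bool (x + y \<le> 1) * (cone2 p x * J y p) \<partial>lborel \<partial>lborel) =
       (\<integral>\<^sup>+y. indicator {0..1} x * (indicator {0..1 - x} y * ennreal (areaQ x y)) \<partial>lborel)" by simp
    also have "\<dots> = indicator {0..1} x * ennreal (areaR x)"
      using areaQ_integral[of x] by (cases "x \<in> {0..1}") auto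
    finally show "(\<integral>\<^sup>+y. \<integral>\<^sup>+p. of_bool (x + y \<le> 1) * (cone2 p x * J y p) \<partial>lborel \<partial>lborel) = \<dots>" .
  qed
  \<comment> \<open>Three substitutions of determinant 3 give 1/27, and 3/320 divided by 27 is
    1/2880.\<close>
  also have "ennreal (1 / 27) * \<dots> = ennreal (1 / 2880)"
    unfolding areaR_integral by (simp flip: ennreal_mult)
  finally show ?thesis .
qed

lemma vol_Fc_1: "vol 1 6 (Fc 1 1 1) = 1 / 2880"
proof -
  have a: "adm 1 1 6 (Fc 1 1 1)" by (rule adm_Fc) auto
  show ?thesis using vol_nnv[OF a] nnv_Fc vol_bounds[OF a] by simp
qed

lemma vol_Fc: "0 < M \<Longrightarrow> M \<le> L \<Longrightarrow> vol L 6 (Fc M M M) = M ^ 6 / 2880"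
  using vol_Fc_scale[of M L] vol_Fc_1 by simp

section \<open>Coprimality conditions\<close>

lemma sum_neg_power_card_Pow:
  fixes y :: real
  shows "finite B \<Longrightarrow> (\<Sum>R\<in>Pow B. y ^ card R) = (1 + y) ^ card B"
proof (induction B rule: finite_induct)
  case (insert b B)
  have "(\<Sum>R\<in>Pow (insert b B). y ^ card R) = (\<Sum>R\<in>Pow B. y ^ card R) + (\<Sum>R\<in>insert b ` Pow B. y ^ card R)"
    unfolding Pow_insert by (rule sum.union_disjoint) (use insert in auto)
  also have "(\<Sum>R\<in>insert b ` Pow B. y ^ card R) = (\<Sum>R\<in>Pow B. y ^ card (insert b R))"
    by (rule sum.reindex[unfolded o_def]) (use insert in \<open>auto simp: inj_on_def\<close>)
  also have "\<dots> = (\<Sum>R\<in>Pow B. y * y ^ card R)"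
    by (rule sum.cong) (use insert finite_subset in \<open>fastforce simp: card_insert_if\<close>)+
  finally show ?case using insert by (simp add: sum_distrib_left[symmetric] algebra_simps)
qed simp

text \<open>The weight \<open>mob\<close> is the Moebius transform on the Boolean lattice of the indicator of \<open>\<F>\<close>.\<close>

definition mob :: "nat set set \<Rightarrow> nat set \<Rightarrow> real" where
  "mob \<F> S = (\<Sum>T\<in>Pow S. (-1) ^ card (S - T) * of_bool (T \<in> \<F>))"

text \<open>Writing S as the disjoint union of T and R, the sum over the subsets R of
  \<open>A - T\<close> is the binomial expansion of \<open>(1 - x) ^ card (A - T)\<close>. At x = 1
  this is Moebius inversion; at the inverse norm of a prime it is the Euler factor.\<close>

lemma mob_power_sum:
  assumes A: "finite A"
  shows "(\<Sum>S\<in>Pow A. x ^ card S * mob \<F> S) = (\<Sum>T\<in>Pow A. of_bool (T \<in> \<F>) * (x ^ card T * (1 - x) ^ card (A - T)))"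
proof -
  have key: "x ^ card S * ((-1) ^ card (S - T) * b) = b * (x ^ card T * (- x) ^ card (S - T))"
    if ST: "S \<subseteq> A" "T \<subseteq> S" for S T and b :: real
  proof -
    have f: "finite S" "finite T" using A finite_subset[of S A] finite_subset[of T S] ST by auto
    have c: "card S = card T + card (S - T)"
      using card_Diff_subset[OF f(2) ST(2)] card_mono[OF f(1) ST(2)] by simp
    have "(- x) ^ n = (-1) ^ n * x ^ n" for n
      by (simp flip: power_mult_distrib)
    thus ?thesis unfolding c by (simp add: power_add)
  qed
  have "(\<Sum>S\<in>Pow A. x ^ card S * mob \<F> S) =
     (\<Sum>(S, T)\<in>Sigma (Pow A) Pow. x ^ card S * ((-1) ^ card (S - T) * of_bool (T \<in> \<F>)))"
    unfolding mob_def sum_distrib_left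
    by (rule sum.Sigma) (use A finite_subset in auto)
  also have "\<dots> = (\<Sum>(T, R)\<in>Sigma (Pow A) (\<lambda>T. Pow (A - T)). of_bool (T \<in> \<F>) * (x ^ card T * (- x) ^ card R))"
    by (rule sum.reindex_bij_witness[of _ "\<lambda>(T, R). (T \<union> R, T)" "\<lambda>(S, T). (T, S - T)"])
       (auto simp: Un_absorb1 Diff_triv Un_Diff key)
  also have "\<dots> = (\<Sum>T\<in>Pow A. \<Sum>R\<in>Pow (A - T). of_bool (T \<in> \<F>) * (x ^ card T * (- x) ^ card R))"
    by (rule sum.Sigma[symmetric]) (use A in auto)
  also have "\<dots> = (\<Sum>T\<in>Pow A. of_bool (T \<in> \<F>) * (x ^ card T * (1 - x) ^ card (A - T)))"
    by (simp only: sum_distrib_left[symmetric] sum_neg_power_card_Pow[OF finite_Diff[OF A]]) simp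
  finally show ?thesis .
qed

lemma mob_sum: "finite A \<Longrightarrow> (\<Sum>S\<in>Pow A. mob \<F> S) = of_bool (A \<in> \<F>)"
proof -
  assume A: "finite A"
  have "(\<Sum>S\<in>Pow A. mob \<F> S) = (\<Sum>T\<in>Pow A. of_bool (T \<in> \<F>) * 0 ^ card (A - T))"
    using mob_power_sum[OF A, of 1 \<F>] by simp
  also have "\<dots> = (\<Sum>T\<in>Pow A. if T = A then of_bool (T \<in> \<F>) else 0)"
    by (rule sum.cong) (use A in \<open>auto simp: power_0_left\<close>)
  also have "\<dots> = of_bool (A \<in> \<F>)" using A by simp
  finally show ?thesis .
qed

lemma mob_abs_le: "finite S \<Longrightarrow> \<bar>mob \<F> S\<bar> \<le> 2 ^ card S"
proof -
  assume S: "finite S"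
  have "\<bar>mob \<F> S\<bar> \<le> (\<Sum>T\<in>Pow S. 1)"
    unfolding mob_def by (rule order_trans[OF sum_abs sum_mono]) (auto simp: abs_mult)
  thus ?thesis using S by (simp add: card_Pow)
qed

lemma mob_empty: "{} \<in> \<F> \<Longrightarrow> mob \<F> {} = 1" by (simp add: mob_def)

text \<open>This vanishing makes the Moebius series converge: a prime that occurs in a divisor of
  nonzero weight occurs at two indices or more.\<close>

lemma mob_singleton: "{} \<in> \<F> \<Longrightarrow> {j} \<in> \<F> \<Longrightarrow> mob \<F> {j} = 0"
proof -
  assume "{} \<in> \<F>" "{j} \<in> \<F>"
  moreover have "Pow {j} = {{}, {j}}" by auto
  ultimately show ?thesis by (simp add: mob_def)
qed

text \<open>A finite product of choices, extended by \<open>{}\<close> outside F so that divisors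
  supported on different sets of primes live in one type.\<close>

definition DF :: "'p set \<Rightarrow> ('p \<Rightarrow> nat set set) \<Rightarrow> ('p \<Rightarrow> nat set) set" where
  "DF F A = {d. \<forall>p. if p \<in> F then d p \<in> A p else d p = {}}"

lemma DF_insert:
  assumes "p \<notin> F"
  shows "DF (insert p F) A = (\<lambda>(S, d). d(p := S)) ` (A p \<times> DF F A)"
    and "inj_on (\<lambda>(S, d). d(p := S)) (A p \<times> DF F A)"
proof -
  show "DF (insert p F) A = (\<lambda>(S, d). d(p := S)) ` (A p \<times> DF F A)"
  proof (intro Set.set_eqI iffI)
    fix d assume d: "d \<in> DF (insert p F) A"
    have "d(p := {}) \<in> DF F A" using d assms unfolding DF_def by (auto split: if_splits)
    moreover have "d p \<in> A p" using d unfolding DF_def by (auto split: if_splits)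
    ultimately show "d \<in> (\<lambda>(S, d). d(p := S)) ` (A p \<times> DF F A)"
      by (intro image_eqI[of _ _ "(d p, d(p := {}))"]) auto
  next
    fix d assume "d \<in> (\<lambda>(S, d). d(p := S)) ` (A p \<times> DF F A)"
    thus "d \<in> DF (insert p F) A" using assms by (fastforce simp: DF_def split: if_splits)
  qed
  show "inj_on (\<lambda>(S, d). d(p := S)) (A p \<times> DF F A)"
  proof (rule inj_onI, clarify)
    fix S d S' d' assume d: "d \<in> DF F A" "d' \<in> DF F A" "d(p := S) = d'(p := S')"
    have "S = S'" using fun_cong[OF d(3), of p] by simp
    moreover have "d x = d' x" for x
      using fun_cong[OF d(3), of x] d(1,2) assms unfolding DF_def by (cases "x = p") auto
    ultimately show "S = S' \<and> d = d'" by auto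
  qed
qed

lemma DF_empty: "DF {} A = {\<lambda>_. {}}" by (auto simp: DF_def)

lemma finite_DF: "finite F \<Longrightarrow> (\<And>p. p \<in> F \<Longrightarrow> finite (A p)) \<Longrightarrow> finite (DF F A)"
  by (induction F rule: finite_induct) (simp_all add: DF_empty DF_insert)

text \<open>Distributivity. This is how the local factors at finitely many primes become sums over
  divisors.\<close>

lemma sum_DF_prod:
  fixes h :: "'p \<Rightarrow> nat set \<Rightarrow> real"
  shows "finite F \<Longrightarrow> (\<Sum>d\<in>DF F A. \<Prod>p\<in>F. h p (d p)) = (\<Prod>p\<in>F. \<Sum>S\<in>A p. h p S)"
proof (induction F rule: finite_induct)
  case (insert p F)
  have "(\<Sum>d\<in>DF (insert p F) A. \<Prod>p\<in>insert p F. h p (d p)) =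
    (\<Sum>(S, d)\<in>A p \<times> DF F A. \<Prod>q\<in>insert p F. h q ((d(p := S)) q))"
    unfolding DF_insert(1)[OF insert.hyps(2)] sum.reindex[OF DF_insert(2)[OF insert.hyps(2)]]
    by (simp add: case_prod_beta)
  also have "\<dots> = (\<Sum>(S, d)\<in>A p \<times> DF F A. h p S * (\<Prod>q\<in>F. h q (d q)))"
  proof (rule sum.cong[OF refl], clarify)
    fix S d
    have "(\<Prod>q\<in>F. h q ((d(p := S)) q)) = (\<Prod>q\<in>F. h q (d q))"
      by (rule prod.cong) (use insert in auto)
    thus "(\<Prod>q\<in>insert p F. h q ((d(p := S)) q)) = h p S * (\<Prod>q\<in>F. h q (d q))"
      using insert by simp
  qed
  also have "\<dots> = (\<Sum>S\<in>A p. h p S) * (\<Sum>d\<in>DF F A. \<Prod>q\<in>F. h q (d q))"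
    by (simp add: sum_product sum.cartesian_product)
  finally show ?case using insert by simp
qed (simp add: DF_empty)

text \<open>
  The indices 0 to 8 stand for the exponent vectors (3,0,0), (0,3,0), (0,0,3), (2,1,0), (1,2,0), (0,2,1),
  (0,1,2), (1,0,2), (2,0,1), the lattice points on the boundary of a triangle. \<open>Face\<close> consists of the empty
  set, the points and the pairs of neighbours. A vector with a zero coordinate and with coordinate sum
  divisible by 3 is a natural combination of the points of a face in exactly one way.
\<close>

definition Face :: "nat set set" where
  "Face = {{}, {0}, {1}, {2}, {3}, {4}, {5}, {6}, {7}, {8}, {0,3}, {3,4}, {4,1}, {1,5}, {5,6}, {6,2}, {2,7}, {7,8}, {8,0}}"

abbreviation "pow9 \<equiv> Pow {..<9 :: nat}"

lemma Face_sub: "Face \<subseteq> pow9" by (auto simp: Face_def)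

lemma Face_0 [simp]: "{} \<in> Face" by (simp add: Face_def)

lemma Face_1: "j < 9 \<Longrightarrow> {j} \<in> Face"
proof -
  assume "j < 9"
  hence "j = 0 \<or> j = 1 \<or> j = 2 \<or> j = 3 \<or> j = 4 \<or> j = 5 \<or> j = 6 \<or> j = 7 \<or> j = 8" by linarith
  thus ?thesis by (auto simp: Face_def)
qed

text \<open>The boundary of the triangle is a cycle with nine points and nine edges, so the faces
  contribute \<open>(1 - q)^9 + 9 q (1 - q)^8 + 9 q^2 (1 - q)^7\<close>.\<close>

lemma mob_Euler_factor:
  "(\<Sum>S\<in>pow9. q ^ card S * mob Face S) = (1 - q) ^ 7 * (1 + 7 * q + q\<^sup>2)"
proof -
  have "(\<Sum>S\<in>pow9. q ^ card S * mob Face S) =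
      (\<Sum>T\<in>pow9. of_bool (T \<in> Face) * (q ^ card T * (1 - q) ^ card ({..<9} - T)))"
    by (rule mob_power_sum) simp
  also have "\<dots> = (\<Sum>T\<in>Face. q ^ card T * (1 - q) ^ (9 - card T))"
  proof (rule sum.mono_neutral_cong_right)
    fix T assume "T \<in> Face"
    hence "T \<subseteq> {..<9}" "finite T" using Face_sub finite_subset[of T "{..<9}"] by auto
    thus "of_bool (T \<in> Face) * (q ^ card T * (1 - q) ^ card ({..<9} - T)) = q ^ card T * (1 - q) ^ (9 - card T)"
      using \<open>T \<in> Face\<close> by (simp add: card_Diff_subset)
  qed (use Face_sub in auto)
  also have "\<dots> = (1 - q) ^ 9 + 9 * (q * (1 - q) ^ 8) + 9 * (q\<^sup>2 * (1 - q) ^ 7)"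
    unfolding Face_def by (simp add: doubleton_eq_iff) (simp add: power2_eq_square)
  also have "\<dots> = (1 - q) ^ 7 * ((1 - q)\<^sup>2 + 9 * q * (1 - q) + 9 * q\<^sup>2)"
  proof -
    define u where "u = 1 - q"
    have u: "u ^ 9 = u ^ 7 * u\<^sup>2" "u ^ 8 = u ^ 7 * u" by (simp_all flip: power_add power_Suc2)
    show ?thesis unfolding u_def[symmetric] u by (simp add: algebra_simps)
  qed
  also have "(1 - q)\<^sup>2 + 9 * q * (1 - q) + 9 * q\<^sup>2 = 1 + 7 * q + q\<^sup>2" by (simp add: power2_eq_square algebra_simps)
  finally show ?thesis .
qed

text \<open>The rows for all nine vectors. The corners stand in front, so that \<open>dot V1\<close>
  splits into 3 times the first entry plus \<open>dot W1\<close> of the last six.\<close>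

definition V1 :: "real list" where "V1 = [3, 0, 0] @ W1"
definition V2 :: "real list" where "V2 = [0, 3, 0] @ W2"
definition V3 :: "real list" where "V3 = [0, 0, 3] @ W3"

lemma length_9: "length xs = 9 \<longleftrightarrow> (\<exists>a b c d e f g h i. xs = [a, b, c, d, e, f, g, h, i])"
  by (auto simp: numeral_eq_Suc length_Suc_conv)

lemma V_nonneg: "\<forall>w\<in>set V1. w \<ge> 0" "\<forall>w\<in>set V2. w \<ge> 0" "\<forall>w\<in>set V3. w \<ge> 0"
  by (simp_all add: V1_def V2_def V3_def W_nonneg)

lemma dot_add: "length xs = length ys \<Longrightarrow> dot ws (map2 (+) xs ys) = dot ws xs + dot ws ys"
proof (induction ws xs arbitrary: ys rule: dot.induct)
  case (1 w ws t ts)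
  thus ?case by (cases ys) (auto simp: algebra_simps)
qed auto

lemma dot_V_sum: "length ts = 9 \<Longrightarrow> dot V1 ts + dot V2 ts + dot V3 ts = 3 * sum_list ts"
  by (auto simp: length_9 V1_def V2_def V3_def W1_def W2_def W3_def)

section \<open>Counting 9-tuples of ideals under three bounds\<close>

context norm_system
begin

definition lnn :: "'p multiset \<Rightarrow> real" where "lnn m = ln (real (nrm N m))"

lemma lnn_add: "m \<in> II \<Longrightarrow> m' \<in> II \<Longrightarrow> lnn (m + m') = lnn m + lnn m'"
  using nrm_pos by (simp add: lnn_def ln_mult)

lemma lnn_nonneg: "m \<in> II \<Longrightarrow> lnn m \<ge> 0" using ln_nrm_nonneg by (simp add: lnn_def)

lemma II_add [simp]: "m + m' \<in> II \<longleftrightarrow> m \<in> II \<and> m' \<in> II" by (auto simp: II_def)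

lemma IN_lnn: "m \<in> IN (exp L) \<longleftrightarrow> m \<in> II \<and> lnn m \<le> L" by (simp add: IN_exp_ln lnn_def)

text \<open>\<open>exp (sum_list ts)\<close> is the product of the norms, so it undoes the weights
  of \<open>Sm\<close> and leaves a plain sum over tuples.\<close>

lemma sum_lists_Sm:
  "(\<Sum>zs\<in>{zs. set zs \<subseteq> IN (exp L) \<and> length zs = k}. g (map lnn zs)) = Sm L k (\<lambda>ts. exp (sum_list ts) * g ts)"
proof (induction k arbitrary: g)
  case 0
  have "{zs. set zs \<subseteq> IN (exp L) \<and> length zs = 0} = {[]}" by auto
  thus ?case by simp
next
  case (Suc k)
  define A where "A = {zs. set zs \<subseteq> IN (exp L) \<and> length zs = k}"
  have img: "{zs. set zs \<subseteq> IN (exp L) \<and> length zs = Suc k} = (\<lambda>(m, zs). m # zs) ` (IN (exp L) \<times> A)"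
    by (auto simp: A_def length_Suc_conv image_iff)
  have "(\<Sum>zs\<in>{zs. set zs \<subseteq> IN (exp L) \<and> length zs = Suc k}. g (map lnn zs)) =
    (\<Sum>m\<in>IN (exp L). \<Sum>zs\<in>A. g (lnn m # map lnn zs))"
    unfolding img by (subst sum.reindex) (auto simp: inj_on_def sum.cartesian_product intro!: sum.cong)
  also have "\<dots> = (\<Sum>m\<in>IN (exp L). Sm L k (\<lambda>ts. exp (sum_list ts) * g (lnn m # ts)))"
  proof (rule sum.cong[OF refl])
    fix m
    show "(\<Sum>zs\<in>A. g (lnn m # map lnn zs)) = Sm L k (\<lambda>ts. exp (sum_list ts) * g (lnn m # ts))"
      unfolding A_def by (rule Suc.IH[of "\<lambda>ts. g (lnn m # ts)"])
  qed
  also have "\<dots> = (\<Sum>m\<in>IN (exp L). Sm L k (\<lambda>ts. exp (lnn m + sum_list ts) * g (lnn m # ts)) / nrm N m)"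
  proof (rule sum.cong[OF refl])
    fix m assume "m \<in> IN (exp L)"
    hence p: "real (nrm N m) > 0" using nrm_pos by (simp add: IN_def)
    have "Sm L k (\<lambda>ts. exp (lnn m + sum_list ts) * g (lnn m # ts)) = Sm L k (\<lambda>ts. real (nrm N m) * (exp (sum_list ts) * g (lnn m # ts)))"
      using p by (simp add: exp_add lnn_def mult.assoc)
    thus "Sm L k (\<lambda>ts. exp (sum_list ts) * g (lnn m # ts)) = Sm L k (\<lambda>ts. exp (lnn m + sum_list ts) * g (lnn m # ts)) / nrm N m"
      using p by (simp add: Sm_cmult)
  qed
  finally show ?case by (simp only: Sm.simps lnn_def[symmetric] sum_list.Cons)
qed

text \<open>Three separate bounds are carried, because dividing a tuple by a Moebius divisor lowers
  them by different amounts.\<close>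

definition RR :: "real \<Rightarrow> real \<Rightarrow> real \<Rightarrow> 'p multiset list set" where
  "RR c1 c2 c3 = {ns. length ns = 9 \<and> set ns \<subseteq> II \<and> dot V1 (map lnn ns) \<le> c1 \<and> dot V2 (map lnn ns) \<le> c2 \<and> dot V3 (map lnn ns) \<le> c3}"

lemma RR_sub:
  assumes c: "c1 \<le> L" "c2 \<le> L" "c3 \<le> L" "L \<ge> 0"
  shows "RR c1 c2 c3 \<subseteq> {ns. set ns \<subseteq> IN (exp L) \<and> length ns = 9}"
proof
  fix ns assume ns: "ns \<in> RR c1 c2 c3"
  then obtain a b c d e f g h i where e: "ns = [a, b, c, d, e, f, g, h, i]" by (auto simp: RR_def length_9)
  have "lnn a \<ge> 0" "lnn b \<ge> 0" "lnn c \<ge> 0" "lnn d \<ge> 0" "lnn e \<ge> 0" "lnn f \<ge> 0" "lnn g \<ge> 0" "lnn h \<ge> 0" "lnn i \<ge> 0"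
    using ns lnn_nonneg by (auto simp: RR_def e)
  thus "ns \<in> {ns. set ns \<subseteq> IN (exp L) \<and> length ns = 9}"
    using ns c by (auto simp: RR_def e IN_lnn V1_def V2_def V3_def W1_def W2_def W3_def)
qed

lemma finite_RR: "finite (RR c1 c2 c3)"
proof -
  define L where "L = Max {c1, c2, c3, 0}"
  have "RR c1 c2 c3 \<subseteq> {ns. set ns \<subseteq> IN (exp L) \<and> length ns = 9}"
    by (rule RR_sub) (auto simp: L_def)
  thus ?thesis by (rule finite_subset) (simp add: finite_lists_length_eq)
qed

text \<open>Once the last six ideals are fixed, the corners vary independently, each over the ideals
  whose cube fits into the remaining room.\<close>

lemma card_RR:
  assumes c: "c1 \<le> L" "c2 \<le> L" "c3 \<le> L" "L \<ge> 0"
  shows "real (card (RR c1 c2 c3)) = Sm L 6 (Gc c1 c2 c3)"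
proof -
  define A where "A = {zs. set zs \<subseteq> IN (exp L) \<and> length zs = 6}"
  define B where "B = (\<lambda>zs. IN (exp ((c1 - dot W1 (map lnn zs)) / 3)) \<times>
     IN (exp ((c2 - dot W2 (map lnn zs)) / 3)) \<times> IN (exp ((c3 - dot W3 (map lnn zs)) / 3)))"
  have finA: "finite A" by (simp add: A_def finite_lists_length_eq)
  have "bij_betw (\<lambda>(zs, y1, y2, y3). y1 # y2 # y3 # zs) (Sigma A B) (RR c1 c2 c3)"
  proof (rule bij_betw_imageI)
    show "inj_on (\<lambda>(zs, y1, y2, y3). y1 # y2 # y3 # zs) (Sigma A B)" by (auto simp: inj_on_def)
    show "(\<lambda>(zs, y1, y2, y3). y1 # y2 # y3 # zs) ` Sigma A B = RR c1 c2 c3"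
    proof (intro Set.set_eqI iffI)
      fix ns assume "ns \<in> (\<lambda>(zs, y1, y2, y3). y1 # y2 # y3 # zs) ` Sigma A B"
      then obtain zs y1 y2 y3 where "ns = y1 # y2 # y3 # zs" "zs \<in> A" "(y1, y2, y3) \<in> B zs" by auto
      thus "ns \<in> RR c1 c2 c3"
        by (auto simp: A_def B_def RR_def IN_lnn V1_def V2_def V3_def subset_iff)
    next
      fix ns assume ns: "ns \<in> RR c1 c2 c3"
      then obtain y1 y2 y3 zs where e: "ns = y1 # y2 # y3 # zs" "length zs = 6"
        by (auto simp: RR_def numeral_eq_Suc length_Suc_conv)
      have "set ns \<subseteq> IN (exp L)" using RR_sub[OF c] ns by blast
      hence "zs \<in> A" using e by (auto simp: A_def)
      moreover have "(y1, y2, y3) \<in> B zs"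
        using ns e by (auto simp: RR_def B_def IN_lnn V1_def V2_def V3_def)
      ultimately show "ns \<in> (\<lambda>(zs, y1, y2, y3). y1 # y2 # y3 # zs) ` Sigma A B"
        using e by (intro image_eqI[of _ _ "(zs, y1, y2, y3)"]) auto
    qed
  qed
  hence "card (RR c1 c2 c3) = card (Sigma A B)" by (simp add: bij_betw_same_card)
  also have "\<dots> = (\<Sum>zs\<in>A. card (B zs))" by (rule card_SigmaI) (auto simp: finA B_def)
  also have "real \<dots> = (\<Sum>zs\<in>A. cl (c1 - dot W1 (map lnn zs)) * cl (c2 - dot W2 (map lnn zs)) * cl (c3 - dot W3 (map lnn zs)))"
    by (simp add: B_def card_cartesian_product cl_def mult.assoc)
  also have "\<dots> = Sm L 6 (Gc c1 c2 c3)"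
    using sum_lists_Sm[where L = L and k = 6 and g = "\<lambda>ts. cl (c1 - dot W1 ts) * cl (c2 - dot W2 ts) * cl (c3 - dot W3 ts)"]
    by (simp add: A_def Gc_def[abs_def])
  finally show ?thesis .
qed

definition Cmain :: real where "Cmain = \<rho> ^ 9 / 2880"

text \<open>The last term is \<open>6 * \<rho> ^ 9 / 2880\<close>, with 6 from differentiating
  \<open>L ^ 6\<close>: the cost of moving the bounds by a divisor.\<close>

definition Cerr :: real where
  "Cerr = (18 * (K2 * (\<rho> + K2)\<^sup>2) * (\<rho> + C0) + 6 * C1 * \<rho> ^ 3) * K1 ^ 5 + \<rho> ^ 9 / 480"

lemma pow6_diff_le:
  fixes L \<eta> :: real assumes "0 \<le> \<eta>" "\<eta> \<le> L" shows "L ^ 6 - (L - \<eta>) ^ 6 \<le> 6 * L ^ 5 * \<eta>"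
proof -
  define a where "a = L - \<eta>"
  have a: "0 \<le> a" "a \<le> L" using assms by (auto simp: a_def)
  have "L ^ 6 - a ^ 6 = (L - a) * (L ^ 5 + L ^ 4 * a + L ^ 3 * a ^ 2 + L ^ 2 * a ^ 3 + L * a ^ 4 + a ^ 5)"
    by (simp add: eval_nat_numeral algebra_simps)
  also have "\<dots> \<le> (L - a) * (L ^ 5 + L ^ 4 * L + L ^ 3 * L ^ 2 + L ^ 2 * L ^ 3 + L * L ^ 4 + L ^ 5)"
    using a by (intro mult_left_mono add_mono power_mono) auto
  also have "\<dots> = 6 * L ^ 5 * \<eta>" by (simp add: a_def eval_nat_numeral algebra_simps)
  finally show ?thesis by (simp add: a_def)
qed

text \<open>The region lies between the symmetric ones with bounds \<open>L - \<eta>\<close> and L,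
  where \<eta> is the total shift, and their volumes follow by scaling. If \<eta> is at least L, the
  lower bound 0 is good enough.\<close>

lemma vol_Fc_shift:
  assumes d: "0 \<le> d1" "0 \<le> d2" "0 \<le> d3" and L: "L > 0"
  shows "\<bar>vol L 6 (Fc (L - d1) (L - d2) (L - d3)) - L ^ 6 / 2880\<bar> \<le> L ^ 5 * (d1 + d2 + d3) / 480"
proof -
  define \<eta> where "\<eta> = d1 + d2 + d3"
  have \<eta>: "\<eta> \<ge> 0" using d by (simp add: \<eta>_def)
  define w where "w = vol L 6 (Fc (L - d1) (L - d2) (L - d3))"
  have a1: "adm L 1 6 (Fc (L - d1) (L - d2) (L - d3))" and a2: "adm L 1 6 (Fc L L L)"
    and a3: "adm L 1 6 (Fc (L - \<eta>) (L - \<eta>) (L - \<eta>))"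
    by (rule adm_Fc; use d \<eta> in simp)+
  have "w \<le> vol L 6 (Fc L L L)"
    unfolding w_def by (rule vol_mono[OF a1 a2]) (use L d in \<open>auto simp: Fc_def\<close>)
  hence up: "w \<le> L ^ 6 / 2880" using vol_Fc[of L L] L by simp
  have lo: "L ^ 6 / 2880 - w \<le> L ^ 5 * \<eta> / 480"
  proof (cases "\<eta> < L")
    case True
    have "vol L 6 (Fc (L - \<eta>) (L - \<eta>) (L - \<eta>)) \<le> w"
      unfolding w_def by (rule vol_mono[OF a3 a1]) (use L d in \<open>auto simp: Fc_def \<eta>_def\<close>)
    hence "(L - \<eta>) ^ 6 / 2880 \<le> w" using vol_Fc[of "L - \<eta>" L] True \<eta> by simp
    thus ?thesis using pow6_diff_le[of \<eta> L] True \<eta> by simp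
  next
    case False
    have "0 \<le> w" unfolding w_def using vol_bounds[OF a1] L by simp
    moreover have "L ^ 6 \<le> L ^ 5 * \<eta>" using False L by (simp add: eval_nat_numeral)
    moreover have "L ^ 5 * \<eta> \<ge> 0" using L \<eta> by simp
    ultimately show ?thesis by simp
  qed
  have "L ^ 5 * \<eta> / 480 \<ge> 0" using L \<eta> by simp
  thus ?thesis using up lo by (simp add: w_def[symmetric] \<eta>_def[symmetric] abs_le_iff)
qed

text \<open>The point is uniformity in the shifts. Main term and error both carry the factor
  \<open>exp (- (d1 + d2 + d3) / 3)\<close>, which will be the reciprocal norm of the divisor, and
  the error is otherwise only linear in the shifts.\<close>

lemma card_RR_asymp:
  assumes d: "0 \<le> d1" "0 \<le> d2" "0 \<le> d3" and L: "L > 0"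
  shows "\<bar>real (card (RR (L - d1) (L - d2) (L - d3))) - exp (L - (d1 + d2 + d3) / 3) * Cmain * L ^ 6\<bar> \<le>
    exp (L - (d1 + d2 + d3) / 3) * (Cerr * (1 + L) ^ 5 * (1 + (d1 + d2 + d3)))"
proof -
  define E where "E = exp (L - (d1 + d2 + d3) / 3)"
  define \<eta> where "\<eta> = d1 + d2 + d3"
  have \<eta>: "\<eta> \<ge> 0" using d by (simp add: \<eta>_def)
  define A where "A = (18 * (K2 * (\<rho> + K2)\<^sup>2) * (\<rho> + C0) + 6 * C1 * \<rho> ^ 3)"
  have A: "A * K1 ^ 5 \<ge> 0"
    unfolding A_def using K2_pos rho_pos C0_nonneg C1_pos K1_pos by (intro add_nonneg_nonneg mult_nonneg_nonneg) auto
  have e: "(L - d1 + (L - d2) + (L - d3)) / 3 = L - (d1 + d2 + d3) / 3" by (simp add: field_simps)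
  define w where "w = vol L 6 (Fc (L - d1) (L - d2) (L - d3))"
  have 1: "\<bar>real (card (RR (L - d1) (L - d2) (L - d3))) - E * (\<rho> ^ 9 * w)\<bar> \<le> E * (A * (K1 * (1 + L)) ^ 5)"
    using Sm_Gc[of "L - d1" L "L - d2" "L - d3"] d L unfolding e E_def[symmetric]
    by (subst card_RR[of _ L]) (auto simp: w_def A_def)
  have "\<bar>E * (\<rho> ^ 9 * w) - E * Cmain * L ^ 6\<bar> = E * \<rho> ^ 9 * \<bar>w - L ^ 6 / 2880\<bar>"
    using rho_pos by (simp add: Cmain_def E_def abs_mult[symmetric] abs_mult_pos' algebra_simps)
  also have "\<dots> \<le> E * \<rho> ^ 9 * (L ^ 5 * \<eta> / 480)"
    using vol_Fc_shift[OF d L] rho_pos unfolding w_def \<eta>_def by (intro mult_left_mono) (auto simp: E_def)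
  finally have 2: "\<bar>E * (\<rho> ^ 9 * w) - E * Cmain * L ^ 6\<bar> \<le> E * (\<rho> ^ 9 / 480 * (L ^ 5 * \<eta>))" by (simp add: algebra_simps)
  have "\<bar>real (card (RR (L - d1) (L - d2) (L - d3))) - E * Cmain * L ^ 6\<bar> \<le>
     E * (A * (K1 * (1 + L)) ^ 5) + E * (\<rho> ^ 9 / 480 * (L ^ 5 * \<eta>))" using 1 2 by linarith
  also have "\<dots> = E * (A * K1 ^ 5 * (1 + L) ^ 5 + \<rho> ^ 9 / 480 * (L ^ 5 * \<eta>))"
    unfolding power_mult_distrib by (simp only: distrib_left mult_ac)
  also have "\<dots> \<le> E * (A * K1 ^ 5 * ((1 + L) ^ 5 * (1 + \<eta>)) + \<rho> ^ 9 / 480 * ((1 + L) ^ 5 * (1 + \<eta>)))"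
  proof (intro mult_left_mono add_mono)
    show "(1 + L) ^ 5 \<le> (1 + L) ^ 5 * (1 + \<eta>)"
      using L \<eta> by (simp add: algebra_simps)
    show "L ^ 5 * \<eta> \<le> (1 + L) ^ 5 * (1 + \<eta>)"
      using L \<eta> by (intro mult_mono power_mono) auto
  qed (use rho_pos A in \<open>auto simp: E_def\<close>)
  also have "\<dots> = E * (Cerr * (1 + L) ^ 5 * (1 + \<eta>))" by (simp add: Cerr_def A_def algebra_simps)
  finally show ?thesis by (simp add: E_def \<eta>_def)
qed

end

text \<open>A quarter power absorbs the logarithm that the uniform estimate produces, turning the
  exponent -1 of \<open>nd\<close> into -3/4.\<close>

lemma one_plus_ln_le: "x \<ge> 1 \<Longrightarrow> 1 + ln x \<le> 4 * x powr (1 / 4)" for x :: real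
proof -
  assume x: "x \<ge> 1"
  have "ln (x powr (1 / 4)) \<le> x powr (1 / 4) - 1" by (rule ln_le_minus_one) (use x in simp)
  thus ?thesis using x by (simp add: ln_powr)
qed

section \<open>Moebius divisors, absolute convergence and the Euler product\<close>

context norm_system
begin

text \<open>A 9-tuple of squarefree ideals, recorded prime by prime as the set of indices whose
  ideal the prime divides. Then \<open>mu\<close> is the product of the local weights and
  \<open>nd\<close> the product of the nine norms.\<close>

definition DD :: "('p \<Rightarrow> nat set) set" where
  "DD = {d. (\<forall>p. d p \<subseteq> {..<9}) \<and> finite {p. d p \<noteq> {}} \<and> {p. d p \<noteq> {}} \<subseteq> P}"

definition mu :: "('p \<Rightarrow> nat set) \<Rightarrow> real" where "mu d = (\<Prod>p\<in>{p. d p \<noteq> {}}. mob Face (d p))"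
definition nd :: "('p \<Rightarrow> nat set) \<Rightarrow> real" where "nd d = (\<Prod>p\<in>{p. d p \<noteq> {}}. real (N p) ^ card (d p))"

lemma mu_superset: "finite F \<Longrightarrow> {p. d p \<noteq> {}} \<subseteq> F \<Longrightarrow> mu d = (\<Prod>p\<in>F. mob Face (d p))"
  unfolding mu_def by (rule prod.mono_neutral_left) (auto simp: mob_empty)

lemma nd_superset: "finite F \<Longrightarrow> {p. d p \<noteq> {}} \<subseteq> F \<Longrightarrow> nd d = (\<Prod>p\<in>F. real (N p) ^ card (d p))"
  unfolding nd_def by (rule prod.mono_neutral_left) auto

lemma nd_ge1: assumes d: "d \<in> DD" shows "nd d \<ge> 1"
  unfolding nd_def
proof (rule prod_ge_1)
  fix p assume "p \<in> {p. d p \<noteq> {}}"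
  hence "p \<in> P" using d unfolding DD_def by blast
  from N_ge[OF this] show "1 \<le> real (N p) ^ card (d p)" by (intro one_le_power) simp
qed

lemma DF_sub_DD: "finite F \<Longrightarrow> F \<subseteq> P \<Longrightarrow> DF F (\<lambda>_. pow9) \<subseteq> DD"
proof
  fix d assume F: "finite F" "F \<subseteq> P" and d: "d \<in> DF F (\<lambda>_. pow9)"
  have s: "{p. d p \<noteq> {}} \<subseteq> F" using d by (force simp: DF_def)
  moreover have "d p \<subseteq> {..<9}" for p
  proof -
    have "if p \<in> F then d p \<in> pow9 else d p = {}" using d unfolding DF_def by blast
    thus ?thesis by (auto split: if_splits)
  qed
  ultimately show "d \<in> DD" using F finite_subset by (auto simp: DD_def)
qed

lemma DD_in_DF: "d \<in> DD \<Longrightarrow> {p. d p \<noteq> {}} \<subseteq> F \<Longrightarrow> d \<in> DF F (\<lambda>_. pow9)"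
  by (auto simp: DD_def DF_def)

lemma DF_supp: "d \<in> DF F A \<Longrightarrow> {p. d p \<noteq> {}} \<subseteq> F"
  by (force simp: DF_def)

lemma sum_mu_DF:
  assumes "finite F"
  shows "(\<Sum>d\<in>DF F (\<lambda>_. pow9). mu d / nd d) = (\<Prod>p\<in>F. (1 - 1 / N p) ^ 7 * (1 + 7 / N p + 1 / (real (N p))\<^sup>2))"
proof -
  have "(\<Sum>d\<in>DF F (\<lambda>_. pow9). mu d / nd d) =
      (\<Sum>d\<in>DF F (\<lambda>_. pow9). \<Prod>p\<in>F. (1 / N p) ^ card (d p) * mob Face (d p))"
  proof (rule sum.cong[OF refl])
    fix d assume "d \<in> DF F (\<lambda>_. pow9)"
    hence "{p. d p \<noteq> {}} \<subseteq> F" by (rule DF_supp)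
    thus "mu d / nd d = (\<Prod>p\<in>F. (1 / N p) ^ card (d p) * mob Face (d p))"
      using mu_superset[OF assms] nd_superset[OF assms]
      by (simp add: prod_dividef[symmetric] power_one_over field_simps)
  qed
  also have "\<dots> = (\<Prod>p\<in>F. \<Sum>S\<in>pow9. (1 / N p) ^ card S * mob Face S)"
    by (rule sum_DF_prod[OF assms])
  also have "\<dots> = (\<Prod>p\<in>F. (1 - 1 / N p) ^ 7 * (1 + 7 / N p + 1 / (real (N p))\<^sup>2))"
    unfolding mob_Euler_factor by (simp add: power_one_over)
  finally show ?thesis .
qed

text \<open>Primes are singletons among all multisets, over which the sum of the norms to the power
  -3/2 converges. The exponent 3/2 is twice the 3/4 used for \<open>nd\<close>.\<close>

lemma sum_primes_bounded:
  obtains K where "\<And>F. finite F \<Longrightarrow> F \<subseteq> P \<Longrightarrow> (\<Sum>p\<in>F. real (N p) powr (- (3 / 2))) \<le> K"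
proof -
  have s: "summable (\<lambda>k. real k powr (- (3 / 2)))" by (simp add: summable_real_powr_iff)
  define K where "K = (\<rho> + C0) * suminf (\<lambda>k. real k powr (- (3 / 2)))"
  have "(\<Sum>p\<in>F. real (N p) powr (- (3 / 2))) \<le> K" if F: "finite F" "F \<subseteq> P" for F
  proof -
    define B where "B = Max (insert 0 (N ` F))"
    have B: "N p \<le> B" if "p \<in> F" for p using that F by (auto simp: B_def)
    have "(\<Sum>p\<in>F. real (N p) powr (- (3 / 2))) = (\<Sum>m\<in>(\<lambda>p. {#p#}) ` F. real (nrm N m) powr (- (3 / 2)))"
      by (subst sum.reindex) (auto simp: inj_on_def)
    also have "\<dots> \<le> (\<Sum>m\<in>IN (real B). real (nrm N m) powr (- (3 / 2)))"
      by (rule sum_mono2[OF finite_IN]) (use F B in \<open>auto simp: IN_def II_def\<close>)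
    also have "\<dots> = (\<Sum>k=1..B. rr k * real k powr (- (3 / 2)))"
      using sum_IN[of "real B" "\<lambda>k. real k powr (- (3 / 2))"] by simp
    also have "\<dots> \<le> (\<rho> + C0) * (\<Sum>k=1..B. real k powr (- (3 / 2)))"
      by (rule sum_rr_antimono_le) (auto intro!: powr_mono2')
    also have "\<dots> \<le> (\<rho> + C0) * suminf (\<lambda>k. real k powr (- (3 / 2)))"
      by (intro mult_left_mono sum_le_suminf s) (use rho_pos C0_nonneg in auto)
    finally show ?thesis by (simp add: K_def)
  qed
  thus ?thesis using that by blast
qed

text \<open>Singletons have weight 0, so the local factor is at most 1 plus a multiple of
  \<open>N p powr (- (3 / 2))\<close>: there are 2^9 sets, each of weight at most 2^9. The exponent
  3/4 lies above 1/2, for convergence, and below 1, to leave room for a logarithm.\<close>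

lemma mu_abs_summable: "(\<lambda>d. \<bar>mu d\<bar> * nd d powr (- (3 / 4))) summable_on DD"
proof -
  obtain K where K: "\<And>F. finite F \<Longrightarrow> F \<subseteq> P \<Longrightarrow> (\<Sum>p\<in>F. real (N p) powr (- (3 / 2))) \<le> K"
    using sum_primes_bounded by blast
  have local: "(\<Sum>S\<in>pow9. \<bar>mob Face S\<bar> * (real (N p) ^ card S) powr (- (3 / 4))) \<le> 1 + 2 ^ 18 * real (N p) powr (- (3 / 2))"
    if p: "p \<in> P" for p
  proof -
    define x where "x = real (N p)"
    have x: "x \<ge> 1" using N_ge[OF p] by (simp add: x_def)
    have "(\<Sum>S\<in>pow9. \<bar>mob Face S\<bar> * (x ^ card S) powr (- (3 / 4))) =
       1 + (\<Sum>S\<in>pow9 - {{}}. \<bar>mob Face S\<bar> * (x ^ card S) powr (- (3 / 4)))"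
      by (subst sum.remove[of _ "{}"]) (auto simp: mob_empty)
    also have "(\<Sum>S\<in>pow9 - {{}}. \<bar>mob Face S\<bar> * (x ^ card S) powr (- (3 / 4))) \<le>
       (\<Sum>S\<in>pow9 - {{}}. 2 ^ 9 * x powr (- (3 / 2)))"
    proof (rule sum_mono)
      fix S assume S: "S \<in> pow9 - {{}}"
      have fS: "finite S" "card S \<le> 9" using S finite_subset[of S "{..<9}"] card_mono[of "{..<9}" S] by auto
      show "\<bar>mob Face S\<bar> * (x ^ card S) powr (- (3 / 4)) \<le> 2 ^ 9 * x powr (- (3 / 2))"
      proof (cases "card S \<ge> 2")
        case True
        have "\<bar>mob Face S\<bar> \<le> 2 ^ card S" by (rule mob_abs_le[OF fS(1)])
        also have "\<dots> \<le> (2 :: real) ^ 9" by (rule power_increasing) (use fS in auto)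
        finally have a: "\<bar>mob Face S\<bar> \<le> 2 ^ 9" .
        have "(x ^ card S) powr (- (3 / 4)) \<le> (x ^ 2) powr (- (3 / 4))"
          by (rule powr_mono2') (use x True in \<open>auto intro!: power_increasing\<close>)
        also have "\<dots> = x powr (- (3 / 2))" using x by (simp add: powr_powr flip: powr_numeral)
        finally show ?thesis using a by (intro mult_mono) auto
      next
        case False
        hence "card S = 1" using S fS by (cases "card S") auto
        then obtain j where j: "S = {j}" by (auto simp: card_1_singleton_iff)
        hence "mob Face S = 0" using S mob_singleton[of Face j] Face_1[of j] by auto
        thus ?thesis by simp
      qed
    qed
    also have "\<dots> = (2 ^ 9 - 1) * 2 ^ 9 * x powr (- (3 / 2))" by (simp add: card_Diff_singleton card_Pow)
    also have "\<dots> \<le> 2 ^ 18 * x powr (- (3 / 2))" by (rule mult_right_mono) auto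
    finally show ?thesis by (simp add: x_def)
  qed
  have bound: "(\<Sum>d\<in>B. \<bar>mu d\<bar> * nd d powr (- (3 / 4))) \<le> exp (2 ^ 18 * K)" if B: "B \<subseteq> DD" "finite B" for B
  proof -
    define F where "F = (\<Union>d\<in>B. {p. d p \<noteq> {}})"
    have F: "finite F" "F \<subseteq> P" using B by (auto simp: F_def DD_def)
    have pos: "\<bar>mu d\<bar> * nd d powr (- (3 / 4)) \<ge> 0" for d by simp
    have "(\<Sum>d\<in>B. \<bar>mu d\<bar> * nd d powr (- (3 / 4))) \<le> (\<Sum>d\<in>DF F (\<lambda>_. pow9). \<bar>mu d\<bar> * nd d powr (- (3 / 4)))"
    proof (rule sum_mono2)
      show "B \<subseteq> DF F (\<lambda>_. pow9)"
      proof
        fix d assume d: "d \<in> B"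
        have "{p. d p \<noteq> {}} \<subseteq> F" using d unfolding F_def by blast
        thus "d \<in> DF F (\<lambda>_. pow9)" using DD_in_DF B d by blast
      qed
    qed (use F in \<open>auto intro!: finite_DF\<close>)
    also have "\<dots> = (\<Sum>d\<in>DF F (\<lambda>_. pow9). \<Prod>p\<in>F. \<bar>mob Face (d p)\<bar> * (real (N p) ^ card (d p)) powr (- (3 / 4)))"
    proof (rule sum.cong[OF refl])
      fix d assume "d \<in> DF F (\<lambda>_. pow9)"
      hence s: "{p. d p \<noteq> {}} \<subseteq> F" by (rule DF_supp)
      show "\<bar>mu d\<bar> * nd d powr (- (3 / 4)) = (\<Prod>p\<in>F. \<bar>mob Face (d p)\<bar> * (real (N p) ^ card (d p)) powr (- (3 / 4)))"
        unfolding mu_superset[OF F(1) s] nd_superset[OF F(1) s]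
        by (simp add: prod.distrib abs_prod prod_powr_distrib)
    qed
    also have "\<dots> = (\<Prod>p\<in>F. \<Sum>S\<in>pow9. \<bar>mob Face S\<bar> * (real (N p) ^ card S) powr (- (3 / 4)))"
      by (rule sum_DF_prod[OF F(1)])
    also have "\<dots> \<le> (\<Prod>p\<in>F. exp (2 ^ 18 * real (N p) powr (- (3 / 2))))"
    proof (rule prod_mono)
      fix p assume p: "p \<in> F"
      have "(\<Sum>S\<in>pow9. \<bar>mob Face S\<bar> * (real (N p) ^ card S) powr (- (3 / 4))) \<le> 1 + 2 ^ 18 * real (N p) powr (- (3 / 2))"
        by (rule local) (use p F in auto)
      also have "\<dots> \<le> exp (2 ^ 18 * real (N p) powr (- (3 / 2)))" by (rule exp_ge_add_one_self)
      finally show "0 \<le> (\<Sum>S\<in>pow9. \<bar>mob Face S\<bar> * (real (N p) ^ card S) powr (- (3 / 4))) \<and>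
         (\<Sum>S\<in>pow9. \<bar>mob Face S\<bar> * (real (N p) ^ card S) powr (- (3 / 4))) \<le> exp (2 ^ 18 * real (N p) powr (- (3 / 2)))"
        by (auto intro!: sum_nonneg)
    qed
    also have "\<dots> = exp (2 ^ 18 * (\<Sum>p\<in>F. real (N p) powr (- (3 / 2))))"
      using F by (simp add: exp_sum sum_distrib_left)
    also have "\<dots> \<le> exp (2 ^ 18 * K)" using K[OF F] by simp
    finally show ?thesis .
  qed
  show ?thesis
    by (rule nonneg_bdd_above_summable_on) (use bound in \<open>auto intro!: bdd_aboveI[of _ "exp (2 ^ 18 * K)"]\<close>)
qed

lemma mu_ln_bound:
  assumes "d \<in> DD"
  shows "\<bar>mu d\<bar> * (1 + 3 * ln (nd d)) / nd d \<le> 12 * (\<bar>mu d\<bar> * nd d powr (- (3 / 4)))"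
proof -
  define x where "x = nd d"
  have x: "x \<ge> 1" using nd_ge1[OF assms] by (simp add: x_def)
  have "1 + 3 * ln x \<le> 12 * x powr (1 / 4)" using one_plus_ln_le[OF x] x by simp
  hence "(1 + 3 * ln x) / x \<le> 12 * x powr (1 / 4) / x" by (rule divide_right_mono) (use x in simp)
  also have "x powr (- (3 / 4)) = x powr (1 / 4) / x"
    using powr_diff[of x "1 / 4" 1] x by simp
  hence "12 * x powr (1 / 4) / x = 12 * x powr (- (3 / 4))" by simp
  finally have "\<bar>mu d\<bar> * ((1 + 3 * ln x) / x) \<le> \<bar>mu d\<bar> * (12 * x powr (- (3 / 4)))" by (rule mult_left_mono) simp
  thus ?thesis by (simp add: x_def mult_ac)
qed

lemma mu_nd_summable: "(\<lambda>d. \<bar>mu d\<bar> * (1 + 3 * ln (nd d)) / nd d) summable_on DD" "(\<lambda>d. norm (mu d / nd d)) summable_on DD"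
proof -
  have s: "(\<lambda>d. 12 * (\<bar>mu d\<bar> * nd d powr (- (3 / 4)))) summable_on DD"
    by (rule summable_on_cmult_right[OF mu_abs_summable])
  have nn: "0 \<le> \<bar>mu d\<bar> * (1 + 3 * ln (nd d)) / nd d" if "d \<in> DD" for d
    using nd_ge1[OF that] by (intro divide_nonneg_nonneg mult_nonneg_nonneg) auto
  show 1: "(\<lambda>d. \<bar>mu d\<bar> * (1 + 3 * ln (nd d)) / nd d) summable_on DD"
    by (rule summable_on_comparison_test[OF s mu_ln_bound nn])
  show "(\<lambda>d. norm (mu d / nd d)) summable_on DD"
  proof (rule summable_on_comparison_test[OF 1])
    fix d assume d: "d \<in> DD"
    have "\<bar>mu d\<bar> * 1 / nd d \<le> \<bar>mu d\<bar> * (1 + 3 * ln (nd d)) / nd d"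
      using nd_ge1[OF d] by (intro divide_right_mono mult_left_mono) auto
    thus "norm (mu d / nd d) \<le> \<bar>mu d\<bar> * (1 + 3 * ln (nd d)) / nd d" using nd_ge1[OF d] by simp
  qed simp
qed

definition singular_series :: real where "singular_series = infsum (\<lambda>d. mu d / nd d) DD"

lemma singular_series_has_sum: "((\<lambda>d. mu d / nd d) has_sum singular_series) DD"
  unfolding singular_series_def using Infinite_Sum.abs_summable_summable[OF mu_nd_summable(2)] by (rule has_sum_infsum)

text \<open>A partial Euler product over F is the sum over the divisors supported on F. These sets
  of divisors are finite and eventually contain any given finite set of divisors, so the limit along
  them is the unconditional sum.\<close>

lemma singular_series_Euler:
  "((\<lambda>F. \<Prod>p\<in>F. (1 - 1 / N p) ^ 7 * (1 + 7 / N p + 1 / (real (N p))\<^sup>2)) \<longlongrightarrow> singular_series)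
     (finite_subsets_at_top P)"
proof -
  have "filterlim (\<lambda>F. DF F (\<lambda>_. pow9)) (finite_subsets_at_top DD) (finite_subsets_at_top P)"
    unfolding filterlim_def le_filter_def
  proof safe
    fix Q assume "eventually Q (finite_subsets_at_top DD)"
    then obtain B where B: "finite B" "B \<subseteq> DD" "\<And>Y. finite Y \<Longrightarrow> B \<subseteq> Y \<Longrightarrow> Y \<subseteq> DD \<Longrightarrow> Q Y"
      by (auto simp: eventually_finite_subsets_at_top)
    define F0 where "F0 = (\<Union>d\<in>B. {p. d p \<noteq> {}})"
    have F0: "finite F0" "F0 \<subseteq> P" using B by (auto simp: F0_def DD_def)
    have "Q (DF F (\<lambda>_. pow9))" if F: "finite F" "F0 \<subseteq> F" "F \<subseteq> P" for F
    proof (rule B(3))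
      show "finite (DF F (\<lambda>_. pow9))" using F by (intro finite_DF) auto
      show "B \<subseteq> DF F (\<lambda>_. pow9)"
      proof
        fix d assume d: "d \<in> B"
        have "{p. d p \<noteq> {}} \<subseteq> F" using d F unfolding F0_def by blast
        thus "d \<in> DF F (\<lambda>_. pow9)" using DD_in_DF B d by blast
      qed
    qed (rule DF_sub_DD[OF F(1,3)])
    thus "eventually Q (filtermap (\<lambda>F. DF F (\<lambda>_. pow9)) (finite_subsets_at_top P))"
      unfolding eventually_filtermap eventually_finite_subsets_at_top using F0 by blast
  qed
  hence "((\<lambda>F. \<Sum>d\<in>DF F (\<lambda>_. pow9). mu d / nd d) \<longlongrightarrow> singular_series) (finite_subsets_at_top P)"
    using filterlim_compose[OF singular_series_has_sum[unfolded has_sum_def]] by blast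
  thus ?thesis
    by (rule Lim_transform_eventually)
       (auto simp: eventually_finite_subsets_at_top sum_mu_DF intro!: exI[of _ "{}"])
qed

end

section \<open>Counting triples of multisets\<close>

text \<open>The disjuncts leave free the exponents at 0,3; 3,4; 1,4; 1,5; 5,6; 2,6; 2,7; 7,8; 0,8,
  the pairs of neighbours. This form suits case distinctions.\<close>

definition face9 :: "(nat \<Rightarrow> nat) \<Rightarrow> bool" where
  "face9 n \<longleftrightarrow>
    (n 1 = 0 \<and> n 2 = 0 \<and> n 4 = 0 \<and> n 5 = 0 \<and> n 6 = 0 \<and> n 7 = 0 \<and> n 8 = 0) \<or>
    (n 0 = 0 \<and> n 1 = 0 \<and> n 2 = 0 \<and> n 5 = 0 \<and> n 6 = 0 \<and> n 7 = 0 \<and> n 8 = 0) \<or>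
    (n 0 = 0 \<and> n 2 = 0 \<and> n 3 = 0 \<and> n 5 = 0 \<and> n 6 = 0 \<and> n 7 = 0 \<and> n 8 = 0) \<or>
    (n 0 = 0 \<and> n 2 = 0 \<and> n 3 = 0 \<and> n 4 = 0 \<and> n 6 = 0 \<and> n 7 = 0 \<and> n 8 = 0) \<or>
    (n 0 = 0 \<and> n 1 = 0 \<and> n 2 = 0 \<and> n 3 = 0 \<and> n 4 = 0 \<and> n 7 = 0 \<and> n 8 = 0) \<or>
    (n 0 = 0 \<and> n 1 = 0 \<and> n 3 = 0 \<and> n 4 = 0 \<and> n 5 = 0 \<and> n 7 = 0 \<and> n 8 = 0) \<or>
    (n 0 = 0 \<and> n 1 = 0 \<and> n 3 = 0 \<and> n 4 = 0 \<and> n 5 = 0 \<and> n 6 = 0 \<and> n 8 = 0) \<or>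
    (n 0 = 0 \<and> n 1 = 0 \<and> n 2 = 0 \<and> n 3 = 0 \<and> n 4 = 0 \<and> n 5 = 0 \<and> n 6 = 0) \<or>
    (n 1 = 0 \<and> n 2 = 0 \<and> n 3 = 0 \<and> n 4 = 0 \<and> n 5 = 0 \<and> n 6 = 0 \<and> n 7 = 0)"

lemma ball_9: "(\<forall>j<9. Q j) \<longleftrightarrow> Q 0 \<and> Q 1 \<and> Q 2 \<and> Q 3 \<and> Q 4 \<and> Q 5 \<and> Q 6 \<and> Q 7 \<and> Q (8::nat)"
  by (simp add: numeral_eq_Suc All_less_Suc) blast

lemma Face_iff:
  "S \<in> Face \<longleftrightarrow> S \<subseteq> {0,3} \<or> S \<subseteq> {3,4} \<or> S \<subseteq> {4,1} \<or> S \<subseteq> {1,5} \<or> S \<subseteq> {5,6} \<or> S \<subseteq> {6,2} \<or> S \<subseteq> {2,7} \<or> S \<subseteq> {7,8} \<or> S \<subseteq> {8,0}"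
proof -
  have e: "S \<subseteq> {a, b} \<longleftrightarrow> S = {} \<or> S = {a} \<or> S = {b} \<or> S = {a, b}" for a b :: nat by blast
  show ?thesis unfolding Face_def e insert_iff empty_iff by (rule iffI; elim disjE; simp)
qed

lemma Face_face9: "{j. j < 9 \<and> n j > 0} \<in> Face \<longleftrightarrow> face9 n"
proof -
  have "{j. j < 9 \<and> n j > 0} \<subseteq> {a, b} \<longleftrightarrow> (\<forall>j<9. j = a \<or> j = b \<or> n j = 0)" for a b
    by auto
  thus ?thesis unfolding Face_iff by (simp only: ball_9) (simp add: face9_def)
qed

definition exps1 :: "(nat \<Rightarrow> nat) \<Rightarrow> nat" where "exps1 n = 3 * n 0 + 2 * n 3 + n 4 + n 7 + 2 * n 8"
definition exps2 :: "(nat \<Rightarrow> nat) \<Rightarrow> nat" where "exps2 n = 3 * n 1 + n 3 + 2 * n 4 + 2 * n 5 + n 6"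
definition exps3 :: "(nat \<Rightarrow> nat) \<Rightarrow> nat" where "exps3 n = 3 * n 2 + n 5 + 2 * n 6 + 2 * n 7 + n 8"

text \<open>Coordinates with respect to the face containing the vector. Truncated subtraction and
  \<open>min\<close> select the cone: for z = 0, \<open>(2 * x - y) div 3\<close> is the coefficient
  of (2,1,0) between (2,1,0) and (1,2,0), vanishes beyond (1,2,0), and is at least the true
  coefficient y between (3,0,0) and (2,1,0).\<close>

definition inv9 :: "nat \<Rightarrow> nat \<Rightarrow> nat \<Rightarrow> nat \<Rightarrow> nat" where
  "inv9 x y z j =
    (if j = 0 then (x - 2 * (y + z)) div 3
     else if j = 1 then (y - 2 * (x + z)) div 3
     else if j = 2 then (z - 2 * (x + y)) div 3
     else if j = 3 then (if z = 0 then min y ((2 * x - y) div 3) else 0)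
     else if j = 4 then (if z = 0 then min x ((2 * y - x) div 3) else 0)
     else if j = 5 then (if x = 0 then min z ((2 * y - z) div 3) else 0)
     else if j = 6 then (if x = 0 then min y ((2 * z - y) div 3) else 0)
     else if j = 7 then (if y = 0 then min x ((2 * z - x) div 3) else 0)
     else (if y = 0 then min z ((2 * x - z) div 3) else 0))"

lemma inv9_exps:
  assumes "face9 n" "j < 9" shows "inv9 (exps1 n) (exps2 n) (exps3 n) j = n j"
proof -
  have "\<forall>j<9. inv9 (exps1 n) (exps2 n) (exps3 n) j = n j"
    using assms(1) unfolding ball_9 face9_def
    by (elim disjE conjE) (simp_all add: inv9_def exps1_def exps2_def exps3_def min_def)
  thus ?thesis using assms(2) by blast
qed

text \<open>The quadrant belonging to an edge is cut into three cones by (2,1) and (1,2). Each is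
  spanned by two neighbouring points that form a basis of the lattice given by
  \<open>3 dvd a + b\<close>.\<close>

lemma two_exponents:
  fixes a b :: nat assumes "3 dvd a + b"
  shows "\<exists>k l. (a = 3 * k + 2 * l \<and> b = l) \<or> (b = 3 * k + 2 * l \<and> a = l) \<or> (a = 2 * k + l \<and> b = k + 2 * l)"
proof -
  obtain m where m: "a + b = 3 * m" using assms by (auto simp: dvd_def)
  consider "a \<ge> 2 * b" | "b \<ge> 2 * a" | "a < 2 * b" "b < 2 * a" by linarith
  thus ?thesis
  proof cases
    case 1
    have "a = 3 * (m - b) + 2 * b" using 1 m by linarith
    thus ?thesis by blast
  next
    case 2
    have "b = 3 * (m - a) + 2 * a" using 2 m by linarith
    thus ?thesis by blast
  next
    case 3
    have "a = 2 * (a - m) + (b - m)" "b = (a - m) + 2 * (b - m)" using 3 m by linarith+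
    thus ?thesis by blast
  qed
qed

lemma inv9_arith:
  fixes k l :: nat
  shows "(3 * k + 2 * l - 2 * l) div 3 = k" "(l - 2 * (3 * k + 2 * l)) div 3 = 0"
    "(2 * (3 * k + 2 * l) - l) div 3 = 2 * k + l" "(2 * l - (3 * k + 2 * l)) div 3 = 0"
    "(2 * k + l - 2 * (k + 2 * l)) div 3 = 0" "(k + 2 * l - 2 * (2 * k + l)) div 3 = 0"
    "(2 * (2 * k + l) - (k + 2 * l)) div 3 = k" "(2 * (k + 2 * l) - (2 * k + l)) div 3 = l"
    "(0 - m) div 3 = (0 :: nat)"
    "min l (2 * k + l) = l" "min (3 * k + 2 * l) 0 = (0::nat)" "min (k + 2 * l) k = k" "min (2 * k + l) l = l"
  by (presburger | simp)+

lemma exps_inv9: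
  assumes "x = 0 \<or> y = 0 \<or> z = 0" "3 dvd x + y + z"
  shows "exps1 (inv9 x y z) = x \<and> exps2 (inv9 x y z) = y \<and> exps3 (inv9 x y z) = z \<and> face9 (inv9 x y z)"
proof -
  note simps = inv9_def exps1_def exps2_def exps3_def face9_def inv9_arith mult_0_right add_0_left add_0_right
    min_0L min_0R if_cancel if_True refl mult_0 diff_0_eq_0 div_0 zero_neq_one
  consider "z = 0" "3 dvd x + y" | "x = 0" "3 dvd y + z" | "y = 0" "3 dvd x + z" using assms by auto
  thus ?thesis
  proof cases
    case 1
    show ?thesis using two_exponents[OF 1(2)] 1(1) by (elim exE disjE conjE) (simp_all add: simps)
  next
    case 2
    show ?thesis using two_exponents[OF 2(2)] 2(1) by (elim exE disjE conjE) (simp_all add: simps)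
  next
    case 3
    show ?thesis using two_exponents[OF 3(2)] 3(1) by (elim exE disjE conjE) (simp_all add: simps)
  qed
qed

lemma inv9_0: "inv9 0 0 0 j = 0" by (simp add: inv9_def)

section \<open>Tuples subject to the face condition, and triples of ideals\<close>

context norm_system
begin

definition sig :: "'p multiset list \<Rightarrow> 'p \<Rightarrow> nat set" where "sig ns p = {j. j < 9 \<and> p \<in># ns ! j}"
definition cop :: "'p multiset list \<Rightarrow> bool" where "cop ns \<longleftrightarrow> (\<forall>p. sig ns p \<in> Face)"
definition supp :: "'p multiset list \<Rightarrow> 'p set" where "supp ns = (\<Union>m\<in>set ns. set_mset m)"

definition ddiv :: "'p multiset list \<Rightarrow> ('p \<Rightarrow> nat set) set" where "ddiv ns = {d. \<forall>p. d p \<subseteq> sig ns p}"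

lemma finite_supp: "finite (supp ns)" by (simp add: supp_def)

lemma sig_supp: "length ns = 9 \<Longrightarrow> p \<notin> supp ns \<Longrightarrow> sig ns p = {}"
  by (auto simp: sig_def supp_def)

lemma ddiv_DF: "length ns = 9 \<Longrightarrow> ddiv ns = DF (supp ns) (\<lambda>p. Pow (sig ns p))"
  using sig_supp[of ns] unfolding ddiv_def DF_def by (auto split: if_splits)

lemma finite_ddiv: "length ns = 9 \<Longrightarrow> finite (ddiv ns)"
  unfolding ddiv_DF by (rule finite_DF) (auto simp: finite_supp sig_def)

lemma ddiv_DD:
  assumes "length ns = 9" "set ns \<subseteq> II" shows "ddiv ns \<subseteq> DD"
proof
  fix d assume d: "d \<in> ddiv ns"
  have s: "{p. d p \<noteq> {}} \<subseteq> supp ns" using d unfolding ddiv_DF[OF assms(1)] by (rule DF_supp)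
  moreover have "supp ns \<subseteq> P" using assms by (auto simp: supp_def II_def)
  ultimately show "d \<in> DD" using finite_subset[OF s finite_supp] d by (auto simp: DD_def ddiv_def sig_def)
qed

text \<open>Both sides factor over the primes that divide the tuple, and at each prime this is
  Moebius inversion on the subsets of \<open>sig ns p\<close>.\<close>

lemma sum_mu_ddiv:
  assumes "length ns = 9" shows "(\<Sum>d\<in>ddiv ns. mu d) = of_bool (cop ns)"
proof -
  have "(\<Sum>d\<in>ddiv ns. mu d) = (\<Sum>d\<in>DF (supp ns) (\<lambda>p. Pow (sig ns p)). \<Prod>p\<in>supp ns. mob Face (d p))"
    unfolding ddiv_DF[OF assms] by (rule sum.cong) (auto intro!: mu_superset finite_supp dest: DF_supp)
  also have "\<dots> = (\<Prod>p\<in>supp ns. \<Sum>S\<in>Pow (sig ns p). mob Face S)"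
    by (rule sum_DF_prod[OF finite_supp])
  also have "\<dots> = (\<Prod>p\<in>supp ns. of_bool (sig ns p \<in> Face))"
    by (intro prod.cong refl mob_sum) (auto simp: sig_def)
  also have "\<dots> = of_bool (\<forall>p\<in>supp ns. sig ns p \<in> Face)"
    using finite_supp[of ns] by (induction rule: finite_induct) auto
  also have "(\<forall>p\<in>supp ns. sig ns p \<in> Face) \<longleftrightarrow> cop ns"
    using sig_supp[OF assms] unfolding cop_def by (metis Face_0)
  finally show ?thesis .
qed

definition dl :: "('p \<Rightarrow> nat set) \<Rightarrow> 'p multiset list" where
  "dl d = map (\<lambda>j. mset_set {p. j \<in> d p}) [0..<9]"

lemma finite_level: "d \<in> DD \<Longrightarrow> finite {p. j \<in> d p}"
  by (rule finite_subset[of _ "{p. d p \<noteq> {}}"]) (auto simp: DD_def)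

lemma dl_II: "d \<in> DD \<Longrightarrow> set (dl d) \<subseteq> II"
  using finite_level[of d] by (auto simp: dl_def II_def DD_def)

lemma lnn_mset_set: "finite A \<Longrightarrow> A \<subseteq> P \<Longrightarrow> lnn (mset_set A) = (\<Sum>p\<in>A. ln (N p))"
proof (induction A rule: finite_induct)
  case (insert p A)
  have "{#p#} \<in> II" "mset_set A \<in> II" using insert by (auto simp: II_def)
  from lnn_add[OF this] show ?case using insert by (simp add: lnn_def)
qed (simp add: lnn_def)

text \<open>The sum over indices is exchanged with the sum over primes, where
  \<open>ln (N p)\<close> occurs \<open>card (d p)\<close> times. The factor 3 is the coordinate sum
  of each of the nine vectors.\<close>

lemma dot_dl:
  assumes d: "d \<in> DD"
  shows "dot V1 (map lnn (dl d)) + dot V2 (map lnn (dl d)) + dot V3 (map lnn (dl d)) = 3 * ln (nd d)"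
proof -
  define F where "F = {p. d p \<noteq> {}}"
  have F: "finite F" "F \<subseteq> P" using d by (auto simp: DD_def F_def)
  have "sum_list (map lnn (dl d)) = (\<Sum>j<9. lnn (mset_set {p. j \<in> d p}))"
    by (simp add: dl_def comp_def interv_sum_list_conv_sum_set_nat atLeast0LessThan)
  also have "\<dots> = (\<Sum>j<9. \<Sum>p\<in>{p\<in>F. j \<in> d p}. ln (N p))"
  proof (rule sum.cong[OF refl])
    fix j :: nat
    have "{p. j \<in> d p} = {p\<in>F. j \<in> d p}" by (auto simp: F_def)
    thus "lnn (mset_set {p. j \<in> d p}) = (\<Sum>p\<in>{p\<in>F. j \<in> d p}. ln (N p))"
      using F by (simp add: lnn_mset_set subset_iff)
  qed
  also have "\<dots> = (\<Sum>p\<in>F. \<Sum>j\<in>{j\<in>{..<9}. j \<in> d p}. ln (N p))"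
    by (rule sum.swap_restrict) (use F in auto)
  also have "\<dots> = (\<Sum>p\<in>F. card (d p) * ln (N p))"
  proof (rule sum.cong[OF refl])
    fix p
    have "{j\<in>{..<9}. j \<in> d p} = d p" using d by (auto simp: DD_def)
    thus "(\<Sum>j\<in>{j\<in>{..<9}. j \<in> d p}. ln (N p)) = card (d p) * ln (N p)" by simp
  qed
  also have "\<dots> = ln (nd d)"
  proof -
    have "real (N p) > 0" if "p \<in> F" for p using N_ge[of p] that F by fastforce
    thus ?thesis unfolding nd_superset[OF F(1), of d, unfolded F_def, OF order_refl, folded F_def]
      using F by (subst ln_prod) (auto simp: ln_realpow)
  qed
  finally show ?thesis using dot_V_sum[of "map lnn (dl d)"] by (simp add: dl_def)
qed

lemma dot_dl_nonneg:
  assumes d: "d \<in> DD"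
  shows "dot V1 (map lnn (dl d)) \<ge> 0" "dot V2 (map lnn (dl d)) \<ge> 0" "dot V3 (map lnn (dl d)) \<ge> 0"
  by (rule dot_nonneg; use dl_II[OF d] lnn_nonneg V_nonneg in auto)+

lemma map_lnn_add:
  "length ns = length ms \<Longrightarrow> set ns \<subseteq> II \<Longrightarrow> set ms \<subseteq> II \<Longrightarrow> map lnn (map2 (+) ns ms) = map2 (+) (map lnn ns) (map lnn ms)"
  by (induction ns ms rule: list_induct2) (auto simp: lnn_add)

lemma map2_add_II: "length ns = length ms \<Longrightarrow> set (map2 (+) ns ms) \<subseteq> II \<longleftrightarrow> set ns \<subseteq> II \<and> set ms \<subseteq> II"
  by (induction ns ms rule: list_induct2) auto

text \<open>Multiplication by \<open>dl d\<close> is a bijection onto the tuples divisible by d; it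
  raises each of the three logarithmic sizes by a fixed amount.\<close>

lemma card_RR_div:
  assumes d: "d \<in> DD"
  shows "card {ns \<in> RR c1 c2 c3. d \<in> ddiv ns} =
    card (RR (c1 - dot V1 (map lnn (dl d))) (c2 - dot V2 (map lnn (dl d))) (c3 - dot V3 (map lnn (dl d))))"
proof -
  have len: "length (dl d) = 9" by (simp add: dl_def)
  let ?R = "RR (c1 - dot V1 (map lnn (dl d))) (c2 - dot V2 (map lnn (dl d))) (c3 - dot V3 (map lnn (dl d)))"
  have mem: "map2 (+) (dl d) ns \<in> RR c1 c2 c3 \<longleftrightarrow> ns \<in> ?R" if "length ns = 9" for ns
  proof (cases "set ns \<subseteq> II")
    case True
    have "dot V (map lnn (map2 (+) (dl d) ns)) = dot V (map lnn (dl d)) + dot V (map lnn ns)" for V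
      by (subst map_lnn_add) (use True that len dl_II[OF d] in \<open>auto simp: dot_add\<close>)
    thus ?thesis using map2_add_II[of "dl d" ns] True that len dl_II[OF d] by (auto simp: RR_def algebra_simps)
  next
    case False
    thus ?thesis using map2_add_II[of "dl d" ns] that len by (auto simp: RR_def)
  qed
  have "bij_betw (\<lambda>ns. map2 (+) (dl d) ns) ?R {ns \<in> RR c1 c2 c3. d \<in> ddiv ns}"
  proof (rule bij_betw_byWitness[of _ "\<lambda>ns. map2 (-) ns (dl d)"])
    have sub1: "map2 (-) (map2 (+) ds ns) ds = ns" if "length ds = length ns" for ds ns :: "'p multiset list"
      using that by (induction ds ns rule: list_induct2) auto
    show "\<forall>ns\<in>?R. map2 (-) (map2 (+) (dl d) ns) (dl d) = ns"
      using len by (auto simp: RR_def intro!: sub1)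
    have bk: "map2 (+) (dl d) (map2 (-) ns (dl d)) = ns" if ns: "length ns = 9" "d \<in> ddiv ns" for ns
    proof (rule nth_equalityI)
      fix j assume "j < length (map2 (+) (dl d) (map2 (-) ns (dl d)))"
      hence j: "j < 9" using len ns by simp
      have "mset_set {p. j \<in> d p} \<subseteq># ns ! j"
      proof (rule mset_subset_eqI)
        fix p
        have "p \<in># ns ! j" if "j \<in> d p" using that ns by (auto simp: ddiv_def sig_def)
        thus "count (mset_set {p. j \<in> d p}) p \<le> count (ns ! j) p"
          using finite_level[OF d, of j] by (cases "j \<in> d p") (auto simp: Suc_le_eq)
      qed
      thus "map2 (+) (dl d) (map2 (-) ns (dl d)) ! j = ns ! j"
        using j len ns by (simp add: dl_def)
    qed (use len ns in simp)
    show "\<forall>ns\<in>{ns \<in> RR c1 c2 c3. d \<in> ddiv ns}. map2 (+) (dl d) (map2 (-) ns (dl d)) = ns"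
      using bk by (auto simp: RR_def)
    show "(\<lambda>ns. map2 (+) (dl d) ns) ` ?R \<subseteq> {ns \<in> RR c1 c2 c3. d \<in> ddiv ns}"
    proof clarify
      fix ns assume ns: "ns \<in> ?R"
      hence l: "length ns = 9" by (simp add: RR_def)
      have "d \<in> ddiv (map2 (+) (dl d) ns)"
        unfolding ddiv_def sig_def
      proof (intro CollectI allI subsetI)
        fix p j assume j: "j \<in> d p"
        hence "j < 9" using d by (auto simp: DD_def)
        thus "j < 9 \<and> p \<in># map2 (+) (dl d) ns ! j"
          using l j finite_level[OF d, of j] by (simp add: dl_def)
      qed
      thus "map2 (+) (dl d) ns \<in> RR c1 c2 c3 \<and> d \<in> ddiv (map2 (+) (dl d) ns)" using mem[OF l] ns by simp
    qed
    show "(\<lambda>ns. map2 (-) ns (dl d)) ` {ns \<in> RR c1 c2 c3. d \<in> ddiv ns} \<subseteq> ?R"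
    proof clarify
      fix ns assume ns: "ns \<in> RR c1 c2 c3" "d \<in> ddiv ns"
      hence l: "length ns = 9" by (simp add: RR_def)
      have "length (map2 (-) ns (dl d)) = 9" using l len by simp
      from mem[OF this] show "map2 (-) ns (dl d) \<in> ?R" using bk[OF l ns(2)] ns(1) by simp
    qed
  qed
  thus ?thesis by (simp add: bij_betw_same_card)
qed

definition Kmu :: real where "Kmu = infsum (\<lambda>d. \<bar>mu d\<bar> * (1 + 3 * ln (nd d)) / nd d) DD"

text \<open>Only finitely many divisors divide some tuple, so the inversion and the exchange of sums
  are finite. The comparison with the main term nevertheless runs over all of \<open>DD\<close>: for
  the other divisors the count is 0, and the same uniform estimate bounds the tail of the
  series.\<close>

theorem card_cop_asymp:
  assumes L: "L > 0"
  shows "\<bar>real (card {ns \<in> RR L L L. cop ns}) - exp L * Cmain * L ^ 6 * singular_series\<bar> \<le>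
    exp L * Cerr * (1 + L) ^ 5 * Kmu"
proof -
  define R where "R = RR L L L"
  define t where "t = (\<lambda>d. real (card {ns \<in> R. d \<in> ddiv ns}))"
  define DB where "DB = (\<Union>ns\<in>R. ddiv ns)"
  have finR: "finite R" by (simp add: R_def finite_RR)
  have DB: "finite DB" "DB \<subseteq> DD"
    unfolding DB_def using finR finite_ddiv ddiv_DD by (auto simp: R_def RR_def)
  have "real (card {ns \<in> R. cop ns}) = (\<Sum>ns\<in>R. of_bool (cop ns))"
    using finR by (simp add: Int_def sum_of_bool_eq)
  also have "\<dots> = (\<Sum>ns\<in>R. \<Sum>d\<in>{d\<in>DB. d \<in> ddiv ns}. mu d)"
  proof (rule sum.cong[OF refl])
    fix ns assume ns: "ns \<in> R"
    have "{d\<in>DB. d \<in> ddiv ns} = ddiv ns" using ns by (auto simp: DB_def)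
    thus "of_bool (cop ns) = (\<Sum>d\<in>{d\<in>DB. d \<in> ddiv ns}. mu d)"
      using sum_mu_ddiv[of ns] ns by (simp add: R_def RR_def)
  qed
  also have "\<dots> = (\<Sum>d\<in>DB. \<Sum>ns\<in>{ns\<in>R. d \<in> ddiv ns}. mu d)"
    by (rule sum.swap_restrict[OF finR DB(1)])
  also have "\<dots> = (\<Sum>d\<in>DB. mu d * t d)" by (simp add: t_def mult.commute)
  finally have M: "real (card {ns \<in> R. cop ns}) = (\<Sum>d\<in>DB. mu d * t d)" .
  have "((\<lambda>d. mu d * t d) has_sum real (card {ns \<in> R. cop ns})) DB"
    unfolding M by (rule has_sum_finite[OF DB(1)])
  hence h1: "((\<lambda>d. mu d * t d) has_sum real (card {ns \<in> R. cop ns})) DD"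
  proof (rule has_sum_cong_neutral[THEN iffD1, rotated -1])
    fix d assume "d \<in> DD - DB"
    hence e: "{ns \<in> R. d \<in> ddiv ns} = {}" by (auto simp: DB_def)
    show "mu d * t d = 0" unfolding t_def e by simp
  qed (use DB in auto)
  define E where "E = exp L * Cmain * L ^ 6"
  have h2: "((\<lambda>d. - E * (mu d / nd d)) has_sum (- E * singular_series)) DD"
    by (rule has_sum_cmult_right[OF singular_series_has_sum])
  define f where "f = (\<lambda>d. mu d * t d + - E * (mu d / nd d))"
  have h3: "(f has_sum (real (card {ns \<in> R. cop ns}) + - E * singular_series)) DD"
    unfolding f_def by (rule has_sum_add[OF h1 h2])
  define G where "G = (\<lambda>d. exp L * Cerr * (1 + L) ^ 5 * (\<bar>mu d\<bar> * (1 + 3 * ln (nd d)) / nd d))"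
  have h4: "(G has_sum (exp L * Cerr * (1 + L) ^ 5 * Kmu)) DD"
    unfolding G_def Kmu_def by (intro has_sum_cmult_right has_sum_infsum mu_nd_summable(1))
  have fG: "\<bar>f d\<bar> \<le> G d" if d: "d \<in> DD" for d
  proof -
    have nd: "nd d \<ge> 1" using nd_ge1[OF d] .
    define d1 d2 d3 where "d1 = dot V1 (map lnn (dl d))" and "d2 = dot V2 (map lnn (dl d))" and "d3 = dot V3 (map lnn (dl d))"
    have s: "d1 + d2 + d3 = 3 * ln (nd d)" using dot_dl[OF d] by (simp add: d1_def d2_def d3_def)
    have e: "exp (L - (d1 + d2 + d3) / 3) = exp L / nd d" unfolding s using nd by (simp add: exp_diff)
    have "t d = real (card (RR (L - d1) (L - d2) (L - d3)))"
      unfolding t_def R_def card_RR_div[OF d] d1_def d2_def d3_def ..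
    hence "\<bar>t d - exp L / nd d * Cmain * L ^ 6\<bar> \<le> exp L / nd d * (Cerr * (1 + L) ^ 5 * (1 + 3 * ln (nd d)))"
      using card_RR_asymp[of d1 d2 d3 L] dot_dl_nonneg[OF d] L unfolding e unfolding s by (simp add: d1_def d2_def d3_def)
    hence "\<bar>mu d\<bar> * \<bar>t d - exp L / nd d * Cmain * L ^ 6\<bar> \<le> \<bar>mu d\<bar> * (exp L / nd d * (Cerr * (1 + L) ^ 5 * (1 + 3 * ln (nd d))))"
      by (rule mult_left_mono) simp
    moreover have "f d = mu d * (t d - exp L / nd d * Cmain * L ^ 6)"
      by (simp add: f_def E_def algebra_simps)
    ultimately show ?thesis by (simp add: abs_mult G_def mult_ac)
  qed
  have "real (card {ns \<in> R. cop ns}) + - E * singular_series \<le> exp L * Cerr * (1 + L) ^ 5 * Kmu"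
    by (rule has_sum_mono[OF h3 h4]) (use fG in \<open>auto simp: abs_le_iff\<close>)
  moreover have "- (exp L * Cerr * (1 + L) ^ 5 * Kmu) \<le> real (card {ns \<in> R. cop ns}) + - E * singular_series"
    by (rule has_sum_mono[OF has_sum_uminusI[OF h4] h3]) (use fG in \<open>force simp: abs_le_iff\<close>)
  ultimately show ?thesis by (simp add: R_def E_def abs_le_iff)
qed

text \<open>The triples of ideals generated by coprime coordinates x1, x2, x3 whose product is a
  cube, in terms of the exponents at each prime.\<close>

definition TR :: "real \<Rightarrow> ('p multiset \<times> 'p multiset \<times> 'p multiset) set" where
  "TR L = {(a, b, c). a \<in> II \<and> b \<in> II \<and> c \<in> II \<and> lnn a \<le> L \<and> lnn b \<le> L \<and> lnn c \<le> L \<and>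
     (\<forall>p. count a p = 0 \<or> count b p = 0 \<or> count c p = 0) \<and> (\<forall>p. 3 dvd count a p + count b p + count c p)}"

definition cmb :: "'p multiset list \<Rightarrow> 'p multiset \<times> 'p multiset \<times> 'p multiset" where
  "cmb ns = (repeat_mset 3 (ns ! 0) + repeat_mset 2 (ns ! 3) + ns ! 4 + ns ! 7 + repeat_mset 2 (ns ! 8),
             repeat_mset 3 (ns ! 1) + ns ! 3 + repeat_mset 2 (ns ! 4) + repeat_mset 2 (ns ! 5) + ns ! 6,
             repeat_mset 3 (ns ! 2) + ns ! 5 + repeat_mset 2 (ns ! 6) + repeat_mset 2 (ns ! 7) + ns ! 8)"

definition icmb :: "'p multiset \<times> 'p multiset \<times> 'p multiset \<Rightarrow> 'p multiset list" where
  "icmb = (\<lambda>(a, b, c). map (\<lambda>j. Abs_multiset (\<lambda>p. inv9 (count a p) (count b p) (count c p) j)) [0..<9])"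

lemma count_icmb:
  assumes "j < 9" shows "count (icmb (a, b, c) ! j) p = inv9 (count a p) (count b p) (count c p) j"
proof -
  \<comment> \<open>Where a, b and c all have exponent 0, the nine exponents are 0 too; so the
    support is finite and \<open>Abs_multiset\<close> returns the intended multiset.\<close>
  have "{p. inv9 (count a p) (count b p) (count c p) j > 0} \<subseteq> set_mset (a + b + c)"
    using inv9_0[of j] by (auto simp: not_in_iff) (metis neq0_conv not_in_iff)
  hence "finite {p. inv9 (count a p) (count b p) (count c p) j > 0}"
    by (rule finite_subset) simp
  thus ?thesis using assms by (simp add: icmb_def count_Abs_multiset)
qed

lemma lnn_repeat: "m \<in> II \<Longrightarrow> lnn (repeat_mset k m) = k * lnn m"
  using nrm_pos by (simp add: lnn_def nrm_repeat_mset ln_realpow)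

lemma repeat_II: "k > 0 \<Longrightarrow> repeat_mset k m \<in> II \<longleftrightarrow> m \<in> II"
proof -
  assume k: "k > 0"
  have "x \<in># repeat_mset k m \<longleftrightarrow> x \<in># m" for x
    using k by (simp flip: count_greater_zero_iff)
  thus ?thesis by (auto simp: II_def)
qed

lemma cmb_II: "length ns = 9 \<Longrightarrow> cmb ns = (a, b, c) \<Longrightarrow> a \<in> II \<and> b \<in> II \<and> c \<in> II \<longleftrightarrow> set ns \<subseteq> II"
  unfolding length_9 by (auto simp: cmb_def repeat_II)

lemma lnn_cmb:
  assumes "length ns = 9" "set ns \<subseteq> II" "cmb ns = (a, b, c)"
  shows "lnn a = dot V1 (map lnn ns)" "lnn b = dot V2 (map lnn ns)" "lnn c = dot V3 (map lnn ns)"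
  using assms unfolding length_9
  by (auto simp: cmb_def lnn_add lnn_repeat repeat_II V1_def V2_def V3_def W1_def W2_def W3_def)

lemma cop_face9: "cop ns \<longleftrightarrow> (\<forall>p. face9 (\<lambda>j. count (ns ! j) p))"
  by (simp add: cop_def sig_def Face_face9[symmetric] count_greater_zero_iff)

text \<open>The correspondence works prime by prime: \<open>cmb\<close> forms the monomials with the
  nine vectors as exponents, and \<open>icmb\<close> recovers the nine exponents from the cone that
  contains the local exponent vector.\<close>

lemma card_TR: "card (TR L) = card {ns \<in> RR L L L. cop ns}"
proof -
  have cnt: "count a p = exps1 (\<lambda>j. count (ns ! j) p) \<and> count b p = exps2 (\<lambda>j. count (ns ! j) p) \<and>
     count c p = exps3 (\<lambda>j. count (ns ! j) p)" if "cmb ns = (a, b, c)" for ns a b c p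
    using that by (auto simp: cmb_def exps1_def exps2_def exps3_def)
  have inv1: "icmb (cmb ns) = ns" if ns: "length ns = 9" "cop ns" for ns
  proof -
    obtain a b c where abc: "cmb ns = (a, b, c)" by (cases "cmb ns") auto
    show ?thesis
    proof (rule nth_equalityI)
      fix j assume "j < length (icmb (cmb ns))"
      hence j: "j < 9" by (simp add: abc icmb_def)
      show "icmb (cmb ns) ! j = ns ! j"
      proof (rule multiset_eqI)
        fix p
        have "face9 (\<lambda>j. count (ns ! j) p)" using ns by (simp add: cop_face9)
        from inv9_exps[OF this j] show "count (icmb (cmb ns) ! j) p = count (ns ! j) p"
          unfolding abc count_icmb[OF j] using cnt[OF abc, of p] by simp
      qed
    qed (simp add: abc icmb_def ns)
  qed
  have loc: "exps1 (\<lambda>j. count (icmb (a, b, c) ! j) p) = count a p" "exps2 (\<lambda>j. count (icmb (a, b, c) ! j) p) = count b p"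
      "exps3 (\<lambda>j. count (icmb (a, b, c) ! j) p) = count c p" "face9 (\<lambda>j. count (icmb (a, b, c) ! j) p)"
    if "count a p = 0 \<or> count b p = 0 \<or> count c p = 0" "3 dvd count a p + count b p + count c p" for a b c p
    using exps_inv9[OF that] by (simp_all add: exps1_def exps2_def exps3_def face9_def count_icmb)
  have "bij_betw cmb {ns \<in> RR L L L. cop ns} (TR L)"
  proof (rule bij_betw_byWitness[of _ icmb])
    show "\<forall>ns\<in>{ns \<in> RR L L L. cop ns}. icmb (cmb ns) = ns" using inv1 by (simp add: RR_def)
    have inv2: "cmb (icmb (a, b, c)) = (a, b, c)" if "(a, b, c) \<in> TR L" for a b c
    proof -
      obtain a' b' c' where abc: "cmb (icmb (a, b, c)) = (a', b', c')" by (cases "cmb (icmb (a, b, c))") auto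
      have "count a' p = count a p \<and> count b' p = count b p \<and> count c' p = count c p" for p
        using cnt[OF abc, of p] loc[of a p b c] that by (simp add: TR_def)
      thus ?thesis unfolding abc by (simp add: multiset_eq_iff)
    qed
    thus "\<forall>x\<in>TR L. cmb (icmb x) = x" by auto
    show "cmb ` {ns \<in> RR L L L. cop ns} \<subseteq> TR L"
    proof (rule image_subsetI)
      fix ns assume "ns \<in> {ns \<in> RR L L L. cop ns}"
      hence ns: "ns \<in> RR L L L" "cop ns" by auto
      obtain a b c where abc: "cmb ns = (a, b, c)" by (cases "cmb ns") auto
      have l: "length ns = 9" "set ns \<subseteq> II" using ns by (auto simp: RR_def)
      have "count a p = 0 \<or> count b p = 0 \<or> count c p = 0" "3 dvd count a p + count b p + count c p" for p
      proof -
        have "face9 (\<lambda>j. count (ns ! j) p)" using ns by (simp add: cop_face9)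
        thus "count a p = 0 \<or> count b p = 0 \<or> count c p = 0"
          using cnt[OF abc, of p] by (auto simp: face9_def exps1_def exps2_def exps3_def)
        have "count a p + count b p + count c p = 3 * (\<Sum>j<9. count (ns ! j) p)"
          using cnt[OF abc, of p] by (simp add: exps1_def exps2_def exps3_def eval_nat_numeral lessThan_Suc)
        thus "3 dvd count a p + count b p + count c p" by simp
      qed
      thus "cmb ns \<in> TR L"
        using cmb_II[OF l(1) abc] l lnn_cmb[OF l abc] ns(1) by (simp add: abc TR_def RR_def)
    qed
    show "icmb ` TR L \<subseteq> {ns \<in> RR L L L. cop ns}"
    proof (rule image_subsetI)
      fix x assume x: "x \<in> TR L"
      obtain a b c where e: "x = (a, b, c)" by (cases x) auto
      note abc = x[unfolded e]
      have l: "length (icmb (a, b, c)) = 9" by (simp add: icmb_def)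
      have s: "set (icmb (a, b, c)) \<subseteq> II" using cmb_II[OF l inv2[OF abc]] abc by (simp add: TR_def)
      have "cop (icmb (a, b, c))" unfolding cop_face9 using loc(4) abc by (simp add: TR_def)
      thus "icmb x \<in> {ns \<in> RR L L L. cop ns}"
        using l s lnn_cmb[OF l s inv2[OF abc]] abc by (simp add: RR_def TR_def e)
    qed
  qed
  thus ?thesis by (simp add: bij_betw_same_card)
qed

end

section \<open>Coordinates in an imaginary quadratic field\<close>

lemma field_embedding_simps:
  assumes "field_embedding (f :: 'a::field_char_0 \<Rightarrow> 'b::field_char_0)"
  shows "f 0 = 0" "f 1 = 1" "f (x + y) = f x + f y" "f (x * y) = f x * f y" "f (- x) = - f x" "f (x - y) = f x - f y"
    "f (of_nat n) = of_nat n" "f (of_int k) = of_int k" "f (of_rat q) = of_rat q"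
proof -
  note d = assms[unfolded field_embedding_def]
  show 1: "f 1 = 1" and add: "f (x + y) = f x + f y" and mult: "f (x * y) = f x * f y" for x y using d by auto
  have "f (0 + 0) = f 0 + f 0" using d by blast
  thus 0: "f 0 = 0" by simp
  have "f (x + (- x)) = f x + f (- x)" for x using d by blast
  thus neg: "f (- x) = - f x" for x using 0 by (simp add: eq_neg_iff_add_eq_0 add.commute)
  show "f (x - y) = f x - f y" using add[of x "- y"] neg by simp
  show nat: "f (of_nat n) = of_nat n" for n by (induction n) (auto simp: 0 1 add)
  show int: "f (of_int k) = of_int k" for k by (cases k) (auto simp: nat neg 1 add simp del: of_nat_Suc)
  obtain a b where q: "q = Fract a b" "b > 0" by (cases q) auto
  have "of_rat q * (of_int b :: 'a) = of_int a" using q by (simp add: of_rat_rat)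
  hence "f (of_rat q) * of_int b = of_int a" using mult int by metis
  thus "f (of_rat q) = of_rat q" using q by (simp add: of_rat_rat field_simps)
qed

text \<open>The field is described by coordinates with respect to 1 and a square root of an integer,
  so that its arithmetic reduces to pairs of rationals.\<close>

locale quad0 =
  fixes \<delta> :: "'k::field_char_0" and D :: int
  assumes dsq: "\<delta> * \<delta> = of_int D" and irr: "\<And>q. \<delta> \<noteq> of_rat q"
    and gen: "\<And>x::'k. \<exists>a b. x = of_rat a + of_rat b * \<delta>"
begin

lemma coord_unique:
  assumes "of_rat a + of_rat b * \<delta> = of_rat a' + of_rat b' * \<delta>" shows "a = a'" "b = b'"
proof -
  have "of_rat (b - b') * \<delta> = of_rat (a' - a)" using assms by (simp add: of_rat_diff algebra_simps)
  hence "b - b' \<noteq> 0 \<Longrightarrow> \<delta> = of_rat ((a' - a) / (b - b'))" by (simp add: of_rat_divide field_simps)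
  thus b: "b = b'" using irr by auto
  show "a = a'" using assms b by simp
qed

definition ra :: "'k \<Rightarrow> rat" where "ra x = (THE a. \<exists>b. x = of_rat a + of_rat b * \<delta>)"
definition rb :: "'k \<Rightarrow> rat" where "rb x = (THE b. \<exists>a. x = of_rat a + of_rat b * \<delta>)"

lemma ra_eq: "ra (of_rat a + of_rat b * \<delta>) = a" and rb_eq: "rb (of_rat a + of_rat b * \<delta>) = b"
  unfolding ra_def rb_def by (rule the_equality; use coord_unique in blast)+

lemma coord: "x = of_rat (ra x) + of_rat (rb x) * \<delta>"
  using gen[of x] ra_eq rb_eq by metis

lemma coordI: "x = of_rat a + of_rat b * \<delta> \<Longrightarrow> ra x = a \<and> rb x = b"
  using ra_eq rb_eq by blast

lemma eq_iff: "x = y \<longleftrightarrow> ra x = ra y \<and> rb x = rb y"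
  using coord by metis

lemma ra_rb_add [simp]: "ra (x + y) = ra x + ra y" "rb (x + y) = rb x + rb y"
proof -
  have "x + y = of_rat (ra x + ra y) + of_rat (rb x + rb y) * \<delta>"
    by (subst (1) coord[of x], subst (1) coord[of y]) (simp add: of_rat_add algebra_simps)
  from coordI[OF this] show "ra (x + y) = ra x + ra y" "rb (x + y) = rb x + rb y" by auto
qed

lemma ra_rb_mult [simp]: "ra (x * y) = ra x * ra y + of_int D * rb x * rb y" "rb (x * y) = ra x * rb y + rb x * ra y"
proof -
  have d: "\<delta> * (\<delta> * z) = of_int D * z" for z by (simp add: dsq mult.assoc[symmetric])
  have "x * y = of_rat (ra x * ra y + of_int D * rb x * rb y) + of_rat (ra x * rb y + rb x * ra y) * \<delta>"
    by (subst (1) coord[of x], subst (1) coord[of y]) (simp add: of_rat_add of_rat_mult algebra_simps d dsq)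
  from coordI[OF this] show "ra (x * y) = ra x * ra y + of_int D * rb x * rb y" "rb (x * y) = ra x * rb y + rb x * ra y" by auto
qed

lemma ra_rb_of_rat [simp]: "ra (of_rat q) = q" "rb (of_rat q) = 0"
  using coordI[of "of_rat q" q 0] by auto
lemma ra_rb_delta [simp]: "ra \<delta> = 0" "rb \<delta> = 1" using coordI[of \<delta> 0 1] by auto
lemma ra_rb_of_int [simp]: "ra (of_int n) = of_int n" "rb (of_int n) = 0"
  using ra_rb_of_rat[of "of_int n"] by auto
lemma ra_rb_of_nat [simp]: "ra (of_nat n) = of_nat n" "rb (of_nat n) = 0"
  using ra_rb_of_rat[of "of_nat n"] by auto
lemma ra_rb_0 [simp]: "ra 0 = 0" "rb 0 = 0" using ra_rb_of_int[of 0] by auto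
lemma ra_rb_1 [simp]: "ra 1 = 1" "rb 1 = 0" using ra_rb_of_int[of 1] by auto
lemma ra_rb_minus [simp]: "ra (- x) = - ra x" "rb (- x) = - rb x"
  using ra_rb_add[of x "- x"] by auto
lemma ra_rb_diff [simp]: "ra (x - y) = ra x - ra y" "rb (x - y) = rb x - rb y"
  using ra_rb_add[of x "- y"] by auto

definition emb :: "'f::field_char_0 \<Rightarrow> 'k \<Rightarrow> 'f" where "emb s x = of_rat (ra x) + of_rat (rb x) * s"

lemma field_embedding_emb:
  assumes "s * s = of_int D" shows "field_embedding (emb s)"
proof -
  have d: "s * (s * z) = of_int D * z" for z by (simp add: assms mult.assoc[symmetric])
  show ?thesis unfolding field_embedding_def emb_def
    by (auto simp: of_rat_add of_rat_mult algebra_simps d assms)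
qed

text \<open>The image of \<delta> is a square root of D, and it determines the embedding.\<close>

lemma embedding_cases:
  fixes f :: "'k \<Rightarrow> 'f::field_char_0" assumes f: "field_embedding f" and s: "s * s = of_int D"
  shows "f = emb s \<or> f = emb (- s)"
proof -
  have "f \<delta> * f \<delta> = s * s" using field_embedding_simps[OF f] dsq s by metis
  hence c: "f \<delta> = s \<or> f \<delta> = - s" using square_eq_iff by blast
  have "f x = emb (f \<delta>) x" for x
    by (subst coord[of x]) (simp add: field_embedding_simps[OF f] emb_def)
  hence "f = emb (f \<delta>)" by (rule ext)
  thus ?thesis using c by metis
qed

definition kcnj :: "'k \<Rightarrow> 'k" where "kcnj x = of_rat (ra x) - of_rat (rb x) * \<delta>"

lemma ra_rb_kcnj [simp]: "ra (kcnj x) = ra x" "rb (kcnj x) = - rb x"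
  using coordI[of "kcnj x" "ra x" "- rb x"] by (auto simp: kcnj_def of_rat_minus)

lemma kcnj_simps [simp]: "kcnj (x + y) = kcnj x + kcnj y" "kcnj (x * y) = kcnj x * kcnj y" "kcnj (x - y) = kcnj x - kcnj y"
  "kcnj (kcnj x) = x" "kcnj (of_rat q) = of_rat q" "kcnj (of_int n) = of_int n" "kcnj 0 = 0" "kcnj 1 = 1" "kcnj (- x) = - kcnj x"
  by (simp_all add: eq_iff algebra_simps)

definition qn :: "'k \<Rightarrow> rat" where "qn x = ra x * ra x - of_int D * rb x * rb x"

lemma qn_kcnj: "of_rat (qn x) = x * kcnj x"
  by (simp add: eq_iff qn_def algebra_simps)

lemma qn_kcnj_eq [simp]: "qn (kcnj x) = qn x" by (simp add: qn_def)

lemma qn_mult: "qn (x * y) = qn x * qn y" by (simp add: qn_def algebra_simps)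

lemma qn_simps [simp]: "qn 0 = 0" "qn 1 = 1" "qn (of_rat q) = q * q" "qn (of_int n) = of_int n * of_int n" "qn (- x) = qn x"
  by (simp_all add: qn_def)

lemma quadratic_eq: "x * x = of_rat (2 * ra x) * x - of_rat (qn x)"
  by (simp add: eq_iff qn_def algebra_simps)

lemma trace_eq: "of_rat (2 * ra x) = x + kcnj x" by (simp add: eq_iff)

end

text \<open>The condition on squares says that D is squarefree; with \<open>D < 0\<close> this is
  the normal form of an imaginary quadratic field.\<close>

locale quad = quad0 \<delta> D for \<delta> :: "'k::field_char_0" and D +
  assumes Dneg: "D < 0" and sqf: "\<And>q::int. q * q dvd D \<Longrightarrow> q * q = 1"

lemma squarefree_factor:
  fixes E :: int assumes "E \<noteq> 0"
  obtains f D :: int where "f > 0" "E = f * f * D" "\<And>q. q * q dvd D \<Longrightarrow> q * q = 1"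
proof -
  define S where "S = {f::int. 0 < f \<and> f * f dvd E}"
  have sub: "S \<subseteq> {1..\<bar>E\<bar>}"
  proof
    fix f assume f: "f \<in> S"
    hence "f * f \<le> \<bar>E\<bar>" using assms zdvd_imp_le[of "f * f" "\<bar>E\<bar>"] by (auto simp: S_def)
    moreover have "f * 1 \<le> f * f" using f by (intro mult_left_mono) (auto simp: S_def)
    ultimately have "f \<le> \<bar>E\<bar>" by linarith
    thus "f \<in> {1..\<bar>E\<bar>}" using f by (auto simp: S_def)
  qed
  hence fin: "finite S" using finite_subset by blast
  have "1 \<in> S" by (simp add: S_def)
  define f where "f = Max S"
  have fS: "f \<in> S" unfolding f_def using fin \<open>1 \<in> S\<close> by (intro Max_in) auto
  then obtain D where D: "E = f * f * D" by (auto simp: S_def dvd_def)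
  have "q * q = 1" if q: "q * q dvd D" for q
  proof -
    have "q \<noteq> 0" using q D assms by auto
    have "(f * \<bar>q\<bar>) * (f * \<bar>q\<bar>) dvd E" unfolding D using q mult_dvd_mono[of "f * f" "f * f" "q * q" D]
      by (simp add: mult_ac abs_mult[symmetric])
    hence "f * \<bar>q\<bar> \<in> S" using fS \<open>q \<noteq> 0\<close> by (simp add: S_def)
    hence "f * \<bar>q\<bar> \<le> f * 1" unfolding f_def using fin by simp
    hence "\<bar>q\<bar> \<le> 1" using fS by (simp add: S_def)
    hence "\<bar>q\<bar> = 1" using \<open>q \<noteq> 0\<close> by linarith
    thus ?thesis using abs_mult_self_eq[of q] by simp
  qed
  thus ?thesis using that[of f D] D fS by (auto simp: S_def)
qed

text \<open>Some x outside the rationals generates the field; completing the square and clearing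
  denominators yields a square root of an integer, whose largest square factor is divided out. D
  cannot be nonnegative, since a real square root of D would give a real embedding.\<close>

lemma imaginary_quadratic_quad:
  fixes K :: "'k::field_char_0 itself" assumes "imaginary_quadratic K"
  obtains \<delta> :: 'k and D where "quad \<delta> D"
proof -
  interpret V: vector_space "\<lambda>(q::rat) (x::'k). of_rat q * x"
    by unfold_locales (auto simp: of_rat_add of_rat_mult algebra_simps)
  have dim: "V.dim (UNIV :: 'k set) = 2" and nore: "\<not> (\<exists>f :: 'k \<Rightarrow> real. field_embedding f)"
    using assms by (auto simp: imaginary_quadratic_def)
  obtain B where B: "V.independent B" "UNIV \<subseteq> V.span B" "card B = 2"
    using V.basis_exists[of UNIV] dim by metis
  then obtain u v where uv: "B = {u, v}" "u \<noteq> v" by (auto simp: card_2_iff)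
  have uspan: "u \<notin> V.span {v}" using B(1) uv by (metis V.independent_insert insertE insert_absorb singletonD)
  have v0: "v \<noteq> 0" using B(1) uv V.dependent_zero by blast
  have ex: "\<exists>a b. x = of_rat a * u + of_rat b * v" for x
  proof -
    have "x \<in> V.span {u, v}" using B(2) uv by auto
    then obtain a where "x - of_rat a * u \<in> V.span {v}" unfolding V.span_insert by auto
    then obtain b where "x - of_rat a * u = of_rat b * v" unfolding V.span_singleton by auto
    thus ?thesis by (intro exI[of _ a] exI[of _ b]) (simp add: algebra_simps)
  qed
  have "\<exists>x::'k. \<forall>q. x \<noteq> of_rat q"
  proof (rule ccontr)
    assume "\<not> ?thesis"
    then obtain r s where r: "u = of_rat r" "v = of_rat s" by metis
    hence "u = of_rat (r / s) * v" using v0 by (simp add: of_rat_divide)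
    thus False using uspan unfolding V.span_singleton by auto
  qed
  then obtain x :: 'k where x: "\<And>q. x \<noteq> of_rat q" by blast
  have genx: "\<exists>p q. y = of_rat p + of_rat q * x" for y
  proof -
    obtain a b where 1: "1 = of_rat a * u + of_rat b * v" using ex by blast
    obtain c d where 2: "x = of_rat c * u + of_rat d * v" using ex by blast
    \<comment> \<open>Determinant of the change from u, v to 1, x. It is nonzero because x is not
      rational, so u and v are combinations of 1 and x by Cramer's rule.\<close>
    define e where "e = a * d - b * c"
    have "of_rat d * (of_rat a * u + of_rat b * v) - of_rat b * (of_rat c * u + of_rat d * v) = of_rat e * u"
      by (simp add: e_def of_rat_diff of_rat_mult algebra_simps)
    hence U: "of_rat e * u = of_rat d - of_rat b * x" by (simp flip: 1 2)
    have "of_rat a * (of_rat c * u + of_rat d * v) - of_rat c * (of_rat a * u + of_rat b * v) = of_rat e * v"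
      by (simp add: e_def of_rat_diff of_rat_mult algebra_simps)
    hence W: "of_rat e * v = of_rat a * x - of_rat c" by (simp flip: 1 2)
    have e0: "e \<noteq> 0"
    proof
      assume e: "e = 0"
      have "b = 0" 
      proof (rule ccontr)
        assume "b \<noteq> 0"
        hence "x = of_rat (d / b)" using U e by (simp add: of_rat_divide field_simps)
        thus False using x by blast
      qed
      moreover have "a = 0"
      proof (rule ccontr)
        assume "a \<noteq> 0"
        hence "x = of_rat (c / a)" using W e by (simp add: of_rat_divide field_simps)
        thus False using x by blast
      qed
      ultimately show False using 1 by simp
    qed
    obtain p q where y: "y = of_rat p * u + of_rat q * v" using ex by blast
    have "of_rat e * y = of_rat p * (of_rat e * u) + of_rat q * (of_rat e * v)" by (simp add: y algebra_simps)
    also have "\<dots> = of_rat (p * d - q * c) + of_rat (q * a - p * b) * x"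
      unfolding U W by (simp add: of_rat_diff of_rat_mult algebra_simps)
    finally have "y = of_rat ((p * d - q * c) / e) + of_rat ((q * a - p * b) / e) * x"
      using e0 by (simp add: of_rat_divide field_simps)
    thus ?thesis by blast
  qed
  obtain p q where pq: "x * x = of_rat p + of_rat q * x" using genx by blast
  \<comment> \<open>The square of \<open>x - q / 2\<close> is r; multiplication by the denominator n
    of r makes the square the integer \<open>m * n\<close>.\<close>
  define r where "r = p + q * q / 4"
  obtain m n where mn: "r = Fract m n" "n > 0" by (cases r) auto
  define y where "y = of_int n * (x - of_rat (q / 2))"
  have yy: "y * y = of_int (m * n)"
  proof -
    have "(x - of_rat (q / 2)) * (x - of_rat (q / 2)) = of_rat r"
      by (simp add: r_def of_rat_add of_rat_mult of_rat_divide algebra_simps pq)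
    moreover have "of_int n * (of_rat r :: 'k) = of_int m" using mn by (simp add: of_rat_rat)
    moreover have "y * y = of_int n * (of_int n * ((x - of_rat (q / 2)) * (x - of_rat (q / 2))))"
      by (simp only: y_def mult_ac)
    ultimately show ?thesis by (simp only: of_int_mult mult.commute)
  qed
  have yirr: "y \<noteq> of_rat s" for s
  proof
    assume "y = of_rat s"
    hence "x = of_rat (s / of_int n + q / 2)" using mn by (simp add: y_def of_rat_add of_rat_divide of_rat_mult field_simps)
    thus False using x by blast
  qed
  have "m * n \<noteq> 0"
  proof
    assume "m * n = 0" hence "y * y = 0" unfolding yy by (simp only: of_int_0)
    hence "y = 0" by simp
    thus False using yirr[of 0] by simp
  qed
  then obtain f D where fD: "f > 0" "m * n = f * f * D" "\<And>q. q * q dvd D \<Longrightarrow> q * q = 1"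
    using squarefree_factor by metis
  define \<delta> where "\<delta> = y / of_int f"
  have q0: "quad0 \<delta> D"
  proof
    show "\<delta> * \<delta> = of_int D" using yy fD by (simp add: \<delta>_def field_simps)
    show "\<delta> \<noteq> of_rat s" for s
    proof
      assume "\<delta> = of_rat s"
      hence "y = of_rat (s * of_int f)" using fD by (simp add: \<delta>_def of_rat_mult field_simps)
      thus False using yirr by blast
    qed
    fix z
    obtain a b where z: "z = of_rat a + of_rat b * x" using genx by blast
    have "x = of_rat (of_int f / of_int n) * \<delta> + of_rat (q / 2)"
      using mn fD by (simp add: \<delta>_def y_def of_rat_divide)
    hence "z = of_rat (a + b * q / 2) + of_rat (b * of_int f / of_int n) * \<delta>"
      unfolding z by (simp add: of_rat_add of_rat_mult of_rat_divide algebra_simps)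
    thus "\<exists>a b. z = of_rat a + of_rat b * \<delta>" by blast
  qed
  have "D < 0"
  proof (rule ccontr)
    assume "\<not> D < 0"
    hence "sqrt (of_int D) * sqrt (of_int D) = (of_int D :: real)" by simp
    thus False using nore quad0.field_embedding_emb[OF q0] by blast
  qed
  hence "quad \<delta> D" using q0 fD(3) by (simp add: quad_def quad_axioms_def)
  thus ?thesis using that by blast
qed

text \<open>In lowest terms, the k-th power of the denominator divides n for every k; since
  \<open>2 ^ n > n\<close>, the denominator is 1.\<close>

lemma rat_int_of_bounded_denominators:
  fixes r :: rat and n :: nat
  assumes n: "n > 0" and int: "\<And>k. of_nat n * r ^ k \<in> \<int>" shows "r \<in> \<int>"
proof -
  obtain a b where r: "r = Fract a b" "b > 0" "coprime a b" by (cases r) auto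
  have dvd: "b ^ k dvd int n" for k
  proof -
    obtain z where z: "of_nat n * r ^ k = of_int z" using int[of k] by (auto elim: Ints_cases)
    have ab: "of_int a = r * of_int b" using r by (simp add: Fract_of_int_quotient)
    have "of_nat n * (of_int a :: rat) ^ k = of_int z * of_int b ^ k"
      unfolding ab power_mult_distrib z[symmetric] by simp
    hence "(of_int (int n * a ^ k) :: rat) = of_int (z * b ^ k)" by simp
    hence "int n * a ^ k = z * b ^ k" by (simp only: of_int_eq_iff)
    hence "b ^ k dvd int n * a ^ k" by simp
    moreover have "coprime (b ^ k) (a ^ k)" using r(3) by (simp add: coprime_commute)
    ultimately show ?thesis by (simp add: coprime_dvd_mult_left_iff)
  qed
  have "b = 1"
  proof (rule ccontr)
    assume "b \<noteq> 1"
    hence "b \<ge> 2" using r by linarith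
    hence "(2::int) ^ n \<le> b ^ n" by (intro power_mono) auto
    moreover have "b ^ n \<le> int n" using dvd[of n] n by (intro zdvd_imp_le) auto
    moreover have "int n < 2 ^ n" by (metis less_exp of_nat_less_iff of_nat_numeral of_nat_power)
    ultimately show False by linarith
  qed
  thus ?thesis using r by (simp add: Fract_of_int_quotient)
qed

section \<open>Algebraic integers characterised by trace and norm\<close>

context quad0
begin

text \<open>The order of elements with integral coordinates. It measures denominators before the
  ring of integers is determined.\<close>

definition MM :: "'k set" where "MM = {x. ra x \<in> \<int> \<and> rb x \<in> \<int>}"

lemma MM_closed: "x \<in> MM \<Longrightarrow> y \<in> MM \<Longrightarrow> x + y \<in> MM" "x \<in> MM \<Longrightarrow> y \<in> MM \<Longrightarrow> x * y \<in> MM"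
  "of_int n \<in> MM" "of_nat m \<in> MM" "x \<in> MM \<Longrightarrow> - x \<in> MM" "x \<in> MM \<Longrightarrow> kcnj x \<in> MM"
  by (auto simp: MM_def)

lemma MM_sum: "(\<And>i. i \<in> A \<Longrightarrow> f i \<in> MM) \<Longrightarrow> sum f A \<in> MM"
proof (induction A rule: infinite_finite_induct)
  case (insert x A) thus ?case by (simp add: MM_closed(1))
qed (simp_all add: MM_def)

lemma common_denominator: obtains n :: nat where "n > 0" "of_nat n * x \<in> MM"
proof -
  obtain a b where 1: "ra x = Fract a b" "b > 0" by (cases "ra x") auto
  obtain c d where 2: "rb x = Fract c d" "d > 0" by (cases "rb x") auto
  have n: "rat_of_nat (nat (b * d)) = of_int b * of_int d" using 1 2 by simp
  have "ra (of_nat (nat (b * d)) * x) = of_int (a * d)" "rb (of_nat (nat (b * d)) * x) = of_int (b * c)"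
    unfolding ra_rb_mult ra_rb_of_nat n using 1 2 by (simp_all add: Fract_of_int_quotient)
  hence "of_nat (nat (b * d)) * x \<in> MM" by (simp add: MM_def)
  thus ?thesis using that[of "nat (b * d)"] 1 2 by simp
qed

lemma common_denominator_finite:
  fixes f :: "nat \<Rightarrow> 'k" obtains N :: nat where "N > 0" "\<And>i. i < n \<Longrightarrow> of_nat N * f i \<in> MM"
proof -
  have "\<exists>N>0. \<forall>i<n. of_nat N * f i \<in> MM"
  proof (induction n)
    case (Suc n)
    then obtain N where N: "N > 0" "\<forall>i<n. of_nat N * f i \<in> MM" by blast
    obtain m where m: "m > 0" "of_nat m * f n \<in> MM" using common_denominator by blast
    have "of_nat (N * m) * f i \<in> MM" if "i < Suc n" for i
    proof (cases "i = n")
      case True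
      have "of_nat (N * m) * f i = of_nat N * (of_nat m * f n)" using True by simp
      thus ?thesis using MM_closed(2)[OF MM_closed(4)[of N] m(2)] by (simp only:)
    next
      case False
      have "of_nat (N * m) * f i = of_nat m * (of_nat N * f i)" by simp
      moreover have "of_nat N * f i \<in> MM" using N False that by simp
      ultimately show ?thesis using MM_closed(2)[OF MM_closed(4)[of m]] by (simp only:)
    qed
    thus ?case using N m by (intro exI[of _ "N * m"]) auto
  qed (auto intro: exI[of _ 1])
  thus ?thesis using that by blast
qed

text \<open>The monic equation expresses every power from the degree on by lower ones with integral
  coefficients, so a common denominator of the first few powers serves for all.\<close>

lemma algebraic_int_bounded_powers:
  assumes "algebraic_int (x :: 'k)" obtains N :: nat where "N > 0" "\<And>k. of_nat N * x ^ k \<in> MM"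
proof -
  obtain p where p: "Polynomial.coeff p (Polynomial.degree p) = 1" "\<forall>i. Polynomial.coeff p i \<in> \<int>" "poly p x = 0"
    using assms by (auto elim: algebraic_int.cases)
  define n where "n = Polynomial.degree p"
  obtain N where N: "N > 0" "\<And>i. i < n \<Longrightarrow> of_nat N * x ^ i \<in> MM"
    using common_denominator_finite[where f = "\<lambda>i. x ^ i"] by blast
  have xn: "x ^ n = - (\<Sum>i<n. Polynomial.coeff p i * x ^ i)"
  proof -
    have "0 = (\<Sum>i\<le>n. Polynomial.coeff p i * x ^ i)" using p(3) by (simp add: poly_altdef n_def)
    also have "\<dots> = (\<Sum>i<n. Polynomial.coeff p i * x ^ i) + x ^ n"
      using p(1) by (simp add: lessThan_Suc_atMost[symmetric] n_def)
    finally show ?thesis by (simp add: eq_neg_iff_add_eq_0 add.commute)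
  qed
  have "of_nat N * x ^ k \<in> MM" for k
  proof (induction k rule: less_induct)
    case (less k)
    show ?case
    proof (cases "k < n")
      case True thus ?thesis using N by blast
    next
      case False
      have "x ^ k = x ^ (k - n) * x ^ n" using False by (simp flip: power_add)
      also have "\<dots> = - (\<Sum>i<n. Polynomial.coeff p i * x ^ (k - n + i))"
        unfolding xn by (simp add: sum_distrib_left power_add mult_ac)
      finally have e: "of_nat N * x ^ k = - (\<Sum>i<n. Polynomial.coeff p i * (of_nat N * x ^ (k - n + i)))"
        by (simp add: sum_distrib_left mult_ac)
      moreover have "Polynomial.coeff p i * (of_nat N * x ^ (k - n + i)) \<in> MM" if "i < n" for i
      proof -
        obtain c where "Polynomial.coeff p i = of_int c" using p(2) Ints_cases by metis
        thus ?thesis using less[of "k - n + i"] that False MM_closed(2,3) by simp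
      qed
      ultimately show ?thesis unfolding e by (intro MM_closed(5) MM_sum) auto
    qed
  qed
  thus ?thesis using that N by blast
qed

lemma kcnj_power: "kcnj (x ^ k) = kcnj x ^ k" by (induction k) auto
lemma of_rat_power': "of_rat (r ^ k) = (of_rat r :: 'k) ^ k" by (rule of_rat_power)

text \<open>Powers of the norm and, by the binomial theorem, of the trace are integral combinations
  of products of powers of x and its conjugate. These have the common denominator
  \<open>N * N\<close>, so trace and norm are rationals all of whose powers have bounded
  denominators.\<close>

lemma algebraic_int_imp_trace_norm:
  assumes "algebraic_int (x :: 'k)" shows "2 * ra x \<in> \<int>" "qn x \<in> \<int>"
proof -
  obtain N where N: "N > 0" "\<And>k. of_nat N * x ^ k \<in> MM" using algebraic_int_bounded_powers[OF assms] by blast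
  have N': "of_nat N * kcnj x ^ k \<in> MM" for k
  proof -
    have "kcnj (of_nat N * x ^ k) = of_nat N * kcnj x ^ k"
      using kcnj_simps(6)[of "int N"] by (simp add: kcnj_power)
    thus ?thesis using MM_closed(6)[OF N(2)[of k]] by simp
  qed
  have rat: "of_rat r \<in> MM \<Longrightarrow> r \<in> \<int>" for r by (simp add: MM_def)
  have prod: "of_nat (N * N) * (x ^ i * kcnj x ^ j) \<in> MM" for i j
    using MM_closed(2)[OF N(2)[of i] N'[of j]] by (simp add: mult_ac)
  show "qn x \<in> \<int>"
  proof (rule rat_int_of_bounded_denominators[of "N * N"])
    fix k
    have "(of_rat (of_nat (N * N) * qn x ^ k) :: 'k) = of_nat (N * N) * (x ^ k * kcnj x ^ k)"
      by (simp add: of_rat_mult of_rat_power qn_kcnj power_mult_distrib)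
    thus "of_nat (N * N) * qn x ^ k \<in> \<int>" using prod[of k k] rat by metis
  qed (use N in simp)
  show "2 * ra x \<in> \<int>"
  proof (rule rat_int_of_bounded_denominators[of "N * N"])
    fix k
    have "(of_rat (of_nat (N * N) * (2 * ra x) ^ k) :: 'k) = of_nat (N * N) * (x + kcnj x) ^ k"
      by (simp only: of_rat_mult[of "of_nat (N * N)"] of_rat_power trace_eq of_rat_of_nat_eq)
    also have "\<dots> = (\<Sum>i\<le>k. of_nat (k choose i) * (of_nat (N * N) * (x ^ i * kcnj x ^ (k - i))))"
      by (simp add: binomial_ring sum_distrib_left mult_ac)
    also have "\<dots> \<in> MM" by (intro MM_sum MM_closed(2) MM_closed(4) prod)
    finally show "of_nat (N * N) * (2 * ra x) ^ k \<in> \<int>" by (rule rat)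
  qed (use N in simp)
qed

lemma algebraic_int_iff: "algebraic_int (x :: 'k) \<longleftrightarrow> 2 * ra x \<in> \<int> \<and> qn x \<in> \<int>"
proof
  assume a: "2 * ra x \<in> \<int> \<and> qn x \<in> \<int>"
  obtain t where t1: "2 * ra x = of_int t" using a Ints_cases by metis
  obtain n where t2: "qn x = of_int n" using a Ints_cases by metis
  note t = t1 t2
  define p :: "'k poly" where "p = [:of_int n, - of_int t, 1:]"
  have "x * x = of_int t * x - of_int n" using quadratic_eq[of x] unfolding t by simp
  hence "poly p x = 0" by (simp add: p_def algebra_simps)
  moreover have "Polynomial.coeff p i \<in> \<int>" for i by (auto simp: p_def coeff_pCons split: nat.splits)
  moreover have "Polynomial.coeff p (Polynomial.degree p) = 1" by (simp add: p_def)
  ultimately show "algebraic_int x" using algebraic_int.intros by blast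
qed (use algebraic_int_imp_trace_norm in blast)

end

section \<open>Integral basis, units, embeddings and discriminant\<close>

context quad
begin

definition ZK :: "'k set" where "ZK = {x. algebraic_int x}"

text \<open>The standard generator of the ring of integers; \<open>wt\<close> and \<open>wn\<close>
  are its trace and norm.\<close>

definition w :: 'k where "w = (if D mod 4 = 1 then (1 + \<delta>) / 2 else \<delta>)"
definition wt :: int where "wt = (if D mod 4 = 1 then 1 else 0)"
definition wn :: int where "wn = (if D mod 4 = 1 then (1 - D) div 4 else - D)"

lemma ra_rb_half [simp]: "ra (x / 2) = ra x / 2" "rb (x / 2) = rb x / 2"
proof -
  have "x / 2 = of_rat (1 / 2) * x" by (simp add: of_rat_divide)
  thus "ra (x / 2) = ra x / 2" "rb (x / 2) = rb x / 2" by (simp_all only: ra_rb_mult ra_rb_of_rat)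
qed

lemma w_coords: "2 * ra w = of_int wt" "rb w = (if D mod 4 = 1 then 1 / 2 else 1)" "qn w = of_int wn"
proof -
  show "2 * ra w = of_int wt" "rb w = (if D mod 4 = 1 then 1 / 2 else 1)" by (simp_all add: w_def wt_def)
  have "4 * ((1 - D) div 4) = 1 - D" if "D mod 4 = 1" using that by presburger
  hence "4 * (of_int ((1 - D) div 4) :: rat) = of_int (1 - D)" if "D mod 4 = 1"
    using that by (metis of_int_mult of_int_numeral)
  thus "qn w = of_int wn" by (auto simp: qn_def w_def wn_def field_simps)
qed

lemma w_sq: "w * w = of_int wt * w - of_int wn"
  using quadratic_eq[of w] unfolding w_coords by simp

lemma kcnj_w: "kcnj w = of_int wt - w"
  using trace_eq[of w] unfolding w_coords by (simp add: algebra_simps)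

text \<open>Let A be the trace, n the norm and u twice the second coordinate, so that
  \<open>A^2 - D u^2 = 4 n\<close>. As D is squarefree, u is an integer; squares modulo 4 then show
  that A and u have equal parity if \<open>D mod 4 = 1\<close> and are both even otherwise.\<close>

lemma ZK_eq: "ZK = {of_int m + of_int n * w | m n. True}"
proof (rule equalityI; rule subsetI)
  fix x assume "x \<in> ZK"
  hence i: "2 * ra x \<in> \<int>" "qn x \<in> \<int>" by (auto simp: ZK_def algebraic_int_iff)
  obtain A where A: "2 * ra x = of_int A" using i(1) Ints_cases by metis
  obtain n where n: "qn x = of_int n" using i(2) Ints_cases by metis
  have e1: "of_int D * (2 * rb x) ^ 2 = (of_int (A * A - 4 * n) :: rat)"
    unfolding of_int_diff of_int_mult n[symmetric] A[symmetric] by (simp add: qn_def power2_eq_square algebra_simps)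
  obtain u v where uv: "2 * rb x = Fract u v" "v > 0" "coprime u v" by (cases "2 * rb x") auto
  have "of_int D * (of_int u)\<^sup>2 = (of_int (A * A - 4 * n) :: rat) * (of_int v)\<^sup>2"
    using e1 uv by (simp add: Fract_of_int_quotient power_divide field_simps)
  hence "(of_int (D * u\<^sup>2) :: rat) = of_int ((A * A - 4 * n) * v\<^sup>2)" by simp
  hence "D * u\<^sup>2 = (A * A - 4 * n) * v\<^sup>2" by (simp only: of_int_eq_iff)
  hence "v\<^sup>2 dvd D * u\<^sup>2" by simp
  moreover have "coprime (v\<^sup>2) (u\<^sup>2)" using uv by (simp add: coprime_commute)
  ultimately have "v\<^sup>2 dvd D" by (simp add: coprime_dvd_mult_left_iff)
  hence "v * v = 1" using sqf[of v] by (simp add: power2_eq_square)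
  hence "v = 1" using uv by (auto simp: zmult_eq_1_iff)
  hence B: "2 * rb x = of_int u" using uv by (simp add: Fract_of_int_quotient)
  have "(of_int (D * (u * u)) :: rat) = of_int (A * A - 4 * n)"
    using e1 unfolding B by (simp add: power2_eq_square)
  hence "D * (u * u) = A * A - 4 * n" by (simp only: of_int_eq_iff)
  hence AB: "A * A - D * (u * u) = 4 * n" by simp
  show "x \<in> {of_int m + of_int n * w | m n. True}"
  proof (cases "D mod 4 = 1")
    case True
    have "even (A * A - D * (u * u))" unfolding AB by simp
    moreover have "odd D" using True by presburger
    ultimately have "even (A - u)" by auto
    then obtain m where "A - u = 2 * m" by blast
    hence m: "A = 2 * m + u" by simp
    have "x = of_int m + of_int u * w"
      using A B True unfolding m by (simp add: eq_iff w_def field_simps)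
    thus ?thesis by blast
  next
    case False
    have "\<not> 4 dvd D" using sqf[of 2] by auto
    hence D: "D mod 4 = 2 \<or> D mod 4 = 3" using False by presburger
    have ev: "even A \<and> even u"
    proof -
      have sq: "(z * z) mod 4 = (if even z then 0 else 1)" for z :: int
      proof (cases "even z")
        case True then obtain k where "z = 2 * k" by blast
        thus ?thesis by simp
      next
        case False then obtain k where k: "z = 2 * k + 1" by (elim oddE)
        have "z * z = 4 * (k * k + k) + 1" by (simp add: k algebra_simps)
        thus ?thesis using False by presburger
      qed
      have e: "A * A = D * (u * u) + 4 * n" using AB by simp
      have "(A * A) mod 4 = (D * (u * u)) mod 4" unfolding e by simp
      also have "\<dots> = ((D mod 4) * ((u * u) mod 4)) mod 4" by (simp add: mod_mult_eq)
      finally show ?thesis unfolding sq using D by (auto split: if_splits)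
    qed
    then obtain m k where "A = 2 * m" "u = 2 * k" by blast
    hence "x = of_int m + of_int k * w" using A B False by (simp add: eq_iff w_def)
    thus ?thesis by blast
  qed
next
  fix x assume "x \<in> {of_int m + of_int n * w | m n. True}"
  then obtain m n where x: "x = of_int m + of_int n * w" by blast
  have "2 * ra x = of_int (2 * m + n * wt)"
    using w_coords(1) by (simp add: x algebra_simps)
  moreover have "(of_rat (qn x) :: 'k) = of_rat (of_int (m * m + m * n * wt + n * n * wn))"
  proof -
    have "(of_rat (qn x) :: 'k) = x * kcnj x" by (rule qn_kcnj)
    also have "\<dots> = of_int (m * m) + of_int (m * n) * (w + kcnj w) + of_int (n * n) * (w * kcnj w)"
      by (simp add: x algebra_simps)
    also have "w + kcnj w = of_int wt" by (simp add: kcnj_w)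
    also have "w * kcnj w = of_int wn" using qn_kcnj[of w] by (simp add: w_coords)
    finally show ?thesis by (simp only: of_rat_of_int_eq) (simp only: of_int_add of_int_mult mult.assoc)
  qed
  hence "qn x = of_int (m * m + m * n * wt + n * n * wn)" by (simp only: of_rat_eq_iff)
  ultimately show "x \<in> ZK" by (simp add: ZK_def algebraic_int_iff)
qed

lemma ZK_I: "of_int m + of_int n * w \<in> ZK" unfolding ZK_eq by blast

lemma ZK_int [simp]: "of_int n \<in> ZK" using ZK_I[of n 0] by simp
lemma ZK_nat [simp]: "of_nat n \<in> ZK" using ZK_int[of "int n"] by simp
lemma ZK_0 [simp]: "0 \<in> ZK" and ZK_1 [simp]: "1 \<in> ZK" using ZK_int[of 0] ZK_int[of 1] by simp_all
lemma ZK_w [simp]: "w \<in> ZK" using ZK_I[of 0 1] by simp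

lemma ZK_add: "x \<in> ZK \<Longrightarrow> y \<in> ZK \<Longrightarrow> x + y \<in> ZK"
proof -
  assume "x \<in> ZK" "y \<in> ZK"
  then obtain a b c d where "x = of_int a + of_int b * w" "y = of_int c + of_int d * w" unfolding ZK_eq by blast
  hence "x + y = of_int (a + c) + of_int (b + d) * w" by (simp add: algebra_simps)
  thus ?thesis using ZK_I by metis
qed

lemma ZK_mult: "x \<in> ZK \<Longrightarrow> y \<in> ZK \<Longrightarrow> x * y \<in> ZK"
proof -
  assume "x \<in> ZK" "y \<in> ZK"
  then obtain a b c d where x: "x = of_int a + of_int b * w" "y = of_int c + of_int d * w" unfolding ZK_eq by blast
  have "x * y = of_int (a * c) + of_int (a * d + b * c) * w + of_int (b * d) * (w * w)" unfolding x by (simp add: algebra_simps)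
  also have "\<dots> = of_int (a * c - b * d * wn) + of_int (a * d + b * c + b * d * wt) * w"
    unfolding w_sq by (simp add: algebra_simps)
  finally show ?thesis using ZK_I by metis
qed

lemma ZK_minus: "x \<in> ZK \<Longrightarrow> - x \<in> ZK"
  using ZK_mult[of "of_int (-1)" x] ZK_int[of "-1"] by (simp del: ZK_int)
lemma ZK_diff: "x \<in> ZK \<Longrightarrow> y \<in> ZK \<Longrightarrow> x - y \<in> ZK"
  using ZK_add[of x "- y"] ZK_minus by simp
lemma ZK_power: "x \<in> ZK \<Longrightarrow> x ^ n \<in> ZK" by (induction n) (auto intro: ZK_mult)

lemma ZK_kcnj: "x \<in> ZK \<Longrightarrow> kcnj x \<in> ZK"
  by (auto simp: ZK_def algebraic_int_iff)

lemma MM_ZK: "x \<in> MM \<Longrightarrow> x \<in> ZK"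
proof -
  assume "x \<in> MM"
  then obtain a b where "ra x = of_int a" "rb x = of_int b" by (auto simp: MM_def elim!: Ints_cases)
  thus ?thesis by (simp add: ZK_def algebraic_int_iff qn_def)
qed

lemma ZK_frac: obtains n :: nat where "n > 0" "of_nat n * x \<in> ZK"
  using common_denominator[of x] MM_ZK by blast

lemma qn_nonneg: "qn x \<ge> 0"
proof -
  have "of_int D * (rb x * rb x) \<le> 0" using Dneg by (intro mult_nonpos_nonneg) auto
  moreover have "ra x * ra x \<ge> 0" by simp
  ultimately show ?thesis unfolding qn_def mult.assoc by linarith
qed

lemma qn_eq_0 [simp]: "qn x = 0 \<longleftrightarrow> x = 0"
proof
  assume "qn x = 0"
  hence "x * kcnj x = 0" using qn_kcnj[of x] by simp
  thus "x = 0" using kcnj_simps(4)[of x] kcnj_simps(7) by (metis mult_eq_0_iff)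
qed simp

definition nn :: "'k \<Rightarrow> nat" where "nn x = nat \<lfloor>qn x\<rfloor>"

lemma of_nat_nn: "x \<in> ZK \<Longrightarrow> of_nat (nn x) = qn x"
  using qn_nonneg[of x] by (auto simp: ZK_def algebraic_int_iff nn_def elim!: Ints_cases)

lemma nn_mult: "x \<in> ZK \<Longrightarrow> y \<in> ZK \<Longrightarrow> nn (x * y) = nn x * nn y"
proof -
  assume "x \<in> ZK" "y \<in> ZK"
  hence "(of_nat (nn (x * y)) :: rat) = of_nat (nn x * nn y)" by (simp add: of_nat_nn ZK_mult qn_mult)
  thus ?thesis by (simp only: of_nat_eq_iff)
qed

lemma nn_eq_0: "x \<in> ZK \<Longrightarrow> nn x = 0 \<longleftrightarrow> x = 0" using of_nat_nn[of x] by (metis of_nat_eq_0_iff qn_eq_0)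

lemma nn_simps [simp]: "nn 1 = 1" "nn 0 = 0" "nn (- x) = nn x" by (simp_all add: nn_def)

lemma nn_kcnj [simp]: "nn (kcnj x) = nn x" by (simp add: nn_def)

definition UU :: "'k set" where "UU = {u \<in> ZK. \<exists>v\<in>ZK. u * v = 1}"

lemma UU_iff: "u \<in> UU \<longleftrightarrow> u \<in> ZK \<and> nn u = 1"
proof
  assume "u \<in> UU"
  then obtain v where v: "u \<in> ZK" "v \<in> ZK" "u * v = 1" by (auto simp: UU_def)
  have "nn u * nn v = 1" using nn_mult[OF v(1,2)] v by simp
  thus "u \<in> ZK \<and> nn u = 1" using v by simp
next
  assume u: "u \<in> ZK \<and> nn u = 1"
  hence "u * kcnj u = 1" using of_nat_nn[of u] qn_kcnj[of u] by simp
  thus "u \<in> UU" using u ZK_kcnj by (auto simp: UU_def)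
qed

text \<open>The embedding that sends \<delta> into the upper half plane. The embedding chosen for
  the norm at infinity is this one or its complex conjugate, with the same modulus.\<close>

definition sg :: "'k \<Rightarrow> complex" where "sg = emb (\<i> * sqrt (- of_int D))"

lemma sg_root: "(\<i> * complex_of_real (sqrt (- of_int D))) * (\<i> * complex_of_real (sqrt (- of_int D))) = of_int D"
proof -
  have "complex_of_real (sqrt (- of_int D)) * complex_of_real (sqrt (- of_int D)) = complex_of_real (- of_int D)"
    using Dneg by (simp flip: of_real_mult)
  thus ?thesis by (simp add: algebra_simps)
qed

lemma sg_embedding: "field_embedding sg" unfolding sg_def by (rule field_embedding_emb[OF sg_root])

lemmas sg_simps = field_embedding_simps[OF sg_embedding]

lemma sg_Re_Im: "Re (sg x) = of_rat (ra x)" "Im (sg x) = of_rat (rb x) * sqrt (- of_int D)"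
proof -
  have r: "(of_rat q :: complex) = complex_of_real (of_rat q)" for q
    by (cases q) (simp add: of_rat_rat)
  show "Re (sg x) = of_rat (ra x)" "Im (sg x) = of_rat (rb x) * sqrt (- of_int D)"
    by (simp_all add: sg_def emb_def r)
qed

lemma sg_norm: "(cmod (sg x))\<^sup>2 = of_rat (qn x)"
proof -
  have "(sqrt (- of_int D))\<^sup>2 = - real_of_int D" using Dneg by simp
  hence "(of_rat (rb x) * sqrt (- of_int D))\<^sup>2 = (of_rat (rb x))\<^sup>2 * (- of_int D :: real)" by (simp only: power_mult_distrib)
  thus ?thesis unfolding cmod_power2 sg_Re_Im qn_def by (simp add: of_rat_diff of_rat_mult power2_eq_square)
qed

lemma embedding_norm:
  assumes "field_embedding (f :: 'k \<Rightarrow> complex)" shows "f = sg \<or> f = cnj \<circ> sg" "(cmod (f x))\<^sup>2 = of_rat (qn x)"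
proof -
  have "emb (- (\<i> * complex_of_real (sqrt (- of_int D)))) y = cnj (sg y)" for y
  proof (rule complex_eqI)
    have r: "(of_rat q :: complex) = complex_of_real (of_rat q)" for q
      by (cases q) (simp add: of_rat_rat)
    show "Re (emb (- (\<i> * complex_of_real (sqrt (- of_int D)))) y) = Re (cnj (sg y))"
      "Im (emb (- (\<i> * complex_of_real (sqrt (- of_int D)))) y) = Im (cnj (sg y))"
      by (simp_all add: emb_def r sg_Re_Im)
  qed
  thus c: "f = sg \<or> f = cnj \<circ> sg" using embedding_cases[OF assms sg_root] by (auto simp: sg_def fun_eq_iff)
  show "(cmod (f x))\<^sup>2 = of_rat (qn x)" using c sg_norm[of x] by auto
qed

lemma norm_infinity_qn: "norm_infinity (x :: 'k) = of_rat (qn x)"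
proof -
  have "field_embedding (complex_embedding :: 'k \<Rightarrow> complex)"
    unfolding complex_embedding_def by (rule someI[of field_embedding sg]) (rule sg_embedding)
  thus ?thesis unfolding norm_infinity_def by (rule embedding_norm(2))
qed

lemma norm_infinity_nn: "x \<in> ZK \<Longrightarrow> norm_infinity x = real (nn x)"
  using of_nat_nn[of x] by (metis norm_infinity_qn of_rat_of_nat_eq)

definition wi :: real where "wi = Im (sg w)"

lemma wi_pos: "wi > 0" using Dneg by (auto simp: wi_def sg_Re_Im w_coords)

text \<open>\<open>wi\<close> is the area of a fundamental parallelogram of the ring of integers.
  The description of the discriminant is unambiguous because two integral bases differ by a matrix
  of determinant 1 or -1, and the alternating form \<open>V\<close> scales by that
  determinant.\<close>

lemma sqrt_abs_disc_eq: "sqrt_abs_disc (TYPE('k)) = 2 * wi"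
proof -
  define d where "d = (if D mod 4 = 1 then D else 4 * D)"
  have wi2: "4 * wi\<^sup>2 = - of_int d"
  proof -
    have "(sqrt (- of_int D))\<^sup>2 = - real_of_int D" using Dneg by simp
    thus ?thesis by (auto simp: wi_def sg_Re_Im w_coords power_mult_distrib d_def power_divide of_rat_divide)
  qed
  define Q where "Q = (\<lambda>E::int. \<exists>(b1::'k) b2 f. {of_int m * b1 + of_int n * b2 | m n. True} = carrier (ring_of_integers TYPE('k)) \<and>
     field_embedding f \<and> of_int E = (f b1 * cnj (f b2) - f b2 * cnj (f b1))\<^sup>2)"
  have carr: "carrier (ring_of_integers TYPE('k)) = ZK" by (simp add: ring_of_integers_def ZK_def)
  have sq: "(z * cnj z' - z' * cnj z)\<^sup>2 = complex_of_real (- 4 * (Im (z * cnj z'))\<^sup>2)" for z z' :: complex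
  proof -
    define t where "t = Im (z * cnj z')"
    have e: "z * cnj z' - z' * cnj z = complex_of_real (2 * t) * \<i>"
      by (simp add: complex_eq_iff t_def)
    show ?thesis unfolding e t_def[symmetric] by (simp add: power_mult_distrib)
  qed
  have Qd: "Q d"
    unfolding Q_def
  proof (intro exI conjI)
    show "{of_int m * 1 + of_int n * w | m n. True} = carrier (ring_of_integers TYPE('k))"
      by (simp add: carr ZK_eq)
    have "- 4 * (Im (sg 1 * cnj (sg w)))\<^sup>2 = real_of_int d" using wi2 by (simp add: sg_simps wi_def)
    thus "of_int d = (sg 1 * cnj (sg w) - sg w * cnj (sg 1))\<^sup>2" unfolding sq by (metis of_real_of_int_eq)
  qed (rule sg_embedding)
  have uniq: "E = d" if QE: "Q E" for E
  proof -
    obtain b1 b2 :: 'k and f where b: "{of_int m * b1 + of_int n * b2 | m n. True} = ZK" "field_embedding f"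
      "of_int E = (f b1 * cnj (f b2) - f b2 * cnj (f b1))\<^sup>2" using QE unfolding Q_def carr by blast
    have "b1 \<in> ZK" unfolding b(1)[symmetric] by (intro CollectI exI[of _ 1] exI[of _ 0]) simp
    then obtain m11 m12 where m1: "b1 = of_int m11 + of_int m12 * w" unfolding ZK_eq by blast
    have "b2 \<in> ZK" unfolding b(1)[symmetric] by (intro CollectI exI[of _ 0] exI[of _ 1]) simp
    then obtain m21 m22 where m2: "b2 = of_int m21 + of_int m22 * w" unfolding ZK_eq by blast
    obtain n11 n12 where n1: "1 = of_int n11 * b1 + of_int n12 * b2" using ZK_1 unfolding b(1)[symmetric] by blast
    obtain n21 n22 where n2: "w = of_int n21 * b1 + of_int n22 * b2" using ZK_w unfolding b(1)[symmetric] by blast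
    have Imf: "\<bar>Im (f x * cnj (f y))\<bar> = \<bar>Im (sg x * cnj (sg y))\<bar>" for x y
      using embedding_norm(1)[OF b(2)] by (auto simp: algebra_simps)
    define V where "V = (\<lambda>x y. Im (sg x * cnj (sg y)))"
    have V1: "V b1 b2 = - of_int (m11 * m22 - m12 * m21) * wi"
      unfolding V_def m1 m2 by (simp add: sg_simps wi_def algebra_simps)
    have V2: "V 1 w = of_int (n11 * n22 - n12 * n21) * V b1 b2"
      unfolding V_def by (subst n1, subst n2) (simp add: sg_simps algebra_simps)
    have "V 1 w = - wi" by (simp add: V_def sg_simps wi_def)
    define e1 e2 where "e1 = n11 * n22 - n12 * n21" and "e2 = m11 * m22 - m12 * m21"
    note e_defs = e1_def[symmetric] e2_def[symmetric]
    have "real_of_int (e1 * e2) * wi = 1 * wi" using V1 V2 \<open>V 1 w = - wi\<close> unfolding e_defs by simp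
    hence "real_of_int ((n11 * n22 - n12 * n21) * (m11 * m22 - m12 * m21)) * wi = 1 * wi" unfolding e_defs .
    hence "real_of_int ((n11 * n22 - n12 * n21) * (m11 * m22 - m12 * m21)) = 1" using wi_pos by simp
    hence "(n11 * n22 - n12 * n21) * (m11 * m22 - m12 * m21) = 1" by linarith
    hence "\<bar>m11 * m22 - m12 * m21\<bar> = 1" by (metis abs_mult abs_zmult_eq_1 abs_1 mult.commute)
    hence "\<bar>V b1 b2\<bar> = wi" using V1 wi_pos by (simp add: abs_mult flip: of_int_abs of_int_mult of_int_diff)
    hence "(Im (f b1 * cnj (f b2)))\<^sup>2 = wi\<^sup>2" using Imf[of b1 b2] wi_pos by (metis V_def power2_abs)
    hence "complex_of_real (of_int E) = complex_of_real (- 4 * wi\<^sup>2)" using b(3) unfolding sq by simp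
    hence "real_of_int E = - 4 * wi\<^sup>2" by (simp only: of_real_eq_iff)
    thus ?thesis using wi2 by simp
  qed
  have "discriminant TYPE('k) = d"
    unfolding discriminant_def using Qd uniq unfolding Q_def by (rule the_equality) auto
  hence "sqrt_abs_disc (TYPE('k)) = sqrt (4 * wi\<^sup>2)"
    using wi2 Dneg by (simp add: sqrt_abs_disc_def d_def abs_if)
  thus ?thesis using wi_pos by (simp add: real_sqrt_mult)
qed

end

section \<open>Elements of bounded norm\<close>

definition lattice_disc :: "real \<Rightarrow> real \<Rightarrow> real \<Rightarrow> (int \<times> int) set" where
  "lattice_disc x0 y R = {(a, b). cmod (Complex (of_int a + of_int b * x0) (of_int b * y)) \<le> R}"

text \<open>
  The rectangles with lower left corners at the lattice points and sides \<open>1\<close> and \<open>y\<close> tile the plane.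
\<close>

lemma lattice_disc_count:
  assumes y: "y > 0" and R: "R \<ge> 0"
  shows "finite (lattice_disc x0 y R)"
    "\<bar>real (card (lattice_disc x0 y R)) * y - pi * R\<^sup>2\<bar> \<le> pi * (2 * (1 + y) + (1 + y)\<^sup>2) * (1 + R)"
proof -
  \<comment> \<open>Bounds the diameter of a tile: the tiles at lattice points of the disc lie in
    the disc of radius \<open>R + c\<close> and cover the one of radius
    \<open>R - c\<close>.\<close>
  define c where "c = 1 + y"
  have c: "c > 0" using y by (simp add: c_def)
  define pt where "pt = (\<lambda>(a::int, b::int). Complex (of_int a + of_int b * x0) (of_int b * y))"
  define S where "S = lattice_disc x0 y R"
  have S: "ab \<in> S \<longleftrightarrow> cmod (pt ab) \<le> R" for ab by (cases ab) (auto simp: S_def lattice_disc_def pt_def)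
  define op cl where "op = (\<lambda>ab. box (pt ab) (pt ab + Complex 1 y))" and "cl = (\<lambda>ab. cbox (pt ab) (pt ab + Complex 1 y))"
  show fin: "finite (lattice_disc x0 y R)"
  proof -
    define B where "B = \<lceil>R / y\<rceil>"
    define A where "A = \<lceil>R + \<bar>of_int B * x0\<bar>\<rceil>"
    have "S \<subseteq> {-A..A} \<times> {-B..B}"
    proof clarify
      fix a b assume "(a, b) \<in> S"
      hence n: "cmod (pt (a, b)) \<le> R" using S by simp
      have "\<bar>of_int b * y\<bar> \<le> R" using abs_Im_le_cmod[of "pt (a, b)"] n by (simp add: pt_def)
      hence "\<bar>real_of_int b\<bar> \<le> R / y" using y by (simp add: abs_mult field_simps)
      hence b: "\<bar>b\<bar> \<le> B" unfolding B_def by linarith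
      have "\<bar>of_int a + of_int b * x0\<bar> \<le> R" using abs_Re_le_cmod[of "pt (a, b)"] n by (simp add: pt_def)
      moreover have "\<bar>of_int b * x0\<bar> \<le> \<bar>of_int B * x0\<bar>"
        using b unfolding abs_mult by (intro mult_right_mono) auto
      ultimately have "\<bar>real_of_int a\<bar> \<le> R + \<bar>of_int B * x0\<bar>" by linarith
      hence "\<bar>a\<bar> \<le> A" unfolding A_def by linarith
      thus "a \<in> {-A..A} \<and> b \<in> {-B..B}" using b by auto
    qed
    thus ?thesis using finite_subset S_def by blast
  qed
  have m: "measure lborel (op ab) = y" "measure lborel (cl ab) = y" for ab
    using y unfolding op_def cl_def measure_lborel_box_eq measure_lborel_cbox_eq
    by (simp_all add: Basis_complex_def inner_complex_def)
  have sub: "op ab \<subseteq> cball 0 (R + c)" if "ab \<in> S" for ab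
  proof
    fix z assume "z \<in> op ab"
    hence "\<bar>Re (z - pt ab)\<bar> \<le> 1" "\<bar>Im (z - pt ab)\<bar> \<le> y" by (auto simp: op_def in_box_complex_iff)
    hence "cmod (z - pt ab) \<le> c" using cmod_le[of "z - pt ab"] by (simp add: c_def)
    moreover have "cmod z \<le> cmod (pt ab) + cmod (z - pt ab)" using norm_triangle_sub by blast
    ultimately show "z \<in> cball 0 (R + c)" using S that by (simp add: dist_norm)
  qed
  have disj: "disjoint_family_on op S"
    unfolding disjoint_family_on_def
  proof (intro ballI impI equals0I)
    fix ab ab' z assume ne: "ab \<noteq> ab'" and z: "z \<in> op ab \<inter> op ab'"
    obtain a b a' b' where e: "ab = (a, b)" "ab' = (a', b')" by (cases ab; cases ab')
    have "of_int b * y < Im z" "Im z < of_int b * y + y" "of_int b' * y < Im z" "Im z < of_int b' * y + y"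
      using z by (auto simp: op_def e in_box_complex_iff pt_def)
    hence "of_int b * y < (of_int b' + 1) * y" "of_int b' * y < (of_int b + 1) * y" by (auto simp: algebra_simps)
    hence "real_of_int b < of_int b' + 1" "real_of_int b' < of_int b + 1" using y by auto
    hence b: "b = b'" by linarith
    have "of_int a + of_int b * x0 < Re z" "Re z < of_int a + of_int b * x0 + 1"
       "of_int a' + of_int b * x0 < Re z" "Re z < of_int a' + of_int b * x0 + 1"
      using z by (auto simp: op_def e b in_box_complex_iff pt_def)
    hence "a = a'" by linarith
    thus False using ne b e by simp
  qed
  have finS: "finite S" using fin S_def by simp
  have "real (card S) * y = (\<Sum>ab\<in>S. measure lborel (op ab))" by (simp add: m)
  also have "\<dots> = measure lborel (\<Union>ab\<in>S. op ab)"
    by (rule measure_finite_Union[symmetric]) (use finS disj in \<open>auto simp: op_def emeasure_lborel_box_eq\<close>)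
  also have "\<dots> \<le> measure lborel (cball (0::complex) (R + c))"
  proof (rule measure_mono_fmeasurable)
    show "cball (0::complex) (R + c) \<in> fmeasurable lborel"
      using emeasure_bounded_finite[OF bounded_cball, of "0::complex" "R + c"] by (intro fmeasurableI) auto
  qed (use sub in \<open>auto simp: op_def\<close>)
  also have "\<dots> = pi * (R + c)\<^sup>2" using R c by (simp add: content_cball unit_ball_vol_2)
  finally have up: "real (card S) * y \<le> pi * (R + c)\<^sup>2" .
  have lo: "pi * (R - c)\<^sup>2 \<le> real (card S) * y" if "R \<ge> c"
  proof -
    have "pi * (R - c)\<^sup>2 = measure lborel (cball (0::complex) (R - c))"
      using that by (simp add: content_cball unit_ball_vol_2)
    also have "\<dots> \<le> measure lborel (\<Union>ab\<in>S. cl ab)"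
    proof (rule measure_mono_fmeasurable)
      show "cball 0 (R - c) \<subseteq> (\<Union>ab\<in>S. cl ab)"
      proof
        fix z :: complex assume z: "z \<in> cball 0 (R - c)"
        define b where "b = \<lfloor>Im z / y\<rfloor>"
        define a where "a = \<lfloor>Re z - of_int b * x0\<rfloor>"
        have "of_int b \<le> Im z / y" "Im z / y < of_int b + 1" by (auto simp: b_def)
        hence b: "of_int b * y \<le> Im z" "Im z \<le> of_int b * y + y" using y by (auto simp: field_simps)
        have a: "of_int a + of_int b * x0 \<le> Re z" "Re z \<le> of_int a + of_int b * x0 + 1"
          unfolding a_def by linarith+
        have cl: "z \<in> cl (a, b)" using a b by (simp add: cl_def in_cbox_complex_iff pt_def)
        have "\<bar>Re (pt (a, b) - z)\<bar> \<le> 1" "\<bar>Im (pt (a, b) - z)\<bar> \<le> y" using a b by (auto simp: pt_def)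
        hence "cmod (pt (a, b) - z) \<le> c" using cmod_le[of "pt (a, b) - z"] by (simp add: c_def)
        moreover have "cmod (pt (a, b)) \<le> cmod z + cmod (pt (a, b) - z)" using norm_triangle_sub by blast
        ultimately have "(a, b) \<in> S" using S z by (simp add: dist_norm)
        thus "z \<in> (\<Union>ab\<in>S. cl ab)" using cl by blast
      qed
      have "bounded (\<Union>ab\<in>S. cl ab)" using finS by (auto simp: cl_def intro!: bounded_UN)
      from emeasure_bounded_finite[OF this] show "(\<Union>ab\<in>S. cl ab) \<in> fmeasurable lborel"
        using finS by (intro fmeasurableI) (auto simp: cl_def)
    qed auto
    also have "\<dots> \<le> (\<Sum>ab\<in>S. measure lborel (cl ab))"
      by (rule measure_UNION_le) (use finS in \<open>auto simp: cl_def\<close>)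
    finally show ?thesis by (simp add: m)
  qed
  have "pi * R\<^sup>2 - real (card S) * y \<le> pi * (2 * R * c + c\<^sup>2)"
  proof (cases "R \<ge> c")
    case True
    have "pi * R\<^sup>2 - pi * (R - c)\<^sup>2 = pi * (2 * R * c - c\<^sup>2)" by (simp add: power2_eq_square algebra_simps)
    also have "\<dots> \<le> pi * (2 * R * c + c\<^sup>2)" by (intro mult_left_mono) auto
    finally show ?thesis using lo[OF True] by simp
  next
    case False
    have "pi * R\<^sup>2 \<le> pi * (2 * R * c + c\<^sup>2)"
      using False R c power_mono[of R c 2] by (intro mult_left_mono) (auto simp: add_increasing)
    moreover have "real (card S) * y \<ge> 0" using y by simp
    ultimately show ?thesis by linarith
  qed
  moreover have "real (card S) * y - pi * R\<^sup>2 \<le> pi * (2 * R * c + c\<^sup>2)"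
    using up by (simp add: power2_eq_square algebra_simps)
  moreover have "pi * (2 * R * c + c\<^sup>2) \<le> pi * ((2 * c + c\<^sup>2) * (1 + R))"
    using R c by (intro mult_left_mono) (auto simp: algebra_simps)
  ultimately have "\<bar>real (card S) * y - pi * R\<^sup>2\<bar> \<le> pi * ((2 * c + c\<^sup>2) * (1 + R))" by linarith
  thus "\<bar>real (card (lattice_disc x0 y R)) * y - pi * R\<^sup>2\<bar> \<le> pi * (2 * (1 + y) + (1 + y)\<^sup>2) * (1 + R)"
    unfolding S_def c_def mult.assoc .
qed

context quad
begin

lemma ZK_bij: "bij_betw (\<lambda>(a, b). of_int a + of_int b * w) (lattice_disc (Re (sg w)) wi (sqrt (real n))) {x \<in> ZK. nn x \<le> n}"
proof (rule bij_betw_imageI)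
  show "inj_on (\<lambda>(a, b). of_int a + of_int b * w) (lattice_disc (Re (sg w)) wi (sqrt (real n)))"
  proof (rule inj_onI, clarify)
    fix a b a' b' :: int assume e: "of_int a + of_int b * w = of_int a' + of_int b' * w"
    have "rb (of_int a + of_int b * w) = rb (of_int a' + of_int b' * w)" by (simp only: e)
    hence "b = b'" using w_coords(2) by (auto split: if_splits)
    thus "a = a' \<and> b = b'" using e by simp
  qed
  have iff: "nn (of_int a + of_int b * w) \<le> n \<longleftrightarrow> (a, b) \<in> lattice_disc (Re (sg w)) wi (sqrt (real n))" for a b
  proof -
    define x where "x = of_int a + of_int b * w"
    have x: "x \<in> ZK" using ZK_I by (simp add: x_def)
    have "sg x = Complex (of_int a + of_int b * Re (sg w)) (of_int b * wi)"
      by (simp add: x_def sg_simps complex_eq_iff wi_def)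
    moreover have "(cmod (sg x))\<^sup>2 = real (nn x)" using sg_norm[of x] norm_infinity_nn[OF x] norm_infinity_qn[of x] by simp
    hence "nn x \<le> n \<longleftrightarrow> cmod (sg x) \<le> sqrt (real n)"
      by (metis norm_ge_zero of_nat_le_iff real_sqrt_abs abs_of_nonneg real_sqrt_le_iff)
    ultimately show ?thesis by (simp add: x_def lattice_disc_def)
  qed
  show "(\<lambda>(a, b). of_int a + of_int b * w) ` lattice_disc (Re (sg w)) wi (sqrt (real n)) = {x \<in> ZK. nn x \<le> n}"
    using iff by (auto simp: ZK_eq image_iff)
qed

lemma finite_nn_le: "finite {x \<in> ZK. nn x \<le> n}"
  using bij_betw_finite[OF ZK_bij] lattice_disc_count(1)[OF wi_pos] by simp

lemma card_nn_le: "\<bar>real (card {x \<in> ZK. nn x \<le> n}) * wi - pi * real n\<bar> \<le> pi * (2 * (1 + wi) + (1 + wi)\<^sup>2) * (1 + sqrt (real n))"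
  using bij_betw_same_card[OF ZK_bij, of n] lattice_disc_count(2)[OF wi_pos, of "sqrt (real n)" "Re (sg w)"] by simp

lemma finite_UU: "finite UU"
  by (rule finite_subset[OF _ finite_nn_le[of 1]]) (auto simp: UU_iff)

lemma UU_1 [simp]: "1 \<in> UU" and UU_mult: "u \<in> UU \<Longrightarrow> v \<in> UU \<Longrightarrow> u * v \<in> UU"
  and UU_ZK: "u \<in> UU \<Longrightarrow> u \<in> ZK" and UU_nonzero: "u \<in> UU \<Longrightarrow> u \<noteq> 0"
  and UU_inverse: "u \<in> UU \<Longrightarrow> inverse u \<in> UU" and UU_power: "u \<in> UU \<Longrightarrow> u ^ n \<in> UU"
proof -
  show "1 \<in> UU" by (simp add: UU_iff)
  show mult: "u \<in> UU \<Longrightarrow> v \<in> UU \<Longrightarrow> u * v \<in> UU" for u v by (simp add: UU_iff ZK_mult nn_mult)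
  show "u \<in> UU \<Longrightarrow> u \<in> ZK" "u \<in> UU \<Longrightarrow> u \<noteq> 0" by (auto simp: UU_iff)
  show "inverse u \<in> UU" if uU: "u \<in> UU"
  proof -
    obtain v where v: "u \<in> ZK" "v \<in> ZK" "u * v = 1" using uU by (auto simp: UU_def)
    hence "inverse u = v" by (simp add: inverse_unique)
    thus ?thesis using v by (auto simp: UU_def mult.commute)
  qed
  show "u ^ n \<in> UU" if u: "u \<in> UU"
  proof (induction n)
    case (Suc n)
    thus ?case using mult[OF u] by simp
  qed (simp add: UU_iff)
qed

lemma card_UU_pos: "card UU > 0" using finite_UU UU_1 by (metis card_gt_0_iff empty_iff)

section \<open>Ideals and class number one\<close>

abbreviation "RR \<equiv> ring_of_integers TYPE('k)"

lemma RR_simps [simp]: "carrier RR = ZK" "mult RR = (*)" "one RR = 1" "ring.zero RR = 0" "add RR = (+)"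
  by (simp_all add: ring_of_integers_def ZK_def)

lemma RR_cring: "cring RR"
proof (rule cringI)
  show "abelian_group RR"
  proof (rule abelian_groupI)
    fix x assume "x \<in> carrier RR"
    thus "\<exists>y\<in>carrier RR. add RR y x = ring.zero RR" using ZK_minus by (intro bexI[of _ "- x"]) auto
  qed (auto simp: ZK_add)
  show "Group.comm_monoid RR"
    by (rule Group.comm_monoidI) (auto simp: ZK_mult algebra_simps)
qed (auto simp: algebra_simps)

lemma RR_Units: "Units RR = UU"
  by (auto simp: Units_def UU_def mult.commute)

lemma unit_number_eq: "unit_number TYPE('k) = card UU" by (simp add: unit_number_def RR_Units)

lemma RR_ideal:
  assumes "0 \<in> I" "I \<subseteq> ZK" "\<And>x y. x \<in> I \<Longrightarrow> y \<in> I \<Longrightarrow> x + y \<in> I" "\<And>x y. x \<in> I \<Longrightarrow> y \<in> ZK \<Longrightarrow> y * x \<in> I"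
  shows "ideal I RR"
proof (rule idealI)
  interpret R: cring RR by (rule RR_cring)
  show "ring RR" by (rule R.ring_axioms)
  show "subgroup I (add_monoid RR)"
  proof (rule subgroup.intro)
    fix x assume x: "x \<in> I"
    have xZ: "x \<in> ZK" using assms x by blast
    have "m_inv (add_monoid RR) x = - x"
      using R.minus_equality[of "- x" x] xZ ZK_minus[of x] by (simp add: a_inv_def)
    moreover have "- x \<in> I" using assms(4)[OF x, of "-1"] ZK_minus[of 1] by simp
    ultimately show "m_inv (add_monoid RR) x \<in> I" by simp
  qed (use assms in auto)
qed (use assms in \<open>auto simp: mult.commute\<close>)

text \<open>I lies in the class of the whole ring, so a I = b \<open>ZK\<close> for some nonzero a
  and b. Then \<open>b = a * g\<close> with g in I, and g generates.\<close>

lemma class_number_1_principal: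
  assumes cn: "class_number RR = 1" and I: "ideal I RR" "I \<noteq> {0}"
  shows "\<exists>g\<in>I. \<forall>x\<in>I. \<exists>z\<in>ZK. x = g * z"
proof -
  define A where "A = {I. ideal I RR \<and> I \<noteq> {0}}"
  define E where "E = ideal_equiv RR"
  have "card (A // E) = 1" using cn by (simp add: class_number_def A_def E_def)
  then obtain Q where Q: "A // E = {Q}" by (auto simp: card_1_singleton_iff)
  have Z: "ideal ZK RR" by (rule RR_ideal) (auto intro: ZK_add ZK_mult)
  have Z0: "ZK \<noteq> {0}" using ZK_1 by (metis singletonD zero_neq_one)
  have "E `` {I} \<in> A // E" "E `` {ZK} \<in> A // E"
    by (rule quotientI; use I Z Z0 in \<open>simp add: A_def\<close>)+
  hence "E `` {I} = E `` {ZK}" unfolding Q by simp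
  moreover have "(ZK, ZK) \<in> E" unfolding E_def ideal_equiv_def
    by (intro CollectI case_prodI conjI bexI[of _ 1]) (use Z Z0 in simp_all)
  ultimately have "(I, ZK) \<in> E" by blast
  then obtain a b where ab: "a \<in> ZK" "a \<noteq> 0" "b \<in> ZK" "b \<noteq> 0" "l_coset RR a I = l_coset RR b ZK"
    by (auto simp: E_def ideal_equiv_def)
  have l: "l_coset RR c J = (\<lambda>j. c * j) ` J" for c J by (auto simp: l_coset_def)
  have eq: "(\<lambda>j. a * j) ` I = (\<lambda>j. b * j) ` ZK" using ab(5) unfolding l .
  have "b * 1 \<in> (\<lambda>j. b * j) ` ZK" by (rule imageI) simp
  then obtain g where g: "g \<in> I" "b = a * g" unfolding eq[symmetric] by auto
  have "\<exists>z\<in>ZK. x = g * z" if x: "x \<in> I" for x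
  proof -
    have "a * x \<in> (\<lambda>j. b * j) ` ZK" unfolding eq[symmetric] using x by (rule imageI)
    then obtain z where "z \<in> ZK" "a * x = b * z" by auto
    thus ?thesis using g ab(2) by (auto simp: mult.assoc)
  qed
  thus ?thesis using g by blast
qed

text \<open>A generator of the ideal spanned by x and y divides both and is a combination of
  them.\<close>

lemma class_number_1_Bezout:
  assumes cn: "class_number RR = 1" and xy: "x \<in> ZK" "y \<in> ZK"
  shows "\<exists>g\<in>ZK. \<exists>u\<in>ZK. \<exists>v\<in>ZK. g = u * x + v * y \<and> (\<exists>a\<in>ZK. x = g * a) \<and> (\<exists>b\<in>ZK. y = g * b)"
proof (cases "x = 0 \<and> y = 0")
  case False
  define I where "I = {u * x + v * y | u v. u \<in> ZK \<and> v \<in> ZK}"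
  have xI: "x \<in> I" unfolding I_def by (rule CollectI, rule exI[of _ 1], rule exI[of _ 0]) simp
  have yI: "y \<in> I" unfolding I_def by (rule CollectI, rule exI[of _ 0], rule exI[of _ 1]) simp
  have "ideal I RR"
  proof (rule RR_ideal)
    show "0 \<in> I" unfolding I_def by (rule CollectI, rule exI[of _ 0], rule exI[of _ 0]) simp
    show "I \<subseteq> ZK" using xy by (auto simp: I_def intro: ZK_add ZK_mult)
    fix s t assume "s \<in> I" 
    then obtain u v where s: "s = u * x + v * y" "u \<in> ZK" "v \<in> ZK" by (auto simp: I_def)
    show "s + t \<in> I" if "t \<in> I"
    proof -
      obtain u' v' where t: "t = u' * x + v' * y" "u' \<in> ZK" "v' \<in> ZK" using \<open>t \<in> I\<close> by (auto simp: I_def)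
      have "s + t = (u + u') * x + (v + v') * y" by (simp add: s t algebra_simps)
      thus ?thesis unfolding I_def using s t ZK_add by blast
    qed
    show "t * s \<in> I" if "t \<in> ZK"
    proof -
      have "t * s = (t * u) * x + (t * v) * y" by (simp add: s algebra_simps)
      thus ?thesis unfolding I_def using s that ZK_mult by blast
    qed
  qed
  moreover have "I \<noteq> {0}" using False xI yI by auto
  ultimately obtain g where g: "g \<in> I" "\<forall>x\<in>I. \<exists>z\<in>ZK. x = g * z" using class_number_1_principal[OF cn] by blast
  then obtain u v where "g = u * x + v * y" "u \<in> ZK" "v \<in> ZK" by (auto simp: I_def)
  moreover from this have "g \<in> ZK" using xy ZK_add ZK_mult by auto
  ultimately show ?thesis using g xI yI by blast
next
  case True
  thus ?thesis by (intro bexI[of _ "0::'k"] conjI) auto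
qed

end

section \<open>Unique factorisation\<close>

text \<open>Class number one enters the arithmetic in the form of this Bezout property, from which
  unique factorisation is derived.\<close>

locale cn1 = quad \<delta> D for \<delta> :: "'k::field_char_0" and D +
  assumes bez: "x \<in> ZK \<Longrightarrow> y \<in> ZK \<Longrightarrow>
    \<exists>g\<in>ZK. \<exists>u\<in>ZK. \<exists>v\<in>ZK. g = u * x + v * y \<and> (\<exists>a\<in>ZK. x = g * a) \<and> (\<exists>b\<in>ZK. y = g * b)"
begin

text \<open>Divisibility in the ring of integers; in the ambient field \<open>dvd\<close> is
  trivial.\<close>

definition dv :: "'k \<Rightarrow> 'k \<Rightarrow> bool" where "dv x y \<longleftrightarrow> (\<exists>z\<in>ZK. y = x * z)"

lemma dvI: "z \<in> ZK \<Longrightarrow> y = x * z \<Longrightarrow> dv x y" by (auto simp: dv_def)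
lemma dv_refl: "dv x x" by (auto simp: dv_def intro: bexI[of _ 1])
lemma dv_trans: "dv x y \<Longrightarrow> dv y z \<Longrightarrow> dv x z"
  unfolding dv_def using ZK_mult by (metis mult.assoc)
lemma dv_mult: "dv x y \<Longrightarrow> z \<in> ZK \<Longrightarrow> dv x (y * z)" "dv x y \<Longrightarrow> z \<in> ZK \<Longrightarrow> dv x (z * y)"
  unfolding dv_def using ZK_mult by (metis mult.assoc, metis mult.assoc mult.commute)
lemma dv_add: "dv x y \<Longrightarrow> dv x z \<Longrightarrow> dv x (y + z)"
  unfolding dv_def using ZK_add by (metis distrib_left)
lemma dv_UU: "dv x u \<Longrightarrow> x \<in> ZK \<Longrightarrow> u \<in> UU \<Longrightarrow> x \<in> UU"
  unfolding dv_def UU_iff using nn_mult by fastforce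
lemma dv_unit_mult: "u \<in> UU \<Longrightarrow> dv x (u * y) \<longleftrightarrow> dv x y"
proof -
  assume u: "u \<in> UU"
  have "dv x (inverse u * (u * y))" if "dv x (u * y)"
    using dv_mult(2)[OF that UU_ZK[OF UU_inverse[OF u]]] .
  thus ?thesis using dv_mult(2)[of x y u] UU_ZK[OF u] UU_nonzero[OF u] by (auto simp: mult.assoc[symmetric])
qed

definition isp :: "'k \<Rightarrow> bool" where
  "isp p \<longleftrightarrow> p \<in> ZK \<and> p \<noteq> 0 \<and> p \<notin> UU \<and> (\<forall>a\<in>ZK. \<forall>b\<in>ZK. dv p (a * b) \<longrightarrow> dv p a \<or> dv p b)"

lemma ring_prime_isp: "p \<in> ZK \<Longrightarrow> ring_prime\<^bsub>RR\<^esub> p \<longleftrightarrow> isp p"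
  by (auto simp: ring_prime_def Divisibility.prime_def factor_def isp_def dv_def RR_Units)

lemma isp_assoc: "isp p \<Longrightarrow> isp q \<Longrightarrow> dv p q \<Longrightarrow> dv q p"
proof -
  assume p: "isp p" and q: "isp q" and "dv p q"
  then obtain z where z: "z \<in> ZK" "q = p * z" by (auto simp: dv_def)
  have "dv q (p * z)" using z dv_refl by simp
  moreover have "\<not> dv q z"
  proof
    assume "dv q z"
    then obtain t where t: "t \<in> ZK" "z = q * t" by (auto simp: dv_def)
    have "z * 1 = z * (p * t)" using t z by (simp add: mult_ac)
    moreover have "z \<noteq> 0" using z q by (auto simp: isp_def)
    ultimately have "p * t = 1" by simp
    hence "p \<in> UU" using t p by (auto simp: UU_def isp_def)
    thus False using p by (simp add: isp_def)
  qed
  ultimately show ?thesis using p q z by (auto simp: isp_def)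
qed

definition prel :: "('k \<times> 'k) set" where "prel = {(p, q). isp p \<and> isp q \<and> dv p q \<and> dv q p}"

lemma prime_classes_eq: "prime_classes TYPE('k) = Collect isp // prel"
proof -
  have 1: "{p \<in> carrier RR. ring_prime\<^bsub>RR\<^esub> p} = Collect isp"
    using ring_prime_isp by (auto simp: isp_def)
  have 2: "{(p, q). p \<in> Collect isp \<and> q \<in> Collect isp \<and> p \<sim>\<^bsub>RR\<^esub> q} = prel"
    by (auto simp: prel_def associated_def factor_def dv_def)
  show ?thesis unfolding prime_classes_def Let_def 1 2 ..
qed

lemma prel_equiv: "equiv (Collect isp) prel"
  by (rule equivI) (auto simp: prel_def refl_on_def sym_def trans_def intro: dv_refl dv_trans)

text \<open>The same choice as in \<open>euler_factor\<close>, so that the Euler product over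
  classes becomes one over the representatives \<open>PP\<close>.\<close>

definition rep :: "'k set \<Rightarrow> 'k" where "rep C = (SOME p. p \<in> C)"
definition PP :: "'k set" where "PP = rep ` prime_classes TYPE('k)"

lemma rep_in: "C \<in> prime_classes TYPE('k) \<Longrightarrow> rep C \<in> C"
  unfolding rep_def prime_classes_eq
  by (rule someI_ex) (use prel_equiv in_quotient_imp_non_empty in blast)

lemma rep_class: "C \<in> prime_classes TYPE('k) \<Longrightarrow> isp (rep C) \<and> C = prel `` {rep C}"
proof -
  assume C: "C \<in> prime_classes TYPE('k)"
  have r: "rep C \<in> C" by (rule rep_in[OF C])
  have C': "C \<in> Collect isp // prel" using C prime_classes_eq by simp
  have "C \<subseteq> Collect isp" using in_quotient_imp_subset[OF prel_equiv C'] .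
  hence p: "isp (rep C)" using r by auto
  then have "prel `` {rep C} \<in> Collect isp // prel" by (auto intro: quotientI)
  moreover have "rep C \<in> prel `` {rep C}" using p by (auto simp: prel_def dv_refl)
  ultimately have "C = prel `` {rep C}"
    using quotient_disj[OF prel_equiv C'] r by blast
  thus ?thesis using p by blast
qed

lemma rep_bij: "bij_betw rep (prime_classes TYPE('k)) PP"
  unfolding PP_def by (rule inj_on_imp_bij_betw) (metis inj_onI rep_class)

lemma PP_isp: "p \<in> PP \<Longrightarrow> isp p" using rep_class by (auto simp: PP_def)
lemma PP_ZK: "p \<in> PP \<Longrightarrow> p \<in> ZK" "p \<in> PP \<Longrightarrow> p \<noteq> 0" "p \<in> PP \<Longrightarrow> p \<notin> UU" using PP_isp by (auto simp: isp_def)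

lemma PP_prime: "p \<in> PP \<Longrightarrow> a \<in> ZK \<Longrightarrow> b \<in> ZK \<Longrightarrow> dv p (a * b) \<Longrightarrow> dv p a \<or> dv p b"
  using PP_isp by (auto simp: isp_def)

lemma PP_ex: "isp q \<Longrightarrow> \<exists>p\<in>PP. dv p q \<and> dv q p"
proof -
  assume q: "isp q"
  define C where "C = prel `` {q}"
  have C: "C \<in> prime_classes TYPE('k)" unfolding C_def prime_classes_eq using q by (auto intro: quotientI)
  have "rep C \<in> C" by (rule rep_in[OF C])
  thus ?thesis using C by (auto simp: C_def prel_def PP_def)
qed

lemma PP_eq: "p \<in> PP \<Longrightarrow> q \<in> PP \<Longrightarrow> dv p q \<Longrightarrow> p = q"
proof -
  assume p: "p \<in> PP" and q: "q \<in> PP" and d: "dv p q"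
  obtain C C' where C: "C \<in> prime_classes TYPE('k)" "p = rep C" "C' \<in> prime_classes TYPE('k)" "q = rep C'"
    using p q by (auto simp: PP_def)
  have "(p, q) \<in> prel" using p q d isp_assoc PP_isp by (auto simp: prel_def)
  hence "prel `` {p} = prel `` {q}" using equiv_class_eq[OF prel_equiv] by blast
  thus "p = q" using C rep_class by metis
qed

lemma nn_PP: "p \<in> PP \<Longrightarrow> nn p \<ge> 2"
proof -
  assume p: "p \<in> PP"
  have "nn p \<noteq> 0" using nn_eq_0 PP_ZK[OF p] by auto
  moreover have "nn p \<noteq> 1" using UU_iff PP_ZK[OF p] by auto
  ultimately show ?thesis by linarith
qed

text \<open>A nonunit divisor d of least norm is prime. If it does not divide b, the greatest common
  divisor g of d and b is a unit: otherwise minimality makes g an associate of d, which would then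
  divide b. The Bezout relation multiplied by a shows that d divides \<open>g * a\<close>.\<close>

lemma prime_divisor_ex:
  assumes x: "x \<in> ZK" "x \<noteq> 0" "x \<notin> UU" shows "\<exists>p\<in>PP. dv p x"
proof -
  obtain d where d: "d \<in> ZK" "dv d x" "d \<notin> UU" "\<And>e. e \<in> ZK \<Longrightarrow> dv e x \<Longrightarrow> e \<notin> UU \<Longrightarrow> nn d \<le> nn e"
    using ex_has_least_nat[of "\<lambda>d. d \<in> ZK \<and> dv d x \<and> d \<notin> UU" x nn] x dv_refl by blast
  have d0: "d \<noteq> 0" using d x by (auto simp: dv_def)
  have "isp d"
    unfolding isp_def
  proof (intro conjI ballI impI)
    fix a b assume ab: "a \<in> ZK" "b \<in> ZK" "dv d (a * b)"
    show "dv d a \<or> dv d b"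
    proof (rule disjCI)
      assume nb: "\<not> dv d b"
      obtain g u v s t where g: "g \<in> ZK" "u \<in> ZK" "v \<in> ZK" "g = u * d + v * b" "s \<in> ZK" "d = g * s" "t \<in> ZK" "b = g * t"
        using bez[OF d(1) ab(2)] by blast
      have "g \<in> UU"
      proof (rule ccontr)
        assume gU: "g \<notin> UU"
        have "dv g x" using dv_trans[OF dvI[OF g(5,6)] d(2)] .
        hence "nn d \<le> nn g" using d(4) g gU by blast
        moreover have "nn d = nn g * nn s" using nn_mult[OF g(1,5)] g(6) by metis
        moreover have "nn d > 0" using nn_eq_0[OF d(1)] d0 by simp
        ultimately have "nn s = 1" by (cases "nn s") auto
        hence sU: "s \<in> UU" using g(5) UU_iff by blast
        have "d * inverse s = g * (s * inverse s)" unfolding g(6) by (rule mult.assoc)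
        hence "g = d * inverse s" using UU_nonzero[OF sU] by (metis mult.right_neutral right_inverse)
        hence "dv d g" by (rule dvI[OF UU_ZK[OF UU_inverse[OF sU]]])
        hence "dv d (g * t)" by (rule dv_mult(1)[OF _ g(7)])
        hence "dv d b" using g(8) by metis
        thus False using nb by simp
      qed
      moreover have "dv d (g * a)"
      proof -
        have e: "g * a = d * (u * a) + v * (a * b)" unfolding g(4) by (simp only: algebra_simps)
        have "dv d (d * (u * a))" by (rule dvI[OF ZK_mult[OF g(2) ab(1)] refl])
        moreover have "dv d (v * (a * b))" by (rule dv_mult(2)[OF ab(3) g(3)])
        ultimately show ?thesis unfolding e by (rule dv_add)
      qed
      ultimately show "dv d a" using dv_unit_mult by blast
    qed
  qed (use d d0 in auto)
  then obtain p where "p \<in> PP" "dv p d" using PP_ex by blast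
  thus ?thesis using dv_trans d(2) by blast
qed

definition II :: "'k multiset set" where "II = {m. set_mset m \<subseteq> PP}"

lemma prod_mset_ZK: "m \<in> II \<Longrightarrow> prod_mset m \<in> ZK \<and> prod_mset m \<noteq> 0"
  by (induction m) (auto simp: II_def PP_ZK ZK_mult)

lemma factorization_ex: "x \<in> ZK \<Longrightarrow> x \<noteq> 0 \<Longrightarrow> \<exists>m\<in>II. \<exists>u\<in>UU. x = u * prod_mset m"
proof (induction "nn x" arbitrary: x rule: less_induct)
  case less
  show ?case
  proof (cases "x \<in> UU")
    case True
    thus ?thesis by (intro bexI[of _ "{#}"] bexI[of _ x]) (auto simp: II_def)
  next
    case False
    obtain p where p: "p \<in> PP" "dv p x" using prime_divisor_ex less False by blast
    then obtain y where y: "y \<in> ZK" "x = p * y" by (auto simp: dv_def)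
    have y0: "y \<noteq> 0" using y less by auto
    have "nn x = nn p * nn y" using y nn_mult PP_ZK p by simp
    moreover have "nn y > 0" using nn_eq_0[OF y(1)] y0 by simp
    ultimately have "nn y < nn x" using nn_PP[OF p(1)] by simp
    from less(1)[OF this y(1) y0] obtain m u where "m \<in> II" "u \<in> UU" "y = u * prod_mset m" by blast
    hence "add_mset p m \<in> II" "u \<in> UU" "x = u * prod_mset (add_mset p m)" using p y by (auto simp: II_def)
    thus ?thesis by blast
  qed
qed

lemma PP_dv_prod: "p \<in> PP \<Longrightarrow> m \<in> II \<Longrightarrow> dv p (prod_mset m) \<Longrightarrow> p \<in># m"
proof (induction m)
  case empty
  hence "dv p 1" by (simp only: prod_mset_empty)
  hence "p \<in> UU" using dv_UU[OF _ PP_ZK(1)[OF empty(1)] UU_1] by blast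
  thus ?case using PP_ZK(3)[OF empty(1)] by blast
next
  case (add q m)
  have "dv p q \<or> dv p (prod_mset m)"
    using PP_prime[OF add.prems(1)] add.prems prod_mset_ZK[of m] PP_ZK by (auto simp: II_def)
  thus ?case using add PP_eq[of p q] by (auto simp: II_def)
qed

lemma factorization_unique:
  assumes "m \<in> II" "m' \<in> II" "u \<in> UU" "u' \<in> UU" "u * prod_mset m = u' * prod_mset m'"
  shows "m = m'"
  using assms
proof (induction m arbitrary: m')
  case empty
  show ?case
  proof (rule ccontr)
    assume "{#} \<noteq> m'"
    then obtain p where p: "p \<in># m'" by (metis multiset_nonemptyE)
    hence pP: "p \<in> PP" using empty by (auto simp: II_def)
    have "dv p (prod_mset m')"
      using p empty prod_mset_ZK[of "m' - {#p#}"] by (metis II_def dvI in_diffD mem_Collect_eq prod_mset.remove subset_iff)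
    hence "dv p u" using dv_mult(2)[of p "prod_mset m'" u'] UU_ZK empty by simp
    thus False using dv_UU[of p u] PP_ZK[OF pP] empty by blast
  qed
next
  case (add p m)
  have pP: "p \<in> PP" and mI: "m \<in> II" using add.prems by (auto simp: II_def)
  have "dv p (u * prod_mset (add_mset p m))"
    using prod_mset_ZK[OF mI] UU_ZK[OF add.prems(3)] ZK_mult by (intro dvI[of "u * prod_mset m"]) auto
  hence "dv p (prod_mset m')" using dv_unit_mult add.prems by metis
  hence p: "p \<in># m'" using PP_dv_prod pP add.prems by blast
  then obtain m'' where m'': "m' = add_mset p m''" by (metis multi_member_split)
  have "p * (u * prod_mset m) = p * (u' * prod_mset m'')" using add.prems(5) m'' by (simp add: mult_ac)
  hence "u * prod_mset m = u' * prod_mset m''" using PP_ZK[OF pP] by simp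
  moreover have "m'' \<in> II" using add.prems m'' by (auto simp: II_def)
  ultimately show ?case using add.IH[OF mI _ add.prems(3,4)] m'' by simp
qed

text \<open>The ideal generated by x as a multiset of primes; units are forgotten.\<close>

definition fac :: "'k \<Rightarrow> 'k multiset" where "fac x = (THE m. m \<in> II \<and> (\<exists>u\<in>UU. x = u * prod_mset m))"

lemma facI: "m \<in> II \<Longrightarrow> u \<in> UU \<Longrightarrow> x = u * prod_mset m \<Longrightarrow> fac x = m"
  unfolding fac_def by (rule the_equality) (use factorization_unique in blast)+

lemma fac: assumes "x \<in> ZK" "x \<noteq> 0" shows "fac x \<in> II" "\<exists>u\<in>UU. x = u * prod_mset (fac x)"
proof -
  obtain m u where m: "m \<in> II" "u \<in> UU" "x = u * prod_mset m" using factorization_ex[OF assms] by blast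
  have "fac x = m" using facI[OF m] .
  thus "fac x \<in> II" "\<exists>u\<in>UU. x = u * prod_mset (fac x)" using m by auto
qed

lemma fac_mult: "x \<in> ZK \<Longrightarrow> x \<noteq> 0 \<Longrightarrow> y \<in> ZK \<Longrightarrow> y \<noteq> 0 \<Longrightarrow> fac (x * y) = fac x + fac y"
proof -
  assume x: "x \<in> ZK" "x \<noteq> 0" and y: "y \<in> ZK" "y \<noteq> 0"
  obtain u where u: "u \<in> UU" "x = u * prod_mset (fac x)" using fac(2)[OF x] by blast
  obtain v where v: "v \<in> UU" "y = v * prod_mset (fac y)" using fac(2)[OF y] by blast
  have "x * y = (u * v) * prod_mset (fac x + fac y)" by (subst u(2), subst v(2)) (simp add: mult_ac)
  moreover have "fac x + fac y \<in> II" using fac(1)[OF x] fac(1)[OF y] by (auto simp: II_def)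
  ultimately show ?thesis using facI UU_mult[OF u(1) v(1)] by blast
qed

lemma fac_UU: "u \<in> UU \<Longrightarrow> fac u = {#}" using facI[of "{#}" u u] by (simp add: II_def)
lemma fac_prod: "m \<in> II \<Longrightarrow> fac (prod_mset m) = m" using facI[of m 1] by simp
lemma fac_PP: "p \<in> PP \<Longrightarrow> fac p = {#p#}" using fac_prod[of "{#p#}"] by (simp add: II_def)

lemma fac_empty: "x \<in> ZK \<Longrightarrow> x \<noteq> 0 \<Longrightarrow> fac x = {#} \<Longrightarrow> x \<in> UU"
  using fac(2)[of x] by auto

lemma fac_power: "x \<in> ZK \<Longrightarrow> x \<noteq> 0 \<Longrightarrow> fac (x ^ n) = repeat_mset n (fac x)"
  by (induction n) (simp_all add: fac_UU fac_mult ZK_power)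

lemma nn_prod_mset: "m \<in> II \<Longrightarrow> nn (prod_mset m) = prod_mset (image_mset nn m)"
proof (induction m)
  case (add p m)
  hence "p \<in> PP" "m \<in> II" by (auto simp: II_def)
  thus ?case using add.IH prod_mset_ZK[of m] PP_ZK[of p] by (simp add: nn_mult)
qed simp

lemma PP_power_dv:
  assumes p: "p \<in> PP" and x: "x \<in> ZK" "x \<noteq> 0" shows "dv (p ^ k) x \<longleftrightarrow> k \<le> count (fac x) p"
proof
  have pZ: "p ^ k \<in> ZK" "p ^ k \<noteq> 0" using PP_ZK[OF p] ZK_power by auto
  have fp: "fac (p ^ k) = repeat_mset k {#p#}" using fac_power[of p k] PP_ZK[OF p] fac_PP[OF p] by simp
  assume "dv (p ^ k) x"
  then obtain z where z: "z \<in> ZK" "x = p ^ k * z" by (auto simp: dv_def)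
  have "z \<noteq> 0" using z x by auto
  hence "fac x = repeat_mset k {#p#} + fac z" using fac_mult[OF pZ z(1)] z fp by simp
  thus "k \<le> count (fac x) p" by simp
next
  assume k: "k \<le> count (fac x) p"
  obtain u where u: "u \<in> UU" "x = u * prod_mset (fac x)" using fac(2)[OF x] by blast
  have "replicate_mset k p \<subseteq># fac x" using k by (simp add: count_le_replicate_mset_subset_eq)
  then obtain m where m: "fac x = replicate_mset k p + m" by (metis mset_subset_eq_exists_conv)
  have "m \<in> II" using fac(1)[OF x] m by (auto simp: II_def)
  hence "u * prod_mset m \<in> ZK" using prod_mset_ZK u UU_ZK ZK_mult by blast
  moreover have "x = p ^ k * (u * prod_mset m)" by (subst u(2), subst m) (simp add: mult_ac)
  ultimately show "dv (p ^ k) x" by (rule dvI)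
qed

lemma PP_dv: "p \<in> PP \<Longrightarrow> x \<in> ZK \<Longrightarrow> x \<noteq> 0 \<Longrightarrow> dv p x \<longleftrightarrow> p \<in># fac x"
  using PP_power_dv[of p x 1] by (simp add: Suc_le_eq)

lemma eq_unit_mult: "x \<in> ZK \<Longrightarrow> x \<noteq> 0 \<Longrightarrow> y \<in> ZK \<Longrightarrow> y \<noteq> 0 \<Longrightarrow> fac x = fac y \<Longrightarrow> \<exists>u\<in>UU. x = u * y"
proof -
  assume x: "x \<in> ZK" "x \<noteq> 0" and y: "y \<in> ZK" "y \<noteq> 0" and e: "fac x = fac y"
  obtain u where u: "u \<in> UU" "x = u * prod_mset (fac x)" using fac(2)[OF x] by blast
  obtain v where v: "v \<in> UU" "y = v * prod_mset (fac y)" using fac(2)[OF y] by blast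
  have "x = (u * inverse v) * y" by (subst u(2), subst v(2)) (use UU_nonzero[OF v(1)] e in simp)
  thus ?thesis using UU_mult[OF u(1) UU_inverse[OF v(1)]] by blast
qed

end

section \<open>Absolute values\<close>

text \<open>Serves to take k-th roots of estimates with a factor linear in k. Bernoulli's inequality
  gives only linear growth of \<open>t ^ k\<close>, so its square is compared with the bound at
  \<open>2 * k\<close>.\<close>

lemma power_linear_bound_imp_le_1:
  fixes t A :: real assumes t: "t \<ge> 0" and b: "\<And>k. t ^ k \<le> A * (real k + 1)" shows "t \<le> 1"
proof (rule ccontr)
  assume "\<not> t \<le> 1"
  define s where "s = t - 1"
  have s: "s > 0" "t = 1 + s" using \<open>\<not> t \<le> 1\<close> by (auto simp: s_def)
  have A: "A \<ge> 1" using b[of 0] by simp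
  obtain k :: nat where k: "3 * A / s\<^sup>2 < real k" using reals_Archimedean2 by blast
  have k1: "k \<ge> 1" using k A s by (cases k) (auto simp: field_simps)
  have "1 + real k * s \<le> t ^ k" using Bernoulli_inequality[of s k] s by simp
  hence "(real k * s)\<^sup>2 \<le> (t ^ k)\<^sup>2" using s by (intro power_mono) auto
  also have "\<dots> = t ^ (2 * k)" by (simp add: power_mult[symmetric] mult.commute)
  also have "\<dots> \<le> A * (real (2 * k) + 1)" by (rule b)
  also have "\<dots> \<le> A * (3 * real k)" using A k1 by (intro mult_left_mono) auto
  finally have "(real k * s\<^sup>2) * real k \<le> (3 * A) * real k" by (simp add: power2_eq_square algebra_simps)
  hence "real k * s\<^sup>2 \<le> 3 * A" using k1 by (simp add: mult.commute)
  thus False using k s by (simp add: field_simps)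
qed

locale absval =
  fixes v :: "'a::field \<Rightarrow> real" assumes av: "absolute_value v"
begin

lemma nonneg: "v x \<ge> 0" and eq_0 [simp]: "v x = 0 \<longleftrightarrow> x = 0" and mult: "v (x * y) = v x * v y" and tri: "v (x + y) \<le> v x + v y"
  using av by (auto simp: absolute_value_def)

lemma v_0 [simp]: "v 0 = 0" by simp
lemma v_1 [simp]: "v 1 = 1" using mult[of 1 1] eq_0[of 1] by simp
lemma v_minus [simp]: "v (- x) = v x"
proof -
  have "v (- 1) * v (- 1) = 1" using mult[of "-1" "-1"] by simp
  hence "v (- 1) = 1" using nonneg[of "-1"] by (metis abs_of_nonneg abs_mult_self_eq real_sqrt_abs2 real_sqrt_one)
  thus ?thesis using mult[of "-1" x] by simp
qed
lemma v_diff_commute: "v (x - y) = v (y - x)" using v_minus[of "x - y"] by simp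
lemma v_pos: "x \<noteq> 0 \<Longrightarrow> v x > 0" using nonneg[of x] eq_0[of x] by linarith
lemma v_inverse: "v (inverse x) = inverse (v x)"
proof (cases "x = 0")
  case False
  hence "v x * v (inverse x) = 1" using mult[of x "inverse x"] by simp
  thus ?thesis by (rule inverse_unique[symmetric])
qed simp
lemma v_divide: "v (x / y) = v x / v y" by (simp add: divide_inverse mult v_inverse)
lemma v_power: "v (x ^ n) = v x ^ n" by (induction n) (simp_all add: mult)
lemma v_sum: "finite A \<Longrightarrow> v (sum f A) \<le> (\<Sum>a\<in>A. v (f a))"
proof (induction A rule: finite_induct)
  case (insert a A) thus ?case using tri[of "f a" "sum f A"] by simp
qed simp
lemma v_of_nat_le: "v (of_nat n) \<le> real n"
proof (induction n)
  case (Suc n) thus ?case using tri[of 1 "of_nat n"] by simp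
qed simp

text \<open>The binomial coefficients have value at most 1, so \<open>(x + y) ^ k\<close> has value
  at most k + 1 times the k-th power of the maximum; k-th roots remove the factor.\<close>

lemma ultrametric_of_bounded:
  assumes b: "\<And>n. v (of_nat n) \<le> 1" shows "v (x + y) \<le> max (v x) (v y)"
proof (cases "max (v x) (v y) = 0")
  case True
  hence "x = 0" "y = 0" using nonneg[of x] nonneg[of y] eq_0 by (metis max.cobounded1 max.cobounded2 order_antisym)+
  thus ?thesis by simp
next
  case False
  define M where "M = max (v x) (v y)"
  have M: "M > 0" using False nonneg[of x] unfolding M_def by linarith
  have "(v (x + y) / M) ^ k \<le> 1 * (real k + 1)" for k
  proof -
    have "v ((x + y) ^ k) \<le> (\<Sum>i\<le>k. v (of_nat (k choose i) * x ^ i * y ^ (k - i)))"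
      unfolding binomial_ring by (rule v_sum) simp
    also have "\<dots> \<le> (\<Sum>i\<le>k. 1 * M ^ i * M ^ (k - i))"
      unfolding mult v_power using nonneg b M
      by (intro sum_mono mult_mono power_mono mult_nonneg_nonneg zero_le_power) (auto simp: M_def)
    also have "\<dots> = (\<Sum>i\<le>k. M ^ k)" by (rule sum.cong) (auto simp flip: power_add)
    finally have "v (x + y) ^ k \<le> (real k + 1) * M ^ k" by (simp add: v_power add.commute)
    thus ?thesis using M by (simp add: power_divide field_simps)
  qed
  hence "v (x + y) / M \<le> 1" using nonneg[of "x + y"] M by (intro power_linear_bound_imp_le_1[of _ 1]) auto
  thus ?thesis using M by (simp add: M_def)
qed

text \<open>Expansion in base n: a number with j digits is a sum of j terms, each a digit of value
  at most n times a power of n.\<close>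

lemma v_digits:
  assumes n: "n \<ge> 2" and c: "c = max 1 (v (of_nat n))"
  shows "m < n ^ j \<Longrightarrow> v (of_nat m) \<le> real j * real n * c ^ j"
proof (induction j arbitrary: m)
  case (Suc j)
  have c1: "c \<ge> 1" "v (of_nat n) \<le> c" using c by auto
  have "m div n < n ^ j" using Suc.prems n by (simp add: less_mult_imp_div_less mult.commute)
  from Suc.IH[OF this] have q: "v (of_nat (m div n)) \<le> real j * real n * c ^ j" .
  have "v (of_nat m) = v (of_nat n * of_nat (m div n) + of_nat (m mod n))"
    by (metis mult_div_mod_eq of_nat_add of_nat_mult)
  also have "\<dots> \<le> v (of_nat n) * v (of_nat (m div n)) + v (of_nat (m mod n))" using tri mult by metis
  also have "\<dots> \<le> c * (real j * real n * c ^ j) + real n * c ^ Suc j"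
  proof (rule add_mono)
    show "v (of_nat n) * v (of_nat (m div n)) \<le> c * (real j * real n * c ^ j)"
      using c1 q nonneg by (intro mult_mono) auto
    have "v (of_nat (m mod n)) \<le> real (m mod n)" by (rule v_of_nat_le)
    also have "\<dots> \<le> real n * 1" using n by simp
    also have "\<dots> \<le> real n * c ^ Suc j" using c1 by (intro mult_left_mono one_le_power) auto
    finally show "v (of_nat (m mod n)) \<le> real n * c ^ Suc j" .
  qed
  also have "\<dots> = real (Suc j) * real n * c ^ Suc j" by (simp add: algebra_simps)
  finally show ?case .
qed simp

text \<open>Ostrowski's argument: expand the powers of \<open>m\<close> in base \<open>n\<close>.\<close>

lemma v_compare:
  assumes n: "n \<ge> 2" and m: "m \<ge> 2"
  shows "v (of_nat m) \<le> max 1 (v (of_nat n)) powr (ln m / ln n)"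
proof -
  define c where "c = max 1 (v (of_nat n))"
  define \<alpha> where "\<alpha> = ln (real m) / ln (real n)"
  have c: "c \<ge> 1" by (simp add: c_def)
  have \<alpha>: "\<alpha> > 0" using m n by (simp add: \<alpha>_def)
  have "(v (of_nat m) / c powr \<alpha>) ^ k \<le> (real n * c * (\<alpha> + 1)) * (real k + 1)" for k
  proof -
    define j where "j = nat \<lfloor>real k * \<alpha>\<rfloor> + 1"
    have j: "real k * \<alpha> < real j" "real j \<le> real k * \<alpha> + 1"
      using \<alpha> by (auto simp: j_def) linarith
    have "real (m ^ k) = exp (real k * \<alpha> * ln (real n))"
      using m n by (simp add: \<alpha>_def exp_of_nat_mult)
    also have "\<dots> < exp (real j * ln (real n))" using j n by simp
    also have "\<dots> = real (n ^ j)" using n by (simp add: exp_of_nat_mult)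
    finally have "m ^ k < n ^ j" by (simp only: of_nat_less_iff)
    from v_digits[OF n c_def this] have "v (of_nat m) ^ k \<le> real j * real n * c ^ j" by (simp add: v_power)
    also have "\<dots> \<le> ((\<alpha> + 1) * (real k + 1)) * real n * (c * (c powr \<alpha>) ^ k)"
    proof (intro mult_mono)
      show "real j \<le> (\<alpha> + 1) * (real k + 1)" using j \<alpha> by (simp add: algebra_simps)
      have "c ^ j = c powr real j" using c by (simp add: powr_realpow)
      also have "\<dots> \<le> c powr (real k * \<alpha> + 1)" using j c by (intro powr_mono) auto
      also have "\<dots> = c * (c powr \<alpha>) ^ k" using c by (simp add: powr_add powr_powr mult.commute flip: powr_realpow)
      finally show "c ^ j \<le> c * (c powr \<alpha>) ^ k" .
    qed (use c \<alpha> in auto)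
    finally have "v (of_nat m) ^ k \<le> (real n * c * (\<alpha> + 1)) * (real k + 1) * (c powr \<alpha>) ^ k" by (simp add: mult_ac)
    thus ?thesis using c by (simp add: power_divide divide_le_eq)
  qed
  hence "v (of_nat m) / c powr \<alpha> \<le> 1" using nonneg[of "of_nat m"] c
    by (intro power_linear_bound_imp_le_1[of _ "real n * c * (\<alpha> + 1)"]) auto
  hence "v (of_nat m) \<le> c powr \<alpha>" using c by (subst (asm) pos_divide_le_eq) auto
  thus ?thesis by (simp add: c_def \<alpha>_def)
qed

text \<open>A single n from 2 on with value at most 1 would bound all values by 1, through
  \<open>v_compare\<close>. Otherwise comparison in both directions makes the quotient of
  \<open>ln (v (of_nat n))\<close> by \<open>ln n\<close> constant; it is the exponent s.\<close>

lemma archimedean_of_nat: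
  assumes ex: "\<exists>n. v (of_nat n) > 1"
  obtains s where "s > 0" "\<And>n. n > 0 \<Longrightarrow> v (of_nat n) = real n powr s"
proof -
  obtain m0 where m0: "v (of_nat m0) > 1" using ex by blast
  have m02: "m0 \<ge> 2" using m0 by (cases "m0 = 0 \<or> m0 = 1") auto
  have gt1: "v (of_nat n) > 1" if n: "n \<ge> 2" for n
  proof (rule ccontr)
    assume "\<not> v (of_nat n) > 1"
    hence "max 1 (v (of_nat n)) = 1" by simp
    thus False using v_compare[OF n m02] m0 by simp
  qed
  define s where "s = ln (v (of_nat 2)) / ln 2"
  have s: "s > 0" using gt1[of 2] by (simp add: s_def)
  have ratio: "ln (v (of_nat m)) / ln m \<le> ln (v (of_nat n)) / ln n" if n: "n \<ge> 2" and m: "m \<ge> 2" for m n :: nat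
  proof -
    have "v (of_nat m) \<le> v (of_nat n) powr (ln m / ln n)" using v_compare[OF n m] gt1[OF n] by (simp add: max_def)
    hence "ln (v (of_nat m)) \<le> ln (v (of_nat n) powr (ln m / ln n))" using gt1[OF m] by (intro ln_mono) auto
    also have "\<dots> = ln m / ln n * ln (v (of_nat n))" using gt1[OF n] by (simp add: ln_powr)
    finally show ?thesis using n m by (simp add: field_simps)
  qed
  have "v (of_nat n) = real n powr s" if n: "n > 0" for n
  proof (cases "n = 1")
    case False
    hence n2: "n \<ge> 2" using n by simp
    have "ln (v (of_nat n)) / ln n = s" using ratio[OF n2, of 2] ratio[of 2 n] n2 by (simp add: s_def)
    hence "ln (v (of_nat n)) = s * ln n" using n2 by (simp add: field_simps)
    hence "exp (ln (v (of_nat n))) = exp (s * ln n)" by simp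
    thus ?thesis using gt1[OF n2] n2 by (simp add: powr_def)
  qed simp
  thus ?thesis using that s by blast
qed

end

lemma absval_equiv: "equiv nontrivial_absolute_values (absolute_value_equiv :: (('k::field \<Rightarrow> real) \<times> ('k \<Rightarrow> real)) set)"
proof (rule equivI)
  show "absolute_value_equiv \<subseteq> nontrivial_absolute_values \<times> nontrivial_absolute_values"
    by (auto simp: absolute_value_equiv_def)
  have nn: "v x \<ge> 0" if "v \<in> nontrivial_absolute_values" for v :: "'k \<Rightarrow> real" and x
    using that by (auto simp: nontrivial_absolute_values_def absolute_value_def)
  show "refl_on nontrivial_absolute_values (absolute_value_equiv :: (('k \<Rightarrow> real) \<times> ('k \<Rightarrow> real)) set)"
  proof (rule refl_onI)
    fix v :: "'k \<Rightarrow> real" assume v: "v \<in> nontrivial_absolute_values"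
    hence "\<forall>x. v x = v x powr 1" using nn[OF v] by simp
    thus "(v, v) \<in> absolute_value_equiv" unfolding absolute_value_equiv_def using v by (blast intro: zero_less_one)
  qed
  show "sym (absolute_value_equiv :: (('k \<Rightarrow> real) \<times> ('k \<Rightarrow> real)) set)"
  proof (rule symI)
    fix v w :: "'k \<Rightarrow> real" assume "(v, w) \<in> absolute_value_equiv"
    then obtain e where e: "v \<in> nontrivial_absolute_values" "w \<in> nontrivial_absolute_values" "e > 0" "\<And>x. w x = v x powr e"
      by (auto simp: absolute_value_equiv_def)
    have "v x = w x powr (1 / e)" for x using e nn[OF e(1)] by (simp add: powr_powr)
    thus "(w, v) \<in> absolute_value_equiv" using e by (auto simp: absolute_value_equiv_def intro!: exI[of _ "1 / e"])
  qed
  show "trans (absolute_value_equiv :: (('k \<Rightarrow> real) \<times> ('k \<Rightarrow> real)) set)"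
  proof (rule transI)
    fix u v w :: "'k \<Rightarrow> real" assume "(u, v) \<in> absolute_value_equiv" "(v, w) \<in> absolute_value_equiv"
    then obtain e f where e: "u \<in> nontrivial_absolute_values" "w \<in> nontrivial_absolute_values" "e > 0" "f > 0"
       "\<And>x. v x = u x powr e" "\<And>x. w x = v x powr f"
      by (auto simp: absolute_value_equiv_def)
    have "w x = u x powr (e * f)" for x using e by (simp add: powr_powr)
    thus "(u, w) \<in> absolute_value_equiv" using e by (auto simp: absolute_value_equiv_def intro!: exI[of _ "e * f"])
  qed
qed

section \<open>Absolute values of the field and the classification of its places\<close>

context cn1
begin

definition dn :: "'k \<Rightarrow> nat" where "dn x = (SOME n. n > 0 \<and> of_nat n * x \<in> ZK)"

lemma dn: "dn x > 0" "of_nat (dn x) * x \<in> ZK"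
proof -
  have "\<exists>n>0. of_nat n * x \<in> ZK" using ZK_frac by blast
  hence "dn x > 0 \<and> of_nat (dn x) * x \<in> ZK" unfolding dn_def by (rule someI_ex)
  thus "dn x > 0" "of_nat (dn x) * x \<in> ZK" by auto
qed

definition ordp :: "'k \<Rightarrow> 'k \<Rightarrow> int" where
  "ordp p x = int (count (fac (of_nat (dn x) * x)) p) - int (count (fac (of_nat (dn x))) p)"

text \<open>The order is independent of the denominator chosen by \<open>dn\<close>, so a fraction
  may be written in any convenient way.\<close>

lemma ordp_frac:
  assumes a: "a \<in> ZK" "a \<noteq> 0" and b: "b \<in> ZK" "b \<noteq> 0"
  shows "ordp p (a / b) = int (count (fac a) p) - int (count (fac b) p)"
proof -
  define n where "n = (of_nat (dn (a / b)) :: 'k)"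
  have n: "n \<in> ZK" "n \<noteq> 0" "n * (a / b) \<in> ZK" "n * (a / b) \<noteq> 0" using dn[of "a / b"] a b by (auto simp: n_def)
  have "fac (n * (a / b)) + fac b = fac n + fac a"
    using fac_mult[OF n(3,4) b] fac_mult[OF n(1,2) a] b by simp
  hence "count (fac (n * (a / b)) + fac b) p = count (fac n + fac a) p" by simp
  thus ?thesis unfolding ordp_def n_def by simp
qed

lemma ordp_ZK: "a \<in> ZK \<Longrightarrow> a \<noteq> 0 \<Longrightarrow> ordp p a = int (count (fac a) p)"
  using ordp_frac[of a 1 p] by (simp add: fac_UU)

lemma frac_ex: obtains a b where "a \<in> ZK" "b \<in> ZK" "b \<noteq> 0" "x = a / b"
proof -
  have "of_nat (dn x) * x \<in> ZK" "(of_nat (dn x) :: 'k) \<noteq> 0" using dn[of x] by auto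
  thus ?thesis using that[of "of_nat (dn x) * x" "of_nat (dn x)"] by simp
qed

lemma ordp_mult: "x \<noteq> 0 \<Longrightarrow> y \<noteq> 0 \<Longrightarrow> ordp p (x * y) = ordp p x + ordp p y"
proof -
  assume x: "x \<noteq> 0" and y: "y \<noteq> 0"
  obtain a b where ab: "a \<in> ZK" "b \<in> ZK" "b \<noteq> 0" "x = a / b" by (rule frac_ex)
  obtain c d where cd: "c \<in> ZK" "d \<in> ZK" "d \<noteq> 0" "y = c / d" by (rule frac_ex)
  have "x * y = (a * c) / (b * d)" by (simp add: ab cd)
  thus ?thesis using ab cd x y ordp_frac[of "a * c" "b * d"] ordp_frac[of a b] ordp_frac[of c d]
    by (simp add: fac_mult ZK_mult)
qed

text \<open>The base is the norm of p: this normalisation is the one that the norm to the p-adic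
  field produces.\<close>

definition pv :: "'k \<Rightarrow> 'k \<Rightarrow> real" where
  "pv p x = (if x = 0 then 0 else real (nn p) powi (- ordp p x))"

lemma pv_ZK: "a \<in> ZK \<Longrightarrow> a \<noteq> 0 \<Longrightarrow> pv p a = (1 / real (nn p)) ^ count (fac a) p"
  by (simp add: pv_def ordp_ZK power_int_minus power_one_over inverse_eq_divide)

lemma pv_ultra:
  assumes p: "p \<in> PP" shows "pv p (x + y) \<le> max (pv p x) (pv p y)"
proof (cases "x = 0 \<or> y = 0 \<or> x + y = 0")
  case True
  thus ?thesis using nn_PP[OF p] by (auto simp: pv_def max_def)
next
  case False
  obtain a b where ab: "a \<in> ZK" "b \<in> ZK" "b \<noteq> 0" "x = a / b" by (rule frac_ex)
  obtain c d where cd: "c \<in> ZK" "d \<in> ZK" "d \<noteq> 0" "y = c / d" by (rule frac_ex)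
  define A B E where "A = a * d" and "B = c * b" and "E = b * d"
  have Z: "A \<in> ZK" "B \<in> ZK" "E \<in> ZK" "A + B \<in> ZK" using ab cd by (auto simp: A_def B_def E_def intro: ZK_mult ZK_add)
  have xy: "x = A / E" "y = B / E" "x + y = (A + B) / E" using ab cd by (auto simp: A_def B_def E_def field_simps)
  have nz: "A \<noteq> 0" "B \<noteq> 0" "E \<noteq> 0" "A + B \<noteq> 0" using False ab cd xy by auto
  define k where "k = min (count (fac A) p) (count (fac B) p)"
  have "dv (p ^ k) A" "dv (p ^ k) B" using PP_power_dv[OF p] Z nz by (auto simp: k_def)
  hence "dv (p ^ k) (A + B)" by (rule dv_add)
  hence "k \<le> count (fac (A + B)) p" using PP_power_dv[OF p Z(4) nz(4)] by simp
  hence "ordp p (x + y) \<ge> min (ordp p x) (ordp p y)"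
    unfolding xy(1) xy(2) xy(3)[unfolded xy(1,2)] ordp_frac[OF Z(1) nz(1) Z(3) nz(3)] ordp_frac[OF Z(2) nz(2) Z(3) nz(3)] ordp_frac[OF Z(4) nz(4) Z(3) nz(3)]
    by (auto simp: k_def)
  hence "- ordp p (x + y) \<le> - ordp p x \<or> - ordp p (x + y) \<le> - ordp p y" by linarith
  moreover have "real (nn p) \<ge> 1" using nn_PP[OF p] by simp
  ultimately have "pv p (x + y) \<le> pv p x \<or> pv p (x + y) \<le> pv p y"
    using False by (auto simp: pv_def intro: power_int_increasing)
  thus ?thesis by (auto simp: max_def)
qed

lemma pv_absval: assumes p: "p \<in> PP" shows "absolute_value (pv p)"
proof -
  have N: "real (nn p) > 0" using nn_PP[OF p] by simp
  have nonneg: "pv p x \<ge> 0" for x using N by (simp add: pv_def)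
  have "pv p (x + y) \<le> pv p x + pv p y" for x y
    using pv_ultra[OF p, of x y] nonneg[of x] nonneg[of y] by linarith
  moreover have "pv p (x * y) = pv p x * pv p y" for x y
    using N by (auto simp: pv_def ordp_mult simp flip: power_int_add)
  moreover have "pv p x = 0 \<longleftrightarrow> x = 0" for x using N by (auto simp: pv_def)
  ultimately show ?thesis unfolding absolute_value_def using nonneg by blast
qed

lemma pv_PP: "p \<in> PP \<Longrightarrow> pv p p = 1 / real (nn p)"
  using pv_ZK[of p p] PP_ZK[of p] fac_PP[of p] by simp

lemma pv_PP_other: "p \<in> PP \<Longrightarrow> q \<in> PP \<Longrightarrow> p \<noteq> q \<Longrightarrow> pv p q = 1"
  using pv_ZK[of q p] PP_ZK[of q] fac_PP[of q] by simp

lemma pv_nontrivial: "p \<in> PP \<Longrightarrow> pv p \<in> nontrivial_absolute_values"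
  unfolding nontrivial_absolute_values_def using pv_absval[of p] pv_PP[of p] PP_ZK(2)[of p] nn_PP[of p]
  by (auto intro!: exI[of _ p])

definition av :: "'k \<Rightarrow> real" where "av x = cmod (sg x)"

lemma av_absval: "absolute_value av"
proof -
  have "sg x = 0 \<longleftrightarrow> x = 0" for x
  proof -
    have "(cmod (sg x))\<^sup>2 = 0 \<longleftrightarrow> qn x = 0" unfolding sg_norm by simp
    thus ?thesis by simp
  qed
  thus ?thesis unfolding absolute_value_def av_def by (auto simp: sg_simps norm_mult norm_triangle_ineq)
qed

lemma av_of_nat: "av (of_nat n) = real n" by (simp add: av_def sg_simps)

lemma av_nontrivial: "av \<in> nontrivial_absolute_values"
  unfolding nontrivial_absolute_values_def using av_absval av_of_nat[of 2] by (auto intro!: exI[of _ 2])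

text \<open>Integers of the field satisfy monic quadratic equations over the rational integers, so
  their value is at most 1, and units have value 1. By nontriviality some prime has value below 1,
  and only one does, since Bezout for two of them would give a unit of value below 1. The order at
  that prime then determines v.\<close>

lemma ostrowski_nonarch:
  assumes v: "v \<in> nontrivial_absolute_values" and b: "\<And>n. v (of_nat n) \<le> 1"
  shows "\<exists>p\<in>PP. (pv p, v) \<in> absolute_value_equiv"
proof -
  interpret V: absval v using v by unfold_locales (simp add: nontrivial_absolute_values_def)
  have ultra: "v (x + y) \<le> max (v x) (v y)" for x y by (rule V.ultrametric_of_bounded[OF b])
  have int: "v (of_int n) \<le> 1" for n
    using b by (cases n rule: int_cases2) (auto simp: V.v_minus)
  have Z: "v x \<le> 1" if xZ: "x \<in> ZK" for x
  proof (rule ccontr)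
    assume "\<not> v x \<le> 1"
    hence x1: "v x > 1" by simp
    obtain t n :: int where tn: "2 * ra x = of_int t" "qn x = of_int n"
      using xZ unfolding ZK_def algebraic_int_iff mem_Collect_eq Ints_def by blast
    have "v (x * x) = v (of_int t * x + (- of_int n))" using quadratic_eq[of x] unfolding tn by simp
    also have "\<dots> \<le> max (v (of_int t * x)) (v (- of_int n))" by (rule ultra)
    also have "\<dots> \<le> v x" using int[of t] int[of n] x1 V.nonneg[of x]
      by (auto simp: V.mult V.v_minus intro: mult_left_le_one_le V.nonneg)
    finally have "v x * v x \<le> v x * 1" by (simp add: V.mult)
    thus False using x1 by simp
  qed
  have U: "v u = 1" if "u \<in> UU" for u
  proof -
    have "v u * v (inverse u) = 1" using UU_nonzero[OF that] by (simp flip: V.mult)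
    thus ?thesis using Z[OF UU_ZK[OF that]] Z[OF UU_ZK[OF UU_inverse[OF that]]] V.nonneg[of u] V.nonneg[of "inverse u"]
      by (smt (verit) mult_left_le mult_right_le_one_le)
  qed
  have prodm: "v (prod_mset m) = prod_mset (image_mset v m)" for m by (induction m) (auto simp: V.mult)
  have "\<exists>p\<in>PP. v p < 1"
  proof (rule ccontr)
    assume "\<not> ?thesis"
    hence one: "v p = 1" if "p \<in> PP" for p using Z[OF PP_ZK(1)[OF that]] that by force
    have ZK1: "v x = 1" if x: "x \<in> ZK" "x \<noteq> 0" for x
    proof -
      obtain u where u: "u \<in> UU" "x = u * prod_mset (fac x)" using fac(2)[OF x] by blast
      have "image_mset v (fac x) = image_mset (\<lambda>_. 1) (fac x)"
        by (rule image_mset_cong) (use fac(1)[OF x] one in \<open>auto simp: II_def\<close>)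
      hence "v (prod_mset (fac x)) = 1" unfolding prodm by simp
      thus ?thesis by (subst u(2)) (simp add: V.mult U[OF u(1)])
    qed
    have "v x = 1" if "x \<noteq> 0" for x
    proof -
      obtain a b where ab: "a \<in> ZK" "b \<in> ZK" "b \<noteq> 0" "x = a / b" by (rule frac_ex)
      thus ?thesis using that ZK1[of a] ZK1[of b] by (simp add: V.v_divide)
    qed
    thus False using v by (auto simp: nontrivial_absolute_values_def)
  qed
  then obtain p where p: "p \<in> PP" "v p < 1" by blast
  have other: "v q = 1" if q: "q \<in> PP" "q \<noteq> p" for q
  proof (rule ccontr)
    assume "v q \<noteq> 1"
    hence q1: "v q < 1" using Z[OF PP_ZK(1)[OF q(1)]] by simp
    obtain g a b c d where g: "g \<in> ZK" "a \<in> ZK" "b \<in> ZK" "g = a * p + b * q" "c \<in> ZK" "p = g * c" "d \<in> ZK" "q = g * d"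
      using bez[OF PP_ZK(1)[OF p(1)] PP_ZK(1)[OF q(1)]] by blast
    have nz: "g \<noteq> 0" "c \<noteq> 0" "d \<noteq> 0" using g(6,8) PP_ZK(2)[OF p(1)] PP_ZK(2)[OF q(1)] by auto
    have "{#p#} = fac g + fac c" "{#q#} = fac g + fac d"
      using fac_mult[OF g(1) nz(1) g(5) nz(2)] fac_mult[OF g(1) nz(1) g(7) nz(3)] g(6,8) fac_PP[OF p(1)] fac_PP[OF q(1)] by metis+
    hence "fac g \<subseteq># {#p#}" "fac g \<subseteq># {#q#}" by (metis mset_subset_eq_add_left)+
    hence "fac g = {#}" using q(2) by (metis add_mset_eq_single multi_self_add_other_not_self mset_subset_eqD multiset_nonemptyE singletonD set_mset_add_mset_insert set_mset_empty)
    hence gU: "g \<in> UU" using fac_empty g nz by blast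
    have "v g \<le> max (v (a * p)) (v (b * q))" unfolding g(4) by (rule ultra)
    moreover have "v (a * p) < 1" "v (b * q) < 1"
      using Z[OF g(2)] Z[OF g(3)] p(2) q1 V.nonneg[of p] V.nonneg[of q] V.nonneg[of a] V.nonneg[of b]
      by (simp_all add: V.mult) (smt (verit) mult_left_le_one_le)+
    ultimately show False using U[OF gU] by linarith
  qed
  have ZKv: "v x = v p ^ count (fac x) p" if x: "x \<in> ZK" "x \<noteq> 0" for x
  proof -
    obtain u where u: "u \<in> UU" "x = u * prod_mset (fac x)" using fac(2)[OF x] by blast
    have "v (prod_mset m) = v p ^ count m p" if "m \<in> II" for m
      using that
    proof (induction m)
      case (add q m)
      hence "q \<in> PP" "m \<in> II" by (auto simp: II_def)
      thus ?case using add.IH other[of q] by (cases "q = p") (auto simp: V.mult)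
    qed simp
    thus ?thesis using fac(1)[OF x] by (subst u(2)) (simp add: V.mult U[OF u(1)])
  qed
  have vp: "v p > 0" using V.v_pos PP_ZK(2)[OF p(1)] by blast
  have N: "real (nn p) > 1" using nn_PP[OF p(1)] by simp
  \<comment> \<open>The exponent for which v and \<open>pv p powr e\<close> agree at p, where
    \<open>pv p\<close> takes the value \<open>1 / nn p\<close>.\<close>
  define e where "e = - ln (v p) / ln (real (nn p))"
  have e: "e > 0" unfolding e_def using vp p(2) N by (intro divide_pos_pos) auto
  have vpe: "v p = (1 / real (nn p)) powr e"
  proof -
    have "(1 / real (nn p)) powr e = exp (e * ln (1 / real (nn p)))" using N by (simp add: powr_def)
    also have "e * ln (1 / real (nn p)) = ln (v p)" using N by (simp add: e_def ln_div)
    finally show ?thesis using vp by simp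
  qed
  have ZKe: "v x = pv p x powr e" if x: "x \<in> ZK" "x \<noteq> 0" for x
    unfolding ZKv[OF x] pv_ZK[OF x] vpe using N by (simp add: powr_powr powr_realpow[symmetric] mult.commute)
  have "v x = pv p x powr e" for x
  proof (cases "x = 0")
    case False
    interpret Q: absval "pv p" by unfold_locales (rule pv_absval[OF p(1)])
    obtain a b where ab: "a \<in> ZK" "b \<in> ZK" "b \<noteq> 0" "x = a / b" by (rule frac_ex)
    thus ?thesis using False ZKe[of a] ZKe[of b] Q.nonneg by (simp add: V.v_divide Q.v_divide powr_divide)
  qed (simp add: pv_def)
  hence "(pv p, v) \<in> absolute_value_equiv"
    using e v pv_nontrivial[OF p(1)] by (auto simp: absolute_value_equiv_def)
  thus ?thesis using p by blast
qed

text \<open>On the rationals v is a power s of the usual absolute value. Both coordinates of y are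
  at most \<open>av y\<close> in absolute value, so
  \<open>v y \<le> (1 + v \<delta>) * av y powr s\<close>. Applied to powers of x the estimate loses
  its constant; applied to \<open>inverse x\<close> it turns into an equality.\<close>

lemma ostrowski_arch:
  assumes v: "v \<in> nontrivial_absolute_values" and b: "\<exists>n. v (of_nat n) > 1"
  shows "(av, v) \<in> absolute_value_equiv"
proof -
  interpret V: absval v using v by unfold_locales (simp add: nontrivial_absolute_values_def)
  interpret A: absval av by unfold_locales (rule av_absval)
  obtain s where s: "s > 0" "\<And>n. n > 0 \<Longrightarrow> v (of_nat n) = real n powr s" by (rule V.archimedean_of_nat[OF b]) blast
  have int: "v (of_int n) = \<bar>real_of_int n\<bar> powr s" for n
    using s(2)[of "nat \<bar>n\<bar>"] by (cases "n \<ge> 0"; cases "n = 0") (auto simp: V.v_minus[of "of_int n", symmetric] simp del: V.v_minus)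
  have rat: "v (of_rat q) = \<bar>of_rat q\<bar> powr s" for q
  proof -
    obtain a c where q: "q = Fract a c" "c > 0" by (cases q) auto
    thus ?thesis by (simp add: of_rat_rat V.v_divide int powr_divide abs_div)
  qed
  have le: "v x \<le> av x powr s" for x
  proof (cases "x = 0")
    case False
    have a0: "av x > 0" using A.v_pos[OF False] .
    hence P: "av x powr s > 0" using False by simp
    have "(v x / av x powr s) ^ k \<le> (1 + v \<delta>) * (real k + 1)" for k
    proof -
      have pw: "(av x ^ k) powr s = (av x powr s) ^ k"
        by (simp only: powr_realpow[OF a0, symmetric] powr_realpow[OF P, symmetric] powr_powr mult.commute)
      define y where "y = x ^ k"
      have D1: "sqrt (- of_int D) \<ge> 1" using Dneg by (simp add: real_le_rsqrt)
      have "\<bar>of_rat (ra y)\<bar> \<le> av y" using abs_Re_le_cmod[of "sg y"] by (simp add: sg_Re_Im av_def)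
      hence 1: "v (of_rat (ra y)) \<le> av y powr s" unfolding rat using s by (intro powr_mono2) auto
      have "\<bar>of_rat (rb y) * 1\<bar> \<le> \<bar>of_rat (rb y) * sqrt (- of_int D)\<bar>"
        unfolding abs_mult using D1 by (intro mult_left_mono) auto
      also have "\<dots> \<le> av y" using abs_Im_le_cmod[of "sg y"] by (simp add: sg_Re_Im av_def)
      finally have 2: "v (of_rat (rb y)) \<le> av y powr s" unfolding rat using s by (intro powr_mono2) auto
      have "v y \<le> v (of_rat (ra y)) + v (of_rat (rb y)) * v \<delta>"
        using V.tri[of "of_rat (ra y)" "of_rat (rb y) * \<delta>"] coord[of y] by (simp add: V.mult)
      also have "\<dots> \<le> av y powr s + av y powr s * v \<delta>"
        using 1 2 V.nonneg by (intro add_mono mult_right_mono) auto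
      finally have "v x ^ k \<le> (1 + v \<delta>) * (av x powr s) ^ k"
        unfolding y_def V.v_power A.v_power pw by (simp add: algebra_simps)
      hence "(v x / av x powr s) ^ k \<le> (1 + v \<delta>) * 1"
        unfolding power_divide using P by (subst pos_divide_le_eq) auto
      also have "\<dots> \<le> (1 + v \<delta>) * (real k + 1)"
        using V.nonneg[of \<delta>] by (intro mult_left_mono) auto
      finally show ?thesis .
    qed
    hence "v x / av x powr s \<le> 1" using V.nonneg[of x] by (intro power_linear_bound_imp_le_1[of _ "1 + v \<delta>"]) auto
    thus ?thesis using a0 by (subst (asm) pos_divide_le_eq) auto
  qed simp
  have "v x = av x powr s" for x
  proof (cases "x = 0")
    case False
    have "inverse (v x) \<le> inverse (av x powr s)"
      using le[of "inverse x"] A.nonneg[of x] unfolding V.v_inverse A.v_inverse by (simp add: powr_divide divide_inverse inverse_powr)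
    moreover have "av x powr s > 0" using A.v_pos[OF False] False by simp
    ultimately have "av x powr s \<le> v x" using V.v_pos[OF False] by (simp add: inverse_le_iff_le)
    thus ?thesis using le[of x] by simp
  qed simp
  thus ?thesis using s v av_nontrivial by (auto simp: absolute_value_equiv_def)
qed

definition cls :: "('k \<Rightarrow> real) \<Rightarrow> ('k \<Rightarrow> real) set" where "cls v = absolute_value_equiv `` {v}"

lemma places_eq: "places TYPE('k) = insert (cls av) ((\<lambda>p. cls (pv p)) ` PP)"
proof -
  have "cls v \<in> insert (cls av) ((\<lambda>p. cls (pv p)) ` PP)" if v: "v \<in> nontrivial_absolute_values" for v
  proof (cases "\<exists>n. v (of_nat n) > 1")
    case True
    have "cls v = cls av" unfolding cls_def using equiv_class_eq[OF absval_equiv ostrowski_arch[OF v True]] by (rule sym)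
    thus ?thesis by blast
  next
    case False
    hence "v (of_nat n) \<le> 1" for n by (meson not_le)
    from ostrowski_nonarch[OF v this] obtain p where p: "p \<in> PP" "(pv p, v) \<in> absolute_value_equiv" by blast
    have "cls v = cls (pv p)" unfolding cls_def using equiv_class_eq[OF absval_equiv p(2)] by (rule sym)
    thus ?thesis using p(1) by blast
  qed
  moreover have "cls v \<in> places TYPE('k)" if "v \<in> nontrivial_absolute_values" for v
    using that unfolding places_def cls_def by (rule quotientI)
  ultimately show ?thesis using av_nontrivial pv_nontrivial
    by (auto simp: places_def quotient_def cls_def)
qed

lemma in_cls: "v' \<in> cls v \<Longrightarrow> \<exists>e>0. \<forall>x. v' x = v x powr e" by (auto simp: cls_def absolute_value_equiv_def)

lemma cls_self: "v \<in> nontrivial_absolute_values \<Longrightarrow> v \<in> cls v"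
  using absval_equiv by (auto simp: cls_def equiv_def refl_on_def)

lemma nonarch_cls_pv: "p \<in> PP \<Longrightarrow> nonarchimedean (cls (pv p))"
  unfolding nonarchimedean_def
proof (intro ballI allI)
  fix v' x y assume p: "p \<in> PP" and v': "v' \<in> cls (pv p)"
  then obtain e where e: "e > 0" "\<And>x. v' x = pv p x powr e" using in_cls by blast
  interpret Q: absval "pv p" by unfold_locales (rule pv_absval[OF p])
  have "pv p (x + y) \<le> pv p x \<or> pv p (x + y) \<le> pv p y" using pv_ultra[OF p, of x y] by (auto simp: max_def split: if_splits)
  hence "v' (x + y) \<le> v' x \<or> v' (x + y) \<le> v' y" unfolding e(2) using e(1) Q.nonneg by (auto intro: powr_mono2)
  thus "v' (x + y) \<le> max (v' x) (v' y)" by auto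
qed

lemma arch_cls_av: "\<not> nonarchimedean (cls av)"
proof
  assume "nonarchimedean (cls av)"
  hence "av (1 + 1) \<le> max (av 1) (av 1)" using cls_self[OF av_nontrivial] unfolding nonarchimedean_def by blast
  thus False using av_of_nat[of 2] av_of_nat[of 1] by simp
qed

lemma cls_pv_inj: "inj_on (\<lambda>p. cls (pv p)) PP"
proof (rule inj_onI, rule ccontr)
  fix p q assume p: "p \<in> PP" and q: "q \<in> PP" and e: "cls (pv p) = cls (pv q)" and ne: "p \<noteq> q"
  have "pv p \<in> cls (pv q)" using cls_self[OF pv_nontrivial[OF p]] e by simp
  then obtain s where "pv p p = pv q p powr s" using in_cls by blast
  thus False using pv_PP[OF p] pv_PP_other[OF q p] ne nn_PP[OF p] by simp
qed

end

section \<open>Completions\<close>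

locale uval = absval v for v :: "'a::field \<Rightarrow> real" +
  assumes ultra: "v (x + y) \<le> max (v x) (v y)"
begin

lemma ultra_diff: "v (x - y) \<le> max (v x) (v y)" using ultra[of x "- y"] by simp

lemma v_eq_of_close: assumes "v (x - y) < v x" shows "v y = v x"
proof -
  have "v y \<le> max (v x) (v (x - y))" using ultra_diff[of x "x - y"] by simp
  moreover have "v x \<le> max (v (x - y)) (v y)" using ultra[of "x - y" y] by simp
  ultimately show ?thesis using assms by linarith
qed

definition Cau :: "(nat \<Rightarrow> 'a) \<Rightarrow> bool" where
  "Cau s \<longleftrightarrow> (\<forall>e>0. \<exists>M. \<forall>m\<ge>M. \<forall>n\<ge>M. v (s m - s n) < e)"

definition Nul :: "(nat \<Rightarrow> 'a) \<Rightarrow> bool" where "Nul s \<longleftrightarrow> (\<lambda>n. v (s n)) \<longlonglongrightarrow> 0"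

lemma Nul_iff: "Nul s \<longleftrightarrow> (\<forall>e>0. \<exists>M. \<forall>n\<ge>M. v (s n) < e)"
  unfolding Nul_def LIMSEQ_iff using nonneg by (simp add: abs_of_nonneg)

lemma NulD: "Nul s \<Longrightarrow> e > 0 \<Longrightarrow> \<exists>M. \<forall>n\<ge>M. v (s n) < e" by (auto simp: Nul_iff)
lemma CauD: "Cau s \<Longrightarrow> e > 0 \<Longrightarrow> \<exists>M. \<forall>m\<ge>M. \<forall>n\<ge>M. v (s m - s n) < e" by (auto simp: Cau_def)

lemma Nul_zero [simp]: "Nul (\<lambda>n. 0)" by (simp add: Nul_def)
lemma Cau_const [simp]: "Cau (\<lambda>n. x)" by (simp add: Cau_def)

lemma Nul_mono:
  assumes "Nul s" and le: "\<And>n. v (t n) \<le> C * v (s n)" shows "Nul t"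
proof -
  have "(\<lambda>n. C * v (s n)) \<longlonglongrightarrow> C * 0" using assms(1) unfolding Nul_def by (rule tendsto_mult_left)
  hence "(\<lambda>n. C * v (s n)) \<longlonglongrightarrow> 0" by simp
  from tendsto_sandwich[OF _ _ tendsto_const this] show ?thesis unfolding Nul_def using le nonneg by simp
qed

lemma Nul_add: assumes "Nul s" "Nul t" shows "Nul (\<lambda>n. s n + t n)"
proof -
  have "(\<lambda>n. v (s n) + v (t n)) \<longlonglongrightarrow> 0 + 0" using assms unfolding Nul_def by (rule tendsto_add)
  hence "(\<lambda>n. v (s n) + v (t n)) \<longlonglongrightarrow> 0" by simp
  from tendsto_sandwich[OF _ _ tendsto_const this] show ?thesis unfolding Nul_def using tri nonneg by simp
qed

lemma Nul_minus: "Nul s \<Longrightarrow> Nul (\<lambda>n. - s n)" by (simp add: Nul_def)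
lemma Nul_diff: "Nul s \<Longrightarrow> Nul t \<Longrightarrow> Nul (\<lambda>n. s n - t n)" using Nul_add[OF _ Nul_minus, of s t] by simp

lemma Nul_const: "Nul (\<lambda>n. x) \<longleftrightarrow> x = 0" by (simp add: Nul_def LIMSEQ_const_iff)

lemma Cau_mono:
  assumes s: "Cau s" and le: "\<And>m n. v (t m - t n) \<le> C * v (s m - s n)" shows "Cau t"
  unfolding Cau_def
proof (intro allI impI)
  fix e :: real assume e: "e > 0"
  have C: "\<bar>C\<bar> + 1 > 0" by simp
  obtain M where M: "\<forall>m\<ge>M. \<forall>n\<ge>M. v (s m - s n) < e / (\<bar>C\<bar> + 1)" using CauD[OF s, of "e / (\<bar>C\<bar> + 1)"] e C by auto
  have "v (t m - t n) < e" if "m \<ge> M" "n \<ge> M" for m n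
  proof -
    have "v (t m - t n) \<le> (\<bar>C\<bar> + 1) * v (s m - s n)"
      using le[of m n] by (rule order_trans) (intro mult_right_mono nonneg, simp)
    also have "\<dots> < (\<bar>C\<bar> + 1) * (e / (\<bar>C\<bar> + 1))" using M that C by (intro mult_strict_left_mono) auto
    finally show ?thesis using C by simp
  qed
  thus "\<exists>M. \<forall>m\<ge>M. \<forall>n\<ge>M. v (t m - t n) < e" by blast
qed

lemma Cau_minus: "Cau s \<Longrightarrow> Cau (\<lambda>n. - s n)"
proof -
  have "- a - - b = - (a - b)" for a b :: 'a by simp
  thus "Cau s \<Longrightarrow> Cau (\<lambda>n. - s n)" by (auto elim!: Cau_mono[where C = 1] simp only: v_minus mult_1)
qed

lemma Cau_add: assumes "Cau s" "Cau t" shows "Cau (\<lambda>n. s n + t n)"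
  unfolding Cau_def
proof (intro allI impI)
  fix e :: real assume e: "e > 0"
  obtain M N where M: "\<forall>m\<ge>M. \<forall>n\<ge>M. v (s m - s n) < e" and N: "\<forall>m\<ge>N. \<forall>n\<ge>N. v (t m - t n) < e"
    using CauD[OF assms(1) e] CauD[OF assms(2) e] by blast
  have "v ((s m + t m) - (s n + t n)) < e" if "m \<ge> max M N" "n \<ge> max M N" for m n
  proof -
    have "v ((s m + t m) - (s n + t n)) \<le> max (v (s m - s n)) (v (t m - t n))"
      using ultra[of "s m - s n" "t m - t n"] by (simp add: algebra_simps)
    also have "\<dots> < e" using M N that by simp
    finally show ?thesis .
  qed
  thus "\<exists>M. \<forall>m\<ge>M. \<forall>n\<ge>M. v ((s m + t m) - (s n + t n)) < e" by blast
qed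

lemma Cau_diff: "Cau s \<Longrightarrow> Cau t \<Longrightarrow> Cau (\<lambda>n. s n - t n)" using Cau_add[OF _ Cau_minus, of s t] by simp

lemma Nul_imp_Cau: assumes "Nul s" shows "Cau s"
  unfolding Cau_def
proof (intro allI impI)
  fix e :: real assume e: "e > 0"
  obtain M where M: "\<forall>n\<ge>M. v (s n) < e" using NulD[OF assms e] by blast
  have "v (s m - s n) < e" if "m \<ge> M" "n \<ge> M" for m n
    using ultra_diff[of "s m" "s n"] M that by (meson le_less_trans max_less_iff_conj)
  thus "\<exists>M. \<forall>m\<ge>M. \<forall>n\<ge>M. v (s m - s n) < e" by blast
qed

lemma Cau_cong: "Nul (\<lambda>n. s n - t n) \<Longrightarrow> Cau t \<Longrightarrow> Cau s" using Cau_add[OF Nul_imp_Cau, of "\<lambda>n. s n - t n" t] by simp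

lemma Cau_bounded: assumes "Cau s" obtains B where "B > 0" "\<And>n. v (s n) \<le> B"
proof -
  obtain M where M: "\<forall>m\<ge>M. \<forall>n\<ge>M. v (s m - s n) < 1" using CauD[OF assms, of 1] by auto
  define B where "B = 1 + v (s M) + (\<Sum>i<M. v (s i))"
  have S: "(\<Sum>i<M. v (s i)) \<ge> 0" by (intro sum_nonneg) (simp add: nonneg)
  have "v (s n) \<le> B" for n
  proof (cases "n < M")
    case True
    have "v (s n) \<le> (\<Sum>i<M. v (s i))" using True nonneg by (intro member_le_sum) auto
    thus ?thesis using nonneg[of "s M"] by (simp add: B_def)
  next
    case False
    have "v (s n) \<le> v (s n - s M) + v (s M)" using tri[of "s n - s M" "s M"] by simp
    moreover have "v (s n - s M) < 1" using M False by auto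
    ultimately show ?thesis using S unfolding B_def by linarith
  qed
  moreover have "B > 0" using S nonneg[of "s M"] by (simp add: B_def)
  ultimately show ?thesis using that by blast
qed

lemma Cau_mult: assumes s: "Cau s" and t: "Cau t" shows "Cau (\<lambda>n. s n * t n)"
proof -
  obtain B where B: "B > 0" "\<And>n. v (s n) \<le> B" using Cau_bounded[OF s] by blast
  obtain C where C: "C > 0" "\<And>n. v (t n) \<le> C" using Cau_bounded[OF t] by blast
  show ?thesis unfolding Cau_def
  proof (intro allI impI)
    fix e :: real assume e: "e > 0"
    obtain M where M: "\<forall>m\<ge>M. \<forall>n\<ge>M. v (s m - s n) < e / C" using CauD[OF s, of "e / C"] e C by auto
    obtain N where N: "\<forall>m\<ge>N. \<forall>n\<ge>N. v (t m - t n) < e / B" using CauD[OF t, of "e / B"] e B by auto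
    have "v (s m * t m - s n * t n) < e" if mn: "m \<ge> max M N" "n \<ge> max M N" for m n
    proof -
      have "v (s m * t m - s n * t n) \<le> max (v (s m) * v (t m - t n)) (v (t n) * v (s m - s n))"
        using ultra[of "s m * (t m - t n)" "t n * (s m - s n)"] by (simp add: algebra_simps flip: mult)
      moreover have "v (s m) * v (t m - t n) \<le> B * v (t m - t n)" by (intro mult_right_mono B nonneg)
      moreover have "v (t n) * v (s m - s n) \<le> C * v (s m - s n)" by (intro mult_right_mono C nonneg)
      moreover have "v (t m - t n) < e / B" "v (s m - s n) < e / C" using N M mn by auto
      hence "B * v (t m - t n) < e" "C * v (s m - s n) < e" using B C by (simp_all add: pos_less_divide_eq mult.commute)
      ultimately show ?thesis by linarith
    qed
    thus "\<exists>M. \<forall>m\<ge>M. \<forall>n\<ge>M. v (s m * t m - s n * t n) < e" by blast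
  qed
qed

lemma Nul_mult: assumes "Nul s" "Cau t" shows "Nul (\<lambda>n. s n * t n)" "Nul (\<lambda>n. t n * s n)"
proof -
  obtain B where B: "B > 0" "\<And>n. v (t n) \<le> B" using Cau_bounded[OF assms(2)] by blast
  have "v (s n * t n) \<le> B * v (s n)" for n using mult_right_mono[OF B(2)[of n] nonneg[of "s n"]] by (simp add: mult mult.commute)
  from Nul_mono[OF assms(1) this] show "Nul (\<lambda>n. s n * t n)" .
  thus "Nul (\<lambda>n. t n * s n)" by (simp add: mult.commute)
qed

text \<open>If s is not a null sequence, some late term has value larger than all later differences,
  and by the ultrametric inequality the later terms have the same value.\<close>

lemma Cau_eventually_const:
  assumes s: "Cau s" and n: "\<not> Nul s"
  obtains c M where "c > 0" "\<And>n. n \<ge> M \<Longrightarrow> v (s n) = c"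
proof -
  obtain e where e: "e > 0" "\<forall>M. \<exists>n\<ge>M. v (s n) \<ge> e" using n unfolding Nul_iff by (meson not_less)
  obtain M where M: "\<forall>m\<ge>M. \<forall>n\<ge>M. v (s m - s n) < e" using CauD[OF s e(1)] by blast
  obtain k where k: "k \<ge> M" "v (s k) \<ge> e" using e(2) by blast
  have c: "v (s n) = v (s k)" if n: "n \<ge> M" for n
  proof (rule v_eq_of_close)
    show "v (s k - s n) < v (s k)" using M k n by (meson less_le_trans)
  qed
  have "v (s k) > 0" using k(2) e(1) by linarith
  thus ?thesis using c by (rule that)
qed

lemma Nul_mult_cancel:
  assumes "Cau s" "\<not> Nul s" "Nul (\<lambda>n. s n * t n)" shows "Nul t"
proof -
  obtain c M where c: "c > 0" "\<And>n. n \<ge> M \<Longrightarrow> v (s n) = c" using Cau_eventually_const[OF assms(1,2)] by blast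
  have "(\<lambda>n. v (s n * t n) / c) \<longlonglongrightarrow> 0 / c" using assms(3) c(1) unfolding Nul_def by (intro tendsto_divide) auto
  moreover have "\<forall>\<^sub>F n in sequentially. v (s n * t n) / c = v (t n)"
    unfolding eventually_sequentially using c by (intro exI[of _ M]) (auto simp: mult)
  ultimately show ?thesis unfolding Nul_def by (simp add: filterlim_cong)
qed

text \<open>The terms are eventually nonzero, but early ones may vanish, where
  \<open>inverse 0 = 0\<close>; so the product is 1 up to a null sequence.\<close>

lemma Cau_inverse:
  assumes s: "Cau s" and n: "\<not> Nul s"
  shows "Cau (\<lambda>n. inverse (s n))" "Nul (\<lambda>n. s n * inverse (s n) - 1)"
proof -
  obtain c M where c: "c > 0" "\<And>n. n \<ge> M \<Longrightarrow> v (s n) = c" using Cau_eventually_const[OF assms(1,2)] by blast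
  have nz: "s n \<noteq> 0" if "n \<ge> M" for n using c that by force
  show "Cau (\<lambda>n. inverse (s n))" unfolding Cau_def
  proof (intro allI impI)
    fix e :: real assume e: "e > 0"
    obtain N where N: "\<forall>m\<ge>N. \<forall>n\<ge>N. v (s m - s n) < e * c\<^sup>2" using CauD[OF s, of "e * c\<^sup>2"] e c(1) by auto
    have "v (inverse (s m) - inverse (s n)) < e" if mn: "m \<ge> max M N" "n \<ge> max M N" for m n
    proof -
      have "inverse (s m) - inverse (s n) = (s n - s m) / (s m * s n)" using nz[of m] nz[of n] mn by (simp add: field_simps)
      hence "v (inverse (s m) - inverse (s n)) = v (s n - s m) / c\<^sup>2" using c(2)[of m] c(2)[of n] mn
        by (simp add: v_divide mult power2_eq_square)
      also have "\<dots> < e" using N mn c(1) by (simp add: pos_divide_less_eq)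
      finally show ?thesis .
    qed
    thus "\<exists>M. \<forall>m\<ge>M. \<forall>n\<ge>M. v (inverse (s m) - inverse (s n)) < e" by blast
  qed
  have "\<forall>\<^sub>F n in sequentially. v (s n * inverse (s n) - 1) = 0"
    unfolding eventually_sequentially using nz by (intro exI[of _ M]) auto
  thus "Nul (\<lambda>n. s n * inverse (s n) - 1)" unfolding Nul_def by (simp add: filterlim_cong tendsto_eventually)
qed

lemma v_eventually_eq:
  assumes "Nul (\<lambda>n. s n - x)" "x \<noteq> 0" shows "\<forall>\<^sub>F n in sequentially. v (s n) = v x"
proof -
  obtain M where M: "\<forall>n\<ge>M. v (s n - x) < v x" using NulD[OF assms(1) v_pos[OF assms(2)]] by blast
  have "v (s n) = v x" if "n \<ge> M" for n using M that v_eq_of_close[of x "s n"] by (simp add: v_diff_commute)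
  thus ?thesis unfolding eventually_sequentially by blast
qed

end

text \<open>The definitions quantify over all absolute values in a place. One representative
  suffices, since positive powers have the same Cauchy and null sequences.\<close>

locale uplace = uval v for v :: "'a::field_char_0 \<Rightarrow> real" +
  fixes \<nu> :: "('a \<Rightarrow> real) set"
  assumes \<nu>_self: "v \<in> \<nu>" and \<nu>_powr: "v' \<in> \<nu> \<Longrightarrow> \<exists>e>0. \<forall>x. v' x = v x powr e"
begin

lemma place_cauchy_iff: "place_cauchy \<nu> s \<longleftrightarrow> Cau s"
proof
  assume "place_cauchy \<nu> s" thus "Cau s" using \<nu>_self unfolding place_cauchy_def Cau_def by blast
next
  assume s: "Cau s"
  show "place_cauchy \<nu> s" unfolding place_cauchy_def
  proof (intro ballI allI impI)
    fix v' and \<epsilon> :: real assume v': "v' \<in> \<nu>" and \<epsilon>: "\<epsilon> > 0"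
    obtain e where e: "e > 0" "\<And>x. v' x = v x powr e" using \<nu>_powr[OF v'] by blast
    obtain M where M: "\<forall>m\<ge>M. \<forall>n\<ge>M. v (s m - s n) < \<epsilon> powr (1 / e)" using CauD[OF s, of "\<epsilon> powr (1 / e)"] \<epsilon> by auto
    have "v' (s m - s n) < \<epsilon>" if "m \<ge> M" "n \<ge> M" for m n
    proof -
      have "v' (s m - s n) < (\<epsilon> powr (1 / e)) powr e"
        unfolding e(2) using M that e(1) nonneg by (intro powr_less_mono2) auto
      thus ?thesis using e(1) \<epsilon> by (simp add: powr_powr)
    qed
    thus "\<exists>M. \<forall>m\<ge>M. \<forall>n\<ge>M. v' (s m - s n) < \<epsilon>" by blast
  qed
qed

lemma place_null_iff: "s \<in> place_null \<nu> \<longleftrightarrow> Nul s"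
proof
  assume "s \<in> place_null \<nu>" thus "Nul s" using \<nu>_self unfolding place_null_def Nul_def by blast
next
  assume s: "Nul s"
  show "s \<in> place_null \<nu>" unfolding place_null_def mem_Collect_eq
  proof
    fix v' assume v': "v' \<in> \<nu>"
    obtain e where e: "e > 0" "\<And>x. v' x = v x powr e" using \<nu>_powr[OF v'] by blast
    show "(\<lambda>n. v' (s n)) \<longlonglongrightarrow> 0" unfolding e(2)
      using s e(1) nonneg unfolding Nul_def by (intro tendsto_zero_powrI[where b = e]) auto
  qed
qed

abbreviation "CR \<equiv> cauchy_ring \<nu>"
abbreviation "NI \<equiv> place_null \<nu>"
abbreviation "L \<equiv> completion \<nu>"
definition cl :: "(nat \<Rightarrow> 'a) \<Rightarrow> (nat \<Rightarrow> 'a) set" where "cl s = NI +>\<^bsub>CR\<^esub> s"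

lemma CR_simps: "carrier CR = {s. Cau s}" "mult CR = (\<lambda>s t n. s n * t n)" "one CR = (\<lambda>n. 1)"
  "ring.zero CR = (\<lambda>n. 0)" "add CR = (\<lambda>s t n. s n + t n)"
  by (simp_all add: cauchy_ring_def place_cauchy_iff)

lemma CR_cring: "cring CR"
proof (rule cringI)
  show "abelian_group CR"
  proof (rule abelian_groupI)
    fix s assume "s \<in> carrier CR"
    thus "\<exists>t\<in>carrier CR. t \<oplus>\<^bsub>CR\<^esub> s = \<zero>\<^bsub>CR\<^esub>"
      by (intro bexI[of _ "\<lambda>n. - s n"]) (auto simp: CR_simps Cau_minus)
  qed (auto simp: CR_simps Cau_add fun_eq_iff algebra_simps)
  show "comm_monoid CR" by (rule comm_monoidI) (auto simp: CR_simps Cau_mult fun_eq_iff algebra_simps)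
qed (auto simp: CR_simps fun_eq_iff algebra_simps)

lemma NI_ideal: "ideal NI CR"
proof -
  interpret cring CR by (rule CR_cring)
  have mem: "x \<in> carrier CR" if "x \<in> NI" for x using that by (auto simp: CR_simps place_null_iff Nul_imp_Cau)
  have neg: "\<ominus>\<^bsub>CR\<^esub> s = (\<lambda>n. - s n)" if "Cau s" for s
    using that by (intro minus_equality) (auto simp: CR_simps Cau_minus)
  show ?thesis
  proof (rule idealI)
    show "ring CR" by (rule ring_axioms)
    show "subgroup NI (add_monoid CR)"
    proof (rule add.subgroupI)
      show "NI \<subseteq> carrier CR" using mem by blast
      show "NI \<noteq> {}" using place_null_iff[of "\<lambda>n. 0"] by auto
    next
      fix a assume a: "a \<in> NI"
      hence "Cau a" using mem by (auto simp: CR_simps)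
      thus "\<ominus>\<^bsub>CR\<^esub> a \<in> NI" using a by (simp add: neg place_null_iff Nul_minus)
    qed (auto simp: CR_simps place_null_iff Nul_add)
  qed (auto simp: CR_simps place_null_iff Nul_mult)
qed

lemma mem_cl: "t \<in> cl s \<longleftrightarrow> Nul (\<lambda>n. t n - s n)"
proof -
  have "t \<in> cl s \<longleftrightarrow> (\<exists>h. Nul h \<and> t = (\<lambda>n. h n + s n))"
    unfolding cl_def a_r_coset_def r_coset_def by (auto simp: CR_simps place_null_iff)
  also have "\<dots> \<longleftrightarrow> Nul (\<lambda>n. t n - s n)"
    by (auto intro!: exI[of _ "\<lambda>n. t n - s n"])
  finally show ?thesis .
qed

lemma cl_eq_iff: "cl s = cl t \<longleftrightarrow> Nul (\<lambda>n. s n - t n)"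
proof
  assume "cl s = cl t"
  moreover have "s \<in> cl s" by (simp add: mem_cl)
  ultimately show "Nul (\<lambda>n. s n - t n)" by (simp add: mem_cl)
next
  assume a: "Nul (\<lambda>n. s n - t n)"
  have "Nul (\<lambda>n. u n - s n) \<longleftrightarrow> Nul (\<lambda>n. u n - t n)" for u
    using Nul_add[OF _ a, of "\<lambda>n. u n - s n"] Nul_diff[OF _ a, of "\<lambda>n. u n - t n"] by auto
  thus "cl s = cl t" by (auto simp: mem_cl)
qed

lemma carrier_L: "carrier L = cl ` {s. Cau s}"
  unfolding completion_def FactRing_def A_RCOSETS_def' cl_def by (auto simp: CR_simps)

lemma cl_hom: "ring_hom_cring CR L cl"
  using ideal.rcos_ring_hom_cring[OF NI_ideal CR_cring] unfolding completion_def cl_def .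

lemma cl_hom': "cl \<in> ring_hom CR L"
  using ideal.rcos_ring_hom[OF NI_ideal] unfolding completion_def cl_def .

lemma cl_mult: "Cau s \<Longrightarrow> Cau t \<Longrightarrow> cl s \<otimes>\<^bsub>L\<^esub> cl t = cl (\<lambda>n. s n * t n)"
  using ring_hom_mult[OF cl_hom'] by (simp add: CR_simps)
lemma cl_add: "Cau s \<Longrightarrow> Cau t \<Longrightarrow> cl s \<oplus>\<^bsub>L\<^esub> cl t = cl (\<lambda>n. s n + t n)"
  using ring_hom_add[OF cl_hom'] by (simp add: CR_simps)
lemma cl_one: "\<one>\<^bsub>L\<^esub> = cl (\<lambda>n. 1)"
  using ring_hom_one[OF cl_hom'] by (simp add: CR_simps)
lemma cl_zero: "\<zero>\<^bsub>L\<^esub> = cl (\<lambda>n. 0)"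
  using ring_hom_cring.hom_zero[OF cl_hom] by (simp add: CR_simps)
lemma cl_in: "Cau s \<Longrightarrow> cl s \<in> carrier L" by (auto simp: carrier_L)

lemma L_field: "Ring.field L"
proof -
  interpret L: cring L unfolding completion_def by (rule ideal.quotient_is_cring[OF NI_ideal CR_cring])
  show ?thesis
  proof (rule L.cring_fieldI2)
    show "\<zero>\<^bsub>L\<^esub> \<noteq> \<one>\<^bsub>L\<^esub>" unfolding cl_zero cl_one cl_eq_iff by (simp add: Nul_const)
  next
    fix a assume a: "a \<in> carrier L" "a \<noteq> \<zero>\<^bsub>L\<^esub>"
    obtain s where s0: "Cau s" "a = cl s" using a(1) unfolding carrier_L by blast
    have s: "Cau s" "a = cl s" "\<not> Nul s" using a(2) s0 unfolding s0(2) cl_zero cl_eq_iff by simp_all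
    have "cl s \<otimes>\<^bsub>L\<^esub> cl (\<lambda>n. inverse (s n)) = \<one>\<^bsub>L\<^esub>"
      unfolding cl_mult[OF s(1) Cau_inverse(1)[OF s(1,3)]] cl_one cl_eq_iff by (rule Cau_inverse(2)[OF s(1,3)])
    thus "\<exists>b\<in>carrier L. a \<otimes>\<^bsub>L\<^esub> b = \<one>\<^bsub>L\<^esub>" using cl_in[OF Cau_inverse(1)[OF s(1,3)]] s(2) by blast
  qed
qed

lemma cl_minus: assumes "Cau s" shows "\<ominus>\<^bsub>L\<^esub> cl s = cl (\<lambda>n. - s n)"
proof -
  interpret Ring.field L by (rule L_field)
  have "cl (\<lambda>n. - s n) \<oplus>\<^bsub>L\<^esub> cl s = \<zero>\<^bsub>L\<^esub>" using cl_add[OF Cau_minus[OF assms] assms] unfolding cl_zero by simp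
  thus ?thesis using minus_equality cl_in assms Cau_minus by blast
qed

lemma cl_inv: assumes "Cau s" "\<not> Nul s" shows "inv\<^bsub>L\<^esub> cl s = cl (\<lambda>n. inverse (s n))"
proof -
  interpret Ring.field L by (rule L_field)
  have "cl s \<otimes>\<^bsub>L\<^esub> cl (\<lambda>n. inverse (s n)) = \<one>\<^bsub>L\<^esub>"
    unfolding cl_mult[OF assms(1) Cau_inverse(1)[OF assms]] cl_one cl_eq_iff by (rule Cau_inverse(2)[OF assms])
  thus ?thesis using comm_inv_char cl_in Cau_inverse(1)[OF assms] assms by blast
qed

abbreviation "FF \<equiv> padic_subfield \<nu>"

lemma FF_eq: "FF = {cl (\<lambda>n. of_rat (q n)) | q. Cau (\<lambda>n. of_rat (q n))}"
  by (simp add: padic_subfield_def cl_def place_cauchy_iff)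

lemma FF_I: "Cau (\<lambda>n. of_rat (q n)) \<Longrightarrow> cl (\<lambda>n. of_rat (q n)) \<in> FF" by (auto simp: FF_eq)

lemma FF_E: assumes "c \<in> FF" obtains q where "Cau (\<lambda>n. of_rat (q n))" "c = cl (\<lambda>n. of_rat (q n))"
  using assms by (auto simp: FF_eq)

lemma FF_subfield: "subfield FF L"
proof -
  interpret L: Ring.field L by (rule L_field)
  show ?thesis
  proof (rule L.subfieldI')
    show "subring FF L"
    proof (rule L.subringI)
      show "FF \<subseteq> carrier L" by (auto simp: FF_eq cl_in)
      show "\<one>\<^bsub>L\<^esub> \<in> FF" using FF_I[of "\<lambda>n. 1"] by (simp add: cl_one)
    next
      fix c assume "c \<in> FF"
      then obtain q where q: "Cau (\<lambda>n. of_rat (q n))" "c = cl (\<lambda>n. of_rat (q n))" by (rule FF_E)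
      show "\<ominus>\<^bsub>L\<^esub> c \<in> FF" using FF_I[of "\<lambda>n. - q n"] q Cau_minus[OF q(1)] by (simp add: cl_minus of_rat_minus)
    next
      fix c d assume "c \<in> FF" "d \<in> FF"
      then obtain q r where q: "Cau (\<lambda>n. of_rat (q n))" "c = cl (\<lambda>n. of_rat (q n))"
        and r: "Cau (\<lambda>n. of_rat (r n))" "d = cl (\<lambda>n. of_rat (r n))" by (elim FF_E)
      show "c \<otimes>\<^bsub>L\<^esub> d \<in> FF" using FF_I[of "\<lambda>n. q n * r n"] q r Cau_mult[OF q(1) r(1)] by (simp add: cl_mult of_rat_mult)
      show "c \<oplus>\<^bsub>L\<^esub> d \<in> FF" using FF_I[of "\<lambda>n. q n + r n"] q r Cau_add[OF q(1) r(1)] by (simp add: cl_add of_rat_add)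
    qed
  next
    fix c assume c: "c \<in> FF - {\<zero>\<^bsub>L\<^esub>}"
    then obtain q where q: "Cau (\<lambda>n. of_rat (q n))" "c = cl (\<lambda>n. of_rat (q n))" by (blast elim: FF_E)
    have n: "\<not> Nul (\<lambda>n. of_rat (q n))" using c unfolding q(2) cl_zero Diff_iff singleton_iff cl_eq_iff by simp
    show "inv\<^bsub>L\<^esub> c \<in> FF" using FF_I[of "\<lambda>n. inverse (q n)"] Cau_inverse(1)[OF q(1) n] q cl_inv[OF q(1) n] by (simp add: of_rat_inverse)
  qed
qed

lemma ring_det_1:
  assumes "A 0 0 \<in> carrier L" shows "ring_det L 1 A = A 0 0"
proof -
  interpret L: Ring.field L by (rule L_field)
  have "{\<sigma>. \<sigma> permutes {..<1::nat}} = {id}" by (auto simp: lessThan_Suc permutes_sing)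
  thus ?thesis unfolding ring_det_def using assms by (simp add: lessThan_Suc)
qed

lemma ring_det_2:
  assumes "\<And>i j. i < 2 \<Longrightarrow> j < 2 \<Longrightarrow> A i j \<in> carrier L"
  shows "ring_det L 2 A = A 0 0 \<otimes>\<^bsub>L\<^esub> A 1 1 \<ominus>\<^bsub>L\<^esub> A 1 0 \<otimes>\<^bsub>L\<^esub> A 0 1"
proof -
  interpret L: Ring.field L by (rule L_field)
  have s: "{..<2::nat} = {0, 1}" by auto
  have p: "{\<sigma>. \<sigma> permutes {..<2::nat}} = {id, Transposition.transpose 0 1}" unfolding s by (auto simp: permutes_doubleton_iff)
  have ne: "id \<noteq> (Transposition.transpose 0 1 :: nat \<Rightarrow> nat)" by (metis id_apply transpose_apply_first zero_neq_one)
  have c: "A 0 0 \<in> carrier L" "A 1 1 \<in> carrier L" "A 0 1 \<in> carrier L" "A 1 0 \<in> carrier L" using assms by auto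
  have P: "(\<Otimes>\<^bsub>L\<^esub>i\<in>{..<2::nat}. A i (\<sigma> i)) = A 0 (\<sigma> 0) \<otimes>\<^bsub>L\<^esub> A 1 (\<sigma> 1)"
    if "A 0 (\<sigma> 0) \<in> carrier L" "A 1 (\<sigma> 1) \<in> carrier L" for \<sigma> :: "nat \<Rightarrow> nat"
    unfolding s using that by (subst L.finprod_insert) (auto simp: L.finprod_insert)
  have "ring_det L 2 A = \<one>\<^bsub>L\<^esub> \<otimes>\<^bsub>L\<^esub> (A 0 0 \<otimes>\<^bsub>L\<^esub> A 1 1) \<oplus>\<^bsub>L\<^esub> (\<ominus>\<^bsub>L\<^esub> \<one>\<^bsub>L\<^esub>) \<otimes>\<^bsub>L\<^esub> (A 0 1 \<otimes>\<^bsub>L\<^esub> A 1 0)"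
    unfolding ring_det_def p using ne c P[of id] P[of "Transposition.transpose 0 1"]
    by (subst L.finsum_insert) (auto simp: evenperm_swap)
  thus ?thesis using c by (simp add: L.l_minus L.minus_eq L.m_comm)
qed

end

context uplace
begin

lemma finsum_1: "g 0 \<in> carrier L \<Longrightarrow> (\<Oplus>\<^bsub>L\<^esub>i\<in>{..<1::nat}. g i) = g 0"
proof -
  interpret L: Ring.field L by (rule L_field)
  assume "g 0 \<in> carrier L" thus ?thesis by (simp add: lessThan_Suc)
qed

lemma finsum_2:
  assumes "g 0 \<in> carrier L" "g 1 \<in> carrier L"
  shows "(\<Oplus>\<^bsub>L\<^esub>i\<in>{..<2::nat}. g i) = g 0 \<oplus>\<^bsub>L\<^esub> g 1"
proof -
  interpret L: Ring.field L by (rule L_field)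
  have s: "{..<2::nat} = {0, 1}" by auto
  show ?thesis unfolding s using assms by (subst L.finsum_insert) auto
qed

text \<open>In degree one every basis is a single nonzero vector and the matrix has the single entry
  x. As the norm is a definite description, both existence and independence of the basis are
  shown.\<close>

lemma field_norm_of_full:
  assumes full: "FF = carrier L" and x: "x \<in> carrier L"
  shows "field_norm L FF x = x"
proof -
  interpret L: Ring.field L by (rule L_field)
  have dim: "L.dimension 1 FF (carrier L)" using L.dimension_one[OF FF_subfield] full by simp
  show ?thesis unfolding field_norm_def
  proof (rule the_equality)
    obtain us where us: "set us \<subseteq> carrier L" "L.independent FF us" "length us = 1" "L.Span FF us = carrier L"
      using L.exists_base[OF FF_subfield dim] by blast
    have u: "us ! 0 \<in> carrier L" using us(1,3) by auto
    show "\<exists>us A. L.independent FF us \<and> L.Span FF us = carrier L \<and>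
      (\<forall>i<length us. \<forall>j<length us. A i j \<in> FF) \<and>
      (\<forall>j<length us. x \<otimes>\<^bsub>L\<^esub> us ! j = (\<Oplus>\<^bsub>L\<^esub>i\<in>{..<length us}. A i j \<otimes>\<^bsub>L\<^esub> us ! i)) \<and>
      x = ring_det L (length us) A"
    proof (intro exI conjI)
      show "L.independent FF us" "L.Span FF us = carrier L" using us by auto
      show "\<forall>i<length us. \<forall>j<length us. x \<in> FF" using full x by simp
      show "\<forall>j<length us. x \<otimes>\<^bsub>L\<^esub> us ! j = (\<Oplus>\<^bsub>L\<^esub>i\<in>{..<length us}. x \<otimes>\<^bsub>L\<^esub> us ! i)"
        unfolding us(3) using finsum_1[of "\<lambda>i. x \<otimes>\<^bsub>L\<^esub> us ! i"] u x by simp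
      show "x = ring_det L (length us) (\<lambda>i j. x)" unfolding us(3) using ring_det_1[of "\<lambda>i j. x"] x by simp
    qed
  next
    fix y assume "\<exists>us A. L.independent FF us \<and> L.Span FF us = carrier L \<and>
      (\<forall>i<length us. \<forall>j<length us. A i j \<in> FF) \<and>
      (\<forall>j<length us. x \<otimes>\<^bsub>L\<^esub> us ! j = (\<Oplus>\<^bsub>L\<^esub>i\<in>{..<length us}. A i j \<otimes>\<^bsub>L\<^esub> us ! i)) \<and>
      y = ring_det L (length us) A"
    then obtain us A where us: "L.independent FF us" "L.Span FF us = carrier L"
      "\<forall>i<length us. \<forall>j<length us. A i j \<in> FF"
      "\<forall>j<length us. x \<otimes>\<^bsub>L\<^esub> us ! j = (\<Oplus>\<^bsub>L\<^esub>i\<in>{..<length us}. A i j \<otimes>\<^bsub>L\<^esub> us ! i)"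
      "y = ring_det L (length us) A" by blast
    have len: "length us = 1" using L.dimension_is_inj[OF FF_subfield L.dimensionI[OF FF_subfield us(1,2)] dim] .
    then obtain u where u: "us = [u]" by (cases us) auto
    have ind: "u \<in> carrier L" "u \<notin> L.Span FF []" using us(1) L.independent_backwards(1,3)[of FF u "[]"] unfolding u by blast+
    hence u0: "u \<noteq> \<zero>\<^bsub>L\<^esub>" by simp
    have A: "A 0 0 \<in> carrier L" using us(3) len full by simp
    have "x \<otimes>\<^bsub>L\<^esub> u = A 0 0 \<otimes>\<^bsub>L\<^esub> u"
      using us(4) finsum_1[of "\<lambda>i. A i 0 \<otimes>\<^bsub>L\<^esub> us ! i"] A ind(1) unfolding len by (simp add: u)
    hence "x = A 0 0" using L.m_rcancel[OF u0 ind(1) x A] by blast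
    thus "y = x" using us(5) ring_det_1[of A, OF A] unfolding len by simp
  qed
qed

end

section \<open>The completion at a prime; primes not associated to their conjugate\<close>

locale cn1_prime = cn1 \<delta> D for \<delta> :: "'k::field_char_0" and D + fixes p :: 'k assumes p: "p \<in> PP"
begin

sublocale P: uplace "pv p" "cls (pv p)"
proof
  show "absolute_value (pv p)" by (rule pv_absval[OF p])
  show "pv p (x + y) \<le> max (pv p x) (pv p y)" for x y by (rule pv_ultra[OF p])
  show "pv p \<in> cls (pv p)" by (rule cls_self[OF pv_nontrivial[OF p]])
  show "v' \<in> cls (pv p) \<Longrightarrow> \<exists>e>0. \<forall>x. v' x = pv p x powr e" for v' by (rule in_cls)
qed

lemma nn_p: "real (nn p) > 1" using nn_PP[OF p] by simp

lemma pv_le_1: assumes "z \<in> ZK" shows "pv p z \<le> 1"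
proof (cases "z = 0")
  case False
  have "(1 / real (nn p)) ^ count (fac z) p \<le> 1" using nn_p by (intro power_le_one) auto
  thus ?thesis using pv_ZK[OF assms False] by simp
qed simp

lemma pv_UU: "u \<in> UU \<Longrightarrow> pv p u = 1"
  using pv_ZK[of u p] UU_ZK[of u] UU_nonzero[of u] by (simp add: fac_UU)

lemma pv_dv: assumes "dv p z" shows "pv p z < 1"
proof -
  obtain y where y: "y \<in> ZK" "z = p * y" using assms by (auto simp: dv_def)
  have "pv p z = 1 / real (nn p) * pv p y" by (simp add: y(2) P.mult pv_PP[OF p])
  also have "\<dots> \<le> 1 / real (nn p) * 1" using pv_le_1[OF y(1)] nn_p by (intro mult_left_mono) auto
  also have "\<dots> < 1" using nn_p by simp
  finally show ?thesis .
qed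

lemma p_kcnj: "of_nat (nn p) = p * kcnj p"
  using qn_kcnj[of p] of_nat_nn[OF PP_ZK(1)[OF p]] by (metis of_rat_of_nat_eq)

text \<open>The rational prime below p, as the least positive integer divisible by p.\<close>

definition ell :: nat where "ell = (LEAST n. n \<ge> 1 \<and> dv p (of_nat n))"

lemma ell_props: "ell \<ge> 1 \<and> dv p (of_nat ell)"
  unfolding ell_def
proof (rule LeastI)
  show "nn p \<ge> 1 \<and> dv p (of_nat (nn p))" using nn_p dvI[OF ZK_kcnj[OF PP_ZK(1)[OF p]] p_kcnj] by simp
qed

lemma ell_le: "n \<ge> 1 \<Longrightarrow> dv p (of_nat n) \<Longrightarrow> ell \<le> n"
  unfolding ell_def by (rule Least_le) simp

lemma ell_prime: "Factorial_Ring.prime ell"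
  unfolding prime_nat_iff
proof (intro conjI allI impI)
  have "ell \<noteq> 1"
  proof
    assume "ell = 1"
    hence "pv p 1 < 1" using pv_dv ell_props by force
    thus False by simp
  qed
  thus "1 < ell" using ell_props by linarith
  fix m assume "m dvd ell"
  then obtain k where k: "ell = m * k" by blast
  have pos: "m \<ge> 1" "k \<ge> 1" using k ell_props by (auto simp: Suc_le_eq intro!: Nat.gr0I)
  have "dv p (of_nat m * of_nat k)" using ell_props k by (metis of_nat_mult)
  hence "dv p (of_nat m) \<or> dv p (of_nat k)" by (intro PP_prime[OF p]) auto
  thus "m = 1 \<or> m = ell"
  proof
    assume "dv p (of_nat m)"
    hence "ell \<le> m" using ell_le pos by blast
    moreover have "m \<le> ell" using k pos by simp
    ultimately show ?thesis by simp
  next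
    assume "dv p (of_nat k)"
    hence "m * k \<le> 1 * k" using ell_le pos k by simp
    thus ?thesis using pos by simp
  qed
qed

lemma pv_ell: "pv p (of_nat ell) < 1" using pv_dv ell_props by blast

text \<open>By Bezout in the integers: if both \<open>ell\<close> and m had value below 1, so would
  1.\<close>

lemma pv_int_coprime: assumes "\<not> int ell dvd m" shows "pv p (of_int m) = 1"
proof (rule ccontr)
  assume ne: "pv p (of_int m) \<noteq> 1"
  have "pv p (of_int m) \<le> 1" by (rule pv_le_1) simp
  hence m: "pv p (of_int m) < 1" using ne by simp
  have "coprime (int ell) m" using assms ell_prime by (intro prime_imp_coprime) auto
  then obtain a b where ab: "a * int ell + b * m = 1" using bezout_int[of "int ell" m] by (auto simp: coprime_iff_gcd_eq_1)
  have "(1 :: 'k) = of_int (a * int ell + b * m)" by (simp only: ab of_int_1)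
  also have "\<dots> = of_int a * of_nat ell + of_int b * of_int m" by simp
  finally have "pv p 1 \<le> max (pv p (of_int a * of_nat ell)) (pv p (of_int b * of_int m))" using P.ultra by metis
  moreover have "pv p (of_int a * of_nat ell) \<le> 1 * pv p (of_nat ell)" unfolding P.mult by (intro mult_right_mono pv_le_1 P.nonneg) simp
  moreover have "pv p (of_int b * of_int m) \<le> 1 * pv p (of_int m)" unfolding P.mult by (intro mult_right_mono pv_le_1 P.nonneg) simp
  ultimately show False using m pv_ell by simp
qed

lemma residue_char: "residue_characteristic (cls (pv p)) = ell"
  unfolding residue_characteristic_def
proof (rule the_equality, intro conjI ballI)
  show "Factorial_Ring.prime ell" by (rule ell_prime)
  fix v' assume "v' \<in> cls (pv p)"
  then obtain e where e: "e > 0" "\<And>x. v' x = pv p x powr e" using in_cls by blast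
  have "pv p (of_nat ell) powr e < 1 powr e" using pv_ell e(1) P.nonneg by (intro powr_less_mono2) auto
  thus "v' (of_nat ell) < 1" by (simp add: e)
next
  fix q assume q: "Factorial_Ring.prime q \<and> (\<forall>v'\<in>cls (pv p). v' (of_nat q) < 1)"
  hence "pv p (of_int (int q)) < 1" using P.\<nu>_self by auto
  hence "int ell dvd int q" using pv_int_coprime[of "int q"] by linarith
  hence "ell dvd q" by simp
  thus "q = ell" using q primes_dvd_imp_eq[OF ell_prime] by blast
qed

lemma pv_of_int: assumes "m \<noteq> 0" shows "pv p (of_int m) = pv p (of_nat ell) ^ multiplicity (int ell) m"
proof -
  have nu: "\<not> is_unit (int ell)" using ell_prime by (metis not_prime_unit prime_nat_int_transfer)
  obtain m' where m': "m = int ell ^ multiplicity (int ell) m * m'" "\<not> int ell dvd m'"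
    using multiplicity_decompose'[OF assms nu] by blast
  have "(of_int m :: 'k) = of_nat ell ^ multiplicity (int ell) m * of_int m'"
    by (subst m'(1)) simp
  thus ?thesis using pv_int_coprime[OF m'(2)] by (simp add: P.mult P.v_power)
qed

text \<open>On the rationals the p-adic absolute value is a power of \<open>pv p\<close>. The
  exponent t, fixed by the value at \<open>ell\<close>, is 1 at split and 1/2 at nonsplit
  primes.\<close>

lemma padic_abs_pv:
  assumes t: "pv p (of_nat ell) powr t = 1 / real ell" and q: "q \<noteq> 0"
  shows "padic_abs ell q = pv p (of_rat q) powr t"
proof -
  obtain a b where ab: "quotient_of q = (a, b)" by fastforce
  have b: "b > 0" and qab: "q = of_int a / of_int b" using quotient_of_denom_pos[OF ab] quotient_of_div[OF ab] by auto
  have a: "a \<noteq> 0" using q qab by auto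
  have l: "real ell > 0" using ell_props by simp
  have c: "pv p (of_nat ell) > 0" using ell_props P.v_pos by simp
  have pw: "(pv p (of_nat ell) ^ k) powr t = (1 / real ell) ^ k" for k
  proof -
    have "(pv p (of_nat ell) ^ k) powr t = (pv p (of_nat ell) powr t) powr real k"
      using c by (simp add: powr_powr mult.commute flip: powr_realpow)
    thus ?thesis unfolding t using l by (simp add: powr_realpow)
  qed
  have "pv p (of_rat q) powr t = (1 / real ell) ^ multiplicity (int ell) a / (1 / real ell) ^ multiplicity (int ell) b"
    unfolding qab of_rat_divide of_rat_of_int_eq P.v_divide using a b c
    by (simp add: pv_of_int powr_divide pw)
  also have "\<dots> = real ell ^ multiplicity (int ell) b / real ell ^ multiplicity (int ell) a"
    using l by (simp add: power_one_over field_simps)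
  also have "\<dots> = real ell powi (int (multiplicity (int ell) b) - int (multiplicity (int ell) a))"
    using l by (simp add: power_int_diff)
  finally show ?thesis using q by (simp add: padic_abs_def ab)
qed

text \<open>Rationals converging to a nonzero x eventually have the same value as x, so the limit
  does not depend on the chosen sequence.\<close>

lemma padic_abs_completion_pv:
  assumes t: "pv p (of_nat ell) powr t = 1 / real ell" and x: "x \<noteq> 0" and F: "P.cl (\<lambda>n. x) \<in> P.FF"
  shows "padic_abs_completion (cls (pv p)) (P.cl (\<lambda>n. x)) = pv p x powr t"
proof -
  define q where "q = (SOME q. (\<lambda>n. of_rat (q n)) \<in> P.cl (\<lambda>n. x))"
  obtain q0 where q0: "P.cl (\<lambda>n. x) = P.cl (\<lambda>n. of_rat (q0 n))" using F by (elim P.FF_E)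
  have "(\<lambda>n. of_rat (q n)) \<in> P.cl (\<lambda>n. x)"
    unfolding q_def by (rule someI[of _ q0]) (simp add: q0 P.mem_cl)
  hence "\<forall>\<^sub>F n in sequentially. pv p (of_rat (q n)) = pv p x"
    unfolding P.mem_cl using x by (rule P.v_eventually_eq)
  hence "\<forall>\<^sub>F n in sequentially. padic_abs ell (q n) = pv p x powr t"
  proof eventually_elim
    case (elim n)
    have "q n \<noteq> 0" using elim P.v_pos[OF x] by auto
    from padic_abs_pv[OF t this] show ?case using elim by simp
  qed
  hence "lim (\<lambda>n. padic_abs ell (q n)) = pv p x powr t" by (intro limI tendsto_eventually)
  thus ?thesis unfolding padic_abs_completion_def residue_char Let_def q_def .
qed

lemma kcnj_kcnj: "kcnj (kcnj x) = x" by (simp add: eq_iff)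

lemma dv_kcnj: "dv x y \<Longrightarrow> dv (kcnj x) (kcnj y)" by (auto simp: dv_def intro: ZK_kcnj)

lemma p_divides_ell: obtains y where "y \<in> ZK" "of_nat ell = p * y" "nn p * nn y = ell * ell" "nn p = ell \<or> nn p = ell * ell"
proof -
  obtain y where y: "y \<in> ZK" "of_nat ell = p * y" using ell_props by (auto simp: dv_def)
  have "of_nat (nn (of_nat ell)) = (of_nat (ell * ell) :: rat)" using of_nat_nn[of "of_nat ell"] by (simp add: qn_def)
  hence "nn (of_nat ell) = ell * ell" by (simp only: of_nat_eq_iff)
  hence nn: "nn p * nn y = ell * ell" using nn_mult[OF PP_ZK(1)[OF p] y(1)] y(2) by simp
  hence "nn p dvd ell ^ 2" by (metis dvd_triv_left power2_eq_square)
  then obtain i where i: "i \<le> 2" "nn p = ell ^ i" using divides_primepow_nat[OF ell_prime] by blast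
  hence "i = 0 \<or> i = 1 \<or> i = 2" by auto
  hence "nn p = ell \<or> nn p = ell * ell" using i(2) nn_p by (auto simp: power2_eq_square)
  thus ?thesis using that y nn by blast
qed

text \<open>If the norm of p were the square of \<open>ell\<close>, then p would be associated to
  the rational number \<open>ell\<close> and divide its own conjugate. So \<open>ell\<close> is
  \<open>p * kcnj p\<close>, with \<open>kcnj p\<close> a unit at p.\<close>

lemma split_ell: assumes split: "\<not> dv p (kcnj p)" shows "pv p (of_nat ell) = 1 / real ell"
proof -
  obtain y where y: "y \<in> ZK" "of_nat ell = p * y" "nn p * nn y = ell * ell" "nn p = ell \<or> nn p = ell * ell"
    by (rule p_divides_ell)
  have "nn p \<noteq> ell * ell"
  proof
    assume "nn p = ell * ell"
    hence "nn y = 1" using y(3) ell_props by simp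
    hence u: "kcnj y \<in> UU" using UU_iff ZK_kcnj[OF y(1)] by simp
    have "kcnj (of_nat ell) = kcnj p * kcnj y" unfolding y(2) by simp
    moreover have "kcnj (of_nat ell) = of_nat ell" by (simp add: eq_iff)
    ultimately have "dv p (kcnj p * kcnj y)" using ell_props by simp
    hence "dv p (kcnj p) \<or> dv p (kcnj y)" using PP_prime[OF p ZK_kcnj[OF PP_ZK(1)[OF p]] UU_ZK[OF u]] by blast
    thus False using split dv_UU[OF _ PP_ZK(1)[OF p] u] PP_ZK(3)[OF p] by blast
  qed
  hence n: "nn p = ell" using y(4) by blast
  have k: "kcnj p \<in> ZK" "kcnj p \<noteq> 0" using ZK_kcnj[OF PP_ZK(1)[OF p]] PP_ZK(2)[OF p] by (auto simp: eq_iff)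
  have "count (fac (kcnj p)) p = 0" using PP_dv[OF p k] split by (simp add: count_eq_zero_iff)
  hence "pv p (kcnj p) = 1" using pv_ZK[OF k] by simp
  thus ?thesis using p_kcnj n pv_PP[OF p] by (simp add: P.mult)
qed

lemma dv_power_imp: "q \<in> PP \<Longrightarrow> x \<in> ZK \<Longrightarrow> dv q (x ^ k) \<Longrightarrow> dv q x"
proof (induction k)
  case 0
  hence "dv q 1" by simp
  moreover have "1 \<in> UU" by (simp add: UU_iff)
  ultimately have "q \<in> UU" using dv_UU PP_ZK(1)[OF 0(1)] by blast
  thus ?case using PP_ZK(3)[OF 0(1)] by blast
next
  case (Suc k)
  thus ?case using PP_prime[OF Suc.prems(1,2) ZK_power[OF Suc.prems(2), of k]] by auto
qed

text \<open>A prime dividing both powers would divide p, hence equal p, and also divide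
  \<open>kcnj p\<close>.\<close>

lemma split_coprime:
  assumes split: "\<not> dv p (kcnj p)"
  obtains a b where "a \<in> ZK" "b \<in> ZK" "a * p ^ k + b * kcnj p ^ k = 1"
proof -
  have Z: "p \<in> ZK" "kcnj p \<in> ZK" using PP_ZK(1)[OF p] ZK_kcnj by auto
  obtain g a b c d where g: "g \<in> ZK" "a \<in> ZK" "b \<in> ZK" "g = a * p ^ k + b * kcnj p ^ k" "c \<in> ZK" "p ^ k = g * c" "d \<in> ZK" "kcnj p ^ k = g * d"
    using bez[OF ZK_power[OF Z(1)] ZK_power[OF Z(2)]] by blast
  have g0: "g \<noteq> 0" using g(6) PP_ZK(2)[OF p] by auto
  have gU: "g \<in> UU"
  proof (rule ccontr)
    assume "g \<notin> UU"
    then obtain q where q: "q \<in> PP" "dv q g" using prime_divisor_ex[OF g(1) g0] by blast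
    have "dv q (p ^ k)" "dv q (kcnj p ^ k)" unfolding g(6,8) using q(2) g(5,7) by (auto intro: dv_mult)
    hence "dv q p" "dv q (kcnj p)" using dv_power_imp[OF q(1)] Z by auto
    thus False using PP_eq[OF q(1) p] split by auto
  qed
  have i: "inverse g \<in> ZK" using UU_ZK[OF UU_inverse[OF gU]] .
  have "inverse g * a * p ^ k + inverse g * b * kcnj p ^ k = inverse g * g" unfolding g(4) by (simp add: algebra_simps)
  thus ?thesis using that[of "inverse g * a" "inverse g * b"] ZK_mult[OF i] g(2,3) g0 by simp
qed

lemma pv_p_power: "pv p (p ^ k) = (1 / real (nn p)) ^ k" by (simp add: P.v_power pv_PP[OF p])

text \<open>
  With \<open>a p\<^sup>k + b (kcnj p)\<^sup>k = 1\<close>, the trace of \<open>x b (kcnj p)\<^sup>k\<close> is a rational number close to \<open>x\<close>.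
\<close>

lemma split_dense:
  assumes split: "\<not> dv p (kcnj p)" and e: "e > 0"
  obtains r where "pv p (of_rat r - x) < e"
proof -
  obtain n :: nat where n: "n > 0" "of_nat n * x \<in> ZK" by (rule ZK_frac)
  define z where "z = of_nat n * x"
  have z: "z \<in> ZK" using n by (simp add: z_def)
  have vn: "pv p (of_nat n) > 0" using n P.v_pos by simp
  obtain k where k: "(1 / real (nn p)) ^ k < e * pv p (of_nat n)"
    using real_arch_pow_inv[of "e * pv p (of_nat n)" "1 / real (nn p)"] e vn nn_p by auto
  obtain a b where ab: "a \<in> ZK" "b \<in> ZK" "a * p ^ k + b * kcnj p ^ k = 1" by (rule split_coprime[OF split])
  define y where "y = z * (b * kcnj p ^ k)"
  have h: "b * kcnj p ^ k = 1 - a * p ^ k" using ab(3) by (simp add: algebra_simps)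
  have "y - z = - (z * a * p ^ k)" unfolding y_def h by (simp add: algebra_simps)
  moreover have "kcnj y = kcnj z * kcnj b * p ^ k" by (simp add: y_def kcnj_power kcnj_kcnj)
  ultimately have "of_rat (2 * ra y) - z = (kcnj z * kcnj b - z * a) * p ^ k"
    unfolding trace_eq by (simp add: algebra_simps)
  moreover have "kcnj z * kcnj b - z * a \<in> ZK" using z ab by (intro ZK_diff ZK_mult ZK_kcnj)
  ultimately have "pv p (of_rat (2 * ra y) - z) \<le> 1 * (1 / real (nn p)) ^ k"
    unfolding pv_p_power[symmetric] by (simp only: P.mult) (intro mult_right_mono pv_le_1 P.nonneg)
  hence le: "pv p (of_rat (2 * ra y) - z) < e * pv p (of_nat n)" using k by simp
  have "of_rat (2 * ra y / of_nat n) - x = (of_rat (2 * ra y) - z) / of_nat n"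
    using n by (simp add: z_def of_rat_divide diff_divide_distrib)
  hence "pv p (of_rat (2 * ra y / of_nat n) - x) < e" using le vn by (simp add: P.v_divide pos_divide_less_eq)
  thus ?thesis by (rule that)
qed

text \<open>The rationals are dense in the field, so a Cauchy sequence may be replaced by a rational
  one within \<open>1 / Suc n\<close> of its n-th term.\<close>

lemma split_full: assumes split: "\<not> dv p (kcnj p)" shows "P.FF = carrier P.L"
proof
  show "P.FF \<subseteq> carrier P.L" by (auto simp: P.FF_eq P.cl_in)
  show "carrier P.L \<subseteq> P.FF"
  proof
    fix c assume "c \<in> carrier P.L"
    then obtain s where s: "P.Cau s" "c = P.cl s" unfolding P.carrier_L by blast
    have "\<forall>n. \<exists>r. pv p (of_rat r - s n) < 1 / real (Suc n)"
      using split_dense[OF split] by (meson of_nat_0_less_iff zero_less_Suc zero_less_divide_1_iff)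
    then obtain r where r: "\<And>n. pv p (of_rat (r n) - s n) < 1 / real (Suc n)" by metis
    have lim: "(\<lambda>n. 1 / real (Suc n)) \<longlonglongrightarrow> 0" using LIMSEQ_Suc[OF lim_1_over_n] by simp
    have N: "P.Nul (\<lambda>n. of_rat (r n) - s n)" unfolding P.Nul_def
      by (rule tendsto_sandwich[OF _ _ tendsto_const lim]) (use r P.nonneg in \<open>auto intro!: always_eventually less_imp_le\<close>)
    have "P.cl (\<lambda>n. of_rat (r n)) = c" unfolding s(2) P.cl_eq_iff by (rule N)
    thus "c \<in> P.FF" using P.FF_I[OF P.Cau_cong[OF N s(1)]] by simp
  qed
qed

lemma split_place_norm:
  assumes split: "\<not> dv p (kcnj p)" and x: "x \<noteq> 0" shows "place_norm (cls (pv p)) x = pv p x"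
proof -
  have c: "P.cl (\<lambda>n. x) \<in> carrier P.L" by (simp add: P.cl_in)
  have "pv p (of_nat ell) powr 1 = 1 / real ell" using split_ell[OF split] by simp
  from padic_abs_completion_pv[OF this x] c show ?thesis
    using nonarch_cls_pv[OF p] P.nonneg P.field_norm_of_full[OF split_full[OF split] c] split_full[OF split]
    by (simp add: place_norm_def to_completion_def P.cl_def)
qed

end

section \<open>Primes associated to their conjugate\<close>

context cn1_prime
begin

lemma nonsplit_kcnj_p: assumes "dv p (kcnj p)" obtains u where "u \<in> UU" "kcnj p = u * p"
proof -
  obtain z where z: "z \<in> ZK" "kcnj p = p * z" using assms by (auto simp: dv_def)
  have "nn (kcnj p) = nn p * nn z" unfolding z(2) by (rule nn_mult[OF PP_ZK(1)[OF p] z(1)])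
  hence "nn z = 1" using nn_p by simp
  thus ?thesis using that[of z] z by (simp add: UU_iff mult.commute)
qed

text \<open>Conjugation maps p to a unit multiple of itself, so it preserves the exponent of
  p.\<close>

lemma nonsplit_pv_kcnj:
  assumes ns: "dv p (kcnj p)" shows "pv p (kcnj x) = pv p x"
proof -
  obtain u where u: "u \<in> UU" "kcnj p = u * p" by (rule nonsplit_kcnj_p[OF ns])
  have k0: "kcnj x = 0 \<longleftrightarrow> x = 0" for x by (simp add: eq_iff)
  have le: "count (fac x) p \<le> count (fac (kcnj x)) p" if x: "x \<in> ZK" "x \<noteq> 0" for x
  proof -
    let ?k = "count (fac x) p"
    have "dv (kcnj (p ^ ?k)) (kcnj x)" using PP_power_dv[OF p x, of ?k] by (intro dv_kcnj) simp
    moreover have "kcnj (p ^ ?k) = p ^ ?k * u ^ ?k" by (simp add: kcnj_power u(2) power_mult_distrib)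
    moreover have "dv (p ^ ?k) (p ^ ?k * u ^ ?k)" by (intro dvI[of "u ^ ?k"] ZK_power UU_ZK u refl)
    ultimately have "dv (p ^ ?k) (kcnj x)" using dv_trans by metis
    thus ?thesis using PP_power_dv[OF p ZK_kcnj[OF x(1)]] k0 x(2) by blast
  qed
  have Z: "pv p (kcnj x) = pv p x" if x: "x \<in> ZK" "x \<noteq> 0" for x
  proof -
    have "count (fac (kcnj x)) p = count (fac x) p"
      using le[OF x] le[OF ZK_kcnj[OF x(1)]] x(2) k0 kcnj_kcnj[of x] by simp
    thus ?thesis using pv_ZK[OF x] pv_ZK[OF ZK_kcnj[OF x(1)]] k0 x(2) by simp
  qed
  show ?thesis
  proof (cases "x = 0")
    case True
    thus ?thesis using k0 by simp
  next
    case False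
    obtain a b where ab: "a \<in> ZK" "b \<in> ZK" "b \<noteq> 0" "x = a / b" by (rule frac_ex)
    have a: "a \<noteq> 0" using ab False by auto
    have "kcnj x * kcnj b = kcnj a" using ab(3,4) by (simp flip: kcnj_simps(2))
    hence "pv p (kcnj x) * pv p b = pv p a" using Z[OF ab(2,3)] Z[OF ab(1) a] by (metis P.mult)
    moreover have "pv p x * pv p b = pv p a" using ab(3,4) by (simp flip: P.mult)
    moreover have "pv p b > 0" using ab(3) P.v_pos by simp
    ultimately show ?thesis by (metis less_irrefl mult_cancel_right)
  qed
qed

text \<open>The value of \<open>ell\<close> is the inverse square of \<open>ell\<close> in both
  cases: if \<open>nn p = ell\<close>, then \<open>ell\<close> is \<open>p * kcnj p\<close> with two
  factors of equal value; otherwise \<open>ell\<close> is a unit times p, whose norm is the square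
  of \<open>ell\<close>.\<close>

lemma nonsplit_ell:
  assumes ns: "dv p (kcnj p)" shows "pv p (of_nat ell) powr (1 / 2) = 1 / real ell"
proof -
  obtain y where y: "y \<in> ZK" "of_nat ell = p * y" "nn p * nn y = ell * ell" "nn p = ell \<or> nn p = ell * ell"
    by (rule p_divides_ell)
  have l: "real ell > 0" using ell_props by simp
  have "pv p (of_nat ell) = (1 / real ell)\<^sup>2"
  proof (cases "nn p = ell")
    case True
    thus ?thesis using p_kcnj pv_PP[OF p] nonsplit_pv_kcnj[OF ns, of p] by (simp add: P.mult power2_eq_square)
  next
    case False
    hence n: "nn p = ell * ell" using y(4) by blast
    hence "nn y = 1" using y(3) ell_props by simp
    hence "y \<in> UU" using y(1) UU_iff by simp
    thus ?thesis using y(2) pv_PP[OF p] n by (simp add: P.mult pv_UU power2_eq_square)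
  qed
  moreover have "((1 / real ell)\<^sup>2) powr (1 / 2) = 1 / real ell" using l by (simp add: powr_half_sqrt)
  ultimately show ?thesis by simp
qed

text \<open>Sum and difference of x and its conjugate are the coordinates times 2 and
  \<open>2 * \<delta>\<close>, and have value at most that of x. So the coordinates are continuous
  for this absolute value.\<close>

lemma nonsplit_coords:
  assumes ns: "dv p (kcnj p)"
  obtains C where "\<And>x. pv p (of_rat (ra x)) \<le> C * pv p x" "\<And>x. pv p (of_rat (rb x)) \<le> C * pv p x"
proof -
  have delta: "\<delta> \<noteq> 0" using ra_rb_delta(2) ra_rb_0(2) zero_neq_one by metis
  have two: "pv p 2 > 0" "pv p (2 * \<delta>) > 0" using delta P.v_pos by auto
  have k: "pv p (kcnj x) = pv p x" for x by (rule nonsplit_pv_kcnj[OF ns])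
  have a: "pv p (of_rat (ra x)) \<le> (1 / pv p 2) * pv p x" for x
  proof -
    have "of_rat (ra x) * 2 = x + kcnj x" using ra_rb_of_nat[of 2] by (simp add: eq_iff)
    hence "pv p (of_rat (ra x)) * pv p 2 \<le> pv p x" using P.ultra[of x "kcnj x"] k by (metis P.mult max.idem)
    thus ?thesis using two by (simp add: pos_le_divide_eq)
  qed
  have b: "pv p (of_rat (rb x)) \<le> (1 / pv p (2 * \<delta>)) * pv p x" for x
  proof -
    have "of_rat (rb x) * (2 * \<delta>) = x - kcnj x" using ra_rb_of_nat[of 2] by (simp add: eq_iff)
    hence "pv p (of_rat (rb x)) * pv p (2 * \<delta>) \<le> pv p x" using P.ultra_diff[of x "kcnj x"] k by (metis P.mult max.idem)
    thus ?thesis using two by (simp add: pos_le_divide_eq)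
  qed
  show ?thesis
  proof (rule that[of "max (1 / pv p 2) (1 / pv p (2 * \<delta>))"])
    fix x
    show "pv p (of_rat (ra x)) \<le> max (1 / pv p 2) (1 / pv p (2 * \<delta>)) * pv p x"
      using a[of x] mult_right_mono[OF max.cobounded1 P.nonneg] by (rule order_trans)
    show "pv p (of_rat (rb x)) \<le> max (1 / pv p 2) (1 / pv p (2 * \<delta>)) * pv p x"
      using b[of x] mult_right_mono[OF max.cobounded2 P.nonneg] by (rule order_trans)
  qed
qed

lemma nonsplit_Cau: assumes ns: "dv p (kcnj p)" and s: "P.Cau s"
  shows "P.Cau (\<lambda>n. of_rat (ra (s n)))" "P.Cau (\<lambda>n. of_rat (rb (s n)))"
proof -
  obtain C where C: "\<And>x. pv p (of_rat (ra x)) \<le> C * pv p x" "\<And>x. pv p (of_rat (rb x)) \<le> C * pv p x"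
    by (rule nonsplit_coords[OF ns]) blast
  have "pv p (of_rat (ra (s m)) - of_rat (ra (s n))) \<le> C * pv p (s m - s n)" for m n
    using C(1)[of "s m - s n"] by (simp add: of_rat_diff)
  thus "P.Cau (\<lambda>n. of_rat (ra (s n)))" by (rule P.Cau_mono[OF s])
  have "pv p (of_rat (rb (s m)) - of_rat (rb (s n))) \<le> C * pv p (s m - s n)" for m n
    using C(2)[of "s m - s n"] by (simp add: of_rat_diff)
  thus "P.Cau (\<lambda>n. of_rat (rb (s n)))" by (rule P.Cau_mono[OF s])
qed

lemma nonsplit_Nul: assumes ns: "dv p (kcnj p)" and s: "P.Nul s"
  shows "P.Nul (\<lambda>n. of_rat (ra (s n)))" "P.Nul (\<lambda>n. of_rat (rb (s n)))"
proof -
  obtain C where C: "\<And>x. pv p (of_rat (ra x)) \<le> C * pv p x" "\<And>x. pv p (of_rat (rb x)) \<le> C * pv p x"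
    by (rule nonsplit_coords[OF ns]) blast
  show "P.Nul (\<lambda>n. of_rat (ra (s n)))" "P.Nul (\<lambda>n. of_rat (rb (s n)))"
    by (rule P.Nul_mono[OF s C(1)], rule P.Nul_mono[OF s C(2)])
qed

text \<open>Coordinates of Cauchy sequences are Cauchy, so 1 and \<delta> span the completion over
  the closure of the rationals. \<delta> is not a limit of rationals, because its second coordinate
  is 1 and theirs is 0.\<close>

lemma nonsplit_dimension: assumes ns: "dv p (kcnj p)" shows "ring.dimension P.L 2 P.FF (carrier P.L)"
proof -
  interpret L: Ring.field P.L by (rule P.L_field)
  define d where "d = P.cl (\<lambda>n. \<delta>)"
  have dC: "d \<in> carrier P.L" by (simp add: d_def P.cl_in)
  have dF: "d \<notin> P.FF"
  proof
    assume "d \<in> P.FF"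
    then obtain q where q: "P.Cau (\<lambda>n. of_rat (q n))" "d = P.cl (\<lambda>n. of_rat (q n))" by (rule P.FF_E)
    hence "P.Nul (\<lambda>n. \<delta> - of_rat (q n))" unfolding d_def P.cl_eq_iff by simp
    from nonsplit_Nul(2)[OF ns this] show False by (simp add: P.Nul_const)
  qed
  have "L.line_extension P.FF d P.FF = carrier P.L"
  proof (intro equalityI subsetI)
    fix c assume "c \<in> L.line_extension P.FF d P.FF"
    then obtain k f where kf: "k \<in> P.FF" "f \<in> P.FF" "c = k \<otimes>\<^bsub>P.L\<^esub> d \<oplus>\<^bsub>P.L\<^esub> f" unfolding L.line_extension_mem_iff by blast
    have "P.FF \<subseteq> carrier P.L" using subfieldE(3)[OF P.FF_subfield] .
    thus "c \<in> carrier P.L" using kf dC by blast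
  next
    fix c assume "c \<in> carrier P.L"
    then obtain s where s: "P.Cau s" "c = P.cl s" unfolding P.carrier_L by blast
    note C = nonsplit_Cau[OF ns s(1)]
    have "P.cl (\<lambda>n. of_rat (rb (s n))) \<otimes>\<^bsub>P.L\<^esub> d \<oplus>\<^bsub>P.L\<^esub> P.cl (\<lambda>n. of_rat (ra (s n)))
        = P.cl (\<lambda>n. of_rat (rb (s n)) * \<delta> + of_rat (ra (s n)))"
      unfolding d_def using C by (simp add: P.cl_mult P.cl_add P.Cau_mult)
    also have "(\<lambda>n. of_rat (rb (s n)) * \<delta> + of_rat (ra (s n))) = s"
    proof
      fix n show "of_rat (rb (s n)) * \<delta> + of_rat (ra (s n)) = s n" by (simp add: eq_iff)
    qed
    finally show "c \<in> L.line_extension P.FF d P.FF" unfolding L.line_extension_mem_iff s(2)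
      using P.FF_I[OF C(1)] P.FF_I[OF C(2)] by metis
  qed
  thus ?thesis using L.dimension.Suc_dim[OF dC dF L.dimension_one[OF P.FF_subfield]] by (simp add: numeral_2_eq_2)
qed

text \<open>
  Cayley--Hamilton for \<open>A\<close>, compared with \<open>x\<^sup>2 = 2 (ra x) x - qn x\<close>, determines the determinant unless
  \<open>x\<close> is rational; then linear independence makes \<open>A\<close> scalar.
\<close>

lemma nonsplit_det:
  assumes ns: "dv p (kcnj p)" and ind: "ring.independent P.L P.FF [u0, u1]"
    and A: "\<And>i j. i < 2 \<Longrightarrow> j < 2 \<Longrightarrow> A i j \<in> P.FF"
    and e0: "P.cl (\<lambda>n. x) \<otimes>\<^bsub>P.L\<^esub> u0 = A 0 0 \<otimes>\<^bsub>P.L\<^esub> u0 \<oplus>\<^bsub>P.L\<^esub> A 1 0 \<otimes>\<^bsub>P.L\<^esub> u1"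
    and e1: "P.cl (\<lambda>n. x) \<otimes>\<^bsub>P.L\<^esub> u1 = A 0 1 \<otimes>\<^bsub>P.L\<^esub> u0 \<oplus>\<^bsub>P.L\<^esub> A 1 1 \<otimes>\<^bsub>P.L\<^esub> u1"
  shows "ring_det P.L 2 A = P.cl (\<lambda>n. of_rat (qn x))"
proof -
  interpret L: Ring.field P.L by (rule P.L_field)
  have i: "u0 \<notin> L.Span P.FF [u1]" "u0 \<in> carrier P.L" "u1 \<in> carrier P.L" "u1 \<notin> L.Span P.FF []"
    using L.independent_backwards[OF ind] L.independent_backwards[OF L.independent_backwards(2)[OF ind]] by blast+
  obtain s0 s1 where s: "P.Cau s0" "u0 = P.cl s0" "P.Cau s1" "u1 = P.cl s1" using i(2,3) unfolding P.carrier_L by blast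
  obtain a where a: "P.Cau (\<lambda>n. of_rat (a n))" "A 0 0 = P.cl (\<lambda>n. of_rat (a n))" using P.FF_E[OF A[of 0 0]] by auto
  obtain b where b: "P.Cau (\<lambda>n. of_rat (b n))" "A 0 1 = P.cl (\<lambda>n. of_rat (b n))" using P.FF_E[OF A[of 0 1]] by auto
  obtain c where c: "P.Cau (\<lambda>n. of_rat (c n))" "A 1 0 = P.cl (\<lambda>n. of_rat (c n))" using P.FF_E[OF A[of 1 0]] by auto
  obtain d where d: "P.Cau (\<lambda>n. of_rat (d n))" "A 1 1 = P.cl (\<lambda>n. of_rat (d n))" using P.FF_E[OF A[of 1 1]] by auto
  note Ca = s(1) s(3) a(1) b(1) c(1) d(1) P.Cau_const
  have inv: "\<not> P.Nul (\<lambda>n. s0 n - of_rat (q n) * s1 n)" if q: "P.Cau (\<lambda>n. of_rat (q n))" for q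
  proof
    assume "P.Nul (\<lambda>n. s0 n - of_rat (q n) * s1 n)"
    hence "u0 = P.cl (\<lambda>n. of_rat (q n)) \<otimes>\<^bsub>P.L\<^esub> u1 \<oplus>\<^bsub>P.L\<^esub> \<zero>\<^bsub>P.L\<^esub>"
      using q s by (simp add: P.cl_mult P.cl_eq_iff P.cl_in P.Cau_mult)
    hence "u0 \<in> L.Span P.FF [u1]" using P.FF_I[OF q] by (auto simp: L.line_extension_mem_iff)
    thus False using i(1) by blast
  qed
  have n0: "\<not> P.Nul s0" using inv[of "\<lambda>n. 0"] by simp
  have n1: "\<not> P.Nul s1"
  proof
    assume "P.Nul s1"
    hence "u1 = \<zero>\<^bsub>P.L\<^esub>" unfolding s(4) P.cl_zero P.cl_eq_iff by simp
    thus False using i(4) by simp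
  qed
  have E0: "P.Nul (\<lambda>n. x * s0 n - (of_rat (a n) * s0 n + of_rat (c n) * s1 n))"
    using e0 Ca unfolding s a c by (simp add: P.cl_mult P.cl_add P.cl_eq_iff P.Cau_mult)
  have E1: "P.Nul (\<lambda>n. x * s1 n - (of_rat (b n) * s0 n + of_rat (d n) * s1 n))"
    using e1 Ca unfolding s b d by (simp add: P.cl_mult P.cl_add P.cl_eq_iff P.Cau_mult)
  have main: "P.Nul (\<lambda>n. of_rat (a n) * of_rat (d n) - of_rat (c n) * of_rat (b n) - of_rat (qn x))"
  proof (cases "rb x = 0")
    case False
    define D where "D n = (x - of_rat (a n)) * (x - of_rat (d n)) - of_rat (c n) * of_rat (b n)" for n
    have "P.Nul (\<lambda>n. ((x - of_rat (d n)) * s1 n) * (x * s0 n - (of_rat (a n) * s0 n + of_rat (c n) * s1 n))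
        + (of_rat (c n) * s1 n) * (x * s1 n - (of_rat (b n) * s0 n + of_rat (d n) * s1 n)))"
      by (intro P.Nul_add P.Nul_mult(2)[OF E0] P.Nul_mult(2)[OF E1] P.Cau_mult P.Cau_diff Ca)
    also have "(\<lambda>n. ((x - of_rat (d n)) * s1 n) * (x * s0 n - (of_rat (a n) * s0 n + of_rat (c n) * s1 n))
        + (of_rat (c n) * s1 n) * (x * s1 n - (of_rat (b n) * s0 n + of_rat (d n) * s1 n)))
        = (\<lambda>n. s0 n * (s1 n * D n))" by (rule ext) (simp add: D_def algebra_simps)
    finally have "P.Nul (\<lambda>n. s0 n * (s1 n * D n))" .
    from P.Nul_mult_cancel[OF s(3) n1 P.Nul_mult_cancel[OF s(1) n0 this]] have ND: "P.Nul D" .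
    have Dr: "rb (D n) = rb x * (2 * ra x - a n - d n)" for n
      by (simp add: D_def algebra_simps flip: of_rat_mult)
    have "P.Nul (\<lambda>n. of_rat (rb x) * of_rat (2 * ra x - a n - d n))"
      using nonsplit_Nul(2)[OF ns ND] unfolding Dr of_rat_mult .
    from P.Nul_mult_cancel[OF P.Cau_const _ this] False
    have Nt: "P.Nul (\<lambda>n. of_rat (2 * ra x - a n - d n))" by (simp add: P.Nul_const)
    have "P.Nul (\<lambda>n. D n - of_rat (2 * ra x - a n - d n) * x)"
      by (intro P.Nul_diff ND P.Nul_mult(1)[OF Nt] P.Cau_const)
    also have "(\<lambda>n. D n - of_rat (2 * ra x - a n - d n) * x)
        = (\<lambda>n. of_rat (a n) * of_rat (d n) - of_rat (c n) * of_rat (b n) - of_rat (qn x))"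
      by (rule ext) (simp add: D_def of_rat_diff of_rat_add left_diff_distrib right_diff_distrib quadratic_eq algebra_simps)
    finally show ?thesis .
  next
    case True
    hence x: "of_rat (ra x) = x" by (simp add: eq_iff)
    define f where "f n = ra x - a n" for n
    define g where "g n = ra x - d n" for n
    have f: "(of_rat (f n) :: 'k) = x - of_rat (a n)" and g: "(of_rat (g n) :: 'k) = x - of_rat (d n)" for n
      by (simp_all add: f_def g_def of_rat_diff x)
    have Cf: "P.Cau (\<lambda>n. of_rat (f n))" and Cg: "P.Cau (\<lambda>n. of_rat (g n))" unfolding f g by (intro P.Cau_diff Ca)+
    have F0: "P.Nul (\<lambda>n. of_rat (f n) * s0 n - of_rat (c n) * s1 n)" using E0 unfolding f by (simp add: algebra_simps)
    have F1: "P.Nul (\<lambda>n. of_rat (b n) * s0 n - of_rat (g n) * s1 n)" using P.Nul_minus[OF E1] unfolding g by (simp add: algebra_simps)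
    have key: "P.Nul (\<lambda>n. of_rat (h n))"
      if h: "P.Cau (\<lambda>n. of_rat (h n))" and k: "P.Cau (\<lambda>n. of_rat (k n))"
        and N: "P.Nul (\<lambda>n. of_rat (h n) * s0 n - of_rat (k n) * s1 n)" for h k
    proof (rule ccontr)
      assume nh: "\<not> P.Nul (\<lambda>n. of_rat (h n))"
      note I = P.Cau_inverse[OF h nh]
      have "P.Nul (\<lambda>n. inverse (of_rat (h n)) * (of_rat (h n) * s0 n - of_rat (k n) * s1 n)
          - (of_rat (h n) * inverse (of_rat (h n)) - 1) * s0 n)"
        by (intro P.Nul_diff P.Nul_mult(2)[OF N] P.Nul_mult(1)[OF I(2)] I(1) s(1))
      also have "(\<lambda>n. inverse (of_rat (h n)) * (of_rat (h n) * s0 n - of_rat (k n) * s1 n)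
          - (of_rat (h n) * inverse (of_rat (h n)) - 1) * s0 n) = (\<lambda>n. s0 n - of_rat (inverse (h n) * k n) * s1 n)"
        by (rule ext) (simp add: of_rat_mult of_rat_inverse algebra_simps)
      finally have "P.Nul (\<lambda>n. s0 n - of_rat (inverse (h n) * k n) * s1 n)" .
      moreover have "P.Cau (\<lambda>n. of_rat (inverse (h n) * k n))" using P.Cau_mult[OF I(1) k] by (simp add: of_rat_mult of_rat_inverse)
      ultimately show False using inv[of "\<lambda>n. inverse (h n) * k n"] by blast
    qed
    have Nf: "P.Nul (\<lambda>n. of_rat (f n))" by (rule key[OF Cf c(1) F0])
    have Nb: "P.Nul (\<lambda>n. of_rat (b n))" by (rule key[OF b(1) Cg F1])
    have "P.Nul (\<lambda>n. of_rat (b n) * s0 n - (of_rat (b n) * s0 n - of_rat (g n) * s1 n))"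
      by (intro P.Nul_diff F1 P.Nul_mult(1)[OF Nb] s(1))
    hence "P.Nul (\<lambda>n. s1 n * of_rat (g n))" by (simp add: mult.commute)
    hence Ng: "P.Nul (\<lambda>n. of_rat (g n))" by (rule P.Nul_mult_cancel[OF s(3) n1])
    have "P.Nul (\<lambda>n. of_rat (f n) * (of_rat (g n) - x) - of_rat (g n) * x - of_rat (b n) * of_rat (c n))"
      by (intro P.Nul_diff P.Nul_mult(1)[OF Nf] P.Nul_mult(1)[OF Ng] P.Nul_mult(1)[OF Nb] P.Cau_diff Cg Ca)
    also have "(\<lambda>n. of_rat (f n) * (of_rat (g n) - x) - of_rat (g n) * x - of_rat (b n) * of_rat (c n))
        = (\<lambda>n. of_rat (a n) * of_rat (d n) - of_rat (c n) * of_rat (b n) - x * x)"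
      by (rule ext) (simp add: f g algebra_simps)
    moreover have "kcnj x = x" using True by (simp add: eq_iff)
    ultimately show ?thesis by (simp add: qn_kcnj)
  qed
  have "ring_det P.L 2 A = A 0 0 \<otimes>\<^bsub>P.L\<^esub> A 1 1 \<ominus>\<^bsub>P.L\<^esub> A 1 0 \<otimes>\<^bsub>P.L\<^esub> A 0 1"
    using subfieldE(3)[OF P.FF_subfield] A by (intro P.ring_det_2) blast
  also have "\<dots> = P.cl (\<lambda>n. of_rat (a n) * of_rat (d n) - of_rat (c n) * of_rat (b n))"
    unfolding a b c d L.minus_eq using Ca by (simp add: P.cl_mult P.cl_add P.cl_minus P.Cau_mult P.Cau_minus)
  also have "\<dots> = P.cl (\<lambda>n. of_rat (qn x))" unfolding P.cl_eq_iff by (rule main)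
  finally show ?thesis .
qed

text \<open>Existence takes any basis and the matrix read off from it; uniqueness holds because
  \<open>nonsplit_det\<close> gives the same determinant for every basis, all of length 2.\<close>

lemma nonsplit_field_norm:
  assumes ns: "dv p (kcnj p)"
  shows "field_norm P.L P.FF (P.cl (\<lambda>n. x)) = P.cl (\<lambda>n. of_rat (qn x))"
proof -
  interpret L: Ring.field P.L by (rule P.L_field)
  note dim = nonsplit_dimension[OF ns]
  define X' where "X' = P.cl (\<lambda>n. x)"
  have xC: "X' \<in> carrier P.L" by (simp add: X'_def P.cl_in)
  have FC: "P.FF \<subseteq> carrier P.L" using subfieldE(3)[OF P.FF_subfield] .
  show ?thesis unfolding field_norm_def X'_def[symmetric]
  proof (rule the_equality)
    obtain us where us: "set us \<subseteq> carrier P.L" "L.independent P.FF us" "length us = 2" "L.Span P.FF us = carrier P.L"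
      using L.exists_base[OF P.FF_subfield dim] by blast
    then obtain u0 u1 where u: "us = [u0, u1]" by (metis (no_types) length_0_conv length_Suc_conv numeral_2_eq_2)
    have uc: "u0 \<in> carrier P.L" "u1 \<in> carrier P.L" using us(1) u by auto
    have sp: "\<exists>a b. a \<in> P.FF \<and> b \<in> P.FF \<and> y = a \<otimes>\<^bsub>P.L\<^esub> u0 \<oplus>\<^bsub>P.L\<^esub> b \<otimes>\<^bsub>P.L\<^esub> u1" if y: "y \<in> carrier P.L" for y
    proof -
      obtain k1 k2 where k: "k1 \<in> P.FF" "k2 \<in> P.FF" "y = k1 \<otimes>\<^bsub>P.L\<^esub> u0 \<oplus>\<^bsub>P.L\<^esub> (k2 \<otimes>\<^bsub>P.L\<^esub> u1 \<oplus>\<^bsub>P.L\<^esub> \<zero>\<^bsub>P.L\<^esub>)"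
      proof -
        have "y \<in> L.line_extension P.FF u0 (L.line_extension P.FF u1 {\<zero>\<^bsub>P.L\<^esub>})" using y us(4) unfolding u by simp
        thus thesis using that unfolding L.line_extension_mem_iff Bex_def singleton_iff by blast
      qed
      moreover have "k2 \<otimes>\<^bsub>P.L\<^esub> u1 \<oplus>\<^bsub>P.L\<^esub> \<zero>\<^bsub>P.L\<^esub> = k2 \<otimes>\<^bsub>P.L\<^esub> u1" using k(2) FC uc by (intro L.r_zero L.m_closed) auto
      ultimately show ?thesis by metis
    qed
    obtain a0 b0 where e0: "a0 \<in> P.FF" "b0 \<in> P.FF" "X' \<otimes>\<^bsub>P.L\<^esub> u0 = a0 \<otimes>\<^bsub>P.L\<^esub> u0 \<oplus>\<^bsub>P.L\<^esub> b0 \<otimes>\<^bsub>P.L\<^esub> u1"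
      using sp[OF L.m_closed[OF xC uc(1)]] by blast
    obtain a1 b1 where e1: "a1 \<in> P.FF" "b1 \<in> P.FF" "X' \<otimes>\<^bsub>P.L\<^esub> u1 = a1 \<otimes>\<^bsub>P.L\<^esub> u0 \<oplus>\<^bsub>P.L\<^esub> b1 \<otimes>\<^bsub>P.L\<^esub> u1"
      using sp[OF L.m_closed[OF xC uc(2)]] by blast
    define A where "A = (\<lambda>i j :: nat. if i = (0::nat) then (if j = 0 then a0 else a1) else (if j = 0 then b0 else b1))"
    have AF: "A i j \<in> P.FF" for i j using e0 e1 by (simp add: A_def)
    have fs: "(\<Oplus>\<^bsub>P.L\<^esub>i\<in>{..<2}. A i j \<otimes>\<^bsub>P.L\<^esub> us ! i) = A 0 j \<otimes>\<^bsub>P.L\<^esub> u0 \<oplus>\<^bsub>P.L\<^esub> A 1 j \<otimes>\<^bsub>P.L\<^esub> u1" for j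
      using P.finsum_2[of "\<lambda>i. A i j \<otimes>\<^bsub>P.L\<^esub> us ! i"] AF FC uc by (simp add: u subset_iff)
    have rows: "X' \<otimes>\<^bsub>P.L\<^esub> u0 = A 0 0 \<otimes>\<^bsub>P.L\<^esub> u0 \<oplus>\<^bsub>P.L\<^esub> A 1 0 \<otimes>\<^bsub>P.L\<^esub> u1"
      "X' \<otimes>\<^bsub>P.L\<^esub> u1 = A 0 1 \<otimes>\<^bsub>P.L\<^esub> u0 \<oplus>\<^bsub>P.L\<^esub> A 1 1 \<otimes>\<^bsub>P.L\<^esub> u1"
      using e0(3) e1(3) by (simp_all add: A_def)
    have det: "ring_det P.L 2 A = P.cl (\<lambda>n. of_rat (qn x))"
      using nonsplit_det[OF ns us(2)[unfolded u], of A x] AF rows unfolding X'_def by simp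
    show "\<exists>us A. L.independent P.FF us \<and> L.Span P.FF us = carrier P.L \<and>
      (\<forall>i<length us. \<forall>j<length us. A i j \<in> P.FF) \<and>
      (\<forall>j<length us. X' \<otimes>\<^bsub>P.L\<^esub> us ! j = (\<Oplus>\<^bsub>P.L\<^esub>i\<in>{..<length us}. A i j \<otimes>\<^bsub>P.L\<^esub> us ! i)) \<and>
      P.cl (\<lambda>n. of_rat (qn x)) = ring_det P.L (length us) A"
    proof (intro exI conjI)
      show "L.independent P.FF us" "L.Span P.FF us = carrier P.L" using us by auto
      show "\<forall>i<length us. \<forall>j<length us. A i j \<in> P.FF" using AF by blast
      show "\<forall>j<length us. X' \<otimes>\<^bsub>P.L\<^esub> us ! j = (\<Oplus>\<^bsub>P.L\<^esub>i\<in>{..<length us}. A i j \<otimes>\<^bsub>P.L\<^esub> us ! i)"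
        unfolding us(3) fs using rows by (auto simp: u less_2_cases_iff)
      show "P.cl (\<lambda>n. of_rat (qn x)) = ring_det P.L (length us) A" unfolding us(3) det ..
    qed
  next
    fix y assume "\<exists>us A. L.independent P.FF us \<and> L.Span P.FF us = carrier P.L \<and>
      (\<forall>i<length us. \<forall>j<length us. A i j \<in> P.FF) \<and>
      (\<forall>j<length us. X' \<otimes>\<^bsub>P.L\<^esub> us ! j = (\<Oplus>\<^bsub>P.L\<^esub>i\<in>{..<length us}. A i j \<otimes>\<^bsub>P.L\<^esub> us ! i)) \<and>
      y = ring_det P.L (length us) A"
    then obtain us A where us: "L.independent P.FF us" "L.Span P.FF us = carrier P.L"
      "\<forall>i<length us. \<forall>j<length us. A i j \<in> P.FF"
      "\<forall>j<length us. X' \<otimes>\<^bsub>P.L\<^esub> us ! j = (\<Oplus>\<^bsub>P.L\<^esub>i\<in>{..<length us}. A i j \<otimes>\<^bsub>P.L\<^esub> us ! i)"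
      "y = ring_det P.L (length us) A" by blast
    have len: "length us = 2" using L.dimension_is_inj[OF P.FF_subfield L.dimensionI[OF P.FF_subfield us(1,2)] dim] .
    then obtain u0 u1 where u: "us = [u0, u1]" by (metis (no_types) length_0_conv length_Suc_conv numeral_2_eq_2)
    have uc: "u0 \<in> carrier P.L" "u1 \<in> carrier P.L" using L.independent_in_carrier[OF us(1)] u by auto
    have AF: "A i j \<in> P.FF" if "i < 2" "j < 2" for i j using us(3) len that by simp
    have fs: "(\<Oplus>\<^bsub>P.L\<^esub>i\<in>{..<2}. A i j \<otimes>\<^bsub>P.L\<^esub> us ! i) = A 0 j \<otimes>\<^bsub>P.L\<^esub> u0 \<oplus>\<^bsub>P.L\<^esub> A 1 j \<otimes>\<^bsub>P.L\<^esub> u1" if "j < 2" for j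
      using P.finsum_2[of "\<lambda>i. A i j \<otimes>\<^bsub>P.L\<^esub> us ! i"] AF[of 0 j] AF[of 1 j] that FC uc by (simp add: u subset_iff)
    have r: "X' \<otimes>\<^bsub>P.L\<^esub> us ! j = A 0 j \<otimes>\<^bsub>P.L\<^esub> u0 \<oplus>\<^bsub>P.L\<^esub> A 1 j \<otimes>\<^bsub>P.L\<^esub> u1" if "j < 2" for j
      using us(4) that fs[OF that] unfolding len by simp
    have "ring_det P.L 2 A = P.cl (\<lambda>n. of_rat (qn x))"
      using nonsplit_det[OF ns us(1)[unfolded u], of A x] AF r[of 0] r[of 1] unfolding X'_def by (simp add: u)
    thus "y = P.cl (\<lambda>n. of_rat (qn x))" using us(5) len by simp
  qed
qed

text \<open>The norm \<open>qn x\<close> has as value the square of \<open>pv p x\<close>, and the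
  exponent 1/2 that relates \<open>pv p\<close> to the p-adic absolute value undoes the
  square.\<close>

lemma nonsplit_place_norm:
  assumes ns: "dv p (kcnj p)" and x: "x \<noteq> 0" shows "place_norm (cls (pv p)) x = pv p x"
proof -
  have q: "of_rat (qn x) \<noteq> (0 :: 'k)" using x by simp
  have F: "P.cl (\<lambda>n. of_rat (qn x)) \<in> P.FF" by (rule P.FF_I) simp
  have "pv p (of_rat (qn x)) = (pv p x)\<^sup>2"
    unfolding qn_kcnj P.mult nonsplit_pv_kcnj[OF ns] by (simp add: power2_eq_square)
  moreover have "((pv p x)\<^sup>2) powr (1 / 2) = pv p x" using P.nonneg[of x] by (simp add: powr_half_sqrt)
  ultimately show ?thesis
    using nonarch_cls_pv[OF p] padic_abs_completion_pv[OF nonsplit_ell[OF ns] q F] nonsplit_field_norm[OF ns, of x]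
    by (simp add: place_norm_def to_completion_def P.cl_def)
qed

lemma place_norm_pv: "x \<noteq> 0 \<Longrightarrow> place_norm (cls (pv p)) x = pv p x"
  using split_place_norm nonsplit_place_norm by blast

end

section \<open>Heights\<close>

text \<open>The index type counts modulo 4, so the coordinate written 0 is the one that
  \<open>forall_4\<close> calls 4.\<close>

lemma four_eq_0: "(4 :: 4) = 0" by simp
lemma all_4: "(\<forall>j::4. Q j) \<longleftrightarrow> Q 0 \<and> Q 1 \<and> Q 2 \<and> Q 3" using forall_4[of Q] unfolding four_eq_0 by blast
lemma Max_range_eqI:
  fixes f :: "4 \<Rightarrow> real"
  shows "(\<And>j. f j \<le> b) \<Longrightarrow> f i = b \<Longrightarrow> (MAX j. f j) = b"
  by (rule Max_eqI) auto

context cn1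
begin

lemma cn1_prime: "p \<in> PP \<Longrightarrow> cn1_prime \<delta> D p"
  by (intro cn1_prime.intro cn1_axioms cn1_prime_axioms.intro)

lemma place_norm_PP: "p \<in> PP \<Longrightarrow> x \<noteq> 0 \<Longrightarrow> place_norm (cls (pv p)) x = pv p x"
  using cn1_prime.place_norm_pv[OF cn1_prime] .

lemma place_norm_av: "place_norm (cls av) x = of_rat (qn x)"
  using arch_cls_av by (simp add: place_norm_def norm_infinity_qn)

lemma pv_mult: "p \<in> PP \<Longrightarrow> pv p (x * y) = pv p x * pv p y"
  using pv_absval[of p] by (auto simp: absolute_value_def)

lemma pv_pos: "p \<in> PP \<Longrightarrow> x \<noteq> 0 \<Longrightarrow> pv p x > 0"
  using pv_absval[of p] by (metis absolute_value_def order_le_less)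

lemma PP_pos: "p \<in> PP \<Longrightarrow> real (nn p) > 1" using nn_PP[of p] by simp

lemma pv_ZK_le_1: "p \<in> PP \<Longrightarrow> z \<in> ZK \<Longrightarrow> pv p z \<le> 1"
  using cn1_prime.pv_le_1[OF cn1_prime] .

lemma product_formula_ZK:
  assumes a: "a \<in> ZK" "a \<noteq> 0" and T: "finite T" "T \<subseteq> PP" "set_mset (fac a) \<subseteq> T"
  shows "real (nn a) * (\<Prod>p\<in>T. pv p a) = 1"
proof -
  have pos: "real (nn p) > 1" if "p \<in> T" for p using that T PP_pos by blast
  obtain u where u: "u \<in> UU" "a = u * prod_mset (fac a)" using fac(2)[OF a] by blast
  have "nn a = nn u * nn (prod_mset (fac a))"
    by (subst u(2)) (rule nn_mult[OF UU_ZK[OF u(1)]], use prod_mset_ZK fac(1)[OF a] in blast)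
  also have "\<dots> = (\<Prod>p\<in>set_mset (fac a). nn p ^ count (fac a) p)"
    using u(1) fac(1)[OF a] by (simp add: UU_iff nn_prod_mset image_prod_mset_multiplicity)
  also have "\<dots> = (\<Prod>p\<in>T. nn p ^ count (fac a) p)"
    using T by (intro prod.mono_neutral_left) (auto simp: not_in_iff)
  finally have "real (nn a) = (\<Prod>p\<in>T. real (nn p) ^ count (fac a) p)" by simp
  moreover have "(\<Prod>p\<in>T. pv p a) = (\<Prod>p\<in>T. 1 / real (nn p) ^ count (fac a) p)"
    by (rule prod.cong) (auto simp: pv_ZK[OF a] power_one_over)
  ultimately have "real (nn a) * (\<Prod>p\<in>T. pv p a) = (\<Prod>p\<in>T. real (nn p) ^ count (fac a) p * (1 / real (nn p) ^ count (fac a) p))"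
    by (simp only: prod.distrib)
  also have "\<dots> = 1" using pos by (intro prod.neutral) fastforce
  finally show ?thesis .
qed

text \<open>T consists of the primes in the numerator or the denominator. It is kept explicit
  because it indexes the finite product of local heights.\<close>

lemma product_formula:
  assumes c: "c \<noteq> 0"
  obtains T where "finite T" "T \<subseteq> PP" "\<And>p. p \<in> PP \<Longrightarrow> p \<notin> T \<Longrightarrow> pv p c = 1" "of_rat (qn c) * (\<Prod>p\<in>T. pv p c) = 1"
proof -
  obtain a b where ab: "a \<in> ZK" "b \<in> ZK" "b \<noteq> 0" "c = a / b" by (rule frac_ex)
  have a0: "a \<noteq> 0" using ab c by auto
  define T where "T = set_mset (fac a) \<union> set_mset (fac b)"
  have T: "finite T" "T \<subseteq> PP" using fac(1)[OF ab(1) a0] fac(1)[OF ab(2,3)] by (auto simp: T_def II_def)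
  have cb: "c * b = a" using ab by simp
  have pc: "pv p c * pv p b = pv p a" if "p \<in> PP" for p using pv_mult[OF that, of c b] cb by simp
  have "pv p c = 1" if "p \<in> PP" "p \<notin> T" for p
    using pc[OF that(1)] that(2) pv_ZK[OF ab(1) a0, of p] pv_ZK[OF ab(2,3), of p] by (auto simp: T_def not_in_iff)
  moreover have "of_rat (qn c) * (\<Prod>p\<in>T. pv p c) = (1 :: real)"
  proof -
    have "qn c * qn b = qn a" using qn_mult[of c b] cb by simp
    hence "of_rat (qn c) * of_rat (qn b) = (of_rat (qn a) :: real)" by (simp flip: of_rat_mult)
    hence q: "of_rat (qn c) * real (nn b) = real (nn a)"
      using of_nat_nn[OF ab(1)] of_nat_nn[OF ab(2)] by (metis of_rat_of_nat_eq)
    have "(\<Prod>p\<in>T. pv p c) * (\<Prod>p\<in>T. pv p b) = (\<Prod>p\<in>T. pv p a)"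
      using T(2) pc by (simp only: prod.distrib[symmetric]) (intro prod.cong, auto)
    hence "(of_rat (qn c) * (\<Prod>p\<in>T. pv p c)) * (real (nn b) * (\<Prod>p\<in>T. pv p b)) = (real (nn a) * (\<Prod>p\<in>T. pv p a))"
      unfolding q[symmetric] by (simp add: mult_ac)
    thus ?thesis using product_formula_ZK[OF ab(1) a0 T] product_formula_ZK[OF ab(2,3) T] by (simp add: T_def)
  qed
  ultimately show ?thesis using that T by blast
qed

text \<open>Integral nonzero coordinates without a common prime factor.\<close>

definition prim :: "'k ^ 4 \<Rightarrow> bool" where
  "prim z \<longleftrightarrow> (\<forall>j. z $ j \<in> ZK \<and> z $ j \<noteq> 0) \<and> (\<forall>p\<in>PP. \<exists>j. p \<notin># fac (z $ j))"

lemma local_height_pv: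
  assumes z: "prim z" and c: "c \<noteq> 0" and p: "p \<in> PP"
  shows "local_height (cls (pv p)) (c *s z) = pv p c"
proof -
  obtain j where j: "p \<notin># fac (z $ j)" using z p by (auto simp: prim_def)
  have z': "z $ i \<in> ZK" "z $ i \<noteq> 0" for i using z by (auto simp: prim_def)
  have e: "place_norm (cls (pv p)) ((c *s z) $ i) = pv p c * pv p (z $ i)" for i
    using place_norm_PP[OF p, of "c * z $ i"] c z' pv_mult[OF p] by simp
  have "pv p (z $ j) = 1" using pv_ZK[OF z', of p] j by (simp add: not_in_iff)
  thus ?thesis unfolding local_height_def e
    using pv_ZK_le_1[OF p z'(1)] pv_pos[OF p c] by (intro Max_range_eqI[where i = j]) auto
qed

lemma local_height_av:
  assumes z: "prim z"
  shows "local_height (cls av) (c *s z) = of_rat (qn c) * (MAX j. real (nn (z $ j)))"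
proof -
  have z': "z $ i \<in> ZK" "z $ i \<noteq> 0" for i using z by (auto simp: prim_def)
  have e: "place_norm (cls av) ((c *s z) $ i) = of_rat (qn c) * real (nn (z $ i))" for i
    unfolding place_norm_av using of_nat_nn[OF z'(1), of i] by (simp add: qn_mult of_rat_mult) (metis of_rat_of_nat_eq)
  have q: "(of_rat (qn c) :: real) \<ge> 0" using qn_nonneg by simp
  have "(MAX j. real (nn (z $ j))) \<in> range (\<lambda>j. real (nn (z $ j)))" by (rule Max_in) auto
  then obtain i where i: "(MAX j. real (nn (z $ j))) = real (nn (z $ i))" by blast
  have "real (nn (z $ j)) \<le> real (nn (z $ i))" for j unfolding i[symmetric] by (rule Max_ge) auto
  thus ?thesis unfolding local_height_def e i using q by (intro Max_range_eqI[where i = i] mult_left_mono) auto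
qed

text \<open>At a prime the local height is \<open>pv p c\<close>, since the coordinates of z are
  integral and one of them is prime to p. The product formula cancels these factors against
  \<open>qn c\<close> at infinity.\<close>

lemma vector_height_prim:
  assumes z: "prim z" and c: "c \<noteq> 0"
  shows "vector_height (c *s z) = (MAX j. real (nn (z $ j)))"
proof -
  obtain T where T: "finite T" "T \<subseteq> PP" "\<And>p. p \<in> PP \<Longrightarrow> p \<notin> T \<Longrightarrow> pv p c = 1" "of_rat (qn c) * (\<Prod>p\<in>T. pv p c) = (1 :: real)"
    by (rule product_formula[OF c]) blast
  let ?h = "\<lambda>\<nu>. local_height \<nu> (c *s z)"
  let ?S = "insert (cls av) ((\<lambda>p. cls (pv p)) ` T)"
  have av: "cls av \<notin> (\<lambda>p. cls (pv p)) ` T"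
    using arch_cls_av nonarch_cls_pv T(2) by auto
  have "vector_height (c *s z) = (\<Prod>\<nu>\<in>?S. ?h \<nu>)"
    unfolding vector_height_def
  proof (rule prod.mono_neutral_left)
    show "finite ?S" using T by simp
    show "{\<nu> \<in> places TYPE('k). ?h \<nu> \<noteq> 1} \<subseteq> ?S"
    proof
      fix \<nu> assume n: "\<nu> \<in> {\<nu> \<in> places TYPE('k). ?h \<nu> \<noteq> 1}"
      show "\<nu> \<in> ?S"
      proof (cases "\<nu> = cls av")
        case False
        then obtain p where p: "p \<in> PP" "\<nu> = cls (pv p)" using n unfolding places_eq by blast
        have "pv p c \<noteq> 1" using n local_height_pv[OF z c p(1)] unfolding p(2) by simp
        hence "p \<in> T" using T(3)[OF p(1)] by blast
        thus ?thesis unfolding p(2) by blast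
      qed simp
    qed
    have "?S \<subseteq> places TYPE('k)" unfolding places_eq using T(2) by blast
    thus "\<forall>\<nu>\<in>?S - {\<nu> \<in> places TYPE('k). ?h \<nu> \<noteq> 1}. ?h \<nu> = 1" by blast
  qed
  also have "\<dots> = ?h (cls av) * (\<Prod>\<nu>\<in>(\<lambda>p. cls (pv p)) ` T. ?h \<nu>)" using av T(1) by simp
  also have "(\<Prod>\<nu>\<in>(\<lambda>p. cls (pv p)) ` T. ?h \<nu>) = (\<Prod>p\<in>T. pv p c)"
    using inj_on_subset[OF cls_pv_inj T(2)] local_height_pv[OF z c] T(2) by (subst prod.reindex) (auto intro!: prod.cong)
  also have "?h (cls av) = of_rat (qn c) * (MAX j. real (nn (z $ j)))" by (rule local_height_av[OF z])
  finally show ?thesis using T(4) by (simp add: mult.commute mult.left_commute)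
qed

text \<open>Denominators are cleared and the greatest common divisor, the intersection of the four
  factorisations, is divided out. Dividing also by the unit of coordinate 1 fixes the remaining
  scaling.\<close>

lemma prim_ex:
  assumes x: "\<And>j. (x :: 'k ^ 4) $ j \<noteq> 0"
  obtains c z where "c \<noteq> 0" "prim z" "x = c *s z" "z $ 1 = prod_mset (fac (z $ 1))"
proof -
  define d :: 'k where "d = (\<Prod>j\<in>UNIV. of_nat (dn (x $ j)))"
  have d: "d \<noteq> 0" using dn by (auto simp: d_def)
  have y: "d * x $ j \<in> ZK" for j
  proof -
    have "d = of_nat (\<Prod>i\<in>UNIV - {j}. dn (x $ i)) * of_nat (dn (x $ j))"
      by (simp add: d_def prod.remove[of UNIV j] mult.commute)
    hence "d * x $ j = of_nat (\<Prod>i\<in>UNIV - {j}. dn (x $ i)) * (of_nat (dn (x $ j)) * x $ j)" by (simp add: mult.assoc)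
    thus ?thesis using ZK_mult[OF ZK_nat dn(2)] by metis
  qed
  define m where "m j = fac (d * x $ j)" for j
  have y0: "d * x $ j \<noteq> 0" for j using d x by simp
  have m: "m j \<in> II" for j using fac(1)[OF y y0] by (simp add: m_def)
  define g where "g = m 0 \<inter># m 1 \<inter># m 2 \<inter># m 3"
  have gm: "g \<subseteq># m j" for j
  proof -
    have "\<forall>j. g \<subseteq># m j" unfolding all_4 g_def by (auto simp: subseteq_mset_def)
    thus ?thesis by blast
  qed
  have gI: "g \<in> II" using mset_subset_eqD[OF gm] m[of 0] by (auto simp: II_def)
  have mgI: "m j - g \<in> II" for j using m[of j] by (auto simp: II_def dest: in_diffD)
  have "\<exists>u\<in>UU. d * x $ j = u * prod_mset (m j)" for j using fac(2)[OF y y0] by (simp add: m_def)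
  then obtain u where u: "\<And>j. u j \<in> UU" "\<And>j. d * x $ j = u j * prod_mset (m j)" by metis
  define z :: "'k ^ 4" where "z = (\<chi> j. inverse (u 1) * u j * prod_mset (m j - g))"
  define c where "c = u 1 * prod_mset g / d"
  have uu: "inverse (u 1) * u j \<in> UU" for j using u(1) by (simp add: UU_mult UU_inverse)
  have zf: "fac (z $ j) = m j - g" for j using facI[OF mgI uu] by (simp add: z_def)
  have c0: "c \<noteq> 0" using d prod_mset_ZK[OF gI] UU_nonzero[OF u(1)] by (simp add: c_def)
  have xc: "x = c *s z"
  proof (rule vec_eq_iff[THEN iffD2], rule allI)
    fix j
    have "prod_mset (m j) = prod_mset (g + (m j - g))" using gm[of j] by simp
    hence "d * x $ j = u j * (prod_mset g * prod_mset (m j - g))" unfolding u(2) by simp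
    thus "x $ j = (c *s z) $ j" using d UU_nonzero[OF u(1), of 1] by (simp add: c_def z_def field_simps)
  qed
  have "prim z" unfolding prim_def
  proof (intro conjI allI ballI)
    fix j
    show "z $ j \<in> ZK" "z $ j \<noteq> 0"
      using prod_mset_ZK[OF mgI, of j] UU_ZK[OF uu, of j] UU_nonzero[OF uu, of j] by (auto simp: z_def intro!: ZK_mult)
  next
    fix p
    have "count g p = count (m 0) p \<or> count g p = count (m 1) p \<or> count g p = count (m 2) p \<or> count g p = count (m 3) p"
      by (auto simp: g_def min_def)
    thus "\<exists>j. p \<notin># fac (z $ j)" unfolding zf not_in_iff by auto
  qed
  moreover have "z $ 1 = prod_mset (fac (z $ 1))" unfolding zf using UU_nonzero[OF u(1), of 1] by (simp add: z_def)
  ultimately show ?thesis using that c0 xc by blast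
qed

text \<open>Both vectors have local height 1 at every prime, so c has value 1 there; numerator and
  denominator of c then have the same factorisation.\<close>

lemma prim_pv_const: assumes "prim z" "prim (c *s z)" "c \<noteq> 0" shows "c \<in> UU"
proof -
  obtain a b where ab: "a \<in> ZK" "b \<in> ZK" "b \<noteq> 0" "c = a / b" by (rule frac_ex)
  have a0: "a \<noteq> 0" using ab assms(3) by auto
  have one: "pv p c = 1" if p: "p \<in> PP" for p
  proof -
    have "1 *s (c *s z) = c *s z" by simp
    thus ?thesis using local_height_pv[OF assms(1,3) p] local_height_pv[OF assms(2) one_neq_zero p] pv_absval[OF p]
      absval.v_1[OF absval.intro] by metis
  qed
  have "count (fac a) p = count (fac b) p" for p
  proof (cases "p \<in> PP")
    case True
    have "pv p a = pv p c * pv p b" using pv_mult[OF True, of c b] ab by simp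
    hence "(1 / real (nn p)) ^ count (fac a) p = (1 / real (nn p)) ^ count (fac b) p"
      using one[OF True] pv_ZK[OF ab(1) a0] pv_ZK[OF ab(2,3)] by simp
    hence "real (nn p) ^ count (fac a) p = real (nn p) ^ count (fac b) p" by (simp add: power_one_over)
    thus ?thesis using PP_pos[OF True] power_inject_exp by blast
  next
    case False
    thus ?thesis using fac(1)[OF ab(1) a0] fac(1)[OF ab(2,3)] by (metis (no_types, lifting) II_def mem_Collect_eq not_in_iff subsetD)
  qed
  hence "fac a = fac b" by (simp add: multiset_eq_iff)
  then obtain u where "u \<in> UU" "a = u * b" using eq_unit_mult[OF ab(1) a0 ab(2,3)] by blast
  thus ?thesis using ab by simp
qed

section \<open>Projective points, their heights and coprime representatives\<close>

definition pcl :: "'k ^ 4 \<Rightarrow> ('k ^ 4) set" where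
  "pcl x = {(x, y). x \<noteq> 0 \<and> y \<noteq> 0 \<and> (\<exists>c. c \<noteq> 0 \<and> y = c *s x)} `` {x}"

lemma pcl_iff: "y \<in> pcl x \<longleftrightarrow> x \<noteq> 0 \<and> y \<noteq> 0 \<and> (\<exists>c. c \<noteq> 0 \<and> y = c *s x)"
  by (auto simp: pcl_def)

lemma projective_space_eq: "projective_space = pcl ` (UNIV - {0})"
  by (auto simp: projective_space_def quotient_def pcl_def)

lemma pcl_self: "x \<noteq> 0 \<Longrightarrow> x \<in> pcl x" unfolding pcl_iff by (auto intro!: exI[of _ 1])

lemma pcl_scale: assumes c: "c \<noteq> 0" and x: "x \<noteq> 0" shows "pcl (c *s x) = pcl x"
proof -
  have cx: "c *s x \<noteq> 0" using c x by simp
  have "(\<exists>d. d \<noteq> 0 \<and> y = d *s (c *s x)) \<longleftrightarrow> (\<exists>d. d \<noteq> 0 \<and> y = d *s x)" for y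
  proof
    assume "\<exists>d. d \<noteq> 0 \<and> y = d *s (c *s x)"
    then obtain d where "d \<noteq> 0" "y = d *s (c *s x)" by blast
    thus "\<exists>d. d \<noteq> 0 \<and> y = d *s x" using c by (intro exI[of _ "d * c"]) (simp add: vector_smult_assoc)
  next
    assume "\<exists>d. d \<noteq> 0 \<and> y = d *s x"
    then obtain d where "d \<noteq> 0" "y = d *s x" by blast
    thus "\<exists>d. d \<noteq> 0 \<and> y = d *s (c *s x)" using c by (intro exI[of _ "d / c"]) (simp add: vector_smult_assoc)
  qed
  thus ?thesis using x cx by (auto simp: pcl_iff set_eq_iff)
qed

lemma prim_nonzero: "prim z \<Longrightarrow> z \<noteq> 0" by (auto simp: prim_def vec_eq_iff)

lemma height_prim: assumes z: "prim z" shows "height (pcl z) = (MAX j. real (nn (z $ j)))"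
proof -
  have "(SOME x. x \<in> pcl z) \<in> pcl z" using pcl_self[OF prim_nonzero[OF z]] by (rule someI)
  then obtain c where "c \<noteq> 0" "(SOME x. x \<in> pcl z) = c *s z" by (auto simp: pcl_iff)
  thus ?thesis unfolding height_def using vector_height_prim[OF z] by simp
qed

text \<open>On the surface x0 vanishes exactly when one of the other coordinates does, so off the
  three lines all coordinates are nonzero and \<open>prim_ex\<close> applies.\<close>

lemma open_subset_prim:
  "P \<in> open_subset \<longleftrightarrow> (\<exists>z. prim z \<and> z $ 1 = prod_mset (fac (z $ 1)) \<and> (z $ 0) ^ 3 = z $ 1 * z $ 2 * z $ 3 \<and> P = pcl z)"
proof
  assume P: "P \<in> open_subset"
  then obtain x where x: "x \<noteq> 0" "P = pcl x" by (auto simp: open_subset_def cubic_surface_def projective_space_eq)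
  have eq: "(y $ 0) ^ 3 = y $ 1 * y $ 2 * y $ 3" if "y \<in> pcl x" for y using P that x by (auto simp: open_subset_def cubic_surface_def)
  have line: "\<not> (x $ 0 = 0 \<and> x $ j = 0)" if "j \<in> {1, 2, 3}" for j
  proof
    assume "x $ 0 = 0 \<and> x $ j = 0"
    hence "\<forall>y\<in>pcl x. y $ 0 = 0 \<and> y $ j = 0" by (auto simp: pcl_iff)
    hence "P \<in> coordinate_line j" using x by (auto simp: coordinate_line_def projective_space_eq)
    thus False using P that by (auto simp: open_subset_def)
  qed
  have x0: "x $ 0 \<noteq> 0" using eq[OF pcl_self[OF x(1)]] line[of 1] line[of 2] line[of 3] by auto
  have "x $ 1 * x $ 2 * x $ 3 \<noteq> 0" using x0 eq[OF pcl_self[OF x(1)]] by (metis power_eq_0_iff)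
  hence "\<forall>j. x $ j \<noteq> 0" unfolding all_4 using x0 by auto
  then obtain c z where cz: "c \<noteq> 0" "prim z" "x = c *s z" "z $ 1 = prod_mset (fac (z $ 1))" using prim_ex[of x] by blast
  have "P = pcl z" unfolding x(2) cz(3) using pcl_scale[OF cz(1) prim_nonzero[OF cz(2)]] .
  moreover have "z \<in> pcl x" unfolding cz(3) pcl_scale[OF cz(1) prim_nonzero[OF cz(2)]] by (rule pcl_self[OF prim_nonzero[OF cz(2)]])
  ultimately show "\<exists>z. prim z \<and> z $ 1 = prod_mset (fac (z $ 1)) \<and> (z $ 0) ^ 3 = z $ 1 * z $ 2 * z $ 3 \<and> P = pcl z"
    using cz eq by blast
next
  assume "\<exists>z. prim z \<and> z $ 1 = prod_mset (fac (z $ 1)) \<and> (z $ 0) ^ 3 = z $ 1 * z $ 2 * z $ 3 \<and> P = pcl z"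
  then obtain z where z: "prim z" "(z $ 0) ^ 3 = z $ 1 * z $ 2 * z $ 3" "P = pcl z" by blast
  note z0 = prim_nonzero[OF z(1)]
  have "(y $ 0) ^ 3 = y $ 1 * y $ 2 * y $ 3" if "y \<in> pcl z" for y
  proof -
    obtain c where "y = c *s z" using \<open>y \<in> pcl z\<close> by (auto simp: pcl_iff)
    thus ?thesis using z(2) by (simp add: power3_eq_cube mult.assoc)
  qed
  hence "P \<in> cubic_surface" using z0 z(3) by (auto simp: cubic_surface_def projective_space_eq)
  moreover have "P \<notin> coordinate_line j" for j
  proof
    assume "P \<in> coordinate_line j"
    hence "z $ 0 = 0" using pcl_self[OF z0] z(3) by (auto simp: coordinate_line_def)
    thus False using z(1) by (auto simp: prim_def)
  qed
  ultimately show "P \<in> open_subset" by (simp add: open_subset_def)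
qed

end

section \<open>Rational points\<close>

text \<open>The cube root of an ideal whose exponents are divisible by 3.\<close>

definition mset_third :: "'a multiset \<Rightarrow> 'a multiset" where
  "mset_third s = (\<Sum>x\<in>set_mset s. replicate_mset (count s x div 3) x)"

lemma count_mset_third: "count (mset_third s) x = count s x div 3"
proof -
  have "count (mset_third s) x = (\<Sum>y\<in>set_mset s. if y = x then count s y div 3 else 0)"
    unfolding mset_third_def count_sum by (intro sum.cong) auto
  thus ?thesis by (simp add: not_in_iff)
qed

lemma mset_third: "(\<And>x. 3 dvd count s x) \<Longrightarrow> mset_third s + mset_third s + mset_third s = s"
  by (rule multiset_eqI) (simp add: count_mset_third, metis dvd_mult_div_cancel mult_2 mult_Suc numeral_3_eq_3 numeral_2_eq_2 add.assoc add.commute)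

context cn1
begin

definition triples :: "real \<Rightarrow> ('k multiset \<times> 'k multiset \<times> 'k multiset) set" where
  "triples B = {(a, b, c). a \<in> II \<and> b \<in> II \<and> c \<in> II \<and>
     real (nn (prod_mset a)) \<le> B \<and> real (nn (prod_mset b)) \<le> B \<and> real (nn (prod_mset c)) \<le> B \<and>
     (\<forall>p. count a p = 0 \<or> count b p = 0 \<or> count c p = 0) \<and> (\<forall>p. 3 dvd count a p + count b p + count c p)}"

text \<open>
  Scaling by units normalises \<open>x\<^sub>1\<close> to \<open>prod_mset a\<close>; then the units of \<open>x\<^sub>0\<close> and \<open>x\<^sub>2\<close> are free and
  that of \<open>x\<^sub>3\<close> is determined.
\<close>

definition zv :: "'k \<times> 'k \<times> 'k multiset \<times> 'k multiset \<times> 'k multiset \<Rightarrow> 'k ^ 4" where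
  "zv = (\<lambda>(u, t, a, b, c). \<chi> j. if j = 0 then u * prod_mset (mset_third (a + b + c)) else
     if j = 1 then prod_mset a else if j = 2 then t * prod_mset b else u ^ 3 * inverse t * prod_mset c)"

lemma zv_nth:
  "zv (u, t, a, b, c) $ 0 = u * prod_mset (mset_third (a + b + c))" "zv (u, t, a, b, c) $ 1 = prod_mset a"
  "zv (u, t, a, b, c) $ 2 = t * prod_mset b" "zv (u, t, a, b, c) $ 3 = u ^ 3 * inverse t * prod_mset c"
  by (simp_all add: zv_def)

lemma UU_power: "u \<in> UU \<Longrightarrow> u ^ k \<in> UU" by (induction k) (auto intro: UU_mult)

lemma II_third: "a \<in> II \<Longrightarrow> mset_third a \<in> II"
  by (auto simp: II_def simp flip: count_greater_zero_iff simp: count_mset_third)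

lemma triplesD:
  assumes "(a, b, c) \<in> triples B" shows "a \<in> II" "b \<in> II" "c \<in> II" "a + b + c \<in> II"
    "mset_third (a + b + c) \<in> II" "mset_third (a + b + c) + mset_third (a + b + c) + mset_third (a + b + c) = a + b + c"
    "\<And>p. count a p = 0 \<or> count b p = 0 \<or> count c p = 0"
proof -
  show *: "a \<in> II" "b \<in> II" "c \<in> II" using assms by (auto simp: triples_def)
  show "a + b + c \<in> II" using * by (auto simp: II_def)
  thus "mset_third (a + b + c) \<in> II" by (rule II_third)
  show "mset_third (a + b + c) + mset_third (a + b + c) + mset_third (a + b + c) = a + b + c"
    by (rule mset_third) (use assms in \<open>simp add: triples_def\<close>)
  show "\<And>p. count a p = 0 \<or> count b p = 0 \<or> count c p = 0" using assms by (simp add: triples_def)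
qed

lemma UU_3: "u \<in> UU \<Longrightarrow> t \<in> UU \<Longrightarrow> u ^ 3 * inverse t \<in> UU" by (intro UU_mult UU_power UU_inverse)

lemma zv_fac:
  assumes "u \<in> UU" "t \<in> UU" "(a, b, c) \<in> triples B"
  shows "fac (zv (u, t, a, b, c) $ 0) = mset_third (a + b + c)" "fac (zv (u, t, a, b, c) $ 1) = a"
    "fac (zv (u, t, a, b, c) $ 2) = b" "fac (zv (u, t, a, b, c) $ 3) = c"
  using facI[OF triplesD(5)[OF assms(3)] assms(1) refl] fac_prod[OF triplesD(1)[OF assms(3)]]
    facI[OF triplesD(2)[OF assms(3)] assms(2) refl] facI[OF triplesD(3)[OF assms(3)] UU_3[OF assms(1,2)] refl]
  by (simp_all only: zv_nth)

lemma zv_ZK: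
  assumes "u \<in> UU" "t \<in> UU" "(a, b, c) \<in> triples B"
  shows "zv (u, t, a, b, c) $ j \<in> ZK \<and> zv (u, t, a, b, c) $ j \<noteq> 0"
proof -
  have P: "v * prod_mset m \<in> ZK \<and> v * prod_mset m \<noteq> 0" if "v \<in> UU" "m \<in> II" for v m
    using prod_mset_ZK[OF that(2)] UU_ZK[OF that(1)] UU_nonzero[OF that(1)] by (auto intro: ZK_mult)
  have "\<forall>j. zv (u, t, a, b, c) $ j \<in> ZK \<and> zv (u, t, a, b, c) $ j \<noteq> 0"
    unfolding all_4 zv_nth using P[OF assms(1) triplesD(5)[OF assms(3)]] P[OF assms(2) triplesD(2)[OF assms(3)]]
      P[OF UU_3[OF assms(1,2)] triplesD(3)[OF assms(3)]] prod_mset_ZK[OF triplesD(1)[OF assms(3)]] by blast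
  thus ?thesis by blast
qed

lemma zv_prim:
  assumes a: "u \<in> UU" "t \<in> UU" "(a, b, c) \<in> triples B" shows "prim (zv (u, t, a, b, c))"
  unfolding prim_def
proof (intro conjI ballI)
  show "\<forall>j. zv (u, t, a, b, c) $ j \<in> ZK \<and> zv (u, t, a, b, c) $ j \<noteq> 0" using zv_ZK[OF a] by blast
  fix p
  show "\<exists>j. p \<notin># fac (zv (u, t, a, b, c) $ j)"
    using triplesD(7)[OF a(3), of p] zv_fac[OF a] by (metis not_in_iff)
qed

lemma zv_eq:
  assumes a: "u \<in> UU" "t \<in> UU" "(a, b, c) \<in> triples B"
  shows "(zv (u, t, a, b, c) $ 0) ^ 3 = zv (u, t, a, b, c) $ 1 * zv (u, t, a, b, c) $ 2 * zv (u, t, a, b, c) $ 3"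
proof -
  have "prod_mset (mset_third (a + b + c)) ^ 3 = prod_mset (mset_third (a + b + c) + mset_third (a + b + c) + mset_third (a + b + c))"
    by (simp add: power3_eq_cube)
  also have "\<dots> = prod_mset a * prod_mset b * prod_mset c" unfolding triplesD(6)[OF a(3)] by simp
  finally show ?thesis using UU_nonzero[OF a(2)] unfolding zv_nth by (simp add: power_mult_distrib)
qed

lemma zv_unit_1:
  assumes "u \<in> UU" "t \<in> UU" "(a, b, c) \<in> triples B"
  shows "zv (u, t, a, b, c) $ 1 = prod_mset (fac (zv (u, t, a, b, c) $ 1))"
  unfolding zv_fac[OF assms] by (simp add: zv_nth)

lemma nn_unit_mult: "u \<in> UU \<Longrightarrow> x \<in> ZK \<Longrightarrow> nn (u * x) = nn x"
  using nn_mult[of u x] by (simp add: UU_iff)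

lemma nn_fac: "x \<in> ZK \<Longrightarrow> x \<noteq> 0 \<Longrightarrow> nn x = nn (prod_mset (fac x))"
  using fac[of x] nn_unit_mult prod_mset_ZK by metis

text \<open>The cube of the norm of x0 is the product of the other three norms, so x0 never has the
  strictly largest norm.\<close>

lemma height_le_iff:
  assumes z: "prim z" and e: "(z $ 0) ^ 3 = z $ 1 * z $ 2 * z $ 3"
  shows "height (pcl z) \<le> B \<longleftrightarrow> real (nn (z $ 1)) \<le> B \<and> real (nn (z $ 2)) \<le> B \<and> real (nn (z $ 3)) \<le> B"
proof -
  have Z: "z $ j \<in> ZK" for j using z by (auto simp: prim_def)
  have n1: "nn ((z $ 0) ^ 3) = nn (z $ 0) * (nn (z $ 0) * nn (z $ 0))"
    using Z by (simp add: power3_eq_cube nn_mult ZK_mult mult.assoc)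
  have n2: "nn (z $ 1 * z $ 2 * z $ 3) = nn (z $ 1) * nn (z $ 2) * nn (z $ 3)" using Z by (simp add: nn_mult ZK_mult)
  have "real (nn (z $ 0) * (nn (z $ 0) * nn (z $ 0))) = real (nn (z $ 1) * nn (z $ 2) * nn (z $ 3))"
    using n1 n2 unfolding e by simp
  hence n: "real (nn (z $ 0)) ^ 3 = real (nn (z $ 1)) * real (nn (z $ 2)) * real (nn (z $ 3))"
    by (simp add: power3_eq_cube)
  have "real (nn (z $ 0)) \<le> B" if le: "real (nn (z $ 1)) \<le> B" "real (nn (z $ 2)) \<le> B" "real (nn (z $ 3)) \<le> B"
  proof -
    have B: "B \<ge> 0" using le(1) of_nat_0_le_iff order_trans by blast
    have "real (nn (z $ 0)) ^ 3 \<le> B * B * B" unfolding n using le B by (intro mult_mono mult_nonneg_nonneg) auto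
    hence "real (nn (z $ 0)) ^ 3 \<le> B ^ 3" by (simp add: power3_eq_cube)
    thus ?thesis using B by (rule power_le_imp_le_base[of _ 2, simplified])
  qed
  moreover have "height (pcl z) \<le> B \<longleftrightarrow> (\<forall>j. real (nn (z $ j)) \<le> B)"
    unfolding height_prim[OF z] by (subst Max_le_iff) auto
  ultimately show ?thesis unfolding all_4 by blast
qed

lemma zv_height:
  assumes a: "u \<in> UU" "t \<in> UU" "(a, b, c) \<in> triples B"
  shows "height (pcl (zv (u, t, a, b, c))) \<le> B"
proof -
  have n: "nn (zv (u, t, a, b, c) $ j) = nn (prod_mset (fac (zv (u, t, a, b, c) $ j)))" for j
    using nn_fac zv_ZK[OF a, of j] by blast
  show ?thesis unfolding height_le_iff[OF zv_prim[OF a] zv_eq[OF a]] n zv_fac[OF a]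
    using a(3) by (simp add: triples_def)
qed

text \<open>Proportional coprime vectors differ by a unit, so their factorisations agree; since both
  have the same entry \<open>prod_mset a\<close> at coordinate 1, the unit is 1.\<close>

lemma zv_inj: "inj_on (\<lambda>x. pcl (zv x)) (UU \<times> UU \<times> triples B)"
proof (rule inj_onI)
  fix x y assume x: "x \<in> UU \<times> UU \<times> triples B" and y: "y \<in> UU \<times> UU \<times> triples B" and e: "pcl (zv x) = pcl (zv y)"
  obtain u t a b c where xe: "x = (u, t, a, b, c)" by (cases x) auto
  obtain u' t' a' b' c' where ye: "y = (u', t', a', b', c')" by (cases y) auto
  have X: "u \<in> UU" "t \<in> UU" "(a, b, c) \<in> triples B" and Y: "u' \<in> UU" "t' \<in> UU" "(a', b', c') \<in> triples B"
    using x y unfolding xe ye by auto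
  have px: "prim (zv x)" unfolding xe by (rule zv_prim[OF X])
  have py: "prim (zv y)" unfolding ye by (rule zv_prim[OF Y])
  have "zv y \<in> pcl (zv x)" unfolding e by (rule pcl_self[OF prim_nonzero[OF py]])
  then obtain k where k: "k \<noteq> 0" "zv y = k *s zv x" by (auto simp: pcl_iff)
  have kU: "k \<in> UU" using prim_pv_const[OF px _ k(1)] py k(2) by simp
  have Z: "zv x $ j \<in> ZK \<and> zv x $ j \<noteq> 0" for j using px by (simp add: prim_def)
  have fe: "fac (zv y $ j) = fac (zv x $ j)" for j
  proof -
    have "zv y $ j = k * zv x $ j" by (simp add: k(2))
    moreover have "fac (k * zv x $ j) = fac k + fac (zv x $ j)"
      using fac_mult[OF UU_ZK[OF kU] k(1)] Z[of j] by blast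
    ultimately show ?thesis by (simp add: fac_UU[OF kU])
  qed
  have abc: "a' = a" "b' = b" "c' = c"
    using fe[of 1] fe[of 2] fe[of 3] unfolding xe ye zv_fac[OF X] zv_fac[OF Y] by simp_all
  have "zv y $ 1 = k * zv x $ 1" by (simp add: k(2))
  hence k1: "k = 1" using Z[of 1] unfolding xe ye zv_nth abc by simp
  hence eq: "zv y = zv x" using k(2) by simp
  have "u = u'" using eq Z[of 0] unfolding xe ye abc by (metis zv_nth(1) mult_cancel_right mult_zero_right)
  moreover have "t = t'" using eq Z[of 2] unfolding xe ye abc by (metis zv_nth(3) mult_cancel_right mult_zero_right)
  ultimately show "x = y" unfolding xe ye abc by simp
qed

text \<open>Factoring the equation of the surface gives the ideal of x0 as a cube root, and
  comparing units expresses that of x3 by those of x0 and x2.\<close>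

lemma zv_surj:
  assumes "P \<in> open_subset" "height P \<le> B" shows "\<exists>x\<in>UU \<times> UU \<times> triples B. P = pcl (zv x)"
proof -
  obtain z where z: "prim z" "z $ 1 = prod_mset (fac (z $ 1))" "(z $ 0) ^ 3 = z $ 1 * z $ 2 * z $ 3" "P = pcl z"
    using assms(1) unfolding open_subset_prim by blast
  have Z: "z $ j \<in> ZK" "z $ j \<noteq> 0" for j using z(1) by (auto simp: prim_def)
  define m where "m j = fac (z $ j)" for j
  have m: "m j \<in> II" for j using fac(1)[OF Z] by (simp add: m_def)
  have "\<exists>v\<in>UU. z $ j = v * prod_mset (m j)" for j using fac(2)[OF Z] by (simp add: m_def)
  then obtain v where v: "\<And>j. v j \<in> UU" "\<And>j. z $ j = v j * prod_mset (m j)" by metis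
  have "fac ((z $ 0) ^ 3) = fac (z $ 1 * z $ 2 * z $ 3)" using z(3) by simp
  hence m3: "m 0 + m 0 + m 0 = m 1 + m 2 + m 3"
    using Z by (simp add: m_def power3_eq_cube fac_mult ZK_mult add.assoc)
  have cnt: "count (m 1) p + count (m 2) p + count (m 3) p = 3 * count (m 0) p" for p
    using arg_cong[OF m3, of "\<lambda>s. count s p"] by simp
  have t0: "mset_third (m 1 + m 2 + m 3) = m 0" by (rule multiset_eqI) (simp add: count_mset_third cnt)
  have zero: "count (m 1) p = 0 \<or> count (m 2) p = 0 \<or> count (m 3) p = 0" for p
  proof (cases "p \<in> PP")
    case True
    then obtain j where j: "count (m j) p = 0" using z(1) unfolding prim_def m_def by (meson not_in_iff)
    have "\<forall>j. count (m j) p = 0 \<longrightarrow> count (m 1) p = 0 \<or> count (m 2) p = 0 \<or> count (m 3) p = 0"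
      unfolding all_4 using cnt[of p] by auto
    from this[rule_format, OF j] show ?thesis .
  next
    case False
    thus ?thesis using m[of 1] by (auto simp: II_def not_in_iff[symmetric])
  qed
  have nm: "nn (z $ j) = nn (prod_mset (m j))" for j using nn_fac[OF Z] by (simp add: m_def)
  have T: "(m 1, m 2, m 3) \<in> triples B"
    using assms(2) m zero unfolding z(4) height_le_iff[OF z(1,3)] nm by (simp add: triples_def cnt)
  have v3: "v 3 = v 0 ^ 3 * inverse (v 2)"
  proof -
    have nz: "prod_mset (m j) \<noteq> 0" for j using prod_mset_ZK[OF m] by blast
    have "z $ 1 = prod_mset (m 1)" using z(2) by (simp add: m_def)
    hence "(v 0 * prod_mset (m 0)) ^ 3 = prod_mset (m 1) * (v 2 * prod_mset (m 2)) * (v 3 * prod_mset (m 3))"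
      using z(3) v(2) by metis
    hence "v 0 ^ 3 * prod_mset (m 0 + m 0 + m 0) = (v 2 * v 3) * prod_mset (m 1 + m 2 + m 3)"
      by (simp add: power3_eq_cube mult_ac)
    hence "v 0 ^ 3 = v 2 * v 3" unfolding m3 using nz by simp
    thus ?thesis using UU_nonzero[OF v(1), of 2] by (simp add: field_simps)
  qed
  have "z = zv (v 0, v 2, m 1, m 2, m 3)"
  proof -
    have "\<forall>j. z $ j = zv (v 0, v 2, m 1, m 2, m 3) $ j"
      unfolding all_4 zv_nth t0 v3[symmetric] using v(2) z(2) by (simp add: m_def)
    thus ?thesis by (simp add: vec_eq_iff)
  qed
  thus ?thesis using v(1) T z(4) by (intro bexI[of _ "(v 0, v 2, m 1, m 2, m 3)"]) auto
qed

lemma counting_function_eq: "counting_function TYPE('k) B = (card UU)\<^sup>2 * card (triples B)"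
proof -
  have "(\<lambda>x. pcl (zv x)) ` (UU \<times> UU \<times> triples B) = {P \<in> (open_subset :: ('k ^ 4) set set). height P \<le> B}"
  proof (intro equalityI subsetI)
    fix P assume "P \<in> (\<lambda>x. pcl (zv x)) ` (UU \<times> UU \<times> triples B)"
    then obtain u t a b c where P: "u \<in> UU" "t \<in> UU" "(a, b, c) \<in> triples B" "P = pcl (zv (u, t, a, b, c))" by auto
    have "P \<in> (open_subset :: ('k ^ 4) set set)" unfolding open_subset_prim
      using zv_prim[OF P(1-3)] zv_unit_1[OF P(1-3)] zv_eq[OF P(1-3)] P(4) by blast
    thus "P \<in> {P \<in> (open_subset :: ('k ^ 4) set set). height P \<le> B}" using zv_height[OF P(1-3)] P(4) by simp
  next
    fix P assume "P \<in> {P \<in> (open_subset :: ('k ^ 4) set set). height P \<le> B}"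
    thus "P \<in> (\<lambda>x. pcl (zv x)) ` (UU \<times> UU \<times> triples B)" using zv_surj by blast
  qed
  hence "card {P \<in> (open_subset :: ('k ^ 4) set set). height P \<le> B} = card (UU \<times> UU \<times> triples B)"
    using card_image[OF zv_inj, of B] by simp
  thus ?thesis unfolding counting_function_def by (simp add: card_cartesian_product power2_eq_square)
qed

definition ideals :: "nat \<Rightarrow> 'k multiset set" where "ideals n = {m \<in> II. nn (prod_mset m) \<le> n}"

text \<open>A nonzero element is in exactly one way a unit times a product of chosen primes; the
  summand 1 is the element 0.\<close>

lemma card_ZK_ideals:
  shows "finite (ideals n)" "card {x \<in> ZK. nn x \<le> n} = 1 + card UU * card (ideals n)"
proof -
  let ?f = "\<lambda>(u, m). u * prod_mset m"
  have inj: "inj_on ?f (UU \<times> ideals n)"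
  proof (rule inj_onI)
    fix x y assume x: "x \<in> UU \<times> ideals n" and y: "y \<in> UU \<times> ideals n" and e: "?f x = ?f y"
    obtain u m u' m' where xy: "x = (u, m)" "y = (u', m')" by (cases x, cases y) auto
    have U: "u \<in> UU" "u' \<in> UU" "m \<in> II" "m' \<in> II" using x y by (auto simp: xy ideals_def)
    have mm: "m = m'" using factorization_unique[OF U(3,4,1,2)] e by (simp add: xy)
    have "prod_mset m' \<noteq> 0" using prod_mset_ZK[OF U(4)] by blast
    thus "x = y" using e by (simp add: xy mm)
  qed
  have img: "?f ` (UU \<times> ideals n) = {x \<in> ZK. nn x \<le> n} - {0}"
  proof (intro equalityI subsetI)
    fix x assume "x \<in> ?f ` (UU \<times> ideals n)"
    then obtain u m where um: "u \<in> UU" "m \<in> II" "nn (prod_mset m) \<le> n" "x = u * prod_mset m" by (auto simp: ideals_def)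
    thus "x \<in> {x \<in> ZK. nn x \<le> n} - {0}"
      using prod_mset_ZK[OF um(2)] UU_ZK[OF um(1)] UU_nonzero[OF um(1)] nn_unit_mult[OF um(1)] by (auto intro: ZK_mult)
  next
    fix x assume x: "x \<in> {x \<in> ZK. nn x \<le> n} - {0}"
    hence x': "x \<in> ZK" "x \<noteq> 0" by auto
    obtain u where "u \<in> UU" "x = u * prod_mset (fac x)" using fac(2)[OF x'] by blast
    moreover have "fac x \<in> ideals n" using fac(1)[OF x'] nn_fac[OF x'] x by (simp add: ideals_def)
    ultimately show "x \<in> ?f ` (UU \<times> ideals n)" by (intro image_eqI[of _ _ "(u, fac x)"]) auto
  qed
  have "finite (?f ` (UU \<times> ideals n))" unfolding img using finite_nn_le[of n] by simp
  hence fin: "finite (UU \<times> ideals n)" using inj by (rule finite_imageD)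
  thus "finite (ideals n)" using UU_1 finite_cartesian_productD2[of UU "ideals n"] by blast
  have "card {x \<in> ZK. nn x \<le> n} = Suc (card ({x \<in> ZK. nn x \<le> n} - {0}))"
    by (rule card.remove) (use finite_nn_le in auto)
  also have "card ({x \<in> ZK. nn x \<le> n} - {0}) = card (UU \<times> ideals n)" using card_image[OF inj] img by simp
  finally show "card {x \<in> ZK. nn x \<le> n} = 1 + card UU * card (ideals n)" by (simp add: card_cartesian_product)
qed

text \<open>The lattice point count divided by \<open>wi\<close> and the number of units. In the
  error, the factor 2 comes from \<open>1 + sqrt n \<le> 2 * sqrt n\<close> and the extra
  \<open>wi\<close> from the element 0.\<close>

lemma card_ideals:
  assumes n: "n \<ge> 1"
  shows "\<bar>real (card (ideals n)) - pi / (wi * card UU) * real n\<bar>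
    \<le> (2 * (pi * (2 * (1 + wi) + (1 + wi)\<^sup>2)) + wi) / (wi * card UU) * sqrt (real n)"
proof -
  define C where "C = pi * (2 * (1 + wi) + (1 + wi)\<^sup>2)"
  define k where "k = real (card UU)"
  have k: "k > 0" "wi > 0" using card_UU_pos wi_pos by (auto simp: k_def)
  have C: "C \<ge> 0" using k by (simp add: C_def)
  have s: "sqrt (real n) \<ge> 1" using n by simp
  define x where "x = real (card (ideals n))"
  have "\<bar>(1 + k * x) * wi - pi * real n\<bar> \<le> C * (1 + sqrt (real n))"
    using card_nn_le[of n] unfolding card_ZK_ideals(2) C_def k_def x_def by simp
  moreover have "C * (1 + sqrt (real n)) \<le> C * (2 * sqrt (real n))" using s C by (intro mult_left_mono) auto
  moreover have "wi \<le> wi * sqrt (real n)" using s k by simp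
  moreover have "k * x * wi - pi * real n = ((1 + k * x) * wi - pi * real n) - wi" by (simp add: algebra_simps)
  ultimately have "\<bar>k * x * wi - pi * real n\<bar> \<le> C * (2 * sqrt (real n)) + wi * sqrt (real n)" using k(2) by linarith
  also have "\<dots> = (2 * C + wi) * sqrt (real n)" by (simp add: algebra_simps)
  finally have "\<bar>k * x * wi - pi * real n\<bar> \<le> (2 * C + wi) * sqrt (real n)" .
  hence "\<bar>k * x * wi - pi * real n\<bar> / (wi * k) \<le> (2 * C + wi) * sqrt (real n) / (wi * k)"
    using k by (intro divide_right_mono) auto
  moreover have "x - pi / (wi * k) * real n = (k * x * wi - pi * real n) / (wi * k)" using k by (simp add: field_simps)
  ultimately show ?thesis using k unfolding C_def[symmetric] k_def[symmetric] x_def[symmetric] by (simp add: abs_divide abs_mult)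
qed

end

context cn1
begin

lemma nrm_nn: "m \<in> II \<Longrightarrow> nrm nn m = nn (prod_mset m)"
  by (simp add: nrm_def nn_prod_mset)

abbreviation "rho \<equiv> pi / (wi * card UU)"
abbreviation "cerr \<equiv> (2 * (pi * (2 * (1 + wi) + (1 + wi)\<^sup>2)) + wi) / (wi * card UU)"

lemma ideals_eq: "{m. set_mset m \<subseteq> PP \<and> nrm nn m \<le> n} = ideals n"
proof -
  have "m \<in> II \<longleftrightarrow> set_mset m \<subseteq> PP" for m by (simp add: II_def)
  thus ?thesis unfolding ideals_def using nrm_nn by (auto simp: set_eq_iff)
qed

lemma norm_system_nn: "norm_system PP nn rho cerr"
proof
  show "p \<in> PP \<Longrightarrow> nn p \<ge> 2" for p by (rule nn_PP)
  show "finite {m. set_mset m \<subseteq> PP \<and> nrm nn m \<le> n}" for n unfolding ideals_eq by (rule card_ZK_ideals(1))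
  show "n \<ge> 1 \<Longrightarrow> \<bar>real (card {m. set_mset m \<subseteq> PP \<and> nrm nn m \<le> n}) - rho * real n\<bar> \<le> cerr * sqrt (real n)" for n
    unfolding ideals_eq by (rule card_ideals)
  show "rho > 0" using wi_pos card_UU_pos by simp
qed

end

sublocale cn1 \<subseteq> NS: norm_system PP nn rho cerr by (rule norm_system_nn)

section \<open>The leading constant and the asymptotic formula\<close>

context cn1
begin

lemma TR_eq_triples:
  assumes B: "B > 0" shows "NS.TR (ln B) = triples B"
proof -
  have II: "NS.II = II" by (simp add: NS.II_def II_def)
  have l: "NS.lnn m \<le> ln B \<longleftrightarrow> real (nn (prod_mset m)) \<le> B" if m: "m \<in> II" for m
    using NS.nrm_pos[unfolded II, OF m] B unfolding NS.lnn_def nrm_nn[OF m] by simp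
  show ?thesis unfolding NS.TR_def triples_def II by (auto simp: l)
qed

lemma euler_factor_rep:
  assumes "C \<in> prime_classes TYPE('k)"
  shows "euler_factor C = (1 - 1 / nn (rep C)) ^ 7 * (1 + 7 / nn (rep C) + 1 / (real (nn (rep C)))\<^sup>2)"
proof -
  have "rep C \<in> PP" using assms by (simp add: PP_def)
  hence "norm_infinity (SOME p. p \<in> C) = real (nn (rep C))" unfolding rep_def[symmetric] by (intro norm_infinity_nn PP_ZK)
  thus ?thesis by (simp add: euler_factor_def Let_def)
qed

text \<open>The bijection \<open>rep\<close> carries the net of finite sets of prime classes to that
  of finite sets of representatives, so both Euler products have the same limit. The factor in front
  follows from \<open>\<rho>\<close> with \<open>wi\<close> equal to half the root of the
  discriminant.\<close>

lemma leading_constant_eq: "leading_constant TYPE('k) = (card UU)\<^sup>2 * NS.Cmain * NS.singular_series"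
proof -
  define g where "g p = (1 - 1 / nn p) ^ 7 * (1 + 7 / nn p + 1 / (real (nn p))\<^sup>2)" for p
  have inj: "inj_on rep (prime_classes TYPE('k))" using rep_bij by (rule bij_betw_imp_inj_on)
  have "((\<lambda>F. \<Prod>p\<in>F. g p) \<longlongrightarrow> NS.singular_series) (finite_subsets_at_top (rep ` prime_classes TYPE('k)))"
    using NS.singular_series_Euler unfolding g_def PP_def .
  hence "((\<lambda>F. \<Prod>p\<in>rep ` F. g p) \<longlongrightarrow> NS.singular_series) (finite_subsets_at_top (prime_classes TYPE('k)))"
    unfolding filtermap_image_finite_subsets_at_top[OF inj, symmetric] filterlim_filtermap .
  moreover have "\<forall>\<^sub>F F in finite_subsets_at_top (prime_classes TYPE('k)). (\<Prod>p\<in>rep ` F. g p) = prod euler_factor F"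
  proof (rule eventually_finite_subsets_at_top_weakI)
    fix F assume F: "finite F" "F \<subseteq> prime_classes TYPE('k)"
    have "(\<Prod>p\<in>rep ` F. g p) = (\<Prod>C\<in>F. g (rep C))" using inj_on_subset[OF inj F(2)] by (simp add: prod.reindex)
    also have "\<dots> = prod euler_factor F" using F(2) by (intro prod.cong) (auto simp: g_def euler_factor_rep)
    finally show "(\<Prod>p\<in>rep ` F. g p) = prod euler_factor F" .
  qed
  ultimately have "(prod euler_factor \<longlongrightarrow> NS.singular_series) (finite_subsets_at_top (prime_classes TYPE('k)))"
    by (rule Lim_transform_eventually)
  hence "Lim (finite_subsets_at_top (prime_classes TYPE('k))) (prod euler_factor) = NS.singular_series"
    by (intro tendsto_Lim) auto
  moreover have "2 ^ 7 * pi ^ 9 / (fact 6 * real (unit_number TYPE('k)) ^ 7 * sqrt_abs_disc TYPE('k) ^ 9) = (card UU)\<^sup>2 * NS.Cmain"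
    unfolding unit_number_eq sqrt_abs_disc_eq NS.Cmain_def using wi_pos card_UU_pos
    by (simp add: fact_numeral field_simps)
  ultimately show ?thesis by (simp add: leading_constant_def)
qed

lemma counting_function_bound:
  assumes B: "B > 1"
  shows "\<bar>real (counting_function TYPE('k) B) - leading_constant TYPE('k) * B * ln B ^ 6\<bar>
    \<le> (card UU)\<^sup>2 * NS.Cerr * NS.Kmu * (B * (1 + ln B) ^ 5)"
proof -
  have L: "ln B > 0" "exp (ln B) = B" using B by simp_all
  have "real (counting_function TYPE('k) B) - leading_constant TYPE('k) * B * ln B ^ 6
      = (card UU)\<^sup>2 * (real (card (triples B)) - B * NS.Cmain * ln B ^ 6 * NS.singular_series)"
    unfolding counting_function_eq leading_constant_eq by (simp add: algebra_simps)
  moreover have "\<bar>real (card (triples B)) - B * NS.Cmain * ln B ^ 6 * NS.singular_series\<bar> \<le> B * NS.Cerr * (1 + ln B) ^ 5 * NS.Kmu"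
    using NS.card_cop_asymp[OF L(1)] B unfolding NS.card_TR[symmetric] L(2) by (simp add: TR_eq_triples)
  ultimately have "\<bar>real (counting_function TYPE('k) B) - leading_constant TYPE('k) * B * ln B ^ 6\<bar>
      \<le> (card UU)\<^sup>2 * (B * NS.Cerr * (1 + ln B) ^ 5 * NS.Kmu)"
    by (simp add: abs_mult mult_left_mono)
  thus ?thesis by (simp add: mult_ac)
qed

lemma counting_function_asymp:
  "(\<lambda>B. real (counting_function TYPE('k) B) - leading_constant TYPE('k) * B * (ln B) ^ 6) \<in> O[at_top](\<lambda>B. B * (ln B) ^ 5)"
proof (rule bigoI)
  define c where "c = \<bar>(card UU)\<^sup>2 * NS.Cerr * NS.Kmu\<bar>"
  show "\<forall>\<^sub>F B in at_top. norm (real (counting_function TYPE('k) B) - leading_constant TYPE('k) * B * (ln B) ^ 6)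
      \<le> (c * 32) * norm (B * (ln B) ^ 5)"
    \<comment> \<open>From \<open>B \<ge> exp 1\<close> on, \<open>1 + ln B \<le> 2 * ln B\<close>;
      the fifth power yields the factor 32.\<close>
    using eventually_ge_at_top[of "exp 1 :: real"]
  proof eventually_elim
    case (elim B)
    have B: "B > 1" using elim exp_gt_one[of 1] by linarith
    have L: "ln B \<ge> 1" using elim B by (metis ln_exp ln_le_cancel_iff exp_gt_zero less_trans zero_less_one)
    have "norm (real (counting_function TYPE('k) B) - leading_constant TYPE('k) * B * (ln B) ^ 6)
        \<le> (card UU)\<^sup>2 * NS.Cerr * NS.Kmu * (B * (1 + ln B) ^ 5)"
      using counting_function_bound[OF B] by simp
    also have "\<dots> \<le> c * (B * (1 + ln B) ^ 5)" using B L by (intro mult_right_mono) (auto simp: c_def)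
    also have "\<dots> \<le> c * (B * (2 * ln B) ^ 5)" using B L by (intro mult_left_mono power_mono) (auto simp: c_def)
    also have "\<dots> = (c * 32) * norm (B * (ln B) ^ 5)" using B L by (simp add: power_mult_distrib)
    finally show ?case .
  qed
qed

end

theorem theorem1:
  fixes K :: "'k::field_char_0 itself"
  assumes "imaginary_quadratic K"
    and "class_number (ring_of_integers K) = 1"
  shows "(\<lambda>B::real. real (counting_function K B) - leading_constant K * B * (ln B) ^ 6)
           \<in> O[at_top](\<lambda>B. B * (ln B) ^ 5)"
proof -
  \<comment> \<open>K serves to name its type, so it may be exchanged for \<open>TYPE('k)\<close>,
    for which the locales are set up.\<close>
  have R: "ring_of_integers K = ring_of_integers TYPE('k)" by (simp add: ring_of_integers_def)
  have C: "counting_function K = counting_function TYPE('k)" by (rule ext) (simp add: counting_function_def)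
  have L: "leading_constant K = leading_constant TYPE('k)"
    unfolding leading_constant_def unit_number_def sqrt_abs_disc_def discriminant_def prime_classes_def R by (rule refl)
  obtain \<delta> :: 'k and D where "quad \<delta> D" by (rule imaginary_quadratic_quad[OF assms(1)])
  then interpret quad \<delta> D .
  interpret cn1 \<delta> D
    by unfold_locales (rule class_number_1_Bezout[OF assms(2)[unfolded R]])
  show ?thesis unfolding C L by (rule counting_function_asymp)
qed

end
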